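(* Work in the homogeneous group-testing setting described in the context, with $p=\delta\pi$, $\delta=\delta(N)$, $\nu=\nu(N)$, $h=h(N)$, weights $w_j$, and estimator $\hat p(x)=1-\hat\mu(x)^{1/\nu}$. Assume there are functions $b$ and $v$, continuous on $\mathcal J$, such that for each $x\in\mathcal I$, as $N\to\infty$: (S1) $\sum_j w_j(x)(\bar X_j-x)\big/\sum_j w_j(x)=0$; (S2) $\sum_j w_j(x)(\bar X_j-x)^2\big/\sum_j w_j(x)=h^2b(x)+o_p(h^2)$; (S3) $\sum_j w_j(x)^2\big/\{\sum_j w_j(x)\}^2=\nu v(x)/(Nh)+o_p\{\nu/(Nh)\}$; (S4) for each integer $k\ge1$, $\sum_j|w_j(x)|^k\big/\{\sum_j w_j(x)\}^k=O_p[\{\nu/(Nh)\}^{k-1}]$. Assume also: (T1) the distribution of $X$ has a continuous density $f$ that is bounded away from zero on an open interval $\mathcal J$ containing $\mathcal I$; (T2) $p=\delta\pi$ is bounded away from $1$ uniformly in $x\in\mathcal I$ and in $N\ge1$; (T3) $\pi$ has two Hölder-continuous derivatives on $\mathcal J$; (T4) for some $\varepsilon>0$, $h+\nu\delta h+\nu^2/(N^{1-\varepsilon}h\delta)\to0$ as $N\to\infty$; (T5) there is a constant $C>0$ such that $w_j(x)=0$ whenever $|\bar X_j-x|>Ch$. Assume finally that $\nu\delta=O(1)$ as $N\to\infty$. Define $$A=\big[(\nu Nh)^{-1}(1-p)^{2-\nu}\{1-(1-p)^\nu\}\,v\big]^{1/2},\qquad B=\tfrac12h^2\{p''-(\nu-1)(1-p)^{-1}(p')^2\}\,b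 .$$ Then $A=O\{(\delta/(Nh))^{1/2}\}$ and $B=O(\delta h^2)$, and for each $x\in\mathcal I$, $$\hat p(x)-p(x)=A(x)V(x)+B(x)+o_p\{\delta h^2+(\delta/(Nh))^{1/2}\},$$ where $V(x)$ is a random variable (depending on $N$) whose distribution converges to the standard normal law as $N\to\infty$. If, in addition, (S1)--(S4) hold uniformly in $x\in\mathcal I$, if for some constants $C,\varepsilon>0$ $$\sup_{x,x'\in\mathcal I:\,|x-x'|\le N^{-C}}\Big\{\frac1{|x-x'|^{\varepsilon}}\sum_k\Big|\frac{w_k(x)}{\sum_jw_j(x)}-\frac{w_k(x')}{\sum_jw_j(x')}\Big|\Big\}=O_p(1),$$ and if $b$ and $v$ are bounded and continuous, then $$\int_{\mathcal I}(\hat p-p)^2=\int_{\mathcal I}(A^2+B^2)+o_p\{\delta^2h^4+\delta/(Nh)\}.$$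
   Context: Setting. For each $N$, $(X_1,Y_1),\dots,(X_N,Y_N)$ are i.i.d. pairs, $X_i$ real-valued with a distribution not depending on $N$, $Y_i\in\{0,1\}$, and $P(Y_i=1\mid X_i=x)=p(x)$, where $p(x)=p_N(x)=\delta(N)\pi(x)$; here $\delta=\delta(N)$ is a sequence of positive numbers (possibly depending on $N$) and $\pi\ge0$ is a fixed function. All limits are as $N\to\infty$. $\mathcal I$ is a given compact nondegenerate interval. Grouping. $\nu=\nu(N)\ge1$ is an integer dividing $N$ (possibly depending on $N$), $J=N/\nu$, and $X_{(1)}\le\dots\le X_{(N)}$ are the ordered values of $\mathcal X=\{X_1,\dots,X_N\}$. For $j=1,\dots,J$, group $j$ is $\mathcal X_j=\{X_{((j-1)\nu+1)},\dots,X_{(j\nu)}\}$, with elements denoted $X_{1j},\dots,X_{\nu j}$; $Y_{ij}$ is the $Y$-value accompanying $X_{ij}$. Put $\bar X_j=\nu^{-1}\sum_{i=1}^\nu X_{ij}$, $Y_j^*=\max_{1\le i\le\nu}Y_{ij}$ and $Z_j^*=1-Y_j^*$. Only the pairs $(\mathcal X_j,Y_j^* )$ are observed. Estimator. $h=h(N)$ is a sequence of positive constants decreasing to $0$. The weights $w_j(x)$, $1\le j\le J$, depend on $\mathcal X$ (and $N$) but not on the variables $Z_j^*$. Define $$\hat\mu(x)=\sum_jw_j(x)Z_j^*\Big/\sum_jw_j(x),\qquad \hat p(x)=1-\hat\mu(x)^{1/\nu}.$$ $\hat\mu$ estimates $\mu(x)=\{1-p(x)\}^\nu$. Sums over $j$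 run over $1\le j\le J$. Primes on $p$ denote derivatives in $x$. $o_p$ and $O_p$ are the usual stochastic order symbols. *)

theory Defs
  imports "HOL-Probability.Probability" "HOL-Library.Landau_Symbols"
begin

text \<open>
  The probability space \<open>M N\<close> may change with the sample size \<open>N\<close>. Events of probability tending
  to one are expressed through a measurable subset. For measurable events this is the
  usual notion; it also covers suprema over intervals and integrals over \<open>x\<close>, whose measurability
  in \<open>\<omega>\<close> is not part of the assumptions.
\<close>

definition whp :: "(nat \<Rightarrow> 'a measure) \<Rightarrow> (nat \<Rightarrow> 'a \<Rightarrow> bool) \<Rightarrow> bool" where
  "whp M Q \<longleftrightarrow> (\<forall>\<eta>>0. \<forall>\<^sub>F N in sequentially.
     \<exists>E\<in>sets (M N). 1 - \<eta> \<le> measure (M N) E \<and> (\<forall>\<omega>\<in>E. Q N \<omega>))"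

text \<open>\<open>Z N t = o\<^sub>p(r N)\<close> and \<open>Z N t = O\<^sub>p(r N)\<close>, uniformly in \<open>t \<in> T N\<close>.\<close>

definition o_prob_on ::
  "(nat \<Rightarrow> 'a measure) \<Rightarrow> (nat \<Rightarrow> 't set) \<Rightarrow> (nat \<Rightarrow> 't \<Rightarrow> 'a \<Rightarrow> real) \<Rightarrow> (nat \<Rightarrow> real) \<Rightarrow> bool" where
  "o_prob_on M T Z r \<longleftrightarrow> (\<forall>\<epsilon>>0. whp M (\<lambda>N \<omega>. \<forall>t\<in>T N. \<bar>Z N t \<omega>\<bar> \<le> \<epsilon> * r N))"

definition O_prob_on ::
  "(nat \<Rightarrow> 'a measure) \<Rightarrow> (nat \<Rightarrow> 't set) \<Rightarrow> (nat \<Rightarrow> 't \<Rightarrow> 'a \<Rightarrow> real) \<Rightarrow> (nat \<Rightarrow> real) \<Rightarrow> bool" where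
  "O_prob_on M T Z r \<longleftrightarrow> (\<forall>\<eta>>0. \<exists>K. \<forall>\<^sub>F N in sequentially.
     \<exists>E\<in>sets (M N). 1 - \<eta> \<le> measure (M N) E \<and> (\<forall>\<omega>\<in>E. \<forall>t\<in>T N. \<bar>Z N t \<omega>\<bar> \<le> K * r N))"

definition o_prob :: "(nat \<Rightarrow> 'a measure) \<Rightarrow> (nat \<Rightarrow> 'a \<Rightarrow> real) \<Rightarrow> (nat \<Rightarrow> real) \<Rightarrow> bool" where
  "o_prob M Z r \<longleftrightarrow> o_prob_on M (\<lambda>_. {()}) (\<lambda>N _. Z N) r"

definition hoelder_on :: "real set \<Rightarrow> (real \<Rightarrow> real) \<Rightarrow> bool" where
  "hoelder_on S g \<longleftrightarrow> (\<exists>\<alpha>>0. \<alpha> \<le> 1 \<and> (\<exists>K. \<forall>x\<in>S. \<forall>y\<in>S. \<bar>g x - g y\<bar> \<le> K * \<bar>x - y\<bar> powr \<alpha>))"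

text \<open>
  A sample consists of \<open>u i\<close> and \<open>y i\<close> for \<open>1 \<le> i \<le> N\<close>. The index \<open>rank_index N u i\<close> is that of the
  \<open>i\<close>-th smallest of the values \<open>u 1, \<dots>, u N\<close>, ties (a null event in the model) being broken
  by the original index. Groups have size \<open>n\<close> and \<open>j\<close> runs from \<open>1\<close> to \<open>N div n\<close>.
\<close>

definition rank_index :: "nat \<Rightarrow> (nat \<Rightarrow> real) \<Rightarrow> nat \<Rightarrow> nat" where
  "rank_index N u i = sort_key u [1..<Suc N] ! (i - 1)"

definition order_stat :: "nat \<Rightarrow> (nat \<Rightarrow> real) \<Rightarrow> nat \<Rightarrow> real" where
  "order_stat N u i = u (rank_index N u i)"

definition group_mean :: "nat \<Rightarrow> nat \<Rightarrow> (nat \<Rightarrow> real) \<Rightarrow> nat \<Rightarrow> real" where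
  "group_mean n N u j = (\<Sum>i=1..n. order_stat N u ((j - 1) * n + i)) / real n"

definition Y_star :: "nat \<Rightarrow> nat \<Rightarrow> (nat \<Rightarrow> real) \<Rightarrow> (nat \<Rightarrow> real) \<Rightarrow> nat \<Rightarrow> real" where
  "Y_star n N u y j = Max ((\<lambda>i. y (rank_index N u ((j - 1) * n + i))) ` {1..n})"

definition Z_star :: "nat \<Rightarrow> nat \<Rightarrow> (nat \<Rightarrow> real) \<Rightarrow> (nat \<Rightarrow> real) \<Rightarrow> nat \<Rightarrow> real" where
  "Z_star n N u y j = 1 - Y_star n N u y j"

text \<open>
  A weight system \<open>w\<close> assigns to \<open>N\<close>, \<open>j\<close> and \<open>x\<close> a function of the ordered sample
  \<open>(X\<^sub>(\<^sub>1\<^sub>), \<dots>, X\<^sub>(\<^sub>N\<^sub>))\<close>; it has no access to the responses.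
\<close>

type_synonym weights = "nat \<Rightarrow> nat \<Rightarrow> real \<Rightarrow> (nat \<Rightarrow> real) \<Rightarrow> real"

definition weight :: "weights \<Rightarrow> nat \<Rightarrow> (nat \<Rightarrow> real) \<Rightarrow> nat \<Rightarrow> real \<Rightarrow> real" where
  "weight w N u j x = w N j x (\<lambda>i\<in>{1..N}. order_stat N u i)"

definition weight_sum :: "weights \<Rightarrow> nat \<Rightarrow> nat \<Rightarrow> (nat \<Rightarrow> real) \<Rightarrow> real \<Rightarrow> real" where
  "weight_sum w n N u x = (\<Sum>j=1..N div n. weight w N u j x)"

definition weighted_mean ::
  "weights \<Rightarrow> nat \<Rightarrow> nat \<Rightarrow> (nat \<Rightarrow> real) \<Rightarrow> real \<Rightarrow> (nat \<Rightarrow> real) \<Rightarrow> real" where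
  "weighted_mean w n N u x g = (\<Sum>j=1..N div n. weight w N u j x * g j) / weight_sum w n N u x"

definition mu_hat ::
  "weights \<Rightarrow> nat \<Rightarrow> nat \<Rightarrow> (nat \<Rightarrow> real) \<Rightarrow> (nat \<Rightarrow> real) \<Rightarrow> real \<Rightarrow> real" where
  "mu_hat w n N u y x = weighted_mean w n N u x (Z_star n N u y)"

text \<open>
  Weights may be negative, so \<open>mu_hat\<close> may be, too; \<open>root n\<close> is then the odd extension
  of the \<open>n\<close>-th root.
\<close>

definition p_hat ::
  "weights \<Rightarrow> nat \<Rightarrow> nat \<Rightarrow> (nat \<Rightarrow> real) \<Rightarrow> (nat \<Rightarrow> real) \<Rightarrow> real \<Rightarrow> real" where
  "p_hat w n N u y x = 1 - root n (mu_hat w n N u y x)"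

text \<open>
  Taking \<open>T = {x}\<close> gives the conditions at a point \<open>x\<close>, taking \<open>T = I\<close> those uniform over \<open>I\<close>.
  As division by zero yields zero, the first conjunct makes explicit that the quotients
  are meaningful with probability tending to one.
\<close>

definition weight_conditions ::
  "(nat \<Rightarrow> 'a measure) \<Rightarrow> (nat \<Rightarrow> nat \<Rightarrow> 'a \<Rightarrow> real) \<Rightarrow> (nat \<Rightarrow> nat) \<Rightarrow> (nat \<Rightarrow> real) \<Rightarrow> weights \<Rightarrow>
   (real \<Rightarrow> real) \<Rightarrow> (real \<Rightarrow> real) \<Rightarrow> real set \<Rightarrow> bool" where
  "weight_conditions M X \<nu> h w b v T \<longleftrightarrow>
     whp M (\<lambda>N \<omega>. \<forall>x\<in>T. weight_sum w (\<nu> N) N (\<lambda>i. X N i \<omega>) x \<noteq> 0) \<and>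
     whp M (\<lambda>N \<omega>. \<forall>x\<in>T. weighted_mean w (\<nu> N) N (\<lambda>i. X N i \<omega>) x
         (\<lambda>j. group_mean (\<nu> N) N (\<lambda>i. X N i \<omega>) j - x) = 0) \<and>
     o_prob_on M (\<lambda>_. T)
       (\<lambda>N x \<omega>. weighted_mean w (\<nu> N) N (\<lambda>i. X N i \<omega>) x
           (\<lambda>j. (group_mean (\<nu> N) N (\<lambda>i. X N i \<omega>) j - x)\<^sup>2) - (h N)\<^sup>2 * b x)
       (\<lambda>N. (h N)\<^sup>2) \<and>
     o_prob_on M (\<lambda>_. T)
       (\<lambda>N x \<omega>. (\<Sum>j=1..N div \<nu> N. (weight w N (\<lambda>i. X N i \<omega>) j x)\<^sup>2)
           / (weight_sum w (\<nu> N) N (\<lambda>i. X N i \<omega>) x)\<^sup>2 - real (\<nu> N) * v x / (real N * h N))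
       (\<lambda>N. real (\<nu> N) / (real N * h N)) \<and>
     (\<forall>k\<ge>1. O_prob_on M (\<lambda>_. T)
       (\<lambda>N x \<omega>. (\<Sum>j=1..N div \<nu> N. \<bar>weight w N (\<lambda>i. X N i \<omega>) j x\<bar> ^ k)
           / weight_sum w (\<nu> N) N (\<lambda>i. X N i \<omega>) x ^ k)
       (\<lambda>N. (real (\<nu> N) / (real N * h N)) ^ (k - 1)))"

definition A_term ::
  "(nat \<Rightarrow> nat) \<Rightarrow> (nat \<Rightarrow> real) \<Rightarrow> (nat \<Rightarrow> real \<Rightarrow> real) \<Rightarrow> (real \<Rightarrow> real) \<Rightarrow> nat \<Rightarrow> real \<Rightarrow> real" where
  "A_term \<nu> h p v N x =
     sqrt (1 / (real (\<nu> N) * real N * h N) * (1 - p N x) powi (2 - int (\<nu> N))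
           * (1 - (1 - p N x) ^ \<nu> N) * v x)"

definition B_term ::
  "(nat \<Rightarrow> nat) \<Rightarrow> (nat \<Rightarrow> real) \<Rightarrow> (nat \<Rightarrow> real \<Rightarrow> real) \<Rightarrow> (real \<Rightarrow> real) \<Rightarrow> nat \<Rightarrow> real \<Rightarrow> real" where
  "B_term \<nu> h p b N x =
     1/2 * (h N)\<^sup>2 * (deriv (deriv (p N)) x
        - (real (\<nu> N) - 1) * inverse (1 - p N x) * (deriv (p N) x)\<^sup>2) * b x"

end

theory Submission
  imports Defs "HOL-Real_Asymp.Real_Asymp"
begin

text \<open>
  Given the covariates, the indicators that a group is clear are independent, with mean the product
  of the values \<open>1 - p\<close> over the group. So the estimate of \<open>\<mu> x = (1 - p x) ^ \<nu>\<close> is its conditional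
  mean plus a sum \<open>S x\<close> of independent centred bounded variables, weighted by the normalised
  weights. Since the density is bounded below, groups near \<open>x\<close> have diameter \<open>o(h)\<close>, and a Taylor
  expansion together with (S1) and (S2) gives the conditional mean. The map \<open>y \<mapsto> 1 - y powr (1 / \<nu>)\<close>
  has derivative \<open>L x\<close> at \<open>\<mu> x\<close>, so that the error is \<open>L x * S x + B x\<close> up to lower order, and by
  (S3) and (S4) the characteristic function of \<open>L x * S x / A x\<close> converges to that of the normal law.

  For the integrated error, the Hoelder condition allows \<open>x\<close> to be replaced by the points of a grid of
  polynomial size, on which Hoeffding's inequality bounds \<open>S\<close> uniformly. The sums at points further
  apart than twice the window use disjoint groups, so the integrals of \<open>(L x * S x)\<^sup>2\<close> and
  \<open>L x * S x * B x\<close> have conditional variances smaller by a factor \<open>h\<close> than the squares of their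
  natural orders, and Chebyshev's inequality applies.
\<close>

section \<open>Weighted sums of independent bounded variables\<close>

text \<open>Conditioning is done without regular conditional distributions: for each of the finitely
  many response vectors the law of the covariates on that event is given by an explicit density, so
  a conditional estimate is an estimate for a finite law at a fixed sample. The weights are
  controlled only with high probability. What is needed of them is collected in a property
  \<open>good\<close> of the sample, whose constant \<open>K1\<close> depends on the probability
  level alone; the tolerance \<kappa> is chosen after \<open>K1\<close>. The obstacle is that
  \<delta> may tend to 0 while \<nu> grows. The powers of \<nu> and \<delta> must be kept: the
  variance of a group outcome is at most of order \<open>\<nu> * \<delta>\<close>, and replacing the
  members of a group by their mean costs only a second-order error, because deviations from the mean
  cancel. Since \<open>\<nu> * \<delta>\<close> is bounded, \<mu> stays away from 0, where the root
  is not smooth. In the integral, a step function in x replaces \<open>S\<close>, so that only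
  finitely many random variables are left and measurability enters only at fixed x. The bound on
  weight increments also makes the estimate continuous in x, hence its squared error
  integrable.\<close>

definition (in prob_space) bounded_rv :: "('a \<Rightarrow> real) \<Rightarrow> bool" where
  "bounded_rv f \<longleftrightarrow> f \<in> borel_measurable M \<and> (\<exists>B. \<forall>\<omega>\<in>space M. \<bar>f \<omega>\<bar> \<le> B)"

context prob_space
begin

lemma bounded_rvI:
  "f \<in> borel_measurable M \<Longrightarrow> (\<And>\<omega>. \<omega> \<in> space M \<Longrightarrow> \<bar>f \<omega>\<bar> \<le> B) \<Longrightarrow> bounded_rv f"
  by (auto simp: bounded_rv_def)

lemma bounded_rv_measurable: "bounded_rv f \<Longrightarrow> f \<in> borel_measurable M"
  by (simp add: bounded_rv_def)

lemma bounded_rv_integrable: "bounded_rv f \<Longrightarrow> integrable M f"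
  unfolding bounded_rv_def
  by (elim conjE exE, rule integrable_const_bound) (auto intro: AE_I2)

lemma bounded_rv_const: "bounded_rv (\<lambda>_. c)"
  by (auto simp: bounded_rv_def)

lemma bounded_rv_mult:
  assumes "bounded_rv f" "bounded_rv g"
  shows "bounded_rv (\<lambda>\<omega>. f \<omega> * g \<omega>)"
proof -
  obtain B1 B2 where B: "\<forall>\<omega>\<in>space M. \<bar>f \<omega>\<bar> \<le> B1" "\<forall>\<omega>\<in>space M. \<bar>g \<omega>\<bar> \<le> B2"
    using assms by (auto simp: bounded_rv_def)
  have "\<bar>f \<omega> * g \<omega>\<bar> \<le> B1 * B2" if "\<omega> \<in> space M" for \<omega>
    unfolding abs_mult using B that by (intro mult_mono) (auto intro: order_trans[OF abs_ge_zero])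
  then show ?thesis
    using assms by (intro bounded_rvI[where B = "B1 * B2"]) (auto simp: bounded_rv_def)
qed

lemma bounded_rv_add:
  assumes "bounded_rv f" "bounded_rv g"
  shows "bounded_rv (\<lambda>\<omega>. f \<omega> + g \<omega>)"
proof -
  obtain B1 B2 where B: "\<forall>\<omega>\<in>space M. \<bar>f \<omega>\<bar> \<le> B1" "\<forall>\<omega>\<in>space M. \<bar>g \<omega>\<bar> \<le> B2"
    using assms by (auto simp: bounded_rv_def)
  then have "\<bar>f \<omega> + g \<omega>\<bar> \<le> B1 + B2" if "\<omega> \<in> space M" for \<omega>
    using that by (meson abs_triangle_ineq add_mono order_trans)
  then show ?thesis
    using assms by (intro bounded_rvI[where B = "B1 + B2"]) (auto simp: bounded_rv_def)
qed

lemma bounded_rv_cmult: "bounded_rv f \<Longrightarrow> bounded_rv (\<lambda>\<omega>. c * f \<omega>)"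
  by (intro bounded_rv_mult bounded_rv_const)

lemma bounded_rv_diff: "bounded_rv f \<Longrightarrow> bounded_rv g \<Longrightarrow> bounded_rv (\<lambda>\<omega>. f \<omega> - g \<omega>)"
  using bounded_rv_add[of f "\<lambda>\<omega>. (-1) * g \<omega>"] bounded_rv_cmult[of g "-1"] by simp

lemma bounded_rv_power: "bounded_rv f \<Longrightarrow> bounded_rv (\<lambda>\<omega>. f \<omega> ^ k)"
  by (induction k) (auto intro: bounded_rv_const bounded_rv_mult)

lemma bounded_rv_sum:
  "(\<And>i. i \<in> A \<Longrightarrow> bounded_rv (f i)) \<Longrightarrow> bounded_rv (\<lambda>\<omega>. \<Sum>i\<in>A. f i \<omega>)"
  by (induction A rule: infinite_finite_induct) (auto intro: bounded_rv_const bounded_rv_add)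

text \<open>Boundedness, unlike integrability, is preserved by products, so these rules discharge
  the integrability conditions of all polynomial expressions below.\<close>

lemmas bounded_rv_intros = bounded_rv_const bounded_rv_cmult bounded_rv_mult bounded_rv_add
  bounded_rv_diff bounded_rv_power bounded_rv_sum

lemma chebyshev_zero:
  assumes "bounded_rv f" "t > 0"
  shows "prob {\<omega>\<in>space M. t \<le> \<bar>f \<omega>\<bar>} \<le> expectation (\<lambda>\<omega>. (f \<omega>)\<^sup>2) / t\<^sup>2"
proof -
  have "{\<omega>\<in>space M. t \<le> \<bar>f \<omega>\<bar>} = {\<omega>\<in>space M. t\<^sup>2 \<le> (f \<omega>)\<^sup>2}"
    using assms(2) abs_le_square_iff[of t] by auto
  moreover have "prob {\<omega>\<in>space M. t\<^sup>2 \<le> (f \<omega>)\<^sup>2} \<le> expectation (\<lambda>\<omega>. (f \<omega>)\<^sup>2) / t\<^sup>2"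
    using assms
    by (intro integral_Markov_inequality_measure[where A = "{}"] bounded_rv_integrable bounded_rv_intros) auto
  ultimately show ?thesis by simp
qed

text \<open>Expanding the square leaves covariances. Far pairs contribute nothing; for near pairs
  nonnegativity of the \<open>U k\<close> allows the product of the means to be dropped, and the
  arithmetic-geometric inequality bounds the rest. The \<open>U k\<close> will be squares of linear
  forms, so that \<open>B\<close> bounds a fourth moment.\<close>

lemma expectation_square_centred_sum:
  assumes [simp]: "finite K" and U: "\<And>k. k \<in> K \<Longrightarrow> bounded_rv (U k)"
    and U0: "\<And>k \<omega>. k \<in> K \<Longrightarrow> 0 \<le> U k \<omega>"
    and uncorr: "\<And>k l. k \<in> K \<Longrightarrow> l \<in> K \<Longrightarrow> \<not> near k l \<Longrightarrow>
      expectation (\<lambda>\<omega>. U k \<omega> * U l \<omega>) = expectation (U k) * expectation (U l)"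
    and U2: "\<And>k. k \<in> K \<Longrightarrow> expectation (\<lambda>\<omega>. (U k \<omega>)\<^sup>2) \<le> B"
    and lam: "\<And>k. k \<in> K \<Longrightarrow> 0 \<le> lam k"
  shows "expectation (\<lambda>\<omega>. (\<Sum>k\<in>K. lam k * (U k \<omega> - expectation (U k)))\<^sup>2)
    \<le> B * (\<Sum>k\<in>K. \<Sum>l\<in>K. if near k l then lam k * lam l else 0)"
proof -
  note brv = bounded_rv_integrable bounded_rv_intros U
  have "expectation (\<lambda>\<omega>. (\<Sum>k\<in>K. lam k * (U k \<omega> - expectation (U k)))\<^sup>2)
      = expectation (\<lambda>\<omega>. \<Sum>k\<in>K. \<Sum>l\<in>K. lam k * lam l * ((U k \<omega> - expectation (U k)) * (U l \<omega> - expectation (U l))))"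
    by (simp add: power2_eq_square sum_product algebra_simps)
  also have "\<dots> = (\<Sum>k\<in>K. \<Sum>l\<in>K. expectation (\<lambda>\<omega>. lam k * lam l * ((U k \<omega> - expectation (U k)) * (U l \<omega> - expectation (U l)))))"
    by (subst Bochner_Integration.integral_sum, intro brv, assumption+)
       (intro sum.cong refl Bochner_Integration.integral_sum brv)
  also have "\<dots> \<le> (\<Sum>k\<in>K. \<Sum>l\<in>K. if near k l then lam k * lam l * B else 0)"
  proof (intro sum_mono)
    fix k l assume kl: "k \<in> K" "l \<in> K"
    have "expectation (\<lambda>\<omega>. (U k \<omega> - expectation (U k)) * (U l \<omega> - expectation (U l)))
      = expectation (\<lambda>\<omega>. U k \<omega> * U l \<omega> - expectation (U l) * U k \<omega> - expectation (U k) * U l \<omega>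
          + expectation (U k) * expectation (U l))"
      by (simp add: algebra_simps)
    also have "\<dots> = expectation (\<lambda>\<omega>. U k \<omega> * U l \<omega>) - expectation (U l) * expectation (U k)
        - expectation (U k) * expectation (U l) + expectation (U k) * expectation (U l)"
      using kl by (simp add: brv prob_space)
    finally have cov: "expectation (\<lambda>\<omega>. (U k \<omega> - expectation (U k)) * (U l \<omega> - expectation (U l)))
        = expectation (\<lambda>\<omega>. U k \<omega> * U l \<omega>) - expectation (U l) * expectation (U k)"
      by simp
    have "expectation (\<lambda>\<omega>. U k \<omega> * U l \<omega>) \<le> expectation (\<lambda>\<omega>. (1/2) * ((U k \<omega>)\<^sup>2 + (U l \<omega>)\<^sup>2))"
    proof (intro integral_mono brv kl)
      fix \<omega>
      show "U k \<omega> * U l \<omega> \<le> (1/2) * ((U k \<omega>)\<^sup>2 + (U l \<omega>)\<^sup>2)"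
        using sum_squares_bound[of "U k \<omega>" "U l \<omega>"] by simp
    qed
    also have "\<dots> = (1/2) * (expectation (\<lambda>\<omega>. (U k \<omega>)\<^sup>2) + expectation (\<lambda>\<omega>. (U l \<omega>)\<^sup>2))"
      using kl by (simp add: brv)
    also have "\<dots> \<le> B" using U2[OF kl(1)] U2[OF kl(2)] by simp
    finally have 1: "expectation (\<lambda>\<omega>. U k \<omega> * U l \<omega>) \<le> B" .
    have 2: "0 \<le> expectation (U l) * expectation (U k)"
      using U0 kl by (intro mult_nonneg_nonneg integral_nonneg) auto
    show "expectation (\<lambda>\<omega>. lam k * lam l * ((U k \<omega> - expectation (U k)) * (U l \<omega> - expectation (U l))))
        \<le> (if near k l then lam k * lam l * B else 0)"
    proof (cases "near k l")
      case True
      have "expectation (\<lambda>\<omega>. (U k \<omega> - expectation (U k)) * (U l \<omega> - expectation (U l))) \<le> B"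
        using cov 1 2 by linarith
      then have "lam k * lam l * expectation (\<lambda>\<omega>. (U k \<omega> - expectation (U k)) * (U l \<omega> - expectation (U l)))
          \<le> lam k * lam l * B"
        using lam kl by (intro mult_left_mono) auto
      then show ?thesis using True by simp
    next
      case False
      then show ?thesis using cov uncorr[OF kl] by simp
    qed
  qed
  also have "\<dots> = B * (\<Sum>k\<in>K. \<Sum>l\<in>K. if near k l then lam k * lam l else 0)"
    by (auto simp: sum_distrib_left algebra_simps intro!: sum.cong)
  finally show ?thesis .
qed

text \<open>The counterpart for signed coefficients, with far pairs orthogonal. It serves the cross
  term between the stochastic error and the bias.\<close>

lemma expectation_square_sum_le:
  assumes [simp]: "finite K" and U: "\<And>k. k \<in> K \<Longrightarrow> bounded_rv (U k)"
    and uncorr: "\<And>k l. k \<in> K \<Longrightarrow> l \<in> K \<Longrightarrow> \<not> near k l \<Longrightarrow> expectation (\<lambda>\<omega>. U k \<omega> * U l \<omega>) = 0"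
    and U2: "\<And>k. k \<in> K \<Longrightarrow> expectation (\<lambda>\<omega>. (U k \<omega>)\<^sup>2) \<le> B"
  shows "expectation (\<lambda>\<omega>. (\<Sum>k\<in>K. c k * U k \<omega>)\<^sup>2)
    \<le> B * (\<Sum>k\<in>K. \<Sum>l\<in>K. if near k l then \<bar>c k\<bar> * \<bar>c l\<bar> else 0)"
proof -
  note brv = bounded_rv_integrable bounded_rv_intros U
  have "expectation (\<lambda>\<omega>. (\<Sum>k\<in>K. c k * U k \<omega>)\<^sup>2)
      = expectation (\<lambda>\<omega>. \<Sum>k\<in>K. \<Sum>l\<in>K. c k * c l * (U k \<omega> * U l \<omega>))"
    by (simp add: power2_eq_square sum_product algebra_simps)
  also have "\<dots> = (\<Sum>k\<in>K. \<Sum>l\<in>K. expectation (\<lambda>\<omega>. c k * c l * (U k \<omega> * U l \<omega>)))"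
    by (subst Bochner_Integration.integral_sum, intro brv, assumption+)
       (intro sum.cong refl Bochner_Integration.integral_sum brv)
  also have "\<dots> \<le> (\<Sum>k\<in>K. \<Sum>l\<in>K. if near k l then \<bar>c k\<bar> * \<bar>c l\<bar> * B else 0)"
  proof (intro sum_mono)
    fix k l assume kl: "k \<in> K" "l \<in> K"
    have "\<bar>expectation (\<lambda>\<omega>. U k \<omega> * U l \<omega>)\<bar> \<le> expectation (\<lambda>\<omega>. \<bar>U k \<omega> * U l \<omega>\<bar>)"
      by (rule integral_abs_bound)
    also have "\<dots> \<le> expectation (\<lambda>\<omega>. (1/2) * ((U k \<omega>)\<^sup>2 + (U l \<omega>)\<^sup>2))"
    proof (intro integral_mono)
      show "integrable M (\<lambda>\<omega>. \<bar>U k \<omega> * U l \<omega>\<bar>)" "integrable M (\<lambda>\<omega>. (1/2) * ((U k \<omega>)\<^sup>2 + (U l \<omega>)\<^sup>2))"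
        by (intro integrable_abs brv kl)+
      fix \<omega>
      show "\<bar>U k \<omega> * U l \<omega>\<bar> \<le> (1/2) * ((U k \<omega>)\<^sup>2 + (U l \<omega>)\<^sup>2)"
        using sum_squares_bound[of "\<bar>U k \<omega>\<bar>" "\<bar>U l \<omega>\<bar>"] by (simp add: abs_mult)
    qed
    also have "\<dots> = (1/2) * (expectation (\<lambda>\<omega>. (U k \<omega>)\<^sup>2) + expectation (\<lambda>\<omega>. (U l \<omega>)\<^sup>2))"
      using kl by (simp add: brv)
    also have "\<dots> \<le> B" using U2[OF kl(1)] U2[OF kl(2)] by simp
    finally have 1: "\<bar>expectation (\<lambda>\<omega>. U k \<omega> * U l \<omega>)\<bar> \<le> B" .
    have "c k * c l * expectation (\<lambda>\<omega>. U k \<omega> * U l \<omega>) \<le> \<bar>c k * c l * expectation (\<lambda>\<omega>. U k \<omega> * U l \<omega>)\<bar>"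
      by simp
    also have "\<dots> \<le> \<bar>c k\<bar> * \<bar>c l\<bar> * B"
      unfolding abs_mult using 1 by (intro mult_left_mono) auto
    finally show "expectation (\<lambda>\<omega>. c k * c l * (U k \<omega> * U l \<omega>)) \<le> (if near k l then \<bar>c k\<bar> * \<bar>c l\<bar> * B else 0)"
      using uncorr[OF kl] by auto
  qed
  also have "\<dots> = B * (\<Sum>k\<in>K. \<Sum>l\<in>K. if near k l then \<bar>c k\<bar> * \<bar>c l\<bar> else 0)"
    by (auto simp: sum_distrib_left algebra_simps intro!: sum.cong)
  finally show ?thesis .
qed

end

lemma norm_triangle_via: "norm (a - c) \<le> norm (a - b) + norm (b - c :: 'a :: real_normed_vector)"
  using norm_triangle_ineq[of "a - b" "b - c"] by simp

section \<open>Linear forms in independent centred variables bounded by one\<close>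

locale indep_centred = prob_space +
  fixes I :: "'i set" and \<xi> :: "'i \<Rightarrow> 'a \<Rightarrow> real"
  assumes fin: "finite I" and indep: "indep_vars (\<lambda>_. borel) \<xi> I"
    and bnd: "\<And>i \<omega>. i \<in> I \<Longrightarrow> \<omega> \<in> space M \<Longrightarrow> \<bar>\<xi> i \<omega>\<bar> \<le> 1"
    and mean0: "\<And>i. i \<in> I \<Longrightarrow> expectation (\<xi> i) = 0"
begin

abbreviation lin :: "('i \<Rightarrow> real) \<Rightarrow> 'a \<Rightarrow> real" where
  "lin c \<omega> \<equiv> \<Sum>i\<in>I. c i * \<xi> i \<omega>"

abbreviation var :: "'i \<Rightarrow> real" where
  "var i \<equiv> expectation (\<lambda>\<omega>. (\<xi> i \<omega>)\<^sup>2)"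

lemma rv_xi: "i \<in> I \<Longrightarrow> \<xi> i \<in> borel_measurable M"
  using indep unfolding indep_vars_def by blast

lemma brv_xi: "i \<in> I \<Longrightarrow> bounded_rv (\<xi> i)"
  using rv_xi bnd by (auto intro: bounded_rvI)

lemma brv_lin_subset: "F \<subseteq> I \<Longrightarrow> bounded_rv (\<lambda>\<omega>. \<Sum>i\<in>F. c i * \<xi> i \<omega>)"
  by (intro bounded_rv_sum bounded_rv_cmult brv_xi) auto

lemma brv_lin: "bounded_rv (lin c)"
  by (rule brv_lin_subset) simp

lemma indep_scaled: "F \<subseteq> I \<Longrightarrow> indep_vars (\<lambda>_. borel) (\<lambda>i \<omega>. c i * \<xi> i \<omega>) F"
  by (rule indep_vars_compose2[OF indep_vars_subset[OF indep]]) auto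

lemma expectation_xi_prod:
  assumes "i \<in> I" "j \<in> I" "i \<noteq> j"
  shows "expectation (\<lambda>\<omega>. \<xi> i \<omega> * \<xi> j \<omega>) = 0"
proof -
  have "expectation (\<lambda>\<omega>. \<Prod>k\<in>{i,j}. \<xi> k \<omega>) = (\<Prod>k\<in>{i,j}. expectation (\<xi> k))"
    using assms by (intro indep_vars_lebesgue_integral indep_vars_subset[OF indep])
      (auto intro: bounded_rv_integrable brv_xi)
  then show ?thesis using assms mean0 by simp
qed

lemma expectation_lin_mult:
  "expectation (\<lambda>\<omega>. lin a \<omega> * lin b \<omega>) = (\<Sum>i\<in>I. a i * b i * var i)"
proof -
  note brv = bounded_rv_integrable bounded_rv_intros brv_xi
  have "expectation (\<lambda>\<omega>. lin a \<omega> * lin b \<omega>)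
      = expectation (\<lambda>\<omega>. \<Sum>i\<in>I. \<Sum>j\<in>I. a i * b j * (\<xi> i \<omega> * \<xi> j \<omega>))"
    by (simp add: sum_product algebra_simps)
  also have "\<dots> = (\<Sum>i\<in>I. \<Sum>j\<in>I. expectation (\<lambda>\<omega>. a i * b j * (\<xi> i \<omega> * \<xi> j \<omega>)))"
    by (subst Bochner_Integration.integral_sum, intro brv, assumption+)
       (intro sum.cong refl Bochner_Integration.integral_sum brv)
  also have "\<dots> = (\<Sum>i\<in>I. \<Sum>j\<in>I. if i = j then a i * b i * var i else 0)"
    using expectation_xi_prod by (auto intro!: sum.cong simp: power2_eq_square)
  also have "\<dots> = (\<Sum>i\<in>I. a i * b i * var i)"
    using fin by simp
  finally show ?thesis .
qed

lemma expectation_lin_square: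
  "expectation (\<lambda>\<omega>. (lin c \<omega>)\<^sup>2) = (\<Sum>i\<in>I. (c i)\<^sup>2 * var i)"
  using expectation_lin_mult[of c c] by (simp add: power2_eq_square)

text \<open>Higher moments are compared with the variance rather than with 1, because the variance
  of a group outcome carries a factor of order \<open>\<nu> * \<delta>\<close> on which later
  estimates depend.\<close>

lemma expectation_power_le_var:
  assumes "i \<in> I" "k \<ge> 2"
  shows "expectation (\<lambda>\<omega>. \<bar>\<xi> i \<omega>\<bar> ^ k) \<le> var i"
proof (rule integral_mono)
  have "bounded_rv (\<lambda>\<omega>. \<bar>\<xi> i \<omega>\<bar>)"
    using brv_xi[OF assms(1)] by (auto simp: bounded_rv_def)
  then show "integrable M (\<lambda>\<omega>. \<bar>\<xi> i \<omega>\<bar> ^ k)"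
    by (intro bounded_rv_integrable bounded_rv_power)
  show "integrable M (\<lambda>\<omega>. (\<xi> i \<omega>)\<^sup>2)"
    by (intro bounded_rv_integrable bounded_rv_power brv_xi assms)
  show "\<omega> \<in> space M \<Longrightarrow> \<bar>\<xi> i \<omega>\<bar> ^ k \<le> (\<xi> i \<omega>)\<^sup>2" for \<omega>
    using power_decreasing[OF assms(2), of "\<bar>\<xi> i \<omega>\<bar>"] bnd[OF assms(1)] by simp
qed

text \<open>Induction on the index set: adding an independent centred summand, the mixed terms with
  a factor to the first power vanish, and only the product of the two variances survives. Mean and
  second moment are carried along for this purpose.\<close>

lemma expectation_lin_4:
  "expectation (\<lambda>\<omega>. (lin c \<omega>) ^ 4) \<le> 3 * (\<Sum>i\<in>I. (c i)\<^sup>2 * var i)\<^sup>2 + (\<Sum>i\<in>I. (c i) ^ 4 * var i)"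
proof -
  have "expectation (\<lambda>\<omega>. (\<Sum>i\<in>F. c i * \<xi> i \<omega>) ^ 4)
      \<le> 3 * (\<Sum>i\<in>F. (c i)\<^sup>2 * var i)\<^sup>2 + (\<Sum>i\<in>F. (c i) ^ 4 * var i)
    \<and> expectation (\<lambda>\<omega>. (\<Sum>i\<in>F. c i * \<xi> i \<omega>)\<^sup>2) = (\<Sum>i\<in>F. (c i)\<^sup>2 * var i)
    \<and> expectation (\<lambda>\<omega>. (\<Sum>i\<in>F. c i * \<xi> i \<omega>)) = 0"
    if "finite F" "F \<subseteq> I" for F
    using that
  proof (induction F rule: finite_induct)
    case empty
    then show ?case by simp
  next
    case (insert x F)
    let ?S = "\<lambda>\<omega>. \<Sum>i\<in>F. c i * \<xi> i \<omega>" and ?X = "\<lambda>\<omega>. c x * \<xi> x \<omega>"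
    have S: "bounded_rv ?S" and X: "bounded_rv ?X"
      using insert.prems by (auto intro: brv_lin_subset bounded_rv_cmult brv_xi)
    note brv = bounded_rv_integrable bounded_rv_intros S X
    have ind: "indep_var borel ?X borel ?S"
      using insert by (intro indep_vars_sum indep_scaled) auto
    have split: "expectation (\<lambda>\<omega>. ?X \<omega> ^ k * ?S \<omega> ^ l) = expectation (\<lambda>\<omega>. ?X \<omega> ^ k) * expectation (\<lambda>\<omega>. ?S \<omega> ^ l)"
      for k l
    proof -
      have "indep_var borel ((\<lambda>t. t ^ k) \<circ> ?X) borel ((\<lambda>t. t ^ l) \<circ> ?S)"
        by (rule indep_var_compose[OF ind]) auto
      then have "indep_var borel (\<lambda>\<omega>. ?X \<omega> ^ k) borel (\<lambda>\<omega>. ?S \<omega> ^ l)"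
        by (simp add: comp_def)
      then show ?thesis
        by (rule indep_var_lebesgue_integral) (intro brv)+
    qed
    have IH: "expectation (\<lambda>\<omega>. ?S \<omega> ^ 4) \<le> 3 * (\<Sum>i\<in>F. (c i)\<^sup>2 * var i)\<^sup>2 + (\<Sum>i\<in>F. (c i) ^ 4 * var i)"
      "expectation (\<lambda>\<omega>. (?S \<omega>)\<^sup>2) = (\<Sum>i\<in>F. (c i)\<^sup>2 * var i)"
      "expectation ?S = 0"
      using insert by auto
    have X1: "expectation ?X = 0" and X2: "expectation (\<lambda>\<omega>. (?X \<omega>)\<^sup>2) = (c x)\<^sup>2 * var x"
      using mean0 insert.prems by (auto simp: power_mult_distrib)
    have X4: "expectation (\<lambda>\<omega>. (?X \<omega>) ^ 4) \<le> (c x) ^ 4 * var x"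
      using expectation_power_le_var[of x 4] insert.prems
      by (auto simp: power_mult_distrib power_even_abs intro!: mult_left_mono)
    have "expectation (\<lambda>\<omega>. (?X \<omega> + ?S \<omega>) ^ 4)
       = expectation (\<lambda>\<omega>. ?X \<omega> ^ 4 * ?S \<omega> ^ 0 + 4 * (?X \<omega> ^ 3 * ?S \<omega> ^ 1) + 6 * (?X \<omega> ^ 2 * ?S \<omega> ^ 2)
           + 4 * (?X \<omega> ^ 1 * ?S \<omega> ^ 3) + ?X \<omega> ^ 0 * ?S \<omega> ^ 4)"
      by (intro Bochner_Integration.integral_cong refl) algebra
    also have "\<dots> = expectation (\<lambda>\<omega>. ?X \<omega> ^ 4 * ?S \<omega> ^ 0) + 4 * expectation (\<lambda>\<omega>. ?X \<omega> ^ 3 * ?S \<omega> ^ 1)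
         + 6 * expectation (\<lambda>\<omega>. ?X \<omega> ^ 2 * ?S \<omega> ^ 2)
         + 4 * expectation (\<lambda>\<omega>. ?X \<omega> ^ 1 * ?S \<omega> ^ 3) + expectation (\<lambda>\<omega>. ?X \<omega> ^ 0 * ?S \<omega> ^ 4)"
      by (subst Bochner_Integration.integral_add, (intro brv)+)+ simp
    also have "\<dots> = expectation (\<lambda>\<omega>. ?X \<omega> ^ 4) + 6 * ((c x)\<^sup>2 * var x * (\<Sum>i\<in>F. (c i)\<^sup>2 * var i))
        + expectation (\<lambda>\<omega>. ?S \<omega> ^ 4)"
      unfolding split using IH X1 X2 by (simp add: prob_space)
    also have "\<dots> \<le> (c x) ^ 4 * var x + 6 * ((c x)\<^sup>2 * var x * (\<Sum>i\<in>F. (c i)\<^sup>2 * var i))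
        + (3 * (\<Sum>i\<in>F. (c i)\<^sup>2 * var i)\<^sup>2 + (\<Sum>i\<in>F. (c i) ^ 4 * var i))"
      using X4 IH by linarith
    \<comment> \<open>The term with coefficient 6 is exactly the mixed term of three times the
      square; the square of the new variance is given away.\<close>
    also have "\<dots> \<le> 3 * ((c x)\<^sup>2 * var x + (\<Sum>i\<in>F. (c i)\<^sup>2 * var i))\<^sup>2 + ((c x) ^ 4 * var x + (\<Sum>i\<in>F. (c i) ^ 4 * var i))"
      using zero_le_power2[of "(c x)\<^sup>2 * var x"] by (simp add: power2_sum)
    finally have 4: "expectation (\<lambda>\<omega>. (?X \<omega> + ?S \<omega>) ^ 4) \<le> \<dots>" .
    have "expectation (\<lambda>\<omega>. (?X \<omega> + ?S \<omega>)\<^sup>2)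
       = expectation (\<lambda>\<omega>. ?X \<omega> ^ 2 * ?S \<omega> ^ 0 + 2 * (?X \<omega> ^ 1 * ?S \<omega> ^ 1) + ?X \<omega> ^ 0 * ?S \<omega> ^ 2)"
      by (intro Bochner_Integration.integral_cong refl) algebra
    also have "\<dots> = expectation (\<lambda>\<omega>. ?X \<omega> ^ 2 * ?S \<omega> ^ 0) + 2 * expectation (\<lambda>\<omega>. ?X \<omega> ^ 1 * ?S \<omega> ^ 1)
         + expectation (\<lambda>\<omega>. ?X \<omega> ^ 0 * ?S \<omega> ^ 2)"
      by (subst Bochner_Integration.integral_add, (intro brv)+)+ simp
    also have "\<dots> = (c x)\<^sup>2 * var x + (\<Sum>i\<in>F. (c i)\<^sup>2 * var i)"
      unfolding split using IH X1 X2 by (simp add: prob_space)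
    finally have 2: "expectation (\<lambda>\<omega>. (?X \<omega> + ?S \<omega>)\<^sup>2) = \<dots>" .
    have 1: "expectation (\<lambda>\<omega>. ?X \<omega> + ?S \<omega>) = 0"
      using X1 IH bounded_rv_integrable[OF S] bounded_rv_integrable[OF X]
      by (simp only: Bochner_Integration.integral_add)
    from 4 2 1 show ?case using insert.hyps by simp
  qed
  from this[OF fin subset_refl] show ?thesis by blast
qed

lemma expectation_lin_squares_disjoint:
  assumes "\<And>i. i \<in> I \<Longrightarrow> a i = 0 \<or> b i = 0"
  shows "expectation (\<lambda>\<omega>. (lin a \<omega>)\<^sup>2 * (lin b \<omega>)\<^sup>2)
    = expectation (\<lambda>\<omega>. (lin a \<omega>)\<^sup>2) * expectation (\<lambda>\<omega>. (lin b \<omega>)\<^sup>2)"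
proof -
  \<comment> \<open>\<open>B\<close> is the set where \<open>a\<close> vanishes, not the support of
    \<open>b\<close>, so it is disjoint from \<open>A\<close> by definition; by hypothesis
    \<open>b\<close> has no terms outside it.\<close>
  define A B where "A = {i\<in>I. a i \<noteq> 0}" and "B = {i\<in>I. a i = 0}"
  have AB: "A \<inter> B = {}" "A \<subseteq> I" "B \<subseteq> I" by (auto simp: A_def B_def)
  have la: "lin a \<omega> = (\<Sum>i\<in>A. a i * \<xi> i \<omega>)" for \<omega>
    unfolding A_def using fin by (intro sum.mono_neutral_right) auto
  have lb: "lin b \<omega> = (\<Sum>i\<in>B. b i * \<xi> i \<omega>)" for \<omega>
    unfolding B_def using fin assms by (intro sum.mono_neutral_right) auto
  have "indep_var borel ((\<lambda>f. (\<Sum>i\<in>A. a i * f i)\<^sup>2) \<circ> (\<lambda>\<omega>. restrict (\<lambda>i. \<xi> i \<omega>) A))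
     borel ((\<lambda>f. (\<Sum>i\<in>B. b i * f i)\<^sup>2) \<circ> (\<lambda>\<omega>. restrict (\<lambda>i. \<xi> i \<omega>) B))"
    by (intro indep_var_compose[OF indep_var_restrict[OF indep AB]]) auto
  then have "indep_var borel (\<lambda>\<omega>. (lin a \<omega>)\<^sup>2) borel (\<lambda>\<omega>. (lin b \<omega>)\<^sup>2)"
    unfolding la lb by (simp add: comp_def cong: sum.cong)
  then show ?thesis
    by (rule indep_var_lebesgue_integral) (intro bounded_rv_integrable bounded_rv_power brv_lin)+
qed

lemma hoeffding_lin:
  assumes s: "(\<Sum>i\<in>I. (c i)\<^sup>2) \<le> s" "0 < s" and t: "0 < t"
  shows "prob {\<omega>\<in>space M. t \<le> \<bar>lin c \<omega>\<bar>} \<le> 2 * exp (- t\<^sup>2 / (2 * s))"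
\<comment> \<open>Hoeffding's exponent divides by the sum of squares; when that vanishes the linear
  form is zero and the event empty.\<close>
proof (cases "(\<Sum>i\<in>I. (c i)\<^sup>2) = 0")
  case True
  then have "\<forall>i\<in>I. c i = 0" using fin by (simp add: sum_nonneg_eq_0_iff)
  then show ?thesis using t by simp
next
  case False
  define d where "d = (\<Sum>i\<in>I. (c i)\<^sup>2)"
  have d: "0 < d" "d \<le> s"
    using False s sum_nonneg[of I "\<lambda>i. (c i)\<^sup>2"] by (auto simp: d_def less_le)
  have b: "AE \<omega> in M. c i * \<xi> i \<omega> \<in> {- \<bar>c i\<bar>..\<bar>c i\<bar>}" if i: "i \<in> I" for i
  proof (rule AE_I2)
    fix \<omega> assume "\<omega> \<in> space M"
    then have "\<bar>c i * \<xi> i \<omega>\<bar> \<le> \<bar>c i\<bar>"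
      using bnd[OF i] by (simp add: abs_mult mult_left_le)
    then show "c i * \<xi> i \<omega> \<in> {- \<bar>c i\<bar>..\<bar>c i\<bar>}" by auto
  qed
  interpret H: Hoeffding_ineq M I "\<lambda>i \<omega>. c i * \<xi> i \<omega>" "\<lambda>i. - \<bar>c i\<bar>" "\<lambda>i. \<bar>c i\<bar>"
      "\<Sum>i\<in>I. expectation (\<lambda>\<omega>. c i * \<xi> i \<omega>)"
    by unfold_locales (use fin b indep_scaled in auto)
  have sq: "(\<Sum>i\<in>I. (\<bar>c i\<bar> - - \<bar>c i\<bar>)\<^sup>2) = 4 * d"
    unfolding d_def sum_distrib_left by (intro sum.cong refl) (simp add: power2_eq_square)
  have "prob {\<omega>\<in>space M. t \<le> \<bar>lin c \<omega> - (\<Sum>i\<in>I. expectation (\<lambda>\<omega>. c i * \<xi> i \<omega>))\<bar>} \<le> 2 * exp (- 2 * t\<^sup>2 / (4 * d))"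
    using H.Hoeffding_ineq_abs_ge[of t] d t unfolding sq by simp
  moreover have "(\<Sum>i\<in>I. expectation (\<lambda>\<omega>. c i * \<xi> i \<omega>)) = 0"
    using mean0 by simp
  ultimately have "prob {\<omega>\<in>space M. t \<le> \<bar>lin c \<omega>\<bar>} \<le> 2 * exp (- (t\<^sup>2 / (2 * d)))"
    by (simp add: field_simps)
  also have "\<dots> \<le> 2 * exp (- (t\<^sup>2 / (2 * s)))"
    using d t by (auto intro!: divide_left_mono)
  finally show ?thesis by simp
qed

text \<open>A quantitative central limit estimate. Both sides are products over \<open>I\<close> of
  factors of modulus at most 1, so they differ by at most the sum of the factorwise differences.
  Each of these is a third-order Taylor error plus the error of \<open>1 - y\<close> against
  \<open>exp (- y)\<close>.\<close>

lemma char_lin: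
  "cmod (expectation (\<lambda>\<omega>. iexp (lin c \<omega>)) - of_real (exp (- (\<Sum>i\<in>I. (c i)\<^sup>2 * var i) / 2)))
    \<le> (\<Sum>i\<in>I. \<bar>c i\<bar> ^ 3 * var i) + (\<Sum>i\<in>I. (c i) ^ 4 * (var i)\<^sup>2)"
proof -
  let ?X = "\<lambda>i \<omega>. c i * \<xi> i \<omega>"
  let ?w = "\<lambda>i. of_real (exp (- ((c i)\<^sup>2 * var i) / 2)) :: complex"
  have X: "bounded_rv (?X i)" if "i \<in> I" for i by (intro bounded_rv_cmult brv_xi that)
  have "expectation (\<lambda>\<omega>. iexp (lin c \<omega>)) = char (distr M borel (lin c)) 1"
    unfolding char_def by (subst integral_distr) (auto simp: bounded_rv_measurable[OF brv_lin])
  also have "\<dots> = (\<Prod>i\<in>I. char (distr M borel (?X i)) 1)"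
    by (rule char_distr_sum[OF indep_scaled]) simp
  finally have 1: "expectation (\<lambda>\<omega>. iexp (lin c \<omega>)) = \<dots>" .
  have 2: "of_real (exp (- (\<Sum>i\<in>I. (c i)\<^sup>2 * var i) / 2)) = (\<Prod>i\<in>I. ?w i)"
    using fin by (simp add: sum_negf[symmetric] sum_divide_distrib exp_sum del: of_real_exp)
  have "cmod ((\<Prod>i\<in>I. char (distr M borel (?X i)) 1) - (\<Prod>i\<in>I. ?w i))
      \<le> (\<Sum>i\<in>I. cmod (char (distr M borel (?X i)) 1 - ?w i))"
  proof (rule norm_prod_diff)
    fix i assume i: "i \<in> I"
    interpret r: real_distribution "distr M borel (?X i)"
      by (rule real_distribution_distr) (rule bounded_rv_measurable[OF X[OF i]])
    show "cmod (char (distr M borel (?X i)) 1) \<le> 1" by (rule r.cmod_char_le_1)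
    show "cmod (?w i) \<le> 1" by (simp del: of_real_exp)
  qed
  also have "\<dots> \<le> (\<Sum>i\<in>I. \<bar>c i\<bar> ^ 3 * var i + (c i) ^ 4 * (var i)\<^sup>2)"
  proof (rule sum_mono)
    fix i assume i: "i \<in> I"
    have var: "variance (?X i) = (c i)\<^sup>2 * var i"
      using mean0[OF i] by (simp add: power_mult_distrib)
    have "cmod (char (distr M borel (?X i)) 1 - (1 - 1\<^sup>2 * ((c i)\<^sup>2 * var i) / 2))
       \<le> (1\<^sup>2 / 6) * expectation (\<lambda>\<omega>. min (6 * (?X i \<omega>)\<^sup>2) (\<bar>1\<bar> * \<bar>?X i \<omega>\<bar> ^ 3))"
      using mean0[OF i] X[OF i]
      by (intro char_approx3' var bounded_rv_integrable bounded_rv_power refl bounded_rv_measurable) auto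
    also have "expectation (\<lambda>\<omega>. min (6 * (?X i \<omega>)\<^sup>2) (\<bar>1\<bar> * \<bar>?X i \<omega>\<bar> ^ 3)) \<le> expectation (\<lambda>\<omega>. \<bar>c i\<bar> ^ 3 * \<bar>\<xi> i \<omega>\<bar> ^ 3)"
    proof (rule integral_mono)
      have b: "bounded_rv (\<lambda>\<omega>. \<bar>\<xi> i \<omega>\<bar>)"
        using brv_xi[OF i] by (auto simp: bounded_rv_def)
      then show b3: "integrable M (\<lambda>\<omega>. \<bar>c i\<bar> ^ 3 * \<bar>\<xi> i \<omega>\<bar> ^ 3)"
        by (intro bounded_rv_integrable bounded_rv_intros)
      have [measurable]: "\<xi> i \<in> borel_measurable M" by (rule rv_xi[OF i])
      show "integrable M (\<lambda>\<omega>. min (6 * (?X i \<omega>)\<^sup>2) (\<bar>1\<bar> * \<bar>?X i \<omega>\<bar> ^ 3))"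
        by (rule Bochner_Integration.integrable_bound[OF b3]) (auto simp: abs_mult power_mult_distrib min_def)
    qed (simp add: abs_mult power_mult_distrib)
    also have "\<dots> \<le> \<bar>c i\<bar> ^ 3 * var i"
      using expectation_power_le_var[OF i, of 3] by (simp add: mult_left_mono)
    finally have a: "cmod (char (distr M borel (?X i)) 1 - of_real (1 - (c i)\<^sup>2 * var i / 2)) \<le> \<bar>c i\<bar> ^ 3 * var i / 6"
      by simp
    define y where "y = (c i)\<^sup>2 * var i / 2"
    have y: "0 \<le> y" by (simp add: y_def)
    have "\<bar>exp (- y) - (1 - y)\<bar> \<le> y\<^sup>2"
    proof -
      have "1 - y \<le> exp (- y)" using exp_ge_add_one_self[of "- y"] by simp
      moreover have "exp (- y) \<le> 1 / (1 + y)"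
        using exp_ge_add_one_self[of y] y by (simp add: exp_minus field_simps)
      moreover have "1 / (1 + y) \<le> 1 - y + y\<^sup>2"
        using y by (simp add: field_simps power2_eq_square)
      ultimately show ?thesis by auto
    qed
    then have "cmod (of_real (1 - y) - of_real (exp (- y))) \<le> y\<^sup>2"
      by (simp add: norm_of_real abs_minus_commute flip: of_real_diff of_real_minus of_real_exp)
    moreover have "y\<^sup>2 \<le> (c i) ^ 4 * (var i)\<^sup>2"
    proof -
      have "y\<^sup>2 = ((c i) ^ 4 * (var i)\<^sup>2) / 4"
        by (simp add: y_def power_mult_distrib power_divide)
      then show ?thesis using zero_le_power2[of y] by linarith
    qed
    ultimately have b: "cmod (of_real (1 - (c i)\<^sup>2 * var i / 2) - ?w i) \<le> (c i) ^ 4 * (var i)\<^sup>2"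
      by (simp add: y_def)
    have "cmod (char (distr M borel (?X i)) 1 - ?w i) \<le>
       cmod (char (distr M borel (?X i)) 1 - of_real (1 - (c i)\<^sup>2 * var i / 2))
       + cmod (of_real (1 - (c i)\<^sup>2 * var i / 2) - ?w i)"
      by (rule norm_triangle_via)
    moreover have "\<bar>c i\<bar> ^ 3 * var i / 6 \<le> \<bar>c i\<bar> ^ 3 * var i" by simp
    ultimately show "cmod (char (distr M borel (?X i)) 1 - ?w i) \<le> \<bar>c i\<bar> ^ 3 * var i + (c i) ^ 4 * (var i)\<^sup>2"
      using a b by linarith
  qed
  finally show ?thesis unfolding 1 2 by (simp add: sum.distrib)
qed

end

section \<open>Order statistics and the conditional law of the groups\<close>

lemma measurable_compose_count:
  assumes "g \<in> measurable M (count_space (UNIV :: 'b :: countable set))"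
    and "\<And>i. f i \<in> measurable M N"
  shows "(\<lambda>x. f (g x) x) \<in> measurable M N"
  using measurable_compose_countable[of f M N g] assms by simp

text \<open>Outside \<open>A\<close> the coordinate is the constant \<open>undefined\<close>, hence
  measurable as well; automatic measurability proofs can thus treat arbitrary indices alike.\<close>

lemma measurable_PiM_component_real [measurable]:
  "(\<lambda>x. x i) \<in> borel_measurable (PiM A (\<lambda>_. borel :: real measure))"
proof (cases "i \<in> A")
  case False
  have "(\<lambda>x. x i) \<in> borel_measurable (PiM A (\<lambda>_. borel :: real measure)) \<longleftrightarrow>
      (\<lambda>x. undefined :: real) \<in> borel_measurable (PiM A (\<lambda>_. borel :: real measure))"
    using False by (intro measurable_cong) (auto simp: space_PiM PiE_def extensional_def)
  then show ?thesis by simp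
qed (rule measurable_component_singleton)

text \<open>Insertion only branches on comparisons of two coordinates. As lists of indices form a
  countable type, \<open>measurable_compose_count\<close> then iterates it to sorting.\<close>

lemma measurable_insort_key [measurable]:
  "(\<lambda>x. insort_key x a L) \<in> measurable (PiM A (\<lambda>_. borel :: real measure)) (count_space (UNIV :: nat list set))"
proof (induction L)
  case (Cons b L)
  have "(\<lambda>x. b # insort_key x a L) \<in> measurable (PiM A (\<lambda>_. borel :: real measure)) (count_space (UNIV :: nat list set))"
    using measurable_compose[OF Cons, of "(#) b" "count_space UNIV"] by simp
  with Cons show ?case by simp
qed simp

lemma measurable_sort_key [measurable]:
  "(\<lambda>x. sort_key x L) \<in> measurable (PiM A (\<lambda>_. borel :: real measure)) (count_space (UNIV :: nat list set))"
proof (induction L)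
  case (Cons b L)
  then show ?case
    unfolding sort_key_simps by (rule measurable_compose_count) (rule measurable_insort_key)
qed simp

lemma measurable_rank_index [measurable]:
  "(\<lambda>x. rank_index N x i) \<in> measurable (PiM A (\<lambda>_. borel :: real measure)) (count_space UNIV)"
  unfolding rank_index_def by (rule measurable_compose[OF measurable_sort_key]) simp

lemma measurable_order_stat [measurable]:
  "(\<lambda>x. order_stat N x i) \<in> borel_measurable (PiM A (\<lambda>_. borel :: real measure))"
  unfolding order_stat_def by (rule measurable_compose_count) simp_all

lemma measurable_group_mean [measurable]:
  "(\<lambda>x. group_mean n N x j) \<in> borel_measurable (PiM A (\<lambda>_. borel :: real measure))"
  unfolding group_mean_def by measurable

lemma insort_key_cong':
  "(\<And>i. i \<in> set L \<Longrightarrow> f i = g i) \<Longrightarrow> f a = g a \<Longrightarrow> insort_key f a L = insort_key g a L"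
  by (induction L) auto

lemma sort_key_cong':
  "(\<And>i. i \<in> set L \<Longrightarrow> f i = g i) \<Longrightarrow> sort_key f L = sort_key g L"
  by (induction L) (auto intro!: insort_key_cong')

lemma rank_index_bij: "bij_betw (rank_index N u) {1..N} {1..N}"
proof -
  have "bij_betw ((!) (sort_key u [1..<Suc N])) {..<N} {1..N}"
    by (rule bij_betw_nth) auto
  moreover have "bij_betw (\<lambda>i. i - 1) {1..N} {..<N}"
    by (rule bij_betwI[where g = Suc]) auto
  ultimately have "bij_betw ((!) (sort_key u [1..<Suc N]) \<circ> (\<lambda>i. i - 1)) {1..N} {1..N}"
    by (rule bij_betw_trans[rotated])
  then show ?thesis by (simp add: rank_index_def comp_def cong: bij_betw_cong)
qed

lemma rank_index_in: "i \<in> {1..N} \<Longrightarrow> rank_index N u i \<in> {1..N}"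
  using rank_index_bij[of N u] by (auto simp: bij_betw_def)

lemma rank_index_cong:
  "(\<And>i. i \<in> {1..N} \<Longrightarrow> u i = u' i) \<Longrightarrow> rank_index N u = rank_index N u'"
  unfolding rank_index_def by (subst sort_key_cong'[of _ u u']) auto

lemma order_stat_cong:
  assumes "\<And>i. i \<in> {1..N} \<Longrightarrow> u i = u' i" "k \<in> {1..N}"
  shows "order_stat N u k = order_stat N u' k"
proof -
  have "rank_index N u = rank_index N u'" by (rule rank_index_cong) (rule assms)
  then show ?thesis
    unfolding order_stat_def using assms(1)[OF rank_index_in[OF assms(2), of u']] by simp
qed

lemma order_stat_mono:
  assumes "1 \<le> i" "i \<le> k" "k \<le> N"
  shows "order_stat N u i \<le> order_stat N u k"
proof -
  let ?s = "sort_key u [1..<Suc N]"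
  have "map u ?s ! (i - 1) \<le> map u ?s ! (k - 1)"
    using assms by (intro sorted_nth_mono) auto
  then show ?thesis using assms by (simp add: order_stat_def rank_index_def)
qed

lemma group_index_in:
  fixes i j n N :: nat
  assumes "j \<in> {1..N div n}" "i \<in> {1..n}"
  shows "(j - 1) * n + i \<in> {1..N}"
proof -
  have "(j - 1) * n + i \<le> (j - 1) * n + n" using assms(2) by simp
  also have "\<dots> = j * n" using assms by (cases j) auto
  also have "\<dots> \<le> (N div n) * n" using assms by (intro mult_right_mono) auto
  also have "\<dots> \<le> N" by simp
  finally show ?thesis using assms by auto
qed

lemma group_mean_cong:
  assumes "\<And>i. i \<in> {1..N} \<Longrightarrow> u i = u' i" "j \<in> {1..N div n}"
  shows "group_mean n N u j = group_mean n N u' j"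
  unfolding group_mean_def
  using group_index_in[OF assms(2)] by (auto intro!: arg_cong2[where f = "(/)"] sum.cong order_stat_cong assms(1))

lemma weight_cong:
  assumes "\<And>i. i \<in> {1..N} \<Longrightarrow> u i = u' i"
  shows "weight w N u = weight w N u'"
proof -
  have "(\<lambda>i\<in>{1..N}. order_stat N u i) = (\<lambda>i\<in>{1..N}. order_stat N u' i)"
    using order_stat_cong[OF assms] by (intro restrict_ext) auto
  then show ?thesis unfolding weight_def by (simp only:)
qed

section \<open>Conditional law of the group outcomes\<close>

definition group_clear :: "nat \<Rightarrow> nat \<Rightarrow> (nat \<Rightarrow> real) \<Rightarrow> (nat \<Rightarrow> bool) \<Rightarrow> nat \<Rightarrow> real" where
  "group_clear n N u y j = of_bool (\<forall>i\<in>{1..n}. \<not> y (rank_index N u ((j - 1) * n + i)))"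

text \<open>Written with the truncated Bernoulli probability, so that it is the exact mean of
  \<open>group_clear\<close> under \<open>response_pmf\<close> at every sample, not only where
  \<open>q\<close> is at most 1.\<close>

definition clear_prob :: "(real \<Rightarrow> real) \<Rightarrow> nat \<Rightarrow> nat \<Rightarrow> (nat \<Rightarrow> real) \<Rightarrow> nat \<Rightarrow> real" where
  "clear_prob q n N u j = (\<Prod>i=1..n. pmf (bernoulli_pmf (q (order_stat N u ((j - 1) * n + i)))) False)"

text \<open>
  \<open>bernoulli_pmf\<close> truncates its parameter to the unit interval, so no range condition on \<open>q\<close> is needed
  for this to be a distribution.
\<close>

definition response_pmf :: "(real \<Rightarrow> real) \<Rightarrow> nat \<Rightarrow> (nat \<Rightarrow> real) \<Rightarrow> (nat \<Rightarrow> bool) pmf" where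
  "response_pmf q N u = Pi_pmf {1..N} False (\<lambda>i. bernoulli_pmf (q (u i)))"

lemma clear_prob_bounds: "0 \<le> clear_prob q n N u j" "clear_prob q n N u j \<le> 1"
  unfolding clear_prob_def by (auto intro!: prod_nonneg prod_le_1 simp: pmf_le_1)

context
begin

interpretation pmf_as_function .

lemma pmf_bernoulli_True': "pmf (bernoulli_pmf p) True = min 1 (max 0 p)"
  by transfer simp

lemma pmf_bernoulli_False': "pmf (bernoulli_pmf p) False = 1 - min 1 (max 0 p)"
  by transfer simp

end

lemma pmf_bernoulli_alt:
  "pmf (bernoulli_pmf p) b = (if b then min 1 (max 0 p) else 1 - min 1 (max 0 p))"
  by (cases b) (simp_all add: pmf_bernoulli_True' pmf_bernoulli_False')

lemma measurable_pmf_bernoulli [measurable (raw)]: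
  "f \<in> borel_measurable M \<Longrightarrow> (\<lambda>x. pmf (bernoulli_pmf (f x)) b) \<in> borel_measurable M"
  unfolding pmf_bernoulli_alt by (cases b) simp_all

lemma measurable_clear_prob [measurable (raw)]:
  assumes [measurable]: "q \<in> borel_measurable borel"
  shows "(\<lambda>x. clear_prob q n N x j) \<in> borel_measurable (PiM A (\<lambda>_. borel :: real measure))"
  unfolding clear_prob_def by measurable

text \<open>The role of \<open>u'\<close> is that of the sample cut off outside
  \<open>{1..N}\<close>, the point of the product space at which measurable functions are evaluated;
  the Boolean responses are cut off likewise.\<close>

lemma Z_star_eq_group_clear:
  assumes j: "j \<in> {1..N div n}" and n: "1 \<le> n"
    and y: "\<And>i. i \<in> {1..N} \<Longrightarrow> y i \<in> {0, 1}"
    and u: "\<And>i. i \<in> {1..N} \<Longrightarrow> u i = u' i"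
  shows "Z_star n N u y j = group_clear n N u' (\<lambda>i. i \<in> {1..N} \<and> y i = 1) j"
proof -
  let ?r = "\<lambda>i. rank_index N u' ((j - 1) * n + i)"
  have r: "rank_index N u = rank_index N u'" by (rule rank_index_cong) (rule u)
  have in': "?r i \<in> {1..N}" if "i \<in> {1..n}" for i
    by (intro rank_index_in group_index_in j that)
  have y': "y (?r i) \<in> {0, 1}" if "i \<in> {1..n}" for i
    using y in' that by blast
  have "Max ((\<lambda>i. y (?r i)) ` {1..n}) = (if \<exists>i\<in>{1..n}. y (?r i) = 1 then 1 else 0)"
  proof (rule Max_eqI)
    show "t \<le> (if \<exists>i\<in>{1..n}. y (?r i) = 1 then 1 else 0)" if "t \<in> (\<lambda>i. y (?r i)) ` {1..n}" for t
      using that y' by fastforce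
    show "(if \<exists>i\<in>{1..n}. y (?r i) = 1 then 1 else 0) \<in> (\<lambda>i. y (?r i)) ` {1..n}"
    proof (cases "\<exists>i\<in>{1..n}. y (?r i) = 1")
      case False
      have 1: "1 \<in> {1..n}" using n by simp
      then have "y (?r 1) = 0" using y'[OF 1] False by blast
      then have "0 \<in> (\<lambda>i. y (?r i)) ` {1..n}" using 1 by (metis image_eqI)
      then show ?thesis using False by simp
    qed (auto intro: rev_image_eqI)
  qed simp
  then show ?thesis
    using in' unfolding Z_star_def Y_star_def group_clear_def r by auto
qed

lemma finite_set_response_pmf: "finite (set_pmf (response_pmf q N u))"
  unfolding response_pmf_def by (subst set_Pi_pmf) (auto intro!: finite_PiE_dflt)

text \<open>Ranking is a bijection, so the groups occupy disjoint sets \<open>K j\<close> of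
  original indices, and a group indicator is a product over \<open>K j\<close> of functions of
  single coordinates. Independence and mean are then inherited from the product law.\<close>

lemma response_indep_centred:
  assumes n: "1 \<le> n"
  shows "indep_centred (measure_pmf (response_pmf q N u)) {1..N div n}
    (\<lambda>j y. group_clear n N u y j - clear_prob q n N u j)"
    and "\<And>j. j \<in> {1..N div n} \<Longrightarrow>
      measure_pmf.expectation (response_pmf q N u) (\<lambda>y. (group_clear n N u y j - clear_prob q n N u j)\<^sup>2)
        = clear_prob q n N u j * (1 - clear_prob q n N u j)"
proof -
  let ?P = "response_pmf q N u"
  define K where "K j = (\<lambda>i. rank_index N u ((j - 1) * n + i)) ` {1..n}" for j
  define a where "a k b = (if b then 0 else 1 :: real)" for k :: nat and b
  have inj: "inj_on (\<lambda>i. rank_index N u ((j - 1) * n + i)) {1..n}" if "j \<in> {1..N div n}" for j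
  proof (rule inj_onI)
    fix i k assume ik: "i \<in> {1..n}" "k \<in> {1..n}"
      "rank_index N u ((j - 1) * n + i) = rank_index N u ((j - 1) * n + k)"
    then have "(j - 1) * n + i = (j - 1) * n + k"
      using rank_index_bij[of N u] group_index_in[OF that, of i] group_index_in[OF that, of k]
      unfolding bij_betw_def inj_on_def by blast
    then show "i = k" by simp
  qed
  have K: "K j \<subseteq> {1..N}" if "j \<in> {1..N div n}" for j
    unfolding K_def using rank_index_in[OF group_index_in[OF that]] by auto
  have disj: "disjoint_family_on K {1..N div n}"
      unfolding disjoint_family_on_def
  proof (intro ballI impI, rule ccontr)
    fix j j' assume jj: "j \<in> {1..N div n}" "j' \<in> {1..N div n}" "j \<noteq> j'" "K j \<inter> K j' \<noteq> {}"
    then obtain k where k: "k \<in> K j" "k \<in> K j'" by blast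
    obtain i where "i \<in> {1..n}" "k = rank_index N u ((j - 1) * n + i)" using k(1) unfolding K_def by blast
    moreover obtain i' where "i' \<in> {1..n}" "k = rank_index N u ((j' - 1) * n + i')" using k(2) unfolding K_def by blast
    ultimately obtain i i' where i: "i \<in> {1..n}" "i' \<in> {1..n}"
      "rank_index N u ((j - 1) * n + i) = rank_index N u ((j' - 1) * n + i')"
      by blast
    then have eq: "(j - 1) * n + i = (j' - 1) * n + i'"
      using rank_index_bij[of N u] group_index_in[OF jj(1), of i] group_index_in[OF jj(2), of i']
      unfolding bij_betw_def inj_on_def by blast
    \<comment> \<open>After a shift by one, the group number can be read off as the quotient of the
      position by \<open>n\<close>.\<close>
    have lt: "i - 1 < n" "i' - 1 < n" using i by auto
    have "(j - 1) * n + (i - 1) = (j' - 1) * n + (i' - 1)"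
      using eq i by auto
    moreover have "((j - 1) * n + (i - 1)) div n = j - 1" "((j' - 1) * n + (i' - 1)) div n = j' - 1"
      using lt n by simp_all
    ultimately have "j - 1 = j' - 1" by metis
    then show False using jj by auto
  qed
  have gc: "group_clear n N u y j = (\<Prod>k\<in>K j. a k (y k))" for y j
  proof (cases "\<forall>i\<in>{1..n}. \<not> y (rank_index N u ((j - 1) * n + i))")
    case True
    then have "\<forall>k\<in>K j. a k (y k) = 1" by (auto simp: K_def a_def)
    then show ?thesis using True by (simp add: group_clear_def)
  next
    case False
    then have "\<exists>k\<in>K j. a k (y k) = 0" by (auto simp: K_def a_def)
    moreover have "finite (K j)" by (simp add: K_def)
    ultimately have "(\<Prod>k\<in>K j. a k (y k)) = 0" by (simp add: prod_zero_iff)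
    then show ?thesis using False by (auto simp: group_clear_def)
  qed
  have ind0: "prob_space.indep_vars (measure_pmf ?P) (\<lambda>_. count_space UNIV) (\<lambda>i y. y i) {1..N}"
    unfolding response_pmf_def by (rule indep_vars_Pi_pmf) simp
  have "prob_space.indep_vars (measure_pmf ?P) (\<lambda>_. borel) (\<lambda>j y. (\<lambda>g. (\<Prod>k\<in>K j. a k (g k)) - clear_prob q n N u j) (restrict (\<lambda>i. y i) (K j))) {1..N div n}"
  proof (rule prob_space.indep_vars_compose2[OF measure_pmf.prob_space_axioms prob_space.indep_vars_restrict[OF measure_pmf.prob_space_axioms ind0 K disj]])
    fix j assume "j \<in> {1..N div n}"
    show "(\<lambda>g. (\<Prod>k\<in>K j. a k (g k)) - clear_prob q n N u j)
        \<in> borel_measurable (PiM (K j) (\<lambda>_. count_space UNIV))"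
    proof (intro borel_measurable_diff borel_measurable_prod borel_measurable_const)
      fix k assume k: "k \<in> K j"
      show "(\<lambda>g. a k (g k)) \<in> borel_measurable (PiM (K j) (\<lambda>_. count_space UNIV))"
        by (rule measurable_compose[OF measurable_component_singleton[OF k]]) simp
    qed
  qed auto
  then have ind: "prob_space.indep_vars (measure_pmf ?P) (\<lambda>_. borel) (\<lambda>j y. group_clear n N u y j - clear_prob q n N u j) {1..N div n}"
    unfolding gc by (simp cong: prod.cong)
  have int: "integrable (measure_pmf ?P) f" for f :: "_ \<Rightarrow> real"
    by (rule integrable_measure_pmf_finite[OF finite_set_response_pmf])
  have mean: "measure_pmf.expectation ?P (\<lambda>y. group_clear n N u y j) = clear_prob q n N u j"
    if j: "j \<in> {1..N div n}" for j
  proof -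
    have fK: "finite (K j)" by (simp add: K_def)
    \<comment> \<open>Factors 1 extend the product over \<open>K j\<close> to all coordinates, the
      form required by the product formula for \<open>Pi_pmf\<close>.\<close>
    have "measure_pmf.expectation ?P (\<lambda>y. group_clear n N u y j)
       = measure_pmf.expectation ?P (\<lambda>y. \<Prod>k\<in>{1..N}. if k \<in> K j then a k (y k) else 1)"
      unfolding gc using K[OF j] by (intro Bochner_Integration.integral_cong refl prod.mono_neutral_cong_left) auto
    also have "\<dots> = (\<Prod>k\<in>{1..N}. measure_pmf.expectation (bernoulli_pmf (q (u k))) (\<lambda>b. if k \<in> K j then a k b else 1))"
      unfolding response_pmf_def
      by (rule expectation_prod_Pi_pmf) (auto simp: a_def intro: integrable_measure_pmf_finite)
    also have "\<dots> = (\<Prod>k\<in>K j. measure_pmf.expectation (bernoulli_pmf (q (u k))) (\<lambda>b. a k b))"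
      using K[OF j] by (intro prod.mono_neutral_cong_right) auto
    also have "\<dots> = (\<Prod>k\<in>K j. pmf (bernoulli_pmf (q (u k))) False)"
    proof (rule prod.cong[OF refl])
      fix k
      show "measure_pmf.expectation (bernoulli_pmf (q (u k))) (\<lambda>b. a k b) = pmf (bernoulli_pmf (q (u k))) False"
        by (subst integral_measure_pmf_real[of "{False}"]) (auto simp: a_def split: if_splits)
    qed
    also have "\<dots> = clear_prob q n N u j"
      unfolding K_def clear_prob_def order_stat_def by (subst prod.reindex[OF inj[OF j]]) (simp add: comp_def)
    finally show ?thesis .
  qed
  show "indep_centred (measure_pmf ?P) {1..N div n}
    (\<lambda>j y. group_clear n N u y j - clear_prob q n N u j)"
  proof unfold_locales
    show "\<bar>group_clear n N u y j - clear_prob q n N u j\<bar> \<le> 1" for y j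
      using clear_prob_bounds[of q n N u j] by (auto simp: group_clear_def)
    show "measure_pmf.expectation ?P (\<lambda>y. group_clear n N u y j - clear_prob q n N u j) = 0"
      if "j \<in> {1..N div n}" for j
      using mean[OF that] by (simp add: int)
  qed (use ind in auto)
  show "measure_pmf.expectation ?P (\<lambda>y. (group_clear n N u y j - clear_prob q n N u j)\<^sup>2)
        = clear_prob q n N u j * (1 - clear_prob q n N u j)" if j: "j \<in> {1..N div n}" for j
  proof -
    let ?m = "clear_prob q n N u j"
    have "measure_pmf.expectation ?P (\<lambda>y. (group_clear n N u y j - ?m)\<^sup>2)
      = measure_pmf.expectation ?P (\<lambda>y. (1 - 2 * ?m) * group_clear n N u y j + ?m\<^sup>2)"
      by (intro Bochner_Integration.integral_cong refl) (auto simp: group_clear_def power2_eq_square algebra_simps)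
    also have "\<dots> = (1 - 2 * ?m) * ?m + ?m\<^sup>2"
      using mean[OF j] by (simp add: int)
    finally show ?thesis by (simp add: power2_eq_square algebra_simps)
  qed
qed

section \<open>Disintegration of the responses given the covariates\<close>

locale binary_sample = prob_space M for M :: "'a measure" +
  fixes N :: nat and X Y :: "nat \<Rightarrow> 'a \<Rightarrow> real" and q :: "real \<Rightarrow> real"
  assumes N1: "1 \<le> N"
    and iid: "indep_vars (\<lambda>_. borel) (\<lambda>i \<omega>. (X i \<omega>, Y i \<omega>)) {1..N}"
    and Y01: "\<And>i \<omega>. i \<in> {1..N} \<Longrightarrow> \<omega> \<in> space M \<Longrightarrow> Y i \<omega> \<in> {0, 1}"
    and q_meas [measurable]: "q \<in> borel_measurable borel"
    and q_nonneg: "\<And>x. 0 \<le> q x"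
    and cond_prob: "\<And>i. i \<in> {1..N} \<Longrightarrow> AE \<omega> in M.
        real_cond_exp M (vimage_algebra (space M) (X i) borel)
          (indicat_real {\<omega>\<in>space M. Y i \<omega> = 1}) \<omega> = q (X i \<omega>)"
begin

definition sample :: "'a \<Rightarrow> nat \<Rightarrow> real" where
  "sample \<omega> = (\<lambda>i\<in>{1..N}. X i \<omega>)"

definition resp :: "'a \<Rightarrow> nat \<Rightarrow> bool" where
  "resp \<omega> i \<longleftrightarrow> i \<in> {1..N} \<and> Y i \<omega> = 1"

lemma pair_measurable: "i \<in> {1..N} \<Longrightarrow> (\<lambda>\<omega>. (X i \<omega>, Y i \<omega>)) \<in> borel_measurable M"
  using iid unfolding indep_vars_def by blast

lemma X_measurable: "i \<in> {1..N} \<Longrightarrow> X i \<in> borel_measurable M"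
  using measurable_compose[OF pair_measurable[unfolded borel_prod[symmetric]] measurable_fst] by simp

lemma Y_measurable: "i \<in> {1..N} \<Longrightarrow> Y i \<in> borel_measurable M"
  using measurable_compose[OF pair_measurable[unfolded borel_prod[symmetric]] measurable_snd] by simp

lemma sample_measurable [measurable]: "sample \<in> measurable M (PiM {1..N} (\<lambda>_. borel))"
  unfolding sample_def by (rule measurable_restrict) (rule X_measurable)

lemma resp_event: "{\<omega>\<in>space M. resp \<omega> = y} \<in> sets M"
proof (cases "\<forall>i. i \<notin> {1..N} \<longrightarrow> \<not> y i")
  case True
  then have eq: "{\<omega>\<in>space M. resp \<omega> = y} = {\<omega>\<in>space M. \<forall>i\<in>{1..N}. (Y i \<omega> = 1) = y i}"
    by (auto simp: resp_def fun_eq_iff)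
  have "{\<omega>\<in>space M. (Y i \<omega> = 1) = y i} \<in> sets M" if "i \<in> {1..N}" for i
  proof -
    note [measurable] = Y_measurable[OF that]
    show ?thesis by measurable
  qed
  then show ?thesis unfolding eq by (intro sets.sets_Collect_finite_All) auto
next
  case False
  then have "{\<omega>\<in>space M. resp \<omega> = y} = {}"
    by (auto simp: resp_def fun_eq_iff)
  then show ?thesis by (simp only: sets.empty_sets)
qed

lemma single_joint:
  assumes i: "i \<in> {1..N}" and A: "A \<in> sets borel"
  shows "emeasure M {\<omega>\<in>space M. X i \<omega> \<in> A \<and> (Y i \<omega> = 1) = b}
    = (\<integral>\<^sup>+\<omega>. indicator A (X i \<omega>) * ennreal (pmf (bernoulli_pmf (q (X i \<omega>))) b) \<partial>M)"
proof -
  note [measurable] = X_measurable[OF i] Y_measurable[OF i] A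
  define F where "F = vimage_algebra (space M) (X i) borel"
  have "subalgebra M F"
    using sets_image_in_sets[OF refl X_measurable[OF i]] by (simp add: subalgebra_def F_def)
  then interpret F: finite_measure_subalgebra M F
    by unfold_locales auto
  let ?T = "{\<omega>\<in>space M. Y i \<omega> = 1}"
  have T[measurable]: "?T \<in> sets M" by measurable
  have intT: "integrable M (indicat_real ?T)" by (simp add: less_top[symmetric])
  \<comment> \<open>Being a conditional probability, \<open>q (X i \<omega>)\<close> is almost
    surely at most 1, so the truncation in \<open>bernoulli_pmf\<close> is inactive along the
    sample.\<close>
  have le1: "AE \<omega> in M. q (X i \<omega>) \<le> 1"
    using F.real_cond_exp_le_c[OF intT, of 1] cond_prob[OF i]
    by (auto simp: F_def indicator_def elim!: eventually_elim2)
  then have pm: "AE \<omega> in M. pmf (bernoulli_pmf (q (X i \<omega>))) True = q (X i \<omega>)"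
    by eventually_elim (simp add: q_nonneg)
  have intq: "integrable M (\<lambda>\<omega>. indicator A (X i \<omega>) * pmf (bernoulli_pmf (q (X i \<omega>))) c)" for c
    by (rule integrable_const_bound[where B = 1]) (auto simp: indicator_def pmf_le_1)
  have SA: "X i -` A \<inter> space M \<in> sets F" unfolding F_def using A by (rule in_vimage_algebra)
  have "measure M {\<omega>\<in>space M. X i \<omega> \<in> A \<and> Y i \<omega> = 1} = (LINT \<omega>|M. indicat_real {\<omega>\<in>space M. X i \<omega> \<in> A \<and> Y i \<omega> = 1} \<omega>)"
    by simp
  also have "\<dots> = (LINT \<omega>:(X i -` A \<inter> space M)|M. indicat_real ?T \<omega>)"
    unfolding set_lebesgue_integral_def by (intro Bochner_Integration.integral_cong refl) (auto simp: indicator_def)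
  also have "\<dots> = (LINT \<omega>:(X i -` A \<inter> space M)|M. real_cond_exp M F (indicat_real ?T) \<omega>)"
    by (rule F.real_cond_exp_intA[OF intT SA])
  also have "\<dots> = (LINT \<omega>|M. indicator A (X i \<omega>) * pmf (bernoulli_pmf (q (X i \<omega>))) True)"
    unfolding set_lebesgue_integral_def
  proof (rule integral_cong_AE)
    show "AE \<omega> in M. indicat_real (X i -` A \<inter> space M) \<omega> *\<^sub>R real_cond_exp M F (indicat_real ?T) \<omega>
        = indicator A (X i \<omega>) * pmf (bernoulli_pmf (q (X i \<omega>))) True"
      using cond_prob[OF i] pm AE_space by eventually_elim (auto simp: F_def indicator_def)
    have "X i -` A \<inter> space M \<in> sets M" by measurable
    then show "(\<lambda>\<omega>. indicat_real (X i -` A \<inter> space M) \<omega> *\<^sub>R real_cond_exp M F (indicat_real ?T) \<omega>) \<in> borel_measurable M"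
      by measurable
  qed measurable
  finally have 1: "measure M {\<omega>\<in>space M. X i \<omega> \<in> A \<and> Y i \<omega> = 1}
      = (LINT \<omega>|M. indicator A (X i \<omega>) * pmf (bernoulli_pmf (q (X i \<omega>))) True)" .
  have "measure M {\<omega>\<in>space M. X i \<omega> \<in> A \<and> (Y i \<omega> = 1) = b}
      = (LINT \<omega>|M. indicator A (X i \<omega>) * pmf (bernoulli_pmf (q (X i \<omega>))) b)"
  proof (cases b)
    case True
    then show ?thesis using 1 by simp
  next
    case False
    have "measure M {\<omega>\<in>space M. X i \<omega> \<in> A} = measure M {\<omega>\<in>space M. X i \<omega> \<in> A \<and> Y i \<omega> = 1}
        + measure M {\<omega>\<in>space M. X i \<omega> \<in> A \<and> Y i \<omega> \<noteq> 1}"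
      by (subst finite_measure_Union[symmetric]) (auto intro!: arg_cong[where f = "measure M"])
    moreover have "measure M {\<omega>\<in>space M. X i \<omega> \<in> A} = (LINT \<omega>|M. indicat_real A (X i \<omega>))"
      by (subst Bochner_Integration.integral_cong[OF refl, where g = "indicat_real {\<omega>\<in>space M. X i \<omega> \<in> A}"])
        (auto simp: indicator_def)
    moreover have "(LINT \<omega>|M. indicat_real A (X i \<omega>)) =
        (LINT \<omega>|M. indicator A (X i \<omega>) * pmf (bernoulli_pmf (q (X i \<omega>))) True
           + indicator A (X i \<omega>) * pmf (bernoulli_pmf (q (X i \<omega>))) False)"
      by (intro Bochner_Integration.integral_cong refl) (auto simp: indicator_def pmf_bernoulli_alt)
    ultimately show ?thesis using 1 False intq by simp
  qed
  then have "emeasure M {\<omega>\<in>space M. X i \<omega> \<in> A \<and> (Y i \<omega> = 1) = b}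
      = ennreal (LINT \<omega>|M. indicator A (X i \<omega>) * pmf (bernoulli_pmf (q (X i \<omega>))) b)"
    by (simp only: emeasure_eq_measure)
  also have "\<dots> = (\<integral>\<^sup>+\<omega>. ennreal (indicator A (X i \<omega>) * pmf (bernoulli_pmf (q (X i \<omega>))) b) \<partial>M)"
    by (rule nn_integral_eq_integral[OF intq, symmetric]) simp
  also have "\<dots> = (\<integral>\<^sup>+\<omega>. indicator A (X i \<omega>) * ennreal (pmf (bernoulli_pmf (q (X i \<omega>))) b) \<partial>M)"
    by (intro nn_integral_cong) (simp add: indicator_def)
  finally show ?thesis .
qed

lemma pmf_response_measurable [measurable]:
  "(\<lambda>\<omega>. pmf (response_pmf q N (sample \<omega>)) y) \<in> borel_measurable M"
proof (cases "\<forall>i. i \<notin> {1..N} \<longrightarrow> \<not> y i")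
  case True
  then have pmf: "pmf (response_pmf q N u) y = (\<Prod>i\<in>{1..N}. pmf (bernoulli_pmf (q (u i))) (y i))" for u
    unfolding response_pmf_def by (intro pmf_Pi') auto
  show ?thesis unfolding pmf by measurable
next
  case False
  then have "pmf (response_pmf q N u) y = 0" for u
    unfolding response_pmf_def by (intro pmf_Pi_outside) auto
  then show ?thesis by simp
qed

text \<open>For a fixed response vector both sides are finite measures on the space of covariates,
  so agreement on rectangles suffices. There independence of the pairs factorises both sides, and
  \<open>single_joint\<close> matches the factors.\<close>

lemma joint_density:
  "distr (density M (\<lambda>\<omega>. indicator {\<omega>\<in>space M. resp \<omega> = y} \<omega>)) (PiM {1..N} (\<lambda>_. borel)) sample
    = distr (density M (\<lambda>\<omega>. ennreal (pmf (response_pmf q N (sample \<omega>)) y))) (PiM {1..N} (\<lambda>_. borel)) sample"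
  (is "distr ?D1 ?P sample = distr ?D2 ?P sample")
proof (cases "\<forall>i. i \<notin> {1..N} \<longrightarrow> \<not> y i")
  case False
  then have "{\<omega>\<in>space M. resp \<omega> = y} = {}"
    by (auto simp: resp_def fun_eq_iff)
  moreover have "pmf (response_pmf q N u) y = 0" for u
    using False unfolding response_pmf_def by (intro pmf_Pi_outside) auto
  ultimately show ?thesis by simp
next
  case True
  have pmf: "pmf (response_pmf q N u) y = (\<Prod>i\<in>{1..N}. pmf (bernoulli_pmf (q (u i))) (y i))" for u
    using True unfolding response_pmf_def by (intro pmf_Pi') auto
  have [measurable]: "{\<omega>\<in>space M. resp \<omega> = y} \<in> sets M" by (rule resp_event)
  have s1 [measurable]: "sample \<in> measurable ?D1 ?P" "sample \<in> measurable ?D2 ?P"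
    using sample_measurable by (simp_all del: One_nat_def)
  have e1: "emeasure (distr ?D1 ?P sample) S = emeasure M {\<omega>\<in>space M. sample \<omega> \<in> S \<and> resp \<omega> = y}"
    if [measurable]: "S \<in> sets ?P" for S
  proof -
    have "emeasure (distr ?D1 ?P sample) S = emeasure ?D1 (sample -` S \<inter> space M)"
      using s1 that by (subst emeasure_distr) (simp_all del: One_nat_def)
    also have "\<dots> = (\<integral>\<^sup>+\<omega>. indicator {\<omega>\<in>space M. resp \<omega> = y} \<omega> * indicator (sample -` S \<inter> space M) \<omega> \<partial>M)"
      by (subst emeasure_density) auto
    also have "\<dots> = (\<integral>\<^sup>+\<omega>. indicator {\<omega>\<in>space M. sample \<omega> \<in> S \<and> resp \<omega> = y} \<omega> \<partial>M)"
      by (intro nn_integral_cong) (auto simp: indicator_def)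
    also have "\<dots> = emeasure M {\<omega>\<in>space M. sample \<omega> \<in> S \<and> resp \<omega> = y}"
      by (rule nn_integral_indicator) (auto simp: Collect_conj_eq2)
    finally show ?thesis .
  qed
  have e2: "emeasure (distr ?D2 ?P sample) S
      = (\<integral>\<^sup>+\<omega>. ennreal (pmf (response_pmf q N (sample \<omega>)) y) * indicator S (sample \<omega>) \<partial>M)"
    if [measurable]: "S \<in> sets ?P" for S
  proof -
    have "emeasure (distr ?D2 ?P sample) S = emeasure ?D2 (sample -` S \<inter> space M)"
      using s1 that by (subst emeasure_distr) (simp_all del: One_nat_def)
    also have "\<dots> = (\<integral>\<^sup>+\<omega>. ennreal (pmf (response_pmf q N (sample \<omega>)) y) * indicator (sample -` S \<inter> space M) \<omega> \<partial>M)"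
      by (subst emeasure_density) auto
    also have "\<dots> = (\<integral>\<^sup>+\<omega>. ennreal (pmf (response_pmf q N (sample \<omega>)) y) * indicator S (sample \<omega>) \<partial>M)"
      by (intro nn_integral_cong) (auto simp: indicator_def)
    finally show ?thesis .
  qed
  show ?thesis
  proof (rule measure_eqI_PiM_finite[where I = "{1..N}" and M = "\<lambda>_. borel" and A = "\<lambda>_. PiE {1..N} (\<lambda>_. UNIV)"])
    show "range (\<lambda>_. PiE {1..N} (\<lambda>_. UNIV)) \<subseteq> prod_algebra {1..N} (\<lambda>_. borel :: real measure)"
      by (auto intro!: prod_algebraI_finite)
    show "(\<Union>i. PiE {1..N} (\<lambda>_. UNIV)) = space (PiM {1..N} (\<lambda>_. borel :: real measure))"
      by (simp add: space_PiM)
    have "PiE {1..N} (\<lambda>_. UNIV) \<in> sets ?P"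
      by (rule sets_PiM_I_finite) auto
    then show "emeasure (distr ?D1 ?P sample) (PiE {1..N} (\<lambda>_. UNIV)) \<noteq> \<infinity>"
      by (subst e1) (auto simp: emeasure_eq_measure)
    fix A assume A: "\<And>i. i \<in> {1..N} \<Longrightarrow> A i \<in> sets (borel :: real measure)"
    have S: "PiE {1..N} A \<in> sets ?P"
      using A by (intro sets_PiM_I_finite) auto
    \<comment> \<open>Independence is given for the pairs, so the conditions on covariate and
      response with the same index are joined in one event.\<close>
    define B where "B i = A i \<times> (if y i then {1} else - {1 :: real})" for i
    have B: "B i \<in> sets borel" if "i \<in> {1..N}" for i
      using A[OF that] unfolding B_def borel_prod[symmetric] by (intro pair_measureI) auto
    have Xi: "(\<lambda>\<omega>. indicator (A i) (X i \<omega>) * ennreal (pmf (bernoulli_pmf (q (X i \<omega>))) (y i))) \<in> borel_measurable M"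
      if "i \<in> {1..N}" for i
    proof -
      note [measurable] = X_measurable[OF that] A[OF that]
      show ?thesis by measurable
    qed
    have "{\<omega>\<in>space M. sample \<omega> \<in> PiE {1..N} A \<and> resp \<omega> = y}
        = (\<Inter>i\<in>{1..N}. (\<lambda>\<omega>. (X i \<omega>, Y i \<omega>)) -` B i \<inter> space M)"
    proof (intro set_eqI iffI)
      fix \<omega> assume "\<omega> \<in> {\<omega>\<in>space M. sample \<omega> \<in> PiE {1..N} A \<and> resp \<omega> = y}"
      then have \<omega>: "\<omega> \<in> space M" "sample \<omega> \<in> PiE {1..N} A" "resp \<omega> = y" by auto
      have "X i \<omega> \<in> A i \<and> (Y i \<omega> = 1) = y i" if "i \<in> {1..N}" for i
        using PiE_mem[OF \<omega>(2) that] fun_cong[OF \<omega>(3), of i] that by (auto simp: sample_def resp_def)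
      then show "\<omega> \<in> (\<Inter>i\<in>{1..N}. (\<lambda>\<omega>. (X i \<omega>, Y i \<omega>)) -` B i \<inter> space M)"
        using \<omega>(1) by (auto simp: B_def)
    next
      fix \<omega> assume a: "\<omega> \<in> (\<Inter>i\<in>{1..N}. (\<lambda>\<omega>. (X i \<omega>, Y i \<omega>)) -` B i \<inter> space M)"
      then have "\<omega> \<in> space M" using N1 by fastforce
      moreover have "X i \<omega> \<in> A i \<and> (Y i \<omega> = 1) = y i" if "i \<in> {1..N}" for i
      proof -
        have "(X i \<omega>, Y i \<omega>) \<in> B i" using a that by blast
        then show ?thesis by (auto simp: B_def split: if_splits)
      qed
      ultimately show "\<omega> \<in> {\<omega>\<in>space M. sample \<omega> \<in> PiE {1..N} A \<and> resp \<omega> = y}"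
        using True by (auto simp: sample_def resp_def fun_eq_iff)
    qed
    then have "emeasure (distr ?D1 ?P sample) (PiE {1..N} A)
        = emeasure M (\<Inter>i\<in>{1..N}. (\<lambda>\<omega>. (X i \<omega>, Y i \<omega>)) -` B i \<inter> space M)"
      by (simp only: e1[OF S])
    also have "\<dots> = (\<Prod>i\<in>{1..N}. emeasure M ((\<lambda>\<omega>. (X i \<omega>, Y i \<omega>)) -` B i \<inter> space M))"
      unfolding emeasure_eq_measure
      using N1 B by (subst indep_varsD_finite[OF iid]) (auto simp: prod_ennreal)
    also have "\<dots> = (\<Prod>i\<in>{1..N}. emeasure M {\<omega>\<in>space M. X i \<omega> \<in> A i \<and> (Y i \<omega> = 1) = y i})"
      by (intro prod.cong refl arg_cong[where f = "emeasure M"]) (auto simp: B_def)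
    also have "\<dots> = (\<Prod>i\<in>{1..N}. \<integral>\<^sup>+\<omega>. indicator (A i) (X i \<omega>) * ennreal (pmf (bernoulli_pmf (q (X i \<omega>))) (y i)) \<partial>M)"
      by (intro prod.cong refl single_joint A)
    also have "\<dots> = (\<integral>\<^sup>+\<omega>. (\<Prod>i\<in>{1..N}. indicator (A i) (X i \<omega>) * ennreal (pmf (bernoulli_pmf (q (X i \<omega>))) (y i))) \<partial>M)"
    proof (rule indep_vars_nn_integral[symmetric])
      show "indep_vars (\<lambda>_. borel) (\<lambda>i \<omega>. indicator (A i) (X i \<omega>) * ennreal (pmf (bernoulli_pmf (q (X i \<omega>))) (y i))) {1..N}"
      proof -
        have "indep_vars (\<lambda>_. borel) (\<lambda>i \<omega>. (\<lambda>z. indicator (A i) (fst z) * ennreal (pmf (bernoulli_pmf (q (fst z))) (y i)))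
            (X i \<omega>, Y i \<omega>)) {1..N}"
        proof (rule indep_vars_compose2[OF iid])
          fix i assume "i \<in> {1..N}"
          note [measurable] = A[OF this]
          show "(\<lambda>z. indicator (A i) (fst z) * ennreal (pmf (bernoulli_pmf (q (fst z))) (y i))) \<in> borel_measurable (borel :: (real \<times> real) measure)"
            unfolding borel_prod[symmetric] by measurable
        qed
        then show ?thesis by simp
      qed
    qed auto
    also have "\<dots> = emeasure (distr ?D2 ?P sample) (PiE {1..N} A)"
      unfolding e2[OF S]
    proof (intro nn_integral_cong)
      fix \<omega>
      have "(\<Prod>i\<in>{1..N}. indicator (A i) (X i \<omega>) * ennreal (pmf (bernoulli_pmf (q (X i \<omega>))) (y i)))
        = (\<Prod>i\<in>{1..N}. indicator (A i) (X i \<omega>)) * ennreal (pmf (response_pmf q N (sample \<omega>)) y)"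
        unfolding pmf by (simp add: prod.distrib prod_ennreal[symmetric] sample_def)
      also have "(\<Prod>i\<in>{1..N}. indicator (A i) (X i \<omega>)) = (indicator (PiE {1..N} A) (sample \<omega>) :: ennreal)"
        by (auto simp: indicator_def sample_def PiE_iff intro!: prod.neutral)
      finally show "(\<Prod>i\<in>{1..N}. indicator (A i) (X i \<omega>) * ennreal (pmf (bernoulli_pmf (q (X i \<omega>))) (y i)))
        = ennreal (pmf (response_pmf q N (sample \<omega>)) y) * indicator (PiE {1..N} A) (sample \<omega>)"
        by (simp add: mult.commute)
    qed
    finally show "emeasure (distr ?D1 ?P sample) (PiE {1..N} A) = emeasure (distr ?D2 ?P sample) (PiE {1..N} A)" .
  qed auto
qed

lemma disintegration:
  fixes F :: "(nat \<Rightarrow> real) \<Rightarrow> (nat \<Rightarrow> bool) \<Rightarrow> 'b :: {banach, second_countable_topology}"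
  assumes F [measurable]: "\<And>y. (\<lambda>x. F x y) \<in> borel_measurable (PiM {1..N} (\<lambda>_. borel))"
    and B: "\<And>x y. norm (F x y) \<le> B"
  shows "(\<integral>\<omega>. F (sample \<omega>) (resp \<omega>) \<partial>M)
      = (\<integral>\<omega>. (\<integral>y. F (sample \<omega>) y \<partial>measure_pmf (response_pmf q N (sample \<omega>))) \<partial>M)"
    and "(\<lambda>\<omega>. \<integral>y. F (sample \<omega>) y \<partial>measure_pmf (response_pmf q N (sample \<omega>))) \<in> borel_measurable M"
    and "(\<lambda>\<omega>. F (sample \<omega>) (resp \<omega>)) \<in> borel_measurable M"
proof -
  define R where "R = PiE_dflt {1..N} False (\<lambda>_. UNIV :: bool set)"
  have finR: "finite R" unfolding R_def by (intro finite_PiE_dflt) auto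
  have resp_R: "resp \<omega> \<in> R" for \<omega>
    unfolding R_def PiE_dflt_def resp_def by auto
  note [measurable] = resp_event
  have inner: "(\<integral>y. F u y \<partial>measure_pmf (response_pmf q N u)) = (\<Sum>y\<in>R. pmf (response_pmf q N u) y *\<^sub>R F u y)" for u
    unfolding response_pmf_def
    by (rule integral_measure_pmf[OF finR]) (auto simp: R_def PiE_dflt_def dest: set_Pi_pmf_subset[THEN subsetD, rotated])
  have outer: "F (sample \<omega>) (resp \<omega>) = (\<Sum>y\<in>R. indicat_real {\<omega>\<in>space M. resp \<omega> = y} \<omega> *\<^sub>R F (sample \<omega>) y)"
    if "\<omega> \<in> space M" for \<omega>
  proof -
    have "(\<Sum>y\<in>R. indicat_real {\<omega>\<in>space M. resp \<omega> = y} \<omega> *\<^sub>R F (sample \<omega>) y)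
       = (\<Sum>y\<in>R. if y = resp \<omega> then F (sample \<omega>) y else 0)"
      using that by (intro sum.cong) auto
    then show ?thesis using finR resp_R by simp
  qed
  have B0: "0 \<le> B" using B norm_ge_zero order_trans by blast
  have int1: "integrable M (\<lambda>\<omega>. indicat_real {\<omega>\<in>space M. resp \<omega> = y} \<omega> *\<^sub>R F (sample \<omega>) y)" for y
    by (rule integrable_const_bound[where B = B]) (auto simp: indicator_def B B0)
  have int2: "integrable M (\<lambda>\<omega>. pmf (response_pmf q N (sample \<omega>)) y *\<^sub>R F (sample \<omega>) y)" for y
  proof (rule integrable_const_bound[where B = "1 * B"], rule AE_I2)
    show "norm (pmf (response_pmf q N (sample \<omega>)) y *\<^sub>R F (sample \<omega>) y) \<le> 1 * B" for \<omega>
      unfolding norm_scaleR by (intro mult_mono B) (auto simp: pmf_le_1)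
  qed measurable
  have eq: "(\<integral>\<omega>. indicat_real {\<omega>\<in>space M. resp \<omega> = y} \<omega> *\<^sub>R F (sample \<omega>) y \<partial>M)
      = (\<integral>\<omega>. pmf (response_pmf q N (sample \<omega>)) y *\<^sub>R F (sample \<omega>) y \<partial>M)" for y
  proof -
    have "(\<integral>\<omega>. indicat_real {\<omega>\<in>space M. resp \<omega> = y} \<omega> *\<^sub>R F (sample \<omega>) y \<partial>M)
      = (\<integral>\<omega>. F (sample \<omega>) y \<partial>density M (\<lambda>\<omega>. ennreal (indicat_real {\<omega>\<in>space M. resp \<omega> = y} \<omega>)))"
      by (subst integral_density) auto
    also have "\<dots> = (\<integral>x. F x y \<partial>distr (density M (\<lambda>\<omega>. indicator {\<omega>\<in>space M. resp \<omega> = y} \<omega>)) (PiM {1..N} (\<lambda>_. borel)) sample)"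
      using sample_measurable F by (subst integral_distr) (simp_all add: ennreal_indicator del: One_nat_def)
    also have "\<dots> = (\<integral>\<omega>. F (sample \<omega>) y \<partial>density M (\<lambda>\<omega>. ennreal (pmf (response_pmf q N (sample \<omega>)) y)))"
      unfolding joint_density using sample_measurable F by (subst integral_distr) (simp_all del: One_nat_def)
    also have "\<dots> = (\<integral>\<omega>. pmf (response_pmf q N (sample \<omega>)) y *\<^sub>R F (sample \<omega>) y \<partial>M)"
      by (subst integral_density) auto
    finally show ?thesis .
  qed
  have "(\<integral>\<omega>. F (sample \<omega>) (resp \<omega>) \<partial>M)
      = (\<integral>\<omega>. (\<Sum>y\<in>R. indicat_real {\<omega>\<in>space M. resp \<omega> = y} \<omega> *\<^sub>R F (sample \<omega>) y) \<partial>M)"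
    by (intro Bochner_Integration.integral_cong refl outer)
  also have "\<dots> = (\<Sum>y\<in>R. \<integral>\<omega>. indicat_real {\<omega>\<in>space M. resp \<omega> = y} \<omega> *\<^sub>R F (sample \<omega>) y \<partial>M)"
    by (rule Bochner_Integration.integral_sum) (rule int1)
  also have "\<dots> = (\<Sum>y\<in>R. \<integral>\<omega>. pmf (response_pmf q N (sample \<omega>)) y *\<^sub>R F (sample \<omega>) y \<partial>M)"
    by (simp only: eq)
  also have "\<dots> = (\<integral>\<omega>. (\<Sum>y\<in>R. pmf (response_pmf q N (sample \<omega>)) y *\<^sub>R F (sample \<omega>) y) \<partial>M)"
    by (rule Bochner_Integration.integral_sum[symmetric]) (rule int2)
  finally show "(\<integral>\<omega>. F (sample \<omega>) (resp \<omega>) \<partial>M)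
      = (\<integral>\<omega>. (\<integral>y. F (sample \<omega>) y \<partial>measure_pmf (response_pmf q N (sample \<omega>))) \<partial>M)"
    unfolding inner .
  show "(\<lambda>\<omega>. \<integral>y. F (sample \<omega>) y \<partial>measure_pmf (response_pmf q N (sample \<omega>))) \<in> borel_measurable M"
    unfolding inner by measurable
  have "(\<lambda>\<omega>. \<Sum>y\<in>R. indicat_real {\<omega>\<in>space M. resp \<omega> = y} \<omega> *\<^sub>R F (sample \<omega>) y) \<in> borel_measurable M"
    by measurable
  then show "(\<lambda>\<omega>. F (sample \<omega>) (resp \<omega>)) \<in> borel_measurable M"
    by (subst measurable_cong[OF outer])
qed

text \<open>The way back from conditional to unconditional probability: deviation bounds are proved
  at fixed samples in \<open>G\<close> and integrated here.\<close>

lemma conditional_prob_le: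
  assumes G [measurable]: "G \<in> sets (PiM {1..N} (\<lambda>_. borel))"
    and Q: "\<And>y. {x\<in>space (PiM {1..N} (\<lambda>_. borel)). Q x y} \<in> sets (PiM {1..N} (\<lambda>_. borel))"
    and le: "\<And>x. x \<in> G \<Longrightarrow> measure_pmf.prob (response_pmf q N x) {y. Q x y} \<le> \<epsilon>"
    and \<epsilon>: "0 \<le> \<epsilon>"
  shows "{\<omega>\<in>space M. sample \<omega> \<in> G \<and> Q (sample \<omega>) (resp \<omega>)} \<in> sets M"
    "prob {\<omega>\<in>space M. sample \<omega> \<in> G \<and> Q (sample \<omega>) (resp \<omega>)} \<le> \<epsilon>"
proof -
  let ?P = "PiM {1..N} (\<lambda>_. borel :: real measure)"
  define F where "F x y = indicat_real {x\<in>space ?P. x \<in> G \<and> Q x y} x" for x y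
  have [measurable]: "{x\<in>space ?P. x \<in> G \<and> Q x y} \<in> sets ?P" for y
    using sets.Int[OF G Q[of y]] sets.sets_into_space[OF G] by (auto simp: Int_def conj_ac cong: conj_cong intro: back_subst[of "\<lambda>A. A \<in> sets ?P"])
  have Fm: "(\<lambda>x. F x y) \<in> borel_measurable ?P" for y
    unfolding F_def by measurable
  have Fb: "norm (F x y) \<le> 1" for x y by (simp add: F_def indicator_def)
  have sp: "sample \<omega> \<in> space ?P" if "\<omega> \<in> space M" for \<omega>
    using measurable_space[OF sample_measurable that] .
  let ?E = "{\<omega>\<in>space M. sample \<omega> \<in> G \<and> Q (sample \<omega>) (resp \<omega>)}"
  have FE: "F (sample \<omega>) (resp \<omega>) = indicat_real ?E \<omega>" if "\<omega> \<in> space M" for \<omega>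
    using sp[OF that] that by (simp add: F_def indicator_def)
  have m: "(\<lambda>\<omega>. F (sample \<omega>) (resp \<omega>)) \<in> borel_measurable M"
    by (rule disintegration(3)[where B = 1]) (rule Fm, rule Fb)
  then have "indicat_real ?E \<in> borel_measurable M"
    by (subst (asm) measurable_cong[OF FE])
  then have "?E \<inter> space M \<in> sets M"
    by (simp add: borel_measurable_indicator_iff)
  moreover have "?E \<inter> space M = ?E" by auto
  ultimately show E: "?E \<in> sets M" by simp
  have "prob ?E = (\<integral>\<omega>. indicat_real ?E \<omega> \<partial>M)" using E by simp
  also have "\<dots> = (\<integral>\<omega>. F (sample \<omega>) (resp \<omega>) \<partial>M)"
    by (intro Bochner_Integration.integral_cong refl) (simp add: FE)
  also have "\<dots> = (\<integral>\<omega>. (\<integral>y. F (sample \<omega>) y \<partial>measure_pmf (response_pmf q N (sample \<omega>))) \<partial>M)"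
    by (rule disintegration(1)[where B = 1]) (rule Fm, rule Fb)
  also have "\<dots> \<le> (\<integral>\<omega>. \<epsilon> \<partial>M)"
  proof (rule integral_mono)
    have le': "(\<integral>y. F x y \<partial>measure_pmf (response_pmf q N x)) \<le> \<epsilon>" if "x \<in> space ?P" for x
    proof (cases "x \<in> G")
      case True
      then have "(\<integral>y. F x y \<partial>measure_pmf (response_pmf q N x)) = (\<integral>y. indicat_real {y. Q x y} y \<partial>measure_pmf (response_pmf q N x))"
        using that by (intro Bochner_Integration.integral_cong refl) (auto simp: F_def indicator_def)
      then show ?thesis using le[OF True] by simp
    qed (simp add: F_def \<epsilon>)
    then show "(\<integral>y. F (sample \<omega>) y \<partial>measure_pmf (response_pmf q N (sample \<omega>))) \<le> \<epsilon>" if "\<omega> \<in> space M" for \<omega>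
      using sp[OF that] by blast
    show "integrable M (\<lambda>\<omega>. \<integral>y. F (sample \<omega>) y \<partial>measure_pmf (response_pmf q N (sample \<omega>)))"
    proof (rule integrable_const_bound[where B = \<epsilon>])
      show "AE \<omega> in M. norm (\<integral>y. F (sample \<omega>) y \<partial>measure_pmf (response_pmf q N (sample \<omega>))) \<le> \<epsilon>"
        using le' sp by (intro AE_I2) (auto simp: F_def intro!: abs_of_nonneg[THEN ord_eq_le_trans] integral_nonneg)
      show "(\<lambda>\<omega>. \<integral>y. F (sample \<omega>) y \<partial>measure_pmf (response_pmf q N (sample \<omega>))) \<in> borel_measurable M"
        by (rule disintegration(2)[where B = 1]) (rule Fm, rule Fb)
    qed
  qed auto
  finally show "prob ?E \<le> \<epsilon>" by (simp add: prob_space)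
qed

text \<open>The standardised error of the estimator need not be bounded over all samples, so
  measurability is provided separately from \<open>disintegration\<close>, by the same finite
  splitting.\<close>

lemma sample_resp_measurable:
  fixes F :: "(nat \<Rightarrow> real) \<Rightarrow> (nat \<Rightarrow> bool) \<Rightarrow> real"
  assumes F [measurable]: "\<And>y. (\<lambda>x. F x y) \<in> borel_measurable (PiM {1..N} (\<lambda>_. borel))"
  shows "(\<lambda>\<omega>. F (sample \<omega>) (resp \<omega>)) \<in> borel_measurable M"
proof -
  define R where "R = PiE_dflt {1..N} False (\<lambda>_. UNIV :: bool set)"
  have finR: "finite R" unfolding R_def by (intro finite_PiE_dflt) auto
  have resp_R: "resp \<omega> \<in> R" for \<omega>
    unfolding R_def PiE_dflt_def resp_def by auto
  note [measurable] = resp_event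
  have outer: "F (sample \<omega>) (resp \<omega>) = (\<Sum>y\<in>R. indicat_real {\<omega>\<in>space M. resp \<omega> = y} \<omega> * F (sample \<omega>) y)"
    if "\<omega> \<in> space M" for \<omega>
  proof -
    have "(\<Sum>y\<in>R. indicat_real {\<omega>\<in>space M. resp \<omega> = y} \<omega> * F (sample \<omega>) y)
       = (\<Sum>y\<in>R. if y = resp \<omega> then F (sample \<omega>) y else 0)"
      using that by (intro sum.cong) auto
    then show ?thesis using finR resp_R by simp
  qed
  have "(\<lambda>\<omega>. \<Sum>y\<in>R. indicat_real {\<omega>\<in>space M. resp \<omega> = y} \<omega> * F (sample \<omega>) y) \<in> borel_measurable M"
    by measurable
  then show ?thesis by (subst measurable_cong[OF outer])
qed

end

section \<open>Roots, products and spacings\<close>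

text \<open>Division by \<open>m\<close> reduces to \<open>root n (1 + s)\<close>, which is bounded
  above by Bernoulli's inequality and below through \<open>exp\<close> and \<open>ln\<close>. What
  matters is the factor \<open>1 / n\<close> in the remainder, with a constant independent of
  \<open>n\<close>.\<close>

lemma root_taylor:
  fixes m d :: real and n :: nat
  assumes n: "1 \<le> n" and m: "0 < m" and d: "\<bar>d\<bar> \<le> m / 2"
  shows "\<bar>root n (m + d) - root n m - root n m / (real n * m) * d\<bar> \<le> 2 * root n m / (real n * m\<^sup>2) * d\<^sup>2"
proof -
  define s where "s = d / m"
  have s: "\<bar>s\<bar> \<le> 1 / 2" using d m by (simp add: s_def field_simps)
  have "m + d = m * (1 + s)" using m by (simp add: s_def field_simps)
  then have eq: "root n (m + d) = root n m * root n (1 + s)" by (simp add: real_root_mult)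
  have "1 + s \<le> (1 + s / real n) ^ n"
    using Bernoulli_inequality[of "s / real n" n] s n by (simp add: field_simps)
  then have "root n (1 + s) \<le> root n ((1 + s / real n) ^ n)"
    using n by (intro real_root_le_mono) auto
  also have "\<dots> = 1 + s / real n"
    using n s by (intro real_root_power_cancel) (auto simp: field_simps)
  finally have up: "root n (1 + s) \<le> 1 + s / real n" .
  have "\<bar>ln (1 + s) - s\<bar> \<le> 2 * s\<^sup>2" using s by (rule abs_ln_one_plus_x_minus_x_bound)
  then have "s - 2 * s\<^sup>2 \<le> ln (1 + s)" by linarith
  then have "(s - 2 * s\<^sup>2) / real n \<le> ln (1 + s) / real n" using n by (simp add: divide_right_mono)
  then have "1 + (s - 2 * s\<^sup>2) / real n \<le> 1 + ln (1 + s) / real n" by simp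
  also have "\<dots> \<le> exp (ln (1 + s) / real n)" by (rule exp_ge_add_one_self)
  also have "\<dots> = root n (1 + s)"
    using n s by (subst root_powr_inverse) (auto simp: powr_def)
  finally have "\<bar>root n (1 + s) - 1 - s / real n\<bar> \<le> 2 * s\<^sup>2 / real n"
    using up by (simp add: diff_divide_distrib)
  then have "root n m * \<bar>root n (1 + s) - 1 - s / real n\<bar> \<le> root n m * (2 * s\<^sup>2 / real n)"
    using m n by (intro mult_left_mono) (auto intro: real_root_ge_zero)
  moreover have "root n (m + d) - root n m - root n m / (real n * m) * d = root n m * (root n (1 + s) - 1 - s / real n)"
    unfolding eq s_def using m n by (simp add: field_simps)
  moreover have "2 * root n m / (real n * m\<^sup>2) * d\<^sup>2 = root n m * (2 * s\<^sup>2 / real n)"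
    using m n by (simp add: s_def field_simps power2_eq_square)
  moreover have "0 \<le> root n m" using m n by (auto intro: real_root_ge_zero)
  ultimately show ?thesis by (simp add: abs_mult)
qed

text \<open>By taking logarithms. The sum and the sum of squares are bounded separately because in
  \<open>prod_near_mean\<close> the sum is small through cancellation, which absolute values would
  destroy.\<close>

lemma prod_one_plus_bound:
  fixes e :: "'i \<Rightarrow> real"
  assumes "finite A" and e: "\<And>i. i \<in> A \<Longrightarrow> \<bar>e i\<bar> \<le> 1 / 2"
    and 1: "\<bar>\<Sum>i\<in>A. e i\<bar> \<le> E1" and 2: "(\<Sum>i\<in>A. (e i)\<^sup>2) \<le> E2" and small: "E1 + 2 * E2 \<le> 1"
  shows "\<bar>(\<Prod>i\<in>A. 1 + e i) - 1\<bar> \<le> 2 * (E1 + 2 * E2)"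
proof -
  define t where "t = (\<Sum>i\<in>A. ln (1 + e i))"
  have pos: "0 < 1 + e i" if "i \<in> A" for i using e[OF that] by linarith
  have P: "(\<Prod>i\<in>A. 1 + e i) = exp t"
    unfolding t_def using assms(1) pos by (simp add: exp_sum)
  have "\<bar>t - (\<Sum>i\<in>A. e i)\<bar> \<le> (\<Sum>i\<in>A. \<bar>ln (1 + e i) - e i\<bar>)"
    unfolding t_def sum_subtractf[symmetric] by (rule sum_abs)
  also have "\<dots> \<le> (\<Sum>i\<in>A. 2 * (e i)\<^sup>2)"
    using e by (intro sum_mono abs_ln_one_plus_x_minus_x_bound) auto
  also have "\<dots> \<le> 2 * E2" using 2 by (simp add: sum_distrib_left[symmetric])
  finally have t: "\<bar>t\<bar> \<le> E1 + 2 * E2" using 1 by linarith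
  have "exp \<bar>t\<bar> \<le> 1 + \<bar>t\<bar> + \<bar>t\<bar>\<^sup>2" using t small by (intro exp_bound) auto
  moreover have "\<bar>t\<bar> * \<bar>t\<bar> \<le> \<bar>t\<bar> * 1" using t small by (intro mult_left_mono) auto
  then have "\<bar>t\<bar>\<^sup>2 \<le> \<bar>t\<bar>" by (simp only: power2_eq_square mult_1_right)
  moreover have "exp t \<le> exp \<bar>t\<bar>" by simp
  moreover have "1 + t \<le> exp t" by (rule exp_ge_add_one_self)
  ultimately have "\<bar>exp t - 1\<bar> \<le> 2 * \<bar>t\<bar>" by linarith
  also have "2 * \<bar>t\<bar> \<le> 2 * (E1 + 2 * E2)" using t by (intro mult_left_mono) auto
  finally show ?thesis unfolding P .
qed

text \<open>The location of \<xi> is part of the conclusion because \<open>mu_taylor\<close>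
  compares the second derivative there with its value at the base point.\<close>

lemma taylor2:
  fixes g g1 g2 :: "real \<Rightarrow> real"
  assumes d1: "\<And>s. s \<in> {a..b} \<Longrightarrow> (g has_real_derivative g1 s) (at s)"
    and d2: "\<And>s. s \<in> {a..b} \<Longrightarrow> (g1 has_real_derivative g2 s) (at s)"
    and x: "x \<in> {a..b}" and t: "t \<in> {a..b}"
  obtains \<xi> where "\<xi> \<in> {a..b}" "\<bar>\<xi> - t\<bar> \<le> \<bar>x - t\<bar>" "g x = g t + g1 t * (x - t) + g2 \<xi> / 2 * (x - t)\<^sup>2"
proof (cases "x = t")
  case True
  then show ?thesis using that[of t] t by simp
next
  case False
  define diff where "diff m = (if m = 0 then g else if m = 1 then g1 else g2)" for m :: nat
  have "\<forall>m s. m < 2 \<and> a \<le> s \<and> s \<le> b \<longrightarrow> DERIV (diff m) s :> diff (Suc m) s"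
    using d1 d2 by (auto simp: diff_def less_2_cases_iff)
  then obtain \<xi> where \<xi>: "if x < t then x < \<xi> \<and> \<xi> < t else t < \<xi> \<and> \<xi> < x"
    "g x = (\<Sum>m<2. (diff m t / fact m) * (x - t) ^ m) + (diff 2 \<xi> / fact 2) * (x - t) ^ 2"
    using Taylor[of 2 diff g a b t x] x t False by (auto simp: diff_def)
  show ?thesis
  proof (rule that)
    show "\<xi> \<in> {a..b}" using \<xi>(1) x t by (auto split: if_splits)
    show "\<bar>\<xi> - t\<bar> \<le> \<bar>x - t\<bar>" using \<xi>(1) by (auto split: if_splits)
    show "g x = g t + g1 t * (x - t) + g2 \<xi> / 2 * (x - t)\<^sup>2"
      using \<xi>(2) by (simp add: diff_def numeral_2_eq_2)
  qed
qed

lemma lipschitz_by_deriv: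
  fixes g g1 :: "real \<Rightarrow> real"
  assumes d1: "\<And>s. s \<in> {a..b} \<Longrightarrow> (g has_real_derivative g1 s) (at s)"
    and K: "\<And>s. s \<in> {a..b} \<Longrightarrow> \<bar>g1 s\<bar> \<le> K"
    and x: "x \<in> {a..b}" and t: "t \<in> {a..b}"
  shows "\<bar>g x - g t\<bar> \<le> K * \<bar>x - t\<bar>"
  using field_differentiable_bound[of "{a..b}" g g1 K x t] assms
  by (auto intro: has_field_derivative_at_within)

text \<open>Relative to the factor at the mean, the factors are \<open>1 + e i\<close>. Their
  first-order parts cancel in the sum, so the error is of order \<open>n * d\<close> times the
  square of the diameter \<open>D\<close>; without the cancellation it would only be of first order
  in \<open>D\<close>.\<close>

lemma prod_near_mean:
  fixes g g1 g2 :: "real \<Rightarrow> real" and x :: "nat \<Rightarrow> real"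
  assumes d1: "\<And>s. s \<in> {a..b} \<Longrightarrow> (g has_real_derivative g1 s) (at s)"
    and d2: "\<And>s. s \<in> {a..b} \<Longrightarrow> (g1 has_real_derivative g2 s) (at s)"
    and K1: "\<And>s. s \<in> {a..b} \<Longrightarrow> \<bar>g1 s\<bar> \<le> K"
    and K2: "\<And>s. s \<in> {a..b} \<Longrightarrow> \<bar>g2 s\<bar> \<le> K"
    and n: "1 \<le> n" and t: "t = (\<Sum>i=1..n. x i) / real n" "t \<in> {a..b}"
    and x: "\<And>i. i \<in> {1..n} \<Longrightarrow> x i \<in> {a..b}" "\<And>i. i \<in> {1..n} \<Longrightarrow> \<bar>x i - t\<bar> \<le> D"
    and d: "0 \<le> d" "d \<le> K" and c: "0 < c" "c \<le> 1 - d * g t" "1 - d * g t \<le> 1"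
    and small: "d * K * D / c \<le> 1 / 2" "real n * d * D\<^sup>2 * (K / c + 2 * K ^ 3 / c\<^sup>2) \<le> 1"
  shows "\<bar>(\<Prod>i=1..n. 1 - d * g (x i)) - (1 - d * g t) ^ n\<bar> \<le> 2 * (real n * d * D\<^sup>2 * (K / c + 2 * K ^ 3 / c\<^sup>2))"
proof -
  define A where "A = 1 - d * g t"
  define e where "e i = - (d * (g (x i) - g t)) / A" for i
  have A: "c \<le> A" "A \<le> 1" "0 < A" using c by (auto simp: A_def)
  have K0: "0 \<le> K" using d by linarith
  have D0: "0 \<le> D" using x(2)[of 1] n by auto
  have lip: "\<bar>g (x i) - g t\<bar> \<le> K * D" if "i \<in> {1..n}" for i
    using lipschitz_by_deriv[OF d1 K1 x(1)[OF that] t(2)] mult_left_mono[OF x(2)[OF that] K0] by linarith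
  have eabs: "\<bar>e i\<bar> \<le> d * K * D / c" if "i \<in> {1..n}" for i
  proof -
    have "\<bar>e i\<bar> = d * \<bar>g (x i) - g t\<bar> / A" using A d by (simp add: e_def abs_mult)
    also have "\<dots> \<le> d * (K * D) / c" using A c d lip[OF that] K0 D0 by (intro frac_le mult_left_mono) auto
    finally show ?thesis by (simp add: mult.assoc)
  qed
  \<comment> \<open>This is where t being the mean of the points gains one power of
    \<open>D\<close>.\<close>
  have sum0: "(\<Sum>i=1..n. x i - t) = 0" using n by (simp add: sum_subtractf t(1))
  have tay: "\<bar>g (x i) - g t - g1 t * (x i - t)\<bar> \<le> K * D\<^sup>2" if i: "i \<in> {1..n}" for i
  proof -
    obtain \<xi> where \<xi>: "\<xi> \<in> {a..b}" "g (x i) = g t + g1 t * (x i - t) + g2 \<xi> / 2 * (x i - t)\<^sup>2"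
      by (rule taylor2[OF d1 d2 x(1)[OF i] t(2)])
    have "\<bar>g (x i) - g t - g1 t * (x i - t)\<bar> = \<bar>g2 \<xi>\<bar> / 2 * \<bar>x i - t\<bar>\<^sup>2"
      unfolding \<xi>(2) by (simp add: abs_mult)
    also have "\<dots> \<le> K * D\<^sup>2"
      using K2[OF \<xi>(1)] x(2)[OF i] K0 by (intro mult_mono power_mono) auto
    finally show ?thesis .
  qed
  have "\<bar>\<Sum>i=1..n. g (x i) - g t\<bar> = \<bar>\<Sum>i=1..n. g (x i) - g t - g1 t * (x i - t)\<bar>"
    using sum0 by (simp add: sum_subtractf sum_distrib_left[symmetric])
  also have "\<dots> \<le> (\<Sum>i=1..n. K * D\<^sup>2)"
    by (rule order_trans[OF sum_abs]) (intro sum_mono tay)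
  finally have s1: "\<bar>\<Sum>i=1..n. g (x i) - g t\<bar> \<le> real n * (K * D\<^sup>2)" by simp
  have "(\<Sum>i=1..n. e i) = - (d * (\<Sum>i=1..n. g (x i) - g t)) / A"
    by (simp add: e_def sum_negf sum_distrib_left sum_divide_distrib)
  then have "\<bar>\<Sum>i=1..n. e i\<bar> = d * \<bar>\<Sum>i=1..n. g (x i) - g t\<bar> / A"
    using A d by (simp add: abs_mult)
  also have "\<dots> \<le> d * (real n * (K * D\<^sup>2)) / c"
    using A c d s1 K0 by (intro frac_le mult_left_mono) auto
  finally have e1: "\<bar>\<Sum>i=1..n. e i\<bar> \<le> d * (real n * (K * D\<^sup>2)) / c" .
  have "(\<Sum>i=1..n. (e i)\<^sup>2) \<le> (\<Sum>i=1..n. (d * K * D / c)\<^sup>2)"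
    by (intro sum_mono) (metis eabs abs_ge_zero power2_abs power_mono)
  also have "\<dots> = real n * d * D\<^sup>2 * (d * K\<^sup>2 / c\<^sup>2)"
    by (simp add: power2_eq_square)
  \<comment> \<open>One of the two factors \<open>d\<close> is traded for \<open>K\<close>, so that
    both sums carry the common factor \<open>n * d * D\<^sup>2\<close>.\<close>
  also have "\<dots> \<le> real n * d * D\<^sup>2 * (K * K\<^sup>2 / c\<^sup>2)"
    using d c K0 by (intro mult_left_mono divide_right_mono mult_right_mono) auto
  finally have e2: "(\<Sum>i=1..n. (e i)\<^sup>2) \<le> real n * d * D\<^sup>2 * (K ^ 3 / c\<^sup>2)"
    by (simp add: power2_eq_square power3_eq_cube mult.assoc)
  have tot: "d * (real n * (K * D\<^sup>2)) / c + 2 * (real n * d * D\<^sup>2 * (K ^ 3 / c\<^sup>2))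
      = real n * d * D\<^sup>2 * (K / c + 2 * K ^ 3 / c\<^sup>2)"
    by (simp add: algebra_simps)
  have half: "\<bar>e i\<bar> \<le> 1 / 2" if "i \<in> {1..n}" for i using eabs[OF that] small(1) by linarith
  have P: "\<bar>(\<Prod>i=1..n. 1 + e i) - 1\<bar> \<le> 2 * (real n * d * D\<^sup>2 * (K / c + 2 * K ^ 3 / c\<^sup>2))"
    using prod_one_plus_bound[OF finite_atLeastAtMost half e1 e2] small(2) unfolding tot by blast
  have "(\<Prod>i=1..n. 1 - d * g (x i)) = (\<Prod>i=1..n. A * (1 + e i))"
  proof (rule prod.cong[OF refl])
    fix i
    have "A * e i = - (d * (g (x i) - g t))" using A by (simp add: e_def)
    then have "A * (1 + e i) = A - d * (g (x i) - g t)" by (simp add: distrib_left)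
    then show "1 - d * g (x i) = A * (1 + e i)" by (simp add: A_def algebra_simps)
  qed
  also have "\<dots> = A ^ n * (\<Prod>i=1..n. 1 + e i)" by (simp add: prod.distrib)
  finally have "(\<Prod>i=1..n. 1 - d * g (x i)) - A ^ n = A ^ n * ((\<Prod>i=1..n. 1 + e i) - 1)"
    by (simp only: right_diff_distrib mult_1_right)
  then have "\<bar>(\<Prod>i=1..n. 1 - d * g (x i)) - A ^ n\<bar> = A ^ n * \<bar>(\<Prod>i=1..n. 1 + e i) - 1\<bar>"
    using A by (simp only: abs_mult) simp
  also have "\<dots> \<le> 1 * \<bar>(\<Prod>i=1..n. 1 + e i) - 1\<bar>"
    using A by (intro mult_right_mono power_le_one) auto
  finally show ?thesis using P by (simp add: A_def)
qed

text \<open>Differentiating the power brings down factors \<open>n * d\<close>, never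
  \<open>n\<close> alone, and \<open>n * d\<close> is at most \<open>K\<close>. Hence the second
  derivative of the power is \<open>n * d\<close> times a function whose oscillation is that of
  \<open>g2\<close> plus a Lipschitz term; \<open>osc\<close> bounds the two together.\<close>

lemma mu_taylor:
  fixes g g1 g2 :: "real \<Rightarrow> real"
  assumes d1: "\<And>s. s \<in> {a..b} \<Longrightarrow> (g has_real_derivative g1 s) (at s)"
    and d2: "\<And>s. s \<in> {a..b} \<Longrightarrow> (g1 has_real_derivative g2 s) (at s)"
    and K1: "\<And>s. s \<in> {a..b} \<Longrightarrow> \<bar>g1 s\<bar> \<le> K"
    and K2: "\<And>s. s \<in> {a..b} \<Longrightarrow> \<bar>g2 s\<bar> \<le> K" and K: "1 \<le> K"
    and n: "1 \<le> n" and d: "0 \<le> d" "real n * d \<le> K"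
    and range: "\<And>s. s \<in> {a..b} \<Longrightarrow> 0 \<le> 1 - d * g s \<and> 1 - d * g s \<le> 1"
    and x: "x \<in> {a..b}" and t: "t \<in> {a..b}"
    and osc: "\<And>s. s \<in> {a..b} \<Longrightarrow> \<bar>s - x\<bar> \<le> \<bar>t - x\<bar> \<Longrightarrow> \<bar>g2 s - g2 x\<bar> + 4 * K ^ 5 * \<bar>s - x\<bar> \<le> \<epsilon>"
  defines "\<mu>1 \<equiv> - (real n * d * g1 x * (1 - d * g x) ^ (n - 1))"
    and "\<mu>2 \<equiv> real n * (real n - 1) * d\<^sup>2 * (g1 x)\<^sup>2 * (1 - d * g x) ^ (n - 2) - real n * d * g2 x * (1 - d * g x) ^ (n - 1)"
  shows "\<bar>(1 - d * g t) ^ n - (1 - d * g x) ^ n - \<mu>1 * (t - x) - \<mu>2 / 2 * (t - x)\<^sup>2\<bar> \<le> real n * d * \<epsilon> * (t - x)\<^sup>2"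
    and "\<bar>\<mu>2\<bar> \<le> real n * d * (2 * K ^ 3)"
proof -
  define G where "G s = 1 - d * g s" for s
  define m1 where "m1 s = - (real n * d * g1 s * G s ^ (n - 1))" for s
  \<comment> \<open>For \<open>n = 1\<close> the exponent \<open>n - 2\<close> is truncated to 0,
    which does no harm because the coefficient \<open>n - 1\<close> vanishes.\<close>
  define m2 where "m2 s = real n * (real n - 1) * d\<^sup>2 * (g1 s)\<^sup>2 * G s ^ (n - 2) - real n * d * g2 s * G s ^ (n - 1)" for s
  have G: "0 \<le> G s" "G s \<le> 1" if "s \<in> {a..b}" for s using range[OF that] by (auto simp: G_def)
  have Gd: "(G has_real_derivative - d * g1 s) (at s)" if "s \<in> {a..b}" for s
    unfolding G_def by (auto intro!: derivative_eq_intros d1[OF that])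
  have D1: "((\<lambda>s. G s ^ n) has_real_derivative m1 s) (at s)" if "s \<in> {a..b}" for s
    by (auto intro!: derivative_eq_intros Gd[OF that] simp: m1_def)
  have D2: "(m1 has_real_derivative m2 s) (at s)" if "s \<in> {a..b}" for s
  proof -
    have "(m1 has_real_derivative - (real n * d * (g1 s * (real (n - 1) * (- d * g1 s) * G s ^ (n - 1 - 1)) + g2 s * G s ^ (n - 1)))) (at s)"
      unfolding m1_def[abs_def] by (auto intro!: derivative_eq_intros Gd[OF that] d2[OF that] simp: algebra_simps)
    moreover have "- (real n * d * (g1 s * (real (n - 1) * (- d * g1 s) * G s ^ (n - 1 - 1)) + g2 s * G s ^ (n - 1))) = m2 s"
      using n by (simp add: m2_def of_nat_diff algebra_simps power2_eq_square numeral_2_eq_2)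
    ultimately show ?thesis by simp
  qed
  have "1 * d \<le> real n * d" using d n by (intro mult_right_mono) auto
  then have dn: "d \<le> real n * d" by simp
  then have d_le: "d \<le> K" using d by linarith
  have k_le: "real k * d \<le> K" if "k \<le> n" for k
    using d that mult_right_mono[of "real k" "real n" d] by simp
  have n1d: "0 \<le> (real n - 1) * d" "(real n - 1) * d \<le> K"
    using n d dn by (simp_all add: left_diff_distrib)
  have Kp: "K \<le> K ^ 5" "K ^ 2 \<le> K ^ 5" "K ^ 3 \<le> K ^ 5" "K ^ 4 \<le> K ^ 5" "K\<^sup>2 \<le> K ^ 3"
    using K power_increasing[of 1 5 K] power_increasing[of 2 5 K] power_increasing[of 3 5 K] power_increasing[of 4 5 K]
      power_increasing[of 2 3 K] by simp_all
  have powdiff: "\<bar>G s ^ k - G x ^ k\<bar> \<le> K\<^sup>2 * \<bar>s - x\<bar>" if s: "s \<in> {a..b}" and k: "k \<le> n" for s k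
  proof -
    have "\<bar>G s ^ k - G x ^ k\<bar> \<le> real k * \<bar>G s - G x\<bar>"
      using norm_power_diff[of "G s" "G x" k] G[OF s] G[OF x] by simp
    also have "\<bar>G s - G x\<bar> = d * \<bar>g s - g x\<bar>"
    proof -
      have "G s - G x = - (d * (g s - g x))" by (simp add: G_def algebra_simps)
      then show ?thesis using d by (simp add: abs_mult)
    qed
    also have "real k * (d * \<bar>g s - g x\<bar>) = (real k * d) * \<bar>g s - g x\<bar>" by simp
    also have "\<dots> \<le> K * (K * \<bar>s - x\<bar>)"
      using k_le[OF k] lipschitz_by_deriv[OF d1 K1 s x] K by (intro mult_mono) auto
    finally show ?thesis by (simp add: power2_eq_square mult.assoc)
  qed
  have osc': "\<bar>m2 s - m2 x\<bar> \<le> real n * d * \<epsilon>" if s: "s \<in> {a..b}" "\<bar>s - x\<bar> \<le> \<bar>t - x\<bar>" for s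
  proof -
    let ?T1 = "\<lambda>s. (real n - 1) * d * ((g1 s)\<^sup>2 * G s ^ (n - 2))"
    let ?T2 = "\<lambda>s. g2 s * G s ^ (n - 1)"
    have m2: "m2 s = real n * d * (?T1 s - ?T2 s)" for s
      by (simp add: m2_def algebra_simps power2_eq_square)
    have sq: "\<bar>(g1 s)\<^sup>2 - (g1 x)\<^sup>2\<bar> \<le> 2 * K\<^sup>2 * \<bar>s - x\<bar>"
    proof -
      have "(g1 s)\<^sup>2 - (g1 x)\<^sup>2 = (g1 s + g1 x) * (g1 s - g1 x)" by (simp add: power2_eq_square algebra_simps)
      then have "\<bar>(g1 s)\<^sup>2 - (g1 x)\<^sup>2\<bar> = \<bar>g1 s + g1 x\<bar> * \<bar>g1 s - g1 x\<bar>" by (simp add: abs_mult)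
      also have "\<dots> \<le> (2 * K) * (K * \<bar>s - x\<bar>)"
        using K1[OF s(1)] K1[OF x] lipschitz_by_deriv[OF d2 K2 s(1) x] K by (intro mult_mono) auto
      finally show ?thesis by (simp add: power2_eq_square)
    qed
    have "(g1 s)\<^sup>2 * G s ^ (n - 2) - (g1 x)\<^sup>2 * G x ^ (n - 2)
        = ((g1 s)\<^sup>2 - (g1 x)\<^sup>2) * G s ^ (n - 2) + (g1 x)\<^sup>2 * (G s ^ (n - 2) - G x ^ (n - 2))"
      by (simp add: algebra_simps)
    then have "\<bar>(g1 s)\<^sup>2 * G s ^ (n - 2) - (g1 x)\<^sup>2 * G x ^ (n - 2)\<bar>
        \<le> \<bar>(g1 s)\<^sup>2 - (g1 x)\<^sup>2\<bar> * G s ^ (n - 2) + (g1 x)\<^sup>2 * \<bar>G s ^ (n - 2) - G x ^ (n - 2)\<bar>"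
      using G[OF s(1)] by (simp add: abs_mult order_trans[OF abs_triangle_ineq])
    also have "\<dots> \<le> (2 * K\<^sup>2 * \<bar>s - x\<bar>) * 1 + K\<^sup>2 * (K\<^sup>2 * \<bar>s - x\<bar>)"
      using sq powdiff[OF s(1), of "n - 2"] G[OF s(1)] power_mono[OF K1[OF x] abs_ge_zero, of 2] K
      by (intro add_mono mult_mono power_le_one) auto
    finally have "\<bar>?T1 s - ?T1 x\<bar> \<le> K * ((2 * K\<^sup>2 * \<bar>s - x\<bar>) * 1 + K\<^sup>2 * (K\<^sup>2 * \<bar>s - x\<bar>))"
      unfolding right_diff_distrib[symmetric] abs_mult using n1d K by (intro mult_mono) auto
    then have t1: "\<bar>?T1 s - ?T1 x\<bar> \<le> (2 * K ^ 3 + K ^ 5) * \<bar>s - x\<bar>"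
      by (simp add: algebra_simps power2_eq_square power3_eq_cube eval_nat_numeral)
    have "?T2 s - ?T2 x = (g2 s - g2 x) * G s ^ (n - 1) + g2 x * (G s ^ (n - 1) - G x ^ (n - 1))"
      by (simp add: algebra_simps)
    then have "\<bar>?T2 s - ?T2 x\<bar> \<le> \<bar>g2 s - g2 x\<bar> * G s ^ (n - 1) + \<bar>g2 x\<bar> * \<bar>G s ^ (n - 1) - G x ^ (n - 1)\<bar>"
      using G[OF s(1)] by (simp add: abs_mult order_trans[OF abs_triangle_ineq])
    also have "\<dots> \<le> \<bar>g2 s - g2 x\<bar> * 1 + K * (K\<^sup>2 * \<bar>s - x\<bar>)"
      using powdiff[OF s(1), of "n - 1"] G[OF s(1)] K2[OF x] K
      by (intro add_mono mult_mono power_le_one) auto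
    finally have t2: "\<bar>?T2 s - ?T2 x\<bar> \<le> \<bar>g2 s - g2 x\<bar> + K ^ 3 * \<bar>s - x\<bar>"
      by (simp add: power2_eq_square power3_eq_cube mult.assoc)
    \<comment> \<open>The origin of \<open>4 * K ^ 5\<close> in \<open>osc\<close>: the Lipschitz
      constants of the two parts of the second derivative are added and rounded up.\<close>
    have "2 * K ^ 3 + K ^ 5 + K ^ 3 \<le> 4 * K ^ 5" using Kp(3) by linarith
    then have "(2 * K ^ 3 + K ^ 5 + K ^ 3) * \<bar>s - x\<bar> \<le> 4 * K ^ 5 * \<bar>s - x\<bar>"
      by (rule mult_right_mono) simp
    then have "\<bar>(?T1 s - ?T2 s) - (?T1 x - ?T2 x)\<bar> \<le> \<bar>g2 s - g2 x\<bar> + 4 * K ^ 5 * \<bar>s - x\<bar>"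
      using t1 t2 unfolding distrib_right by linarith
    also have "\<dots> \<le> \<epsilon>" using osc[OF s] .
    finally have "real n * d * \<bar>(?T1 s - ?T2 s) - (?T1 x - ?T2 x)\<bar> \<le> real n * d * \<epsilon>"
      using d by (intro mult_left_mono) auto
    moreover have "\<bar>m2 s - m2 x\<bar> = real n * d * \<bar>(?T1 s - ?T2 s) - (?T1 x - ?T2 x)\<bar>"
      unfolding m2 right_diff_distrib[symmetric] using d by (simp add: abs_mult)
    ultimately show ?thesis by simp
  qed
  obtain \<xi> where \<xi>: "\<xi> \<in> {a..b}" "\<bar>\<xi> - x\<bar> \<le> \<bar>t - x\<bar>"
    "G t ^ n = G x ^ n + m1 x * (t - x) + m2 \<xi> / 2 * (t - x)\<^sup>2"
    by (rule taylor2[OF D1 D2 t x])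
  have e0: "0 \<le> \<epsilon>" using osc[OF x] by simp
  have "G t ^ n - G x ^ n - m1 x * (t - x) - m2 x / 2 * (t - x)\<^sup>2 = (m2 \<xi> - m2 x) / 2 * (t - x)\<^sup>2"
    unfolding \<xi>(3) by (simp add: left_diff_distrib diff_divide_distrib)
  then have "\<bar>G t ^ n - G x ^ n - m1 x * (t - x) - m2 x / 2 * (t - x)\<^sup>2\<bar> = \<bar>(m2 \<xi> - m2 x) / 2 * (t - x)\<^sup>2\<bar>"
    by (simp only:)
  also have "\<dots> = \<bar>m2 \<xi> - m2 x\<bar> / 2 * (t - x)\<^sup>2" by (simp add: abs_mult)
  also have "\<dots> \<le> real n * d * \<epsilon> * (t - x)\<^sup>2"
  proof (rule mult_right_mono)
    have "0 \<le> real n * d * \<epsilon>" using d e0 by simp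
    moreover have "X / 2 \<le> Y" if "0 \<le> Y" "X \<le> Y" for X Y :: real using that by simp
    ultimately show "\<bar>m2 \<xi> - m2 x\<bar> / 2 \<le> real n * d * \<epsilon>" using osc'[OF \<xi>(1,2)] by blast
  qed simp
  finally show "\<bar>(1 - d * g t) ^ n - (1 - d * g x) ^ n - \<mu>1 * (t - x) - \<mu>2 / 2 * (t - x)\<^sup>2\<bar> \<le> real n * d * \<epsilon> * (t - x)\<^sup>2"
    by (simp add: \<mu>1_def \<mu>2_def m1_def m2_def G_def)
  have "\<mu>2 = real n * d * (((real n - 1) * d) * ((g1 x)\<^sup>2 * G x ^ (n - 2)) - g2 x * G x ^ (n - 1))"
    by (simp add: \<mu>2_def G_def algebra_simps power2_eq_square)
  then have "\<bar>\<mu>2\<bar> = real n * d * \<bar>((real n - 1) * d) * ((g1 x)\<^sup>2 * G x ^ (n - 2)) - g2 x * G x ^ (n - 1)\<bar>"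
    using d by (simp add: abs_mult)
  also have "\<dots> \<le> real n * d * (2 * K ^ 3)"
  proof (rule mult_left_mono)
    have "\<bar>((real n - 1) * d) * ((g1 x)\<^sup>2 * G x ^ (n - 2))\<bar> \<le> K * (K\<^sup>2 * 1)"
      unfolding abs_mult using n1d G[OF x] power_mono[OF K1[OF x] abs_ge_zero, of 2] K
      by (intro mult_mono) (auto intro: power_le_one simp: abs_of_nonneg)
    moreover have "\<bar>g2 x * G x ^ (n - 1)\<bar> \<le> K * 1"
      unfolding abs_mult using G[OF x] K2[OF x] K by (intro mult_mono) (auto intro: power_le_one)
    moreover have "K \<le> K ^ 3" using K power_increasing[of 1 3 K] by simp
    ultimately show "\<bar>((real n - 1) * d) * ((g1 x)\<^sup>2 * G x ^ (n - 2)) - g2 x * G x ^ (n - 1)\<bar> \<le> 2 * K ^ 3"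
      by (simp add: power2_eq_square power3_eq_cube)
  qed (use d in simp)
  finally show "\<bar>\<mu>2\<bar> \<le> real n * d * (2 * K ^ 3)" .
qed

text \<open>A cruder companion of \<open>prod_near_mean\<close>, of first order only. It suffices
  for variances, and with \<open>z = 1\<close> it bounds the probability that a group is not
  clear.\<close>

lemma prod_near_point:
  fixes y :: "'i \<Rightarrow> real"
  assumes "finite A" "\<And>i. i \<in> A \<Longrightarrow> y i \<in> {0..1}" "z \<in> {0..1}" "\<And>i. i \<in> A \<Longrightarrow> \<bar>y i - z\<bar> \<le> E"
  shows "\<bar>(\<Prod>i\<in>A. y i) - z ^ card A\<bar> \<le> real (card A) * E"
proof -
  have "norm ((\<Prod>i\<in>A. y i) - (\<Prod>i\<in>A. z)) \<le> (\<Sum>i\<in>A. norm (y i - z))"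
    by (rule norm_prod_diff) (use assms in auto)
  also have "\<dots> \<le> (\<Sum>i\<in>A. E)" using assms by (intro sum_mono) auto
  finally show ?thesis by simp
qed

text \<open>Members of a group have consecutive ranks. An extreme member further than
  \<open>2 * s\<close> from the mean would leave a whole cell between the extremes, and the
  observations in that cell are too many for the ranks available.\<close>

lemma group_spread:
  fixes u :: "nat \<Rightarrow> real"
  assumes n: "1 \<le> n" and j: "j \<in> {1..N div n}" and s: "0 < s"
    and cells: "\<And>k. k < m \<Longrightarrow> n \<le> card {i\<in>{1..N}. u i \<in> {a + real k * s<..<a + real (Suc k) * s}}"
    and t: "group_mean n N u j \<in> {a + 2 * s..a + real m * s - 2 * s}" and i: "i \<in> {1..n}"
  shows "\<bar>order_stat N u ((j - 1) * n + i) - group_mean n N u j\<bar> \<le> 2 * s"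
proof -
  define t where "t = group_mean n N u j"
  define lo hi where "lo = (j - 1) * n + 1" and "hi = (j - 1) * n + n"
  have lohi: "lo \<in> {1..N}" "hi \<in> {1..N}" "hi = lo + n - 1"
    using group_index_in[OF j, of 1] group_index_in[OF j, of n] n by (auto simp: lo_def hi_def)
  have bet: "order_stat N u lo \<le> order_stat N u ((j - 1) * n + i')" "order_stat N u ((j - 1) * n + i') \<le> order_stat N u hi"
    if "i' \<in> {1..n}" for i'
    using that group_index_in[OF j that] lohi unfolding lo_def hi_def
    by (auto intro!: order_stat_mono)
  have tsum: "real n * t = (\<Sum>i=1..n. order_stat N u ((j - 1) * n + i))"
    using n by (simp add: t_def group_mean_def)
  have "real n * t \<le> (\<Sum>i=1..n. order_stat N u hi)" unfolding tsum by (intro sum_mono bet) auto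
  then have thi: "t \<le> order_stat N u hi" using n by simp
  have "(\<Sum>i=1..n. order_stat N u lo) \<le> real n * t" unfolding tsum by (intro sum_mono bet) auto
  then have tlo: "order_stat N u lo \<le> t" using n by simp
  \<comment> \<open>All observations of a cell lying between the extremes of the group have ranks
    strictly between \<open>lo\<close> and \<open>hi\<close>.\<close>
  have key: False if k: "k < m" and c: "order_stat N u lo \<le> a + real k * s" "a + real (Suc k) * s \<le> order_stat N u hi" for k
  proof -
    let ?C = "{i\<in>{1..N}. u i \<in> {a + real k * s<..<a + real (Suc k) * s}}"
    let ?R = "{r\<in>{1..N}. order_stat N u r \<in> {a + real k * s<..<a + real (Suc k) * s}}"
    have "?C = rank_index N u ` ?R"
    proof (intro equalityI subsetI)
      fix i assume i: "i \<in> ?C"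
      then obtain r where "r \<in> {1..N}" "i = rank_index N u r"
        using rank_index_bij[of N u] unfolding bij_betw_def by blast
      then show "i \<in> rank_index N u ` ?R" using i by (auto simp: order_stat_def)
    qed (use rank_index_in in \<open>auto simp: order_stat_def\<close>)
    then have "n \<le> card ?R"
      using cells[OF k] card_image_le[of ?R "rank_index N u"] by simp
    also have "?R \<subseteq> {lo<..<hi}"
    proof
      fix r assume r: "r \<in> ?R"
      have "lo < r"
      proof (rule ccontr)
        assume "\<not> lo < r"
        then have "order_stat N u r \<le> order_stat N u lo" using r lohi by (intro order_stat_mono) auto
        then show False using r c by auto
      qed
      moreover have "r < hi"
      proof (rule ccontr)
        assume "\<not> r < hi"
        then have "order_stat N u hi \<le> order_stat N u r" using r lohi by (intro order_stat_mono) auto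
        then show False using r c by auto
      qed
      ultimately show "r \<in> {lo<..<hi}" by simp
    qed
    then have "card ?R \<le> card {lo<..<hi}" by (intro card_mono) auto
    \<comment> \<open>Strictly between the extreme ranks lie \<open>n - 2\<close> ranks, or none
      when \<open>n = 1\<close>.\<close>
    also have "\<dots> < n" using lohi n by auto
    finally show False by simp
  qed
  have hi2: "order_stat N u hi \<le> t + 2 * s"
  proof (rule ccontr)
    assume neg: "\<not> ?thesis"
    \<comment> \<open>The first cell that starts at or above the mean.\<close>
    define k where "k = nat \<lceil>(t - a) / s\<rceil>"
    have ge: "(t - a) / s \<ge> 2" using t s by (simp add: t_def field_simps)
    have kr: "(t - a) / s \<le> real k" "real k < (t - a) / s + 1"
      using ge by (auto simp: k_def) linarith+
    have a1: "t \<le> a + real k * s" using kr(1) s by (simp add: field_simps)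
    have a2: "a + real (Suc k) * s \<le> t + 2 * s" using kr(2) s by (simp add: field_simps)
    have "t + 2 * s \<le> a + real m * s" using t by (simp add: t_def)
    then have "real (Suc k) * s \<le> real m * s" using a2 by linarith
    then have "k < m" using s by simp
    then show False using key[of k] a1 a2 tlo neg by linarith
  qed
  have lo2: "t - 2 * s \<le> order_stat N u lo"
  proof (rule ccontr)
    assume neg: "\<not> ?thesis"
    \<comment> \<open>The last cell that ends at or below the mean.\<close>
    define k where "k = nat (\<lfloor>(t - a) / s\<rfloor> - 1)"
    have ge: "(t - a) / s \<ge> 2" using t s by (simp add: t_def field_simps)
    then have fl: "\<lfloor>(t - a) / s\<rfloor> \<ge> 2" by linarith
    have rk: "real k = real_of_int \<lfloor>(t - a) / s\<rfloor> - 1"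
      using fl by (simp add: k_def)
    have kr: "real k + 1 \<le> (t - a) / s" "(t - a) / s < real k + 2"
      unfolding rk by linarith+
    have a1: "a + real (Suc k) * s \<le> t" using kr(1) s by (simp add: field_simps)
    have a2: "t - 2 * s \<le> a + real k * s" using kr(2) s by (simp add: field_simps)
    have "t + 2 * s \<le> a + real m * s" using t by (simp add: t_def)
    then have "real k * s \<le> real m * s - s" using a1 s by (simp add: algebra_simps)
    then have "real (Suc k) * s \<le> real m * s" by (simp add: algebra_simps)
    then have "k < m" using s by simp
    then show False using key[of k] a1 a2 thi neg by linarith
  qed
  show ?thesis using bet[OF i] hi2 lo2 unfolding t_def by linarith
qed

text \<open>A Chernoff bound with exponential parameter 1: Markov's inequality for the exponential
  of minus the count, which factorises by independence.\<close>

lemma (in prob_space) few_points_prob: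
  fixes X :: "nat \<Rightarrow> 'a \<Rightarrow> real"
  assumes ind: "indep_vars (\<lambda>_. borel) X A" and fin: "finite A" and C [measurable]: "C \<in> sets borel"
    and q: "\<And>i. i \<in> A \<Longrightarrow> q \<le> prob {\<omega>\<in>space M. X i \<omega> \<in> C}"
  shows "prob {\<omega>\<in>space M. card {i\<in>A. X i \<omega> \<in> C} < n} \<le> exp (real n - real (card A) * q / 2)"
proof -
  have Xm [measurable]: "X i \<in> borel_measurable M" if "i \<in> A" for i
    using ind that unfolding indep_vars_def by blast
  let ?e = "\<lambda>i \<omega>. exp (- indicat_real C (X i \<omega>))"
  have iv: "indep_vars (\<lambda>_. borel) (\<lambda>i \<omega>. ?e i \<omega>) A"
    by (rule indep_vars_compose2[OF ind]) measurable
  have em: "?e i \<in> borel_measurable M" if "i \<in> A" for i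
    using Xm[OF that] by measurable
  have ib: "integrable M (?e i)" if "i \<in> A" for i
    by (rule integrable_const_bound[where B = 1]) (auto simp: em[OF that])
  have card_eq: "real (card {i\<in>A. X i \<omega> \<in> C}) = (\<Sum>i\<in>A. indicat_real C (X i \<omega>))" for \<omega>
    using fin by (simp add: indicator_def sum.If_cases Int_def)
  have prod_eq: "(\<Prod>i\<in>A. ?e i \<omega>) = exp (- real (card {i\<in>A. X i \<omega> \<in> C}))" for \<omega>
    unfolding card_eq by (simp add: exp_sum[OF fin] sum_negf[symmetric])
  have Ee: "expectation (?e i) \<le> exp (- q / 2)" if i: "i \<in> A" for i
  proof -
    have S [measurable]: "{\<omega>\<in>space M. X i \<omega> \<in> C} \<in> sets M"
      using Xm[OF i] by measurable
    have "expectation (?e i) = expectation (\<lambda>\<omega>. 1 - (1 - exp (-1)) * indicat_real {\<omega>\<in>space M. X i \<omega> \<in> C} \<omega>)"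
      by (intro Bochner_Integration.integral_cong refl) (auto simp: indicator_def)
    also have "\<dots> = 1 - (1 - exp (-1)) * prob {\<omega>\<in>space M. X i \<omega> \<in> C}"
      by (simp add: prob_space less_top[symmetric])
    \<comment> \<open>The half in the exponent of the result comes from
      \<open>1 - exp (-1) \<ge> 1 / 2\<close>.\<close>
    also have "\<dots> \<le> 1 - (1 / 2) * q"
    proof -
      have "exp (-1) \<le> (1 / 2 :: real)" using exp_ge_add_one_self[of 1] by (simp add: exp_minus field_simps)
      then have "(1 / 2) * prob {\<omega>\<in>space M. X i \<omega> \<in> C} \<le> (1 - exp (-1)) * prob {\<omega>\<in>space M. X i \<omega> \<in> C}"
        by (intro mult_right_mono) auto
      then show ?thesis using q[OF i] by linarith
    qed
    also have "\<dots> \<le> exp (- q / 2)" using exp_ge_add_one_self[of "- q / 2"] by simp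
    finally show ?thesis .
  qed
  have int: "integrable M (\<lambda>\<omega>. \<Prod>i\<in>A. ?e i \<omega>)"
    by (rule indep_vars_integrable[OF fin iv ib])
  have "prob {\<omega>\<in>space M. card {i\<in>A. X i \<omega> \<in> C} < n} \<le> prob {\<omega>\<in>space M. exp (- real n) \<le> (\<Prod>i\<in>A. ?e i \<omega>)}"
    unfolding prod_eq
  proof (rule finite_measure_mono)
    have "(\<lambda>\<omega>. \<Prod>i\<in>A. ?e i \<omega>) \<in> borel_measurable M"
      using em by (intro borel_measurable_prod) auto
    then show "{\<omega>\<in>space M. exp (- real n) \<le> exp (- real (card {i\<in>A. X i \<omega> \<in> C}))} \<in> sets M"
      unfolding prod_eq by measurable
  qed auto
  also have "\<dots> \<le> expectation (\<lambda>\<omega>. \<Prod>i\<in>A. ?e i \<omega>) / exp (- real n)"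
    by (rule integral_Markov_inequality_measure[where A = "{}"]) (use int in \<open>auto intro!: AE_I2 prod_nonneg\<close>)
  also have "expectation (\<lambda>\<omega>. \<Prod>i\<in>A. ?e i \<omega>) = (\<Prod>i\<in>A. expectation (?e i))"
    by (rule indep_vars_lebesgue_integral[OF fin iv ib])
  also have "(\<Prod>i\<in>A. expectation (?e i)) / exp (- real n) \<le> (\<Prod>i\<in>A. exp (- q / 2)) / exp (- real n)"
    using Ee by (intro divide_right_mono prod_mono) (auto intro: integral_nonneg)
  also have "\<dots> = exp (real (card A) * (- q / 2)) / exp (- real n)"
    by (simp only: exp_of_nat_mult prod_constant)
  also have "\<dots> = exp (real n - real (card A) * q / 2)"
    by (subst exp_diff[symmetric]) (simp add: algebra_simps)
  finally show ?thesis .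
qed

text \<open>
  The limit variable is only determined up to its law, and where the asymptotic variance vanishes it
  has to be supplied from outside the estimator: here as a quantile transform of an observation.
\<close>

lemma (in prob_space) exists_std_normal:
  fixes X :: "'a \<Rightarrow> real"
  assumes Xm [measurable]: "X \<in> borel_measurable M" and atomless: "\<And>x. prob {\<omega>\<in>space M. X \<omega> = x} = 0"
  shows "\<exists>V\<in>borel_measurable M. distr M borel V = std_normal_distribution"
proof -
  let ?D = "distr M borel X"
  interpret D: cdf_distribution ?D
    unfolding cdf_distribution_def by (rule real_distribution_distr) measurable
  interpret S: cdf_distribution std_normal_distribution
    unfolding cdf_distribution_def by (rule real_dist_normal_dist)
  define F where "F = cdf ?D"
  have at: "measure ?D {x} = 0" for x
    using atomless[of x] by (subst measure_distr) (auto simp: vimage_def Int_def conj_commute)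
  have contF: "isCont F x" for x unfolding F_def D.isCont_cdf by (rule at)
  have Fm [measurable]: "F \<in> borel_measurable borel" unfolding F_def by (rule D.measurable_C)
  \<comment> \<open>The reflection turns \<open>U \<omega> \<le> t\<close> into
    \<open>1 - t \<le> F (X \<omega>)\<close>, the form of inequality that the generalised inverse
    describes.\<close>
  define U where "U \<omega> = 1 - F (X \<omega>)" for \<omega>
  have Um [measurable]: "U \<in> borel_measurable M" unfolding U_def by measurable
  have PU: "prob {\<omega>\<in>space M. U \<omega> \<le> t} = t" if t: "0 < t" "t < 1" for t
  proof -
    let ?I = "D.I (1 - t)"
    have ps: "1 - t \<le> F x \<longleftrightarrow> ?I \<le> x" for x
      unfolding F_def by (rule D.pseudoinverse) (use t in auto)
    have "F ?I \<ge> 1 - t" using ps[of ?I] by simp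
    \<comment> \<open>By continuity a value above \<open>1 - t\<close> would persist slightly to the
      left of the quantile, contradicting its minimality.\<close>
    moreover have "F ?I \<le> 1 - t"
    proof (rule ccontr)
      assume "\<not> F ?I \<le> 1 - t"
      then have gt: "1 - t < F ?I" by simp
      have "\<forall>\<^sub>F y in at_left ?I. 1 - t < F y"
        using contF[of ?I] gt by (intro order_tendstoD(1)) (auto simp: isCont_def intro: tendsto_mono[OF at_le])
      then obtain b where b: "b < ?I" "\<forall>y>b. y < ?I \<longrightarrow> 1 - t < F y"
        unfolding eventually_at_left_field by blast
      obtain y where y: "b < y" "y < ?I" using dense[OF b(1)] by blast
      have "1 - t \<le> F y" using b(2) y by (simp add: less_imp_le)
      then show False using ps[of y] y(2) by linarith
    qed
    ultimately have FI: "F ?I = 1 - t" by simp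
    have "{\<omega>\<in>space M. U \<omega> \<le> t} = {\<omega>\<in>space M. ?I \<le> X \<omega>}"
      using ps by (auto simp: U_def algebra_simps)
    moreover have "prob {\<omega>\<in>space M. ?I \<le> X \<omega>} = 1 - prob {\<omega>\<in>space M. X \<omega> < ?I}"
    proof -
      have "{\<omega>\<in>space M. ?I \<le> X \<omega>} = space M - {\<omega>\<in>space M. X \<omega> < ?I}" by auto
      then show ?thesis by (simp add: prob_compl)
    qed
    moreover have "prob {\<omega>\<in>space M. X \<omega> < ?I} = prob {\<omega>\<in>space M. X \<omega> \<le> ?I}"
    proof -
      have "prob {\<omega>\<in>space M. X \<omega> \<le> ?I} = prob {\<omega>\<in>space M. X \<omega> < ?I} + prob {\<omega>\<in>space M. X \<omega> = ?I}"
        by (subst finite_measure_Union[symmetric]) (auto intro!: arg_cong[where f = prob])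
      then show ?thesis using atomless by simp
    qed
    moreover have "prob {\<omega>\<in>space M. X \<omega> \<le> ?I} = F ?I"
      unfolding F_def cdf_def by (subst measure_distr) (auto intro!: arg_cong[where f = prob])
    ultimately show ?thesis using FI by simp
  qed
  \<comment> \<open>A change on a null set moves the values strictly inside the unit interval, where
    the normal quantile function is defined.\<close>
  define W where "W \<omega> = (if 0 < U \<omega> \<and> U \<omega> < 1 then U \<omega> else 1 / 2)" for \<omega>
  have Wm [measurable]: "W \<in> borel_measurable M" unfolding W_def by measurable
  have W01: "W \<omega> \<in> {0<..<1}" for \<omega> by (auto simp: W_def)
  have P0: "prob {\<omega>\<in>space M. U \<omega> \<le> 0} = 0"
  proof (rule antisym)
    show "prob {\<omega>\<in>space M. U \<omega> \<le> 0} \<le> 0"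
    proof (rule field_le_epsilon)
      fix e :: real assume e: "0 < e"
      have "prob {\<omega>\<in>space M. U \<omega> \<le> 0} \<le> prob {\<omega>\<in>space M. U \<omega> \<le> min e (1 / 2)}"
        using e by (intro finite_measure_mono) auto
      then show "prob {\<omega>\<in>space M. U \<omega> \<le> 0} \<le> 0 + e" using PU[of "min e (1 / 2)"] e by simp
    qed
  qed simp
  have P1: "prob {\<omega>\<in>space M. 1 \<le> U \<omega>} = 0"
  proof (rule antisym)
    show "prob {\<omega>\<in>space M. 1 \<le> U \<omega>} \<le> 0"
    proof (rule field_le_epsilon)
      fix e :: real assume e: "0 < e"
      define t where "t = 1 - min e (1 / 2)"
      have t: "0 < t" "t < 1" using e by (auto simp: t_def)
      have "prob {\<omega>\<in>space M. 1 \<le> U \<omega>} \<le> prob (space M - {\<omega>\<in>space M. U \<omega> \<le> t})"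
        using t by (intro finite_measure_mono) auto
      also have "\<dots> = 1 - t" using PU[OF t] by (simp add: prob_compl)
      finally show "prob {\<omega>\<in>space M. 1 \<le> U \<omega>} \<le> 0 + e" by (simp add: t_def)
    qed
  qed simp
  have AEW: "AE \<omega> in M. W \<omega> = U \<omega>"
  proof -
    have "AE \<omega> in M. \<not> U \<omega> \<le> 0" "AE \<omega> in M. \<not> 1 \<le> U \<omega>"
      using P0 P1 by (auto simp: prob_eq_0)
    then show ?thesis by eventually_elim (auto simp: W_def)
  qed
  have PW: "prob {\<omega>\<in>space M. W \<omega> \<le> t} = t" if t: "0 \<le> t" "t \<le> 1" for t
  proof -
    consider "t = 0" | "t = 1" | "0 < t" "t < 1" using t by linarith
    then show ?thesis
    proof cases
      case 1
      then have e: "{\<omega>\<in>space M. W \<omega> \<le> t} = {}" using W01 by (auto simp: not_le)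
      show ?thesis unfolding e using 1 by simp
    next
      case 2
      then have e: "{\<omega>\<in>space M. W \<omega> \<le> t} = space M" using W01 by (auto simp: less_imp_le)
      show ?thesis unfolding e using 2 by (simp add: prob_space)
    next
      case 3
      have "prob {\<omega>\<in>space M. W \<omega> \<le> t} = prob {\<omega>\<in>space M. U \<omega> \<le> t}"
        using AEW by (intro finite_measure_eq_AE) auto
      then show ?thesis using PU[OF 3] by simp
    qed
  qed
  define V where "V \<omega> = S.I (W \<omega>)" for \<omega>
  have Vm [measurable]: "V \<in> borel_measurable M"
    unfolding V_def
    by (rule measurable_compose[OF measurable_restrict_space2 S.measurable_CI]) (use W01 in auto)
  have "distr M borel V = std_normal_distribution"
  proof (rule cdf_unique)
    show "real_distribution (distr M borel V)" by (rule real_distribution_distr) measurable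
    show "real_distribution std_normal_distribution" by (rule real_dist_normal_dist)
    show "cdf (distr M borel V) = cdf std_normal_distribution"
    proof
      fix y
      have "cdf (distr M borel V) y = prob {\<omega>\<in>space M. V \<omega> \<le> y}"
        unfolding cdf_def by (subst measure_distr) (auto intro!: arg_cong[where f = prob])
      also have "{\<omega>\<in>space M. V \<omega> \<le> y} = {\<omega>\<in>space M. W \<omega> \<le> cdf std_normal_distribution y}"
      proof -
        have "V \<omega> \<le> y \<longleftrightarrow> W \<omega> \<le> cdf std_normal_distribution y" for \<omega>
          unfolding V_def using W01[of \<omega>] by (intro S.pseudoinverse[symmetric]) auto
        then show ?thesis by simp
      qed
      also have "prob \<dots> = cdf std_normal_distribution y"
        by (rule PW) (auto simp: S.cdf_nonneg S.cdf_bounded_prob)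
      finally show "cdf (distr M borel V) y = cdf std_normal_distribution y" .
    qed
  qed
  with Vm show ?thesis by blast
qed

section \<open>Stochastic orders\<close>

text \<open>\<open>whp\<close> at one fixed level. Constants obtained from \<open>O_prob_on\<close>
  depend on the level, so the proofs fix it first and give each of finitely many events a share of
  it.\<close>

definition with_prob :: "(nat \<Rightarrow> 'a measure) \<Rightarrow> real \<Rightarrow> (nat \<Rightarrow> 'a \<Rightarrow> bool) \<Rightarrow> bool" where
  "with_prob M \<eta> Q \<longleftrightarrow> (\<forall>\<^sub>F N in sequentially. \<exists>E\<in>sets (M N). 1 - \<eta> \<le> measure (M N) E \<and> (\<forall>\<omega>\<in>E. Q N \<omega>))"

lemma whp_with_prob: "whp M Q \<longleftrightarrow> (\<forall>\<eta>>0. with_prob M \<eta> Q)"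
  by (simp add: whp_def with_prob_def)

lemma with_prob_mono:
  assumes "with_prob M \<eta> Q" "\<forall>\<^sub>F N in sequentially. \<forall>\<omega>\<in>space (M N). Q N \<omega> \<longrightarrow> R N \<omega>" "\<eta> \<le> \<eta>'"
  shows "with_prob M \<eta>' R"
  using assms(1,2) unfolding with_prob_def
proof eventually_elim
  case (elim N)
  then obtain E where "E \<in> sets (M N)" "1 - \<eta> \<le> measure (M N) E" "\<forall>\<omega>\<in>E. Q N \<omega>" by blast
  moreover then have "\<forall>\<omega>\<in>E. R N \<omega>" using elim(2) sets.sets_into_space by blast
  ultimately show ?case using assms(3) by (intro bexI[of _ E]) auto
qed

lemma with_prob_conj:
  assumes "with_prob M \<eta> P" "with_prob M \<eta>' Q" and "\<forall>N\<ge>1. prob_space (M N)"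
  shows "with_prob M (\<eta> + \<eta>') (\<lambda>N \<omega>. P N \<omega> \<and> Q N \<omega>)"
  using assms(1,2) eventually_ge_at_top[of 1] unfolding with_prob_def
proof eventually_elim
  case (elim N)
  interpret prob_space "M N" using assms(3) elim by blast
  obtain E F where E: "E \<in> events" "1 - \<eta> \<le> prob E" "\<forall>\<omega>\<in>E. P N \<omega>"
    and F: "F \<in> events" "1 - \<eta>' \<le> prob F" "\<forall>\<omega>\<in>F. Q N \<omega>"
    using elim by blast
  have "prob (space (M N) - E \<inter> F) \<le> prob ((space (M N) - E) \<union> (space (M N) - F))"
    using E F by (intro finite_measure_mono) auto
  also have "\<dots> \<le> prob (space (M N) - E) + prob (space (M N) - F)"
    using E F by (intro measure_Un_le) auto
  finally have "1 - (\<eta> + \<eta>') \<le> prob (E \<inter> F)"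
    using E F by (simp add: prob_compl)
  then show ?case using E F by (intro bexI[of _ "E \<inter> F"]) auto
qed

lemma with_prob_event:
  assumes "\<forall>\<^sub>F N in sequentially. {\<omega>\<in>space (M N). \<not> Q N \<omega>} \<in> sets (M N) \<and> measure (M N) {\<omega>\<in>space (M N). \<not> Q N \<omega>} \<le> \<eta>"
    and "\<forall>N\<ge>1. prob_space (M N)"
  shows "with_prob M \<eta> Q"
  using assms(1) eventually_ge_at_top[of 1] unfolding with_prob_def
proof eventually_elim
  case (elim N)
  interpret prob_space "M N" using assms(2) elim by blast
  have "prob (space (M N) - {\<omega>\<in>space (M N). \<not> Q N \<omega>}) = 1 - prob {\<omega>\<in>space (M N). \<not> Q N \<omega>}"
    using elim by (intro prob_compl) auto
  then show ?case using elim by (intro bexI[of _ "space (M N) - {\<omega>\<in>space (M N). \<not> Q N \<omega>}"]) auto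
qed

lemma with_prob_of_o:
  assumes "o_prob_on M T Z r" "0 < \<epsilon>" "0 < \<eta>"
  shows "with_prob M \<eta> (\<lambda>N \<omega>. \<forall>t\<in>T N. \<bar>Z N t \<omega>\<bar> \<le> \<epsilon> * r N)"
  using assms by (simp add: o_prob_on_def whp_with_prob)

lemma with_prob_of_O:
  assumes "O_prob_on M T Z r" "0 < \<eta>"
  obtains K where "with_prob M \<eta> (\<lambda>N \<omega>. \<forall>t\<in>T N. \<bar>Z N t \<omega>\<bar> \<le> K * r N)"
  using assms unfolding O_prob_on_def with_prob_def by blast

lemma exp_minus_lipschitz:
  fixes a b :: real
  assumes "0 \<le> a" "0 \<le> b"
  shows "\<bar>exp (- a) - exp (- b)\<bar> \<le> \<bar>a - b\<bar>"
proof -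
  have key: "exp (- a) - exp (- b) \<le> b - a \<and> 0 \<le> exp (- a) - exp (- b)" if "0 \<le> a" "a \<le> b" for a b :: real
  proof -
    have "exp (- a) - exp (- b) = exp (- a) * (1 - exp (- (b - a)))"
      by (simp add: algebra_simps exp_add[symmetric])
    also have "\<dots> \<le> 1 * (b - a)"
    proof (rule mult_mono)
      show "1 - exp (- (b - a)) \<le> b - a" using exp_ge_add_one_self[of "- (b - a)"] by linarith
    qed (use that in auto)
    finally show ?thesis using that by simp
  qed
  show ?thesis using key[of a b] key[of b a] assms by (cases "a \<le> b") auto
qed

lemma o_prob_add:
  assumes "o_prob M Z1 r" "o_prob M Z2 r" and prob: "\<forall>N\<ge>1. prob_space (M N)"
    and eq: "\<forall>\<^sub>F N in sequentially. \<forall>\<omega>\<in>space (M N). Z N \<omega> = Z1 N \<omega> + Z2 N \<omega>"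
  shows "o_prob M Z r"
  unfolding o_prob_def o_prob_on_def whp_with_prob
proof (intro allI impI)
  fix \<epsilon> \<eta> :: real assume e: "0 < \<epsilon>" "0 < \<eta>"
  have h: "with_prob M (\<eta> / 2) (\<lambda>N \<omega>. \<forall>t\<in>{()}. \<bar>Z' N \<omega>\<bar> \<le> \<epsilon> / 2 * r N)" if "o_prob M Z' r" for Z'
    using with_prob_of_o[OF that[unfolded o_prob_def], of "\<epsilon> / 2" "\<eta> / 2"] e by simp
  show "with_prob M \<eta> (\<lambda>N \<omega>. \<forall>t\<in>{()}. \<bar>Z N \<omega>\<bar> \<le> \<epsilon> * r N)"
  proof (rule with_prob_mono[OF with_prob_conj[OF h[OF assms(1)] h[OF assms(2)] prob]])
    show "\<forall>\<^sub>F N in sequentially. \<forall>\<omega>\<in>space (M N). (\<forall>t\<in>{()}. \<bar>Z1 N \<omega>\<bar> \<le> \<epsilon> / 2 * r N) \<and> (\<forall>t\<in>{()}. \<bar>Z2 N \<omega>\<bar> \<le> \<epsilon> / 2 * r N)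
      \<longrightarrow> (\<forall>t\<in>{()}. \<bar>Z N \<omega>\<bar> \<le> \<epsilon> * r N)"
      using eq
    proof (eventually_elim, intro ballI impI)
      fix N \<omega> t assume a: "\<forall>\<omega>\<in>space (M N). Z N \<omega> = Z1 N \<omega> + Z2 N \<omega>" "\<omega> \<in> space (M N)"
        "(\<forall>t\<in>{()}. \<bar>Z1 N \<omega>\<bar> \<le> \<epsilon> / 2 * r N) \<and> (\<forall>t\<in>{()}. \<bar>Z2 N \<omega>\<bar> \<le> \<epsilon> / 2 * r N)"
      have "\<epsilon> * r N = \<epsilon> / 2 * r N + \<epsilon> / 2 * r N" by simp
      then show "\<bar>Z N \<omega>\<bar> \<le> \<epsilon> * r N" using a abs_triangle_ineq[of "Z1 N \<omega>" "Z2 N \<omega>"] by auto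
    qed
  qed simp
qed

text \<open>Squares an expansion \<open>D = a0 + \<beta> + r\<close>. Products
  \<open>e * \<bar>a0\<bar>\<close> are turned into sums of squares, so that the bound can be
  integrated once the integral of \<open>a0\<^sup>2\<close> is known. The term \<open>t\<close>, a
  discretisation error, is kept apart and enters linearly.\<close>

lemma square_expand:
  fixes D a0 \<beta> :: real
  assumes e: "0 \<le> e" "e \<le> 1" and \<epsilon>: "0 \<le> \<epsilon>" "\<epsilon> \<le> 1" and k: "1 \<le> k" and t: "0 \<le> t" "t \<le> 1"
    and \<beta>: "\<bar>\<beta>\<bar> \<le> k * e" and a0: "\<bar>a0\<bar> \<le> 1" and D: "\<bar>D - (a0 + \<beta>)\<bar> \<le> \<epsilon> * (e + \<bar>a0\<bar>) + 2 * t"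
  shows "\<bar>D\<^sup>2 - (a0\<^sup>2 + 2 * (a0 * \<beta>) + \<beta>\<^sup>2)\<bar> \<le> 2 * \<epsilon> * (2 * k + 1) * (e\<^sup>2 + a0\<^sup>2) + (12 + 8 * k) * t"
proof -
  define s where "s = e + \<bar>a0\<bar>"
  have s: "0 \<le> s" "s \<le> 2" using e a0 by (auto simp: s_def)
  define r where "r = D - (a0 + \<beta>)"
  have r: "\<bar>r\<bar> \<le> \<epsilon> * s + 2 * t" using D by (simp add: r_def s_def)
  have ks: "\<bar>a0 + \<beta>\<bar> \<le> k * s"
  proof -
    have "1 * \<bar>a0\<bar> \<le> k * \<bar>a0\<bar>" using k by (intro mult_right_mono) auto
    then show ?thesis using \<beta> unfolding s_def distrib_left by linarith
  qed
  have es: "\<epsilon> * s \<le> s" using \<epsilon> s mult_right_mono[of \<epsilon> 1 s] by simp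
  have "\<bar>2 * (a0 + \<beta>) + r\<bar> \<le> (2 * k + 1) * s + 2 * t"
  proof -
    have "\<bar>2 * (a0 + \<beta>) + r\<bar> \<le> 2 * \<bar>a0 + \<beta>\<bar> + \<bar>r\<bar>"
      using abs_triangle_ineq[of "2 * (a0 + \<beta>)" r] unfolding abs_mult by (simp only: abs_numeral)
    also have "\<dots> \<le> 2 * (k * s) + (\<epsilon> * s + 2 * t)" by (rule add_mono[OF mult_left_mono[OF ks] r]) simp
    also have "\<dots> \<le> 2 * (k * s) + (s + 2 * t)" by (rule add_left_mono) (rule add_right_mono[OF es])
    finally show ?thesis by (simp add: algebra_simps)
  qed
  then have "\<bar>r\<bar> * \<bar>2 * (a0 + \<beta>) + r\<bar> \<le> (\<epsilon> * s + 2 * t) * ((2 * k + 1) * s + 2 * t)"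
    using r \<epsilon> s t k by (intro mult_mono) auto
  also have "\<dots> = \<epsilon> * (2 * k + 1) * s\<^sup>2 + t * (2 * (\<epsilon> * s) + 2 * (2 * k + 1) * s + 4 * t)"
    by (simp add: algebra_simps power2_eq_square)
  \<comment> \<open>The constant \<open>12 + 8 * k\<close> is 4 plus \<open>8 * k + 4\<close> plus
    4, by \<open>s \<le> 2\<close>, \<open>\<epsilon> \<le> 1\<close> and
    \<open>t \<le> 1\<close>.\<close>
  also have "\<dots> \<le> \<epsilon> * (2 * k + 1) * (2 * (e\<^sup>2 + a0\<^sup>2)) + t * (12 + 8 * k)"
  proof (rule add_mono)
    have "s\<^sup>2 = e\<^sup>2 + a0\<^sup>2 + 2 * (e * \<bar>a0\<bar>)" by (simp add: s_def power2_sum)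
    moreover have "2 * (e * \<bar>a0\<bar>) \<le> e\<^sup>2 + \<bar>a0\<bar>\<^sup>2" using sum_squares_bound[of e "\<bar>a0\<bar>"] by simp
    ultimately have "s\<^sup>2 \<le> 2 * (e\<^sup>2 + a0\<^sup>2)" by simp
    then show "\<epsilon> * (2 * k + 1) * s\<^sup>2 \<le> \<epsilon> * (2 * k + 1) * (2 * (e\<^sup>2 + a0\<^sup>2))"
      using \<epsilon> k by (intro mult_left_mono) auto
    have "2 * (2 * k + 1) * s \<le> 2 * (2 * k + 1) * 2" using k s by (intro mult_left_mono) auto
    moreover have "2 * y + z + 4 * t \<le> 12 + 8 * k" if "y \<le> s" "z \<le> 2 * (2 * k + 1) * 2" for y z
      using that s(2) t(2) by simp
    ultimately have "2 * (\<epsilon> * s) + 2 * (2 * k + 1) * s + 4 * t \<le> 12 + 8 * k" using es by blast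
    then show "t * (2 * (\<epsilon> * s) + 2 * (2 * k + 1) * s + 4 * t) \<le> t * (12 + 8 * k)"
      using t by (intro mult_left_mono) auto
  qed
  finally have "\<bar>r\<bar> * \<bar>2 * (a0 + \<beta>) + r\<bar> \<le> 2 * \<epsilon> * (2 * k + 1) * (e\<^sup>2 + a0\<^sup>2) + (12 + 8 * k) * t"
    by (simp only: mult_ac)
  moreover have "D\<^sup>2 - (a0\<^sup>2 + 2 * (a0 * \<beta>) + \<beta>\<^sup>2) = r * (2 * (a0 + \<beta>) + r)"
    by (simp add: r_def algebra_simps power2_eq_square)
  ultimately show ?thesis by (simp only: abs_mult)
qed

section \<open>Integrals over a set and the arithmetic of the integrated error\<close>

lemma set_integrable_bounded_mult:
  fixes g F :: "real \<Rightarrow> real"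
  assumes g: "set_integrable lborel A g" and F: "F \<in> borel_measurable borel" and B: "\<And>x. x \<in> A \<Longrightarrow> \<bar>F x\<bar> \<le> B"
  shows "set_integrable lborel A (\<lambda>x. g x * F x)"
proof -
  have "integrable lborel (\<lambda>x. B * (indicator A x *\<^sub>R g x))"
    using g unfolding set_integrable_def by (intro integrable_mult_right)
  then have "integrable lborel (\<lambda>x. indicator A x *\<^sub>R (g x * F x))"
  proof (rule Bochner_Integration.integrable_bound)
    have "(\<lambda>x. (indicator A x *\<^sub>R g x) * F x) \<in> borel_measurable lborel"
      using g F unfolding set_integrable_def by (intro borel_measurable_times) auto
    then show "(\<lambda>x. indicator A x *\<^sub>R (g x * F x)) \<in> borel_measurable lborel" by (simp add: mult.assoc)
    have "\<bar>indicator A x *\<^sub>R (g x * F x)\<bar> \<le> \<bar>B * (indicator A x *\<^sub>R g x)\<bar>" for x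
    proof (cases "x \<in> A")
      case True
      then have "\<bar>F x\<bar> \<le> \<bar>B\<bar>" using B[OF True] by linarith
      then show ?thesis using True by (simp add: abs_mult mult.commute mult_right_mono)
    qed simp
    then show "AE x in lborel. norm (indicator A x *\<^sub>R (g x * F x)) \<le> norm (B * (indicator A x *\<^sub>R g x))" by simp
  qed
  then show ?thesis unfolding set_integrable_def .
qed

lemma set_integral_abs_le:
  fixes g F :: "real \<Rightarrow> real"
  assumes "set_integrable lborel A g" "set_integrable lborel A F" "\<And>x. x \<in> A \<Longrightarrow> \<bar>g x\<bar> \<le> F x"
  shows "\<bar>LINT x:A|lborel. g x\<bar> \<le> (LINT x:A|lborel. F x)"
proof -
  have "\<bar>LINT x:A|lborel. g x\<bar> \<le> (LINT x|lborel. \<bar>indicator A x *\<^sub>R g x\<bar>)"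
    unfolding set_lebesgue_integral_def by (rule integral_abs_bound)
  also have "\<dots> \<le> (LINT x:A|lborel. F x)"
    unfolding set_lebesgue_integral_def
  proof (rule integral_mono)
    show "integrable lborel (\<lambda>x. \<bar>indicator A x *\<^sub>R g x\<bar>)"
      using assms(1) unfolding set_integrable_def by (rule integrable_abs)
    show "integrable lborel (\<lambda>x. indicator A x *\<^sub>R F x)" using assms(2) unfolding set_integrable_def .
    show "\<bar>indicator A x *\<^sub>R g x\<bar> \<le> indicator A x *\<^sub>R F x" for x
      using assms(3)[of x] by (auto simp: indicator_def)
  qed
  finally show ?thesis .
qed

lemma set_lint_sum:
  fixes g :: "'i \<Rightarrow> real \<Rightarrow> real"
  assumes "finite K" "\<And>k. k \<in> K \<Longrightarrow> set_integrable lborel A (g k)"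
  shows "(LINT x:A|lborel. (\<Sum>k\<in>K. g k x)) = (\<Sum>k\<in>K. LINT x:A|lborel. g k x)"
  unfolding set_lebesgue_integral_def scaleR_sum_right
  by (rule Bochner_Integration.integral_sum) (use assms in \<open>simp add: set_integrable_def\<close>)

text \<open>Pure arithmetic for \<open>integral_pathwise\<close>. There \<open>d\<close>,
  \<open>a0\<close>, \<open>x\<close>, \<open>b\<close>, \<open>A\<close> are the integrals of the
  squared error, of its stochastic part, of the cross term, of the squared bias and of
  \<open>A2\<close>; \<open>k'\<close> is the length of the interval, and \<open>e\<close>,
  \<open>q\<close> are the natural orders of squared bias and variance.\<close>

lemma integral_combine:
  fixes d a0 x b A e q k k' B E H KA t z :: real
  assumes z: "0 \<le> z" "z \<le> 1" and E: "0 \<le> E" and B: "1 \<le> B" and k: "0 \<le> k'" "k' \<le> k" and e: "0 \<le> e" and q: "0 \<le> q" and cc: "0 < c'"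
    and H: "0 \<le> H" and KA: "0 \<le> KA"
    and d: "\<bar>d - (a0 + 2 * x + b)\<bar> \<le> 2 * (z * E) * (2 * B + 1) * (e * k' + a0) + (12 + 8 * B) * (t * k')"
    and a: "\<bar>a0 - A\<bar> \<le> z * H * q" and x: "\<bar>x\<bar> \<le> z * (e + q)" and A: "A \<le> KA * q" and t: "t \<le> z * q / c'"
  shows "\<bar>d - (A + b)\<bar> \<le> z * (2 * E * (2 * B + 1) * (k + (KA + H)) + (12 + 8 * B) * (k / c') + H + 2) * (e + q)"
proof -
  have "z * H * q \<le> 1 * H * q" using z H q by (intro mult_right_mono) auto
  then have a0: "a0 \<le> (KA + H) * q" using a A unfolding distrib_right by linarith
  have "2 * (z * E) * (2 * B + 1) * (e * k' + a0) \<le> 2 * (z * E) * (2 * B + 1) * ((k + (KA + H)) * (e + q))"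
  proof (rule mult_left_mono)
    have "e * k' \<le> e * k" using e k by (intro mult_left_mono) auto
    moreover have "0 \<le> k * q" "0 \<le> (KA + H) * e" using k q e KA H by auto
    ultimately show "e * k' + a0 \<le> (k + (KA + H)) * (e + q)" using a0 by (simp add: algebra_simps)
    show "0 \<le> 2 * (z * E) * (2 * B + 1)" using z E B by simp
  qed
  moreover have "(12 + 8 * B) * (t * k') \<le> (12 + 8 * B) * (z * (k / c') * (e + q))"
  proof (rule mult_left_mono)
    have "t * k' \<le> z * q / c' * k'" using t k by (intro mult_right_mono) auto
    also have "\<dots> \<le> z * q / c' * k" using z q cc k by (intro mult_left_mono) auto
    also have "\<dots> = z * (k / c') * q" by simp
    also have "\<dots> \<le> z * (k / c') * (e + q)" using z k cc e by (intro mult_left_mono) auto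
    finally show "t * k' \<le> z * (k / c') * (e + q)" .
    show "0 \<le> 12 + 8 * B" using B by simp
  qed
  moreover have "z * H * q \<le> z * H * (e + q)" using z H e by (intro mult_left_mono) auto
  moreover have "\<bar>d - (A + b)\<bar> \<le> \<bar>d - (a0 + 2 * x + b)\<bar> + \<bar>a0 - A\<bar> + 2 * \<bar>x\<bar>" by linarith
  ultimately have "\<bar>d - (A + b)\<bar> \<le> 2 * (z * E) * (2 * B + 1) * ((k + (KA + H)) * (e + q))
      + (12 + 8 * B) * (z * (k / c') * (e + q)) + z * H * (e + q) + 2 * (z * (e + q))"
    using d a x by linarith
  also have "\<dots> = z * (2 * E * (2 * B + 1) * (k + (KA + H)) + (12 + 8 * B) * (k / c') + H + 2) * (e + q)"
  proof -
    have "2 * (z * E) * y * (w * r) + y' * (z * w' * r) + z * H * r + 2 * (z * r) = z * (2 * E * y * w + y' * w' + H + 2) * r"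
      for y w r y' w' :: real by (simp add: algebra_simps)
    then show ?thesis .
  qed
  finally show ?thesis .
qed

lemma whp_mono:
  assumes "whp M P" "\<And>N \<omega>. P N \<omega> \<Longrightarrow> Q N \<omega>"
  shows "whp M Q"
  unfolding whp_with_prob
proof (intro allI impI)
  fix \<eta> :: real assume "0 < \<eta>"
  then have "with_prob M \<eta> P" using assms(1) by (simp add: whp_with_prob)
  then show "with_prob M \<eta> Q" by (rule with_prob_mono) (use assms(2) in auto)
qed

lemma weight_conditions_subset:
  assumes wc: "weight_conditions M X \<nu> h w b v T" and T: "T' \<subseteq> T"
  shows "weight_conditions M X \<nu> h w b v T'"
proof -
  have o: "o_prob_on M (\<lambda>_. T') Z r" if "o_prob_on M (\<lambda>_. T) Z r" for Z r
    unfolding o_prob_on_def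
  proof (intro allI impI)
    fix \<epsilon> :: real assume "0 < \<epsilon>"
    then have "whp M (\<lambda>N \<omega>. \<forall>t\<in>T. \<bar>Z N t \<omega>\<bar> \<le> \<epsilon> * r N)" using that unfolding o_prob_on_def by blast
    then show "whp M (\<lambda>N \<omega>. \<forall>t\<in>T'. \<bar>Z N t \<omega>\<bar> \<le> \<epsilon> * r N)" by (rule whp_mono) (use T in blast)
  qed
  have O: "O_prob_on M (\<lambda>_. T') Z r" if O: "O_prob_on M (\<lambda>_. T) Z r" for Z r
    unfolding O_prob_on_def
  proof (intro allI impI)
    fix \<eta> :: real assume "0 < \<eta>"
    from with_prob_of_O[OF O this] obtain K where "with_prob M \<eta> (\<lambda>N \<omega>. \<forall>t\<in>T. \<bar>Z N t \<omega>\<bar> \<le> K * r N)" by blast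
    then have "with_prob M \<eta> (\<lambda>N \<omega>. \<forall>t\<in>T'. \<bar>Z N t \<omega>\<bar> \<le> K * r N)"
      by (rule with_prob_mono) (rule always_eventually, use T in blast, simp)
    then show "\<exists>K. \<forall>\<^sub>F N in sequentially. \<exists>E\<in>sets (M N). 1 - \<eta> \<le> measure (M N) E \<and> (\<forall>\<omega>\<in>E. \<forall>t\<in>T'. \<bar>Z N t \<omega>\<bar> \<le> K * r N)"
      unfolding with_prob_def by blast
  qed
  have w: "whp M (\<lambda>N \<omega>. \<forall>x\<in>T'. P N x \<omega>)" if "whp M (\<lambda>N \<omega>. \<forall>x\<in>T. P N x \<omega>)" for P
    using that by (rule whp_mono) (use T in blast)
  show ?thesis
    using wc unfolding weight_conditions_def
    by (elim conjE, intro conjI w o) (assumption+, intro allI impI O, blast)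
qed

section \<open>Group testing: constants and typical samples\<close>

locale group_testing =
  fixes M :: "nat \<Rightarrow> 'a measure"
    and X Y :: "nat \<Rightarrow> nat \<Rightarrow> 'a \<Rightarrow> real"
    and f \<pi> b v :: "real \<Rightarrow> real"
    and \<delta> h :: "nat \<Rightarrow> real"
    and \<nu> :: "nat \<Rightarrow> nat"
    and w :: weights
    and I J :: "real set"
    and l u :: real
  assumes I: "I = {l..u}" "l < u"
    and J: "open J" "is_interval J" "I \<subseteq> J"
    and delta: "\<forall>N\<ge>1. 0 < \<delta> N"
    and pi: "\<pi> \<in> borel_measurable borel" "\<forall>x. 0 \<le> \<pi> x"
    and nu: "\<forall>N\<ge>1. 1 \<le> \<nu> N \<and> \<nu> N dvd N"
    and h: "\<forall>N\<ge>1. 0 < h N" "h \<longlonglongrightarrow> 0"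
    and prob: "\<forall>N\<ge>1. prob_space (M N)"
    and iid: "\<forall>N\<ge>1. prob_space.indep_vars (M N) (\<lambda>_. borel) (\<lambda>i \<omega>. (X N i \<omega>, Y N i \<omega>)) {1..N}"
    and density: "\<forall>N\<ge>1. \<forall>i\<in>{1..N}. distributed (M N) lborel (X N i) (\<lambda>x. ennreal (f x))"
    and Y01: "\<forall>N\<ge>1. \<forall>i\<in>{1..N}. \<forall>\<omega>\<in>space (M N). Y N i \<omega> \<in> {0, 1}"
    and cond_prob: "\<forall>N\<ge>1. \<forall>i\<in>{1..N}. AE \<omega> in M N.
        real_cond_exp (M N) (vimage_algebra (space (M N)) (X N i) borel)
          (indicat_real {\<omega>\<in>space (M N). Y N i \<omega> = 1}) \<omega> = \<delta> N * \<pi> (X N i \<omega>)"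
    and w_measurable: "\<forall>N\<ge>1. \<forall>j\<in>{1..N div \<nu> N}. \<forall>x\<in>I.
        w N j x \<in> borel_measurable (Pi\<^sub>M {1..N} (\<lambda>_. borel))"
    and b_v_cont: "continuous_on J b" "continuous_on J v"
    and T1: "\<exists>c>0. \<forall>x\<in>J. c \<le> f x"
    and T2: "\<exists>c>0. \<forall>N\<ge>1. \<forall>x\<in>I. \<delta> N * \<pi> x \<le> 1 - c"
    and T3: "\<forall>x\<in>J. \<pi> field_differentiable at x" "\<forall>x\<in>J. deriv \<pi> field_differentiable at x"
        "continuous_on J (deriv (deriv \<pi>))"
    and T4: "\<exists>\<epsilon>>0. (\<lambda>N. h N + real (\<nu> N) * \<delta> N * h N
        + (real (\<nu> N))\<^sup>2 / (real N powr (1 - \<epsilon>) * h N * \<delta> N)) \<longlonglongrightarrow> 0"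
    and T5: "\<exists>C>0. \<forall>N\<ge>1. \<forall>j\<in>{1..N div \<nu> N}. \<forall>x\<in>I. \<forall>\<omega>\<in>space (M N).
        \<bar>group_mean (\<nu> N) N (\<lambda>i. X N i \<omega>) j - x\<bar> > C * h N
        \<longrightarrow> weight w N (\<lambda>i. X N i \<omega>) j x = 0"
    and nu_delta: "(\<lambda>N. real (\<nu> N) * \<delta> N) \<in> O(\<lambda>_. 1)"
begin

abbreviation p :: "nat \<Rightarrow> real \<Rightarrow> real" where
  "p \<equiv> \<lambda>N x. \<delta> N * \<pi> x"

abbreviation \<pi>1 :: "real \<Rightarrow> real" where "\<pi>1 \<equiv> deriv \<pi>"
abbreviation \<pi>2 :: "real \<Rightarrow> real" where "\<pi>2 \<equiv> deriv (deriv \<pi>)"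

abbreviation \<rho> :: "nat \<Rightarrow> real" where "\<rho> N \<equiv> real (\<nu> N) / (real N * h N)"

lemma pi_derivs:
  assumes "s \<in> J"
  shows "(\<pi> has_real_derivative \<pi>1 s) (at s)" "(\<pi>1 has_real_derivative \<pi>2 s) (at s)"
  using T3 assms by (auto simp: field_differentiable_derivI)

lemma pi_cont: "continuous_on J \<pi>" "continuous_on J \<pi>1"
  using pi_derivs by (meson DERIV_continuous_on has_field_derivative_at_within)+

lemma sample_interp:
  assumes "1 \<le> N"
  shows "binary_sample (M N) N (X N) (Y N) (p N)"
proof -
  interpret prob_space "M N" using prob assms by blast
  show ?thesis
  proof unfold_locales
    show "p N \<in> borel_measurable borel" using pi(1) by measurable
  qed (use assms iid Y01 cond_prob pi(2) delta in \<open>auto intro!: mult_nonneg_nonneg intro: less_imp_le\<close>)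
qed

end

text \<open>
  \<open>K\<close> is a common upper and \<open>c\<close> a common lower bound for the quantities that (T1)--(T5) control;
  \<open>r\<close> enlarges \<open>I\<close> so that the means of all groups in a window remain in \<open>J\<close>.
\<close>

locale group_testing_consts = group_testing +
  fixes r K c e :: real and N0 :: nat
  assumes r: "0 < r" "{l - r..u + r} \<subseteq> J"
    and K: "1 \<le> K" "u - l + 2 * r \<le> K"
    and Kpi: "\<And>s. s \<in> {l - r..u + r} \<Longrightarrow> \<bar>\<pi> s\<bar> \<le> K \<and> \<bar>\<pi>1 s\<bar> \<le> K \<and> \<bar>\<pi>2 s\<bar> \<le> K"
    and Kbv: "\<And>x. x \<in> I \<Longrightarrow> \<bar>b x\<bar> \<le> K \<and> \<bar>v x\<bar> \<le> K"
    and c: "0 < c" "c \<le> 1" "\<And>s. s \<in> J \<Longrightarrow> c \<le> f s"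
    and N0: "1 \<le> N0" "\<And>N. N0 \<le> N \<Longrightarrow> real (\<nu> N) * \<delta> N \<le> K"
    and cp: "\<And>N s. N0 \<le> N \<Longrightarrow> s \<in> {l - r..u + r} \<Longrightarrow> c \<le> 1 - p N s"
    and cmu: "\<And>N x. N0 \<le> N \<Longrightarrow> x \<in> I \<Longrightarrow> c \<le> (1 - p N x) ^ \<nu> N"
    and e: "0 < e" "(\<lambda>N. (real (\<nu> N))\<^sup>2 * real N powr e / (real N * h N * \<delta> N)) \<longlonglongrightarrow> 0"
    and window: "\<And>N j x \<omega>. 1 \<le> N \<Longrightarrow> j \<in> {1..N div \<nu> N} \<Longrightarrow> x \<in> I \<Longrightarrow> \<omega> \<in> space (M N) \<Longrightarrow>
        \<bar>group_mean (\<nu> N) N (\<lambda>i. X N i \<omega>) j - x\<bar> > K * h N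
        \<Longrightarrow> weight w N (\<lambda>i. X N i \<omega>) j x = 0"

text \<open>Compactness and (T1)--(T5) give most bounds directly. The lower bound for \<mu> needs
  more: as p stays below \<open>1 - c2\<close>, \<open>1 - p\<close> is at least
  \<open>exp (- p / c2)\<close>, and \<open>\<nu> * p\<close> is bounded because
  \<open>\<nu> * \<delta>\<close> is.\<close>

lemma (in group_testing) consts_exist:
  "\<exists>r K c e N0. group_testing_consts M X Y f \<pi> b v \<delta> h \<nu> w I J l u r K c e N0"
proof -
  have "l \<in> J" "u \<in> J" using I J by auto
  then obtain r1 r2 where r12: "0 < r1" "ball l r1 \<subseteq> J" "0 < r2" "ball u r2 \<subseteq> J"
    using J(1) by (meson open_contains_ball)
  define r0 where "r0 = min r1 r2 / 2"
  have r0: "0 < r0" using r12 by (simp add: r0_def)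
  have "l - r0 \<in> ball l r1" "u + r0 \<in> ball u r2" using r12 by (auto simp: r0_def dist_real_def min_def)
  then have "l - r0 \<in> J" "u + r0 \<in> J" using r12 by blast+
  then have S0: "{l - r0..u + r0} \<subseteq> J"
    using J(2) unfolding is_interval_1 by (meson atLeastAtMost_iff subsetI)
  have bdd: "\<exists>B. \<forall>s\<in>{l - r0..u + r0}. \<bar>g s\<bar> \<le> B" if "continuous_on J g" for g :: "real \<Rightarrow> real"
  proof -
    have "compact (g ` {l - r0..u + r0})"
      by (intro compact_continuous_image continuous_on_subset[OF that S0]) simp
    then have "bounded (g ` {l - r0..u + r0})" by (rule compact_imp_bounded)
    then show ?thesis unfolding bounded_iff by auto
  qed
  obtain B0 B1 B2 Bb Bv where B: "\<And>s. s \<in> {l - r0..u + r0} \<Longrightarrow> \<bar>\<pi> s\<bar> \<le> B0" "\<And>s. s \<in> {l - r0..u + r0} \<Longrightarrow> \<bar>\<pi>1 s\<bar> \<le> B1"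
    "\<And>s. s \<in> {l - r0..u + r0} \<Longrightarrow> \<bar>\<pi>2 s\<bar> \<le> B2" "\<And>s. s \<in> {l - r0..u + r0} \<Longrightarrow> \<bar>b s\<bar> \<le> Bb" "\<And>s. s \<in> {l - r0..u + r0} \<Longrightarrow> \<bar>v s\<bar> \<le> Bv"
    using bdd[OF pi_cont(1)] bdd[OF pi_cont(2)] bdd[OF T3(3)] bdd[OF b_v_cont(1)] bdd[OF b_v_cont(2)] by metis
  obtain c1 where c1: "0 < c1" "\<forall>x\<in>J. c1 \<le> f x" using T1 by blast
  obtain c2 where c2: "0 < c2" "\<forall>N\<ge>1. \<forall>x\<in>I. p N x \<le> 1 - c2" using T2 by blast
  obtain C where C: "0 < C" "\<forall>N\<ge>1. \<forall>j\<in>{1..N div \<nu> N}. \<forall>x\<in>I. \<forall>\<omega>\<in>space (M N).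
        \<bar>group_mean (\<nu> N) N (\<lambda>i. X N i \<omega>) j - x\<bar> > C * h N
        \<longrightarrow> weight w N (\<lambda>i. X N i \<omega>) j x = 0" using T5 by blast
  obtain e where e: "0 < e" "(\<lambda>N. h N + real (\<nu> N) * \<delta> N * h N
        + (real (\<nu> N))\<^sup>2 / (real N powr (1 - e) * h N * \<delta> N)) \<longlonglongrightarrow> 0" using T4 by blast
  obtain Kd where Kd: "\<forall>\<^sub>F N in sequentially. norm (real (\<nu> N) * \<delta> N) \<le> Kd * norm (1 :: real)"
    using nu_delta by (auto elim: landau_o.bigE)
  then obtain N1 where N1: "\<And>N. N1 \<le> N \<Longrightarrow> \<bar>real (\<nu> N) * \<delta> N\<bar> \<le> Kd"
    by (auto simp: eventually_sequentially)
  define K where "K = 1 + \<bar>B0\<bar> + \<bar>B1\<bar> + \<bar>B2\<bar> + \<bar>Bb\<bar> + \<bar>Bv\<bar> + C + \<bar>Kd\<bar> + (u - l + 2 * r0)"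
  define N0 where "N0 = max 1 N1"
  \<comment> \<open>\<open>c2 / 2\<close> leaves room for the variation of p between
    \<open>I\<close> and its enlargement; the exponential is the lower bound for \<mu>.\<close>
  define cc where "cc = min (min c1 (c2 / 2)) (min 1 (exp (- (K * K / c2))))"
  \<comment> \<open>Small enough for \<open>\<delta> * \<pi>\<close> to change by at most
    \<open>cc\<close> over a distance \<open>r\<close>, as \<delta> and the slope of \<pi> are at
    most \<open>K\<close>.\<close>
  define r where "r = min r0 (cc / (K * K))"
  have K1: "1 \<le> K" using C I r0 by (simp add: K_def)
  have cc: "0 < cc" "cc \<le> c1" "2 * cc \<le> c2" "cc \<le> 1" "cc \<le> exp (- (K * K / c2))"
  proof -
    show "0 < cc" "cc \<le> c1" "cc \<le> 1" "cc \<le> exp (- (K * K / c2))"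
      using c1 c2 by (simp_all add: cc_def min.coboundedI2)
    have "cc \<le> c2 / 2" by (simp add: cc_def)
    then show "2 * cc \<le> c2" by simp
  qed
  have r: "0 < r" "r \<le> r0" "K * K * r \<le> cc"
    using r0 cc K1 by (auto simp: r_def min_def field_simps)
  have Kd_le: "\<bar>Kd\<bar> \<le> K" "C \<le> K" "u - l + 2 * r0 \<le> K"
    and BK: "B0 \<le> K" "B1 \<le> K" "B2 \<le> K" "Bb \<le> K" "Bv \<le> K" using C I r0 by (auto simp: K_def)
  have sub: "{l - r..u + r} \<subseteq> {l - r0..u + r0}" using r by auto
  have nd: "real (\<nu> N) * \<delta> N \<le> K" if "N0 \<le> N" for N
    using N1[of N] that Kd_le by (simp add: N0_def)
  have dK: "0 < \<delta> N" "\<delta> N \<le> K" if "N0 \<le> N" for N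
  proof -
    have N: "1 \<le> N" using that by (simp add: N0_def)
    then show d: "0 < \<delta> N" using delta by blast
    have "1 * \<delta> N \<le> real (\<nu> N) * \<delta> N" using nu N d by (intro mult_right_mono) auto
    then show "\<delta> N \<le> K" using nd[OF that] by simp
  qed
  show ?thesis
  proof (intro exI, unfold_locales)
    show "0 < r" "{l - r..u + r} \<subseteq> J" using r sub S0 by auto
    show "1 \<le> K" "u - l + 2 * r \<le> K" using K1 Kd_le r by auto
    show "\<bar>\<pi> s\<bar> \<le> K \<and> \<bar>\<pi>1 s\<bar> \<le> K \<and> \<bar>\<pi>2 s\<bar> \<le> K" if "s \<in> {l - r..u + r}" for s
    proof -
      have s0: "s \<in> {l - r0..u + r0}" using sub that by blast
      show ?thesis
        using order_trans[OF B(1)[OF s0] BK(1)] order_trans[OF B(2)[OF s0] BK(2)] order_trans[OF B(3)[OF s0] BK(3)] by blast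
    qed
    show "\<bar>b x\<bar> \<le> K \<and> \<bar>v x\<bar> \<le> K" if "x \<in> I" for x
    proof -
      have x0: "x \<in> {l - r0..u + r0}" using that I r0 by simp
      show ?thesis using order_trans[OF B(4)[OF x0] BK(4)] order_trans[OF B(5)[OF x0] BK(5)] by blast
    qed
    show "0 < cc" "cc \<le> 1" using cc by auto
    show "cc \<le> f s" if "s \<in> J" for s by (rule order_trans[OF cc(2) bspec[OF c1(2) that]])
    show "1 \<le> N0" by (simp add: N0_def)
    show "real (\<nu> N) * \<delta> N \<le> K" if "N0 \<le> N" for N by (rule nd[OF that])
    show "cc \<le> 1 - p N s" if N: "N0 \<le> N" and s: "s \<in> {l - r..u + r}" for N s
    proof -
      \<comment> \<open>(T2) speaks about points of \<open>I\<close> only, so s is projected to the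
        nearest one.\<close>
      define x where "x = max l (min u s)"
      have x: "x \<in> I" "\<bar>s - x\<bar> \<le> r" using s I r by (auto simp: x_def min_def max_def)
      have "\<bar>\<pi> s - \<pi> x\<bar> \<le> B1 * \<bar>s - x\<bar>"
      proof (rule lipschitz_by_deriv)
        show "(\<pi> has_real_derivative \<pi>1 t) (at t)" if "t \<in> {l - r0..u + r0}" for t
          using pi_derivs(1) S0 that by blast
        show "\<bar>\<pi>1 t\<bar> \<le> B1" if "t \<in> {l - r0..u + r0}" for t by (rule B(2)[OF that])
        show "s \<in> {l - r0..u + r0}" using sub s by blast
        show "x \<in> {l - r0..u + r0}" using x(1) I r0 by simp
      qed
      also have "\<dots> \<le> K * r" using BK x K1 by (intro mult_mono) auto
      finally have lip: "\<bar>\<pi> s - \<pi> x\<bar> \<le> K * r" .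
      have "\<delta> N * (\<pi> s - \<pi> x) \<le> K * (K * r)"
      proof -
        have "\<delta> N * (\<pi> s - \<pi> x) \<le> \<delta> N * (K * r)"
          using dK[OF N] lip by (intro mult_left_mono) auto
        also have "\<dots> \<le> K * (K * r)" using dK[OF N] K1 r by (intro mult_right_mono) auto
        finally show ?thesis .
      qed
      then have "p N s \<le> p N x + cc" using r by (simp add: algebra_simps)
      moreover have "p N x \<le> 1 - c2" using c2 x N by (simp add: N0_def)
      ultimately show ?thesis using cc by linarith
    qed
    show "cc \<le> (1 - p N x) ^ \<nu> N" if N: "N0 \<le> N" and x: "x \<in> I" for N x
    proof -
      have px: "p N x \<le> 1 - c2" using c2 x N by (simp add: N0_def)
      have p0: "0 \<le> p N x" using pi(2) dK[OF N] by simp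
      have pn: "real (\<nu> N) * p N x \<le> K * K"
      proof -
        have "real (\<nu> N) * \<delta> N * \<pi> x \<le> K * K"
        proof (rule mult_mono)
          have "x \<in> {l - r0..u + r0}" using x I r0 by simp
          then have "\<bar>\<pi> x\<bar> \<le> K" using B(1) BK(1) by (blast intro: order_trans)
          then show "\<pi> x \<le> K" by simp
        qed (use nd[OF N] pi(2) K1 in auto)
        then show ?thesis by (simp add: mult.assoc)
      qed
      have "1 - p N x \<ge> exp (- p N x / c2)"
      proof -
        have "exp (- p N x / c2) \<le> 1 / (1 + p N x / c2)"
          using exp_ge_add_one_self[of "p N x / c2"] p0 c2
          by (simp add: exp_minus inverse_eq_divide frac_le add_pos_nonneg)
        also have "\<dots> \<le> 1 - p N x"
        proof -
          have "1 \<le> (1 - p N x) * (1 + p N x / c2)"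
          proof -
            \<comment> \<open>This rests on \<open>c2 \<le> 1 - p\<close>; it yields
              \<open>1 - p \<ge> 1 / (1 + p / c2)\<close>, which exceeds the exponential.\<close>
            have "p N x \<le> (1 - p N x) * (p N x / c2)"
              using px p0 c2 mult_right_mono[of c2 "1 - p N x" "p N x / c2"] by simp
            then show ?thesis by (simp add: algebra_simps)
          qed
          then show ?thesis using p0 c2 by (simp add: divide_le_eq add_pos_nonneg)
        qed
        finally show ?thesis .
      qed
      then have "exp (- p N x / c2) ^ \<nu> N \<le> (1 - p N x) ^ \<nu> N" by (intro power_mono) auto
      moreover have "exp (- p N x / c2) ^ \<nu> N = exp (- (real (\<nu> N) * p N x / c2))"
        by (simp add: exp_of_nat_mult[symmetric])
      moreover have "exp (- (K * K / c2)) \<le> exp (- (real (\<nu> N) * p N x / c2))"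
        using pn c2 by (simp add: divide_right_mono)
      ultimately show ?thesis using cc by linarith
    qed
    show "0 < e" by (rule e)
    show "(\<lambda>N. (real (\<nu> N))\<^sup>2 * real N powr e / (real N * h N * \<delta> N)) \<longlonglongrightarrow> 0"
    proof (rule tendsto_sandwich[OF _ _ tendsto_const e(2)])
      show "\<forall>\<^sub>F N in sequentially. 0 \<le> (real (\<nu> N))\<^sup>2 * real N powr e / (real N * h N * \<delta> N)"
        using eventually_ge_at_top[of 1]
      proof eventually_elim
        case (elim N)
        then have "0 < h N" "0 < \<delta> N" using h(1) delta by auto
        then show ?case by simp
      qed
      show "\<forall>\<^sub>F N in sequentially. (real (\<nu> N))\<^sup>2 * real N powr e / (real N * h N * \<delta> N) \<le>
          h N + real (\<nu> N) * \<delta> N * h N + (real (\<nu> N))\<^sup>2 / (real N powr (1 - e) * h N * \<delta> N)"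
        using eventually_ge_at_top[of 1]
      proof eventually_elim
        case (elim N)
        have pos: "0 < h N" "0 < \<delta> N" using elim h(1) delta by auto
        have "real N powr (1 - e) = real N / real N powr e" using elim by (simp add: powr_diff)
        then have "(real (\<nu> N))\<^sup>2 / (real N powr (1 - e) * h N * \<delta> N) = (real (\<nu> N))\<^sup>2 * real N powr e / (real N * h N * \<delta> N)"
          using elim pos by (simp add: field_simps)
        then show ?case using pos by (simp add: add_nonneg_nonneg)
      qed
    qed
    show "weight w N (\<lambda>i. X N i \<omega>) j x = 0"
      if "1 \<le> N" "j \<in> {1..N div \<nu> N}" "x \<in> I" "\<omega> \<in> space (M N)" "\<bar>group_mean (\<nu> N) N (\<lambda>i. X N i \<omega>) j - x\<bar> > K * h N" for N j x \<omega>
    proof -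
      have "C * h N \<le> K * h N" using Kd_le h(1) that(1) by (intro mult_right_mono) (auto intro: less_imp_le)
      then have "C * h N < \<bar>group_mean (\<nu> N) N (\<lambda>i. X N i \<omega>) j - x\<bar>" using that(5) by linarith
      then show ?thesis using C(2) that(1-4) by blast
    qed
  qed
qed

context group_testing_consts
begin

abbreviation obs :: "nat \<Rightarrow> 'a \<Rightarrow> nat \<Rightarrow> real" where
  "obs N \<omega> \<equiv> \<lambda>i. X N i \<omega>"

abbreviation p_est :: "nat \<Rightarrow> 'a \<Rightarrow> real \<Rightarrow> real" where
  "p_est N \<omega> \<equiv> p_hat w (\<nu> N) N (obs N \<omega>) (\<lambda>i. Y N i \<omega>)"

abbreviation rexp :: "nat \<Rightarrow> (nat \<Rightarrow> real) \<Rightarrow> ((nat \<Rightarrow> bool) \<Rightarrow> 'c :: {banach, second_countable_topology}) \<Rightarrow> 'c" where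
  "rexp N xs \<equiv> measure_pmf.expectation (response_pmf (p N) N xs)"

abbreviation rprob :: "nat \<Rightarrow> (nat \<Rightarrow> real) \<Rightarrow> (nat \<Rightarrow> bool) set \<Rightarrow> real" where
  "rprob N xs \<equiv> measure_pmf.prob (response_pmf (p N) N xs)"

lemma basic:
  assumes "N0 \<le> N"
  shows "1 \<le> N" "0 < \<delta> N" "\<delta> N \<le> K" "1 \<le> \<nu> N" "real (\<nu> N) \<ge> 1" "0 < h N" "0 < real N" "0 < real N * h N" "0 < \<rho> N"
    "real (\<nu> N) * \<delta> N \<le> K"
proof -
  show N: "1 \<le> N" using assms N0(1) by linarith
  show d: "0 < \<delta> N" and hN: "0 < h N" and n: "1 \<le> \<nu> N" using N delta h nu by auto
  then show n': "real (\<nu> N) \<ge> 1" by simp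
  have "1 * \<delta> N \<le> real (\<nu> N) * \<delta> N" using n' d by (intro mult_right_mono) auto
  then show "\<delta> N \<le> K" using N0(2)[OF assms] by simp
  show "0 < real N" "0 < real N * h N" "0 < \<rho> N" using N hN n by auto
  show "real (\<nu> N) * \<delta> N \<le> K" by (rule N0(2)[OF assms])
qed

section \<open>Consequences of the growth condition (T4)\<close>

lemma ev_N0: "\<forall>\<^sub>F N in sequentially. N0 \<le> N"
  by (rule eventually_ge_at_top)

lemma h_small: "0 < \<epsilon> \<Longrightarrow> \<forall>\<^sub>F N in sequentially. h N \<le> \<epsilon>"
  using order_tendstoD(2)[OF h(2), of \<epsilon>] by (auto elim!: eventually_mono)

lemma T4_small:
  assumes "0 < \<epsilon>"
  shows "\<forall>\<^sub>F N in sequentially. (real (\<nu> N))\<^sup>2 * real N powr e \<le> \<epsilon> * (real N * h N * \<delta> N)"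
  using order_tendstoD(2)[OF e(2) assms] ev_N0
proof eventually_elim
  case (elim N)
  then show ?case using basic[OF elim(2)] by (simp add: divide_less_eq less_imp_le)
qed

lemma powr_ge_1: "N0 \<le> N \<Longrightarrow> 1 \<le> real N powr e"
  using basic[of N] e(1) by (simp add: ge_one_powr_ge_zero)

lemma Nhd_large:
  assumes "0 < \<epsilon>"
  shows "\<forall>\<^sub>F N in sequentially. 1 / (real N * h N * \<delta> N) \<le> \<epsilon> \<and> (real (\<nu> N))\<^sup>2 / (real N * h N * \<delta> N) \<le> \<epsilon>"
  using T4_small[OF assms] ev_N0
proof eventually_elim
  case (elim N)
  note B = basic[OF elim(2)]
  have n2: "1 \<le> (real (\<nu> N))\<^sup>2" using B(5) by simp
  have "(real (\<nu> N))\<^sup>2 * 1 \<le> (real (\<nu> N))\<^sup>2 * real N powr e"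
    using powr_ge_1[OF elim(2)] by (intro mult_left_mono) auto
  then have "(real (\<nu> N))\<^sup>2 \<le> \<epsilon> * (real N * h N * \<delta> N)" "1 \<le> \<epsilon> * (real N * h N * \<delta> N)"
    using elim(1) n2 by linarith+
  then show ?case using B by (simp add: divide_le_eq)
qed

text \<open>Since \<open>\<nu> \<ge> 1\<close> and \<open>\<delta> \<le> K\<close>, (T4) implies
  that the group size falls short of \<open>N * h\<close> by a power of N. Such a power is what
  exponential bounds need to outweigh polynomially many cells or grid points.\<close>

lemma nu_powr_small:
  assumes "0 < \<epsilon>"
  shows "\<forall>\<^sub>F N in sequentially. real (\<nu> N) * real N powr e \<le> \<epsilon> * (real N * h N)"
proof -
  have "0 < \<epsilon> / K" using assms K by simp
  from T4_small[OF this] ev_N0 show ?thesis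
  proof eventually_elim
    case (elim N)
    note B = basic[OF elim(2)]
    have "real (\<nu> N) * real N powr e \<le> (real (\<nu> N))\<^sup>2 * real N powr e"
      using B(5) by (intro mult_right_mono) (auto simp: power2_eq_square)
    also have "\<dots> \<le> \<epsilon> / K * (real N * h N * \<delta> N)" by (rule elim)
    also have "\<dots> = \<epsilon> * (real N * h N) * (\<delta> N / K)" by simp
    also have "\<dots> \<le> \<epsilon> * (real N * h N) * 1"
      using B K assms by (intro mult_left_mono) auto
    finally show ?case by simp
  qed
qed

lemma rho_small:
  assumes "0 < \<epsilon>"
  shows "\<forall>\<^sub>F N in sequentially. \<rho> N \<le> \<epsilon> \<and> \<rho> N * real N powr e \<le> \<epsilon>"
  using nu_powr_small[OF assms] ev_N0
proof eventually_elim
  case (elim N)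
  note B = basic[OF elim(2)]
  have "real (\<nu> N) * 1 \<le> real (\<nu> N) * real N powr e"
    using powr_ge_1[OF elim(2)] by (intro mult_left_mono) auto
  then have "real (\<nu> N) \<le> \<epsilon> * (real N * h N)" using elim(1) by linarith
  then show ?case using elim B by (simp add: divide_le_eq)
qed

text \<open>The margin \<open>r / 2\<close> covers the windows of all points of \<open>I\<close>
  once h is small, and stays clear of the ends of the region divided into cells.\<close>

definition spread :: "nat \<Rightarrow> real \<Rightarrow> (nat \<Rightarrow> real) \<Rightarrow> bool" where
  "spread N \<eta> xs \<longleftrightarrow> (\<forall>j\<in>{1..N div \<nu> N}. group_mean (\<nu> N) N xs j \<in> {l - r / 2..u + r / 2} \<longrightarrow>
     (\<forall>i\<in>{1..\<nu> N}. \<bar>order_stat N xs ((j - 1) * \<nu> N + i) - group_mean (\<nu> N) N xs j\<bar> \<le> \<eta> * h N))"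

text \<open>
  If each cell of length \<open>\<eta> * h / 2\<close> contains at least \<open>\<nu>\<close> observations, no group can straddle a
  cell. The expected number in a cell is of order \<open>N * h\<close>, which by (T4) exceeds \<open>\<nu>\<close> by a power of \<open>N\<close>.
\<close>

lemma spread_whp:
  assumes \<eta>: "0 < \<eta>" and \<theta>: "0 < \<theta>"
  shows "with_prob M \<theta> (\<lambda>N \<omega>. spread N \<eta> (obs N \<omega>))"
proof -
  \<comment> \<open>Half of the target, because \<open>group_spread\<close> locates the members only
    up to two cell lengths.\<close>
  define s where "s N = \<eta> * h N / 2" for N
  define m where "m N = nat \<lfloor>(u - l + 2 * r) / s N\<rfloor>" for N
  define cell where "cell N k = {l - r + real k * s N<..<l - r + real (Suc k) * s N}" for N k
  define Q where "Q N \<omega> \<longleftrightarrow> (\<forall>k\<in>{..<m N}. \<nu> N \<le> card {i\<in>{1..N}. X N i \<omega> \<in> cell N k})" for N \<omega>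
  have "with_prob M \<theta> Q"
  proof (rule with_prob_event)
    \<comment> \<open>With this fraction \<open>N * c * s / 2\<close> is at least twice
      \<open>\<nu> * N powr e\<close>: one half absorbs \<nu> in the exponent of
      \<open>few_points_prob\<close>, the other leaves \<open>- (N powr e)\<close>.\<close>
    have c8: "0 < c * \<eta> / 8" using c \<eta> by simp
    \<comment> \<open>A union bound: since \<open>N * h \<ge> 1\<close> there are at most
      \<open>2 * K / \<eta> * N\<close> cells.\<close>
    have "(\<lambda>N. 2 * K / \<eta> * (real N * exp (- (real N powr e)))) \<longlonglongrightarrow> 0"
      using e(1) by real_asymp
    then have "\<forall>\<^sub>F N in sequentially. 2 * K / \<eta> * (real N * exp (- (real N powr e))) < \<theta>"
      using \<theta> by (rule order_tendstoD)
    with nu_powr_small[OF c8] nu_powr_small[OF zero_less_one] ev_N0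
    show "\<forall>\<^sub>F N in sequentially. {\<omega>\<in>space (M N). \<not> Q N \<omega>} \<in> sets (M N)
        \<and> measure (M N) {\<omega>\<in>space (M N). \<not> Q N \<omega>} \<le> \<theta>"
    proof eventually_elim
      case (elim N)
      note B = basic[OF elim(3)]
      interpret binary_sample "M N" N "X N" "Y N" "p N" by (rule sample_interp[OF B(1)])
      have sN: "0 < s N" using B \<eta> by (simp add: s_def)
      have mr: "real (m N) \<le> (u - l + 2 * r) / s N"
        using sN I r by (simp add: m_def)
      have ms: "real (m N) * s N \<le> u - l + 2 * r"
        using mr sN by (simp add: field_simps)
      have cellJ: "cell N k \<subseteq> J" if "k < m N" for k
      proof -
        have "real (Suc k) * s N \<le> real (m N) * s N" using that sN by (intro mult_right_mono) auto
        then have "l - r + real (Suc k) * s N \<le> u + r" using ms by linarith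
        moreover have "0 \<le> real k * s N" using sN by simp
        ultimately have "cell N k \<subseteq> {l - r..u + r}" unfolding cell_def by auto
        then show ?thesis using r(2) by blast
      qed
      have ind: "indep_vars (\<lambda>_. borel) (X N) {1..N}"
      proof -
        have "indep_vars (\<lambda>_. borel) (\<lambda>i \<omega>. fst (X N i \<omega>, Y N i \<omega>)) {1..N}"
          by (rule indep_vars_compose2[OF iid]) (simp add: borel_prod[symmetric])
        then show ?thesis by simp
      qed
      have pc: "c * s N \<le> prob {\<omega>\<in>space (M N). X N i \<omega> \<in> cell N k}" if i: "i \<in> {1..N}" and k: "k < m N" for i k
      proof -
        have "ennreal (c * s N) = (\<integral>\<^sup>+x. ennreal c * indicator (cell N k) x \<partial>lborel)"
          using c sN by (subst nn_integral_cmult_indicator) (auto simp: cell_def algebra_simps ennreal_mult')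
        also have "\<dots> \<le> (\<integral>\<^sup>+x. ennreal (f x) * indicator (cell N k) x \<partial>lborel)"
          using cellJ[OF k] c(3) by (intro nn_integral_mono) (auto simp: indicator_def intro!: ennreal_leI)
        also have "\<dots> = emeasure (M N) (X N i -` cell N k \<inter> space (M N))"
          using density B(1) i by (subst distributed_emeasure) (auto simp: cell_def)
        also have "X N i -` cell N k \<inter> space (M N) = {\<omega>\<in>space (M N). X N i \<omega> \<in> cell N k}" by auto
        finally show ?thesis by (simp add: emeasure_eq_measure)
      qed
      have ev: "{\<omega>\<in>space (M N). card {i\<in>{1..N}. X N i \<omega> \<in> cell N k} < \<nu> N} \<in> sets (M N)" for k
      proof -
        have eq: "real (card {i\<in>{1..N}. X N i \<omega> \<in> cell N k}) = (\<Sum>i\<in>{1..N}. indicat_real (cell N k) (X N i \<omega>))" for \<omega>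
          by (simp add: indicator_def sum.If_cases Int_def)
        have [measurable]: "cell N k \<in> sets borel" by (simp add: cell_def)
        have "(\<lambda>\<omega>. \<Sum>i\<in>{1..N}. indicat_real (cell N k) (X N i \<omega>)) \<in> borel_measurable (M N)"
        proof (rule borel_measurable_sum)
          fix i assume "i \<in> {1..N}"
          note [measurable] = X_measurable[OF this]
          show "(\<lambda>\<omega>. indicat_real (cell N k) (X N i \<omega>)) \<in> borel_measurable (M N)" by measurable
        qed
        then have "{\<omega>\<in>space (M N). real (card {i\<in>{1..N}. X N i \<omega> \<in> cell N k}) < real (\<nu> N)} \<in> sets (M N)"
          unfolding eq by measurable
        then show ?thesis by (simp only: of_nat_less_iff)
      qed
      define Bad where "Bad k = {\<omega>\<in>space (M N). card {i\<in>{1..N}. X N i \<omega> \<in> cell N k} < \<nu> N}" for k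
      have Bad: "Bad k \<in> sets (M N)" for k unfolding Bad_def by (rule ev)
      have eqU: "{\<omega>\<in>space (M N). \<not> Q N \<omega>} = (\<Union>k\<in>{..<m N}. Bad k)"
        unfolding Q_def Bad_def not_le[symmetric] by blast
      have "prob {\<omega>\<in>space (M N). \<not> Q N \<omega>} \<le> (\<Sum>k\<in>{..<m N}. prob (Bad k))"
        unfolding eqU using Bad by (intro finite_measure_subadditive_finite) auto
      also have "\<dots> \<le> (\<Sum>k\<in>{..<m N}. exp (real (\<nu> N) - real N * (c * s N) / 2))"
      proof (rule sum_mono)
        fix k assume k: "k \<in> {..<m N}"
        have cb: "cell N k \<in> sets borel" by (simp add: cell_def)
        have "prob (Bad k) \<le> exp (real (\<nu> N) - real (card {1..N}) * (c * s N) / 2)"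
          unfolding Bad_def by (rule few_points_prob[OF ind finite_atLeastAtMost cb pc]) (use k in auto)
        then show "prob (Bad k) \<le> exp (real (\<nu> N) - real N * (c * s N) / 2)"
          by (simp only: card_atLeastAtMost diff_Suc_1)
      qed
      also have "\<dots> = real (m N) * exp (real (\<nu> N) - real N * (c * s N) / 2)" by simp
      also have "\<dots> \<le> (2 * K / \<eta> * real N) * exp (- (real N powr e))"
      proof (rule mult_mono)
        have "real (m N) \<le> K / s N" by (rule order_trans[OF mr divide_right_mono[OF K(2) less_imp_le[OF sN]]])
        also have "\<dots> = 2 * K / \<eta> * (1 / h N)" by (simp add: s_def)
        also have "\<dots> \<le> 2 * K / \<eta> * real N"
        proof (rule mult_left_mono)
          have "1 * 1 \<le> real (\<nu> N) * real N powr e"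
            using B(5) powr_ge_1[OF elim(3)] by (intro mult_mono) auto
          then have "1 \<le> real N * h N" using elim(2) by linarith
          then show "1 / h N \<le> real N" using B by (simp add: divide_le_eq)
        qed (use K \<eta> in simp)
        finally show "real (m N) \<le> 2 * K / \<eta> * real N" .
        have "real (\<nu> N) * real N powr e \<le> c * \<eta> / 8 * (real N * h N)" by (rule elim)
        then have 1: "2 * (real (\<nu> N) * real N powr e) \<le> real N * (c * s N) / 2"
          by (simp add: s_def mult_ac)
        have "1 * real N powr e \<le> real (\<nu> N) * real N powr e"
          by (rule mult_right_mono[OF B(5)]) simp
        moreover have "real (\<nu> N) * 1 \<le> real (\<nu> N) * real N powr e"
          using powr_ge_1[OF elim(3)] by (intro mult_left_mono) auto
        ultimately have "real (\<nu> N) - real N * (c * s N) / 2 \<le> - (real N powr e)" using 1 by simp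
        then show "exp (real (\<nu> N) - real N * (c * s N) / 2) \<le> exp (- (real N powr e))" by simp
      qed (use K \<eta> in auto)
      also have "\<dots> \<le> \<theta>" using elim(4) by (simp add: mult.assoc)
      finally have "prob {\<omega>\<in>space (M N). \<not> Q N \<omega>} \<le> \<theta>" .
      moreover have "{\<omega>\<in>space (M N). \<not> Q N \<omega>} \<in> sets (M N)"
        unfolding eqU using Bad by (intro sets.finite_UN) auto
      ultimately show ?case by simp
    qed
  qed (rule prob)
  then show ?thesis
  proof (rule with_prob_mono)
    have "0 < r / (6 * \<eta>)" using r \<eta> by simp
    from h_small[OF this] ev_N0
    show "\<forall>\<^sub>F N in sequentially. \<forall>\<omega>\<in>space (M N). Q N \<omega> \<longrightarrow> spread N \<eta> (obs N \<omega>)"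
    proof eventually_elim
      case (elim N)
      note B = basic[OF elim(2)]
      have sN: "0 < s N" using B \<eta> by (simp add: s_def)
      \<comment> \<open>The cells may stop short of \<open>u + r\<close> by one length, and
        \<open>group_spread\<close> asks for a margin of two; three lengths fit into
        \<open>r / 2\<close>.\<close>
      have s6: "6 * s N \<le> r" using elim(1) \<eta> r by (simp add: s_def field_simps)
      have "(u - l + 2 * r) / s N < real (m N) + 1"
        using sN I r unfolding m_def by linarith
      then have ms: "u - l + 2 * r \<le> real (m N) * s N + s N" using sN by (simp add: field_simps)
      show ?case
      proof (intro ballI impI)
        fix \<omega> assume Q: "Q N \<omega>"
        show "spread N \<eta> (obs N \<omega>)"
          unfolding spread_def
        proof (intro ballI impI)
          fix j i assume j: "j \<in> {1..N div \<nu> N}" and i: "i \<in> {1..\<nu> N}"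
            and g: "group_mean (\<nu> N) N (obs N \<omega>) j \<in> {l - r / 2..u + r / 2}"
          have "\<bar>order_stat N (obs N \<omega>) ((j - 1) * \<nu> N + i) - group_mean (\<nu> N) N (obs N \<omega>) j\<bar> \<le> 2 * s N"
          proof (rule group_spread[OF B(4) j sN _ _ i])
            show "\<nu> N \<le> card {i\<in>{1..N}. X N i \<omega> \<in> {l - r + real k * s N<..<l - r + real (Suc k) * s N}}" if "k < m N" for k
              using Q that unfolding Q_def cell_def by blast
            show "group_mean (\<nu> N) N (obs N \<omega>) j \<in> {l - r + 2 * s N..l - r + real (m N) * s N - 2 * s N}"
              using g s6 ms r(1) by auto
          qed
          then show "\<bar>order_stat N (obs N \<omega>) ((j - 1) * \<nu> N + i) - group_mean (\<nu> N) N (obs N \<omega>) j\<bar> \<le> \<eta> * h N"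
            by (simp add: s_def)
        qed
      qed
    qed
  qed simp
qed

section \<open>Samples on which the weights behave as required\<close>

definition W :: "nat \<Rightarrow> (nat \<Rightarrow> real) \<Rightarrow> real \<Rightarrow> nat \<Rightarrow> real" where
  "W N xs x j = weight w N xs j x / weight_sum w (\<nu> N) N xs x"

text \<open>A deterministic condition at one point, measurable in the sample, under which all
  conditional estimates hold. \<kappa> is a tolerance that may be made small; \<open>K1\<close> is
  the constant from (S4). The third powers serve the normal approximation, the fourth powers both
  that and the fourth moments. The last clause is \<open>spread\<close> restricted to the
  window.\<close>

definition good :: "nat \<Rightarrow> real \<Rightarrow> real \<Rightarrow> real \<Rightarrow> (nat \<Rightarrow> real) \<Rightarrow> bool" where
  "good N \<kappa> K1 x xs \<longleftrightarrow>
     (\<Sum>j=1..N div \<nu> N. W N xs x j) = 1 \<and>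
     (\<Sum>j=1..N div \<nu> N. W N xs x j * (group_mean (\<nu> N) N xs j - x)) = 0 \<and>
     \<bar>(\<Sum>j=1..N div \<nu> N. W N xs x j * (group_mean (\<nu> N) N xs j - x)\<^sup>2) - (h N)\<^sup>2 * b x\<bar> \<le> \<kappa> * (h N)\<^sup>2 \<and>
     \<bar>(\<Sum>j=1..N div \<nu> N. (W N xs x j)\<^sup>2) - \<rho> N * v x\<bar> \<le> \<kappa> * \<rho> N \<and>
     (\<Sum>j=1..N div \<nu> N. \<bar>W N xs x j\<bar>) \<le> K1 \<and>
     (\<Sum>j=1..N div \<nu> N. \<bar>W N xs x j\<bar> ^ 3) \<le> K1 * (\<rho> N)\<^sup>2 \<and>
     (\<Sum>j=1..N div \<nu> N. \<bar>W N xs x j\<bar> ^ 4) \<le> K1 * (\<rho> N) ^ 3 \<and>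
     (\<forall>j\<in>{1..N div \<nu> N}. K * h N < \<bar>group_mean (\<nu> N) N xs j - x\<bar> \<longrightarrow> W N xs x j = 0) \<and>
     (\<forall>j\<in>{1..N div \<nu> N}. \<bar>group_mean (\<nu> N) N xs j - x\<bar> \<le> K * h N \<longrightarrow>
        (\<forall>i\<in>{1..\<nu> N}. \<bar>order_stat N xs ((j - 1) * \<nu> N + i) - group_mean (\<nu> N) N xs j\<bar> \<le> \<kappa> * h N))"

lemma W_cong:
  assumes "\<And>i. i \<in> {1..N} \<Longrightarrow> xs i = xs' i"
  shows "W N xs = W N xs'"
  using weight_cong[OF assms] by (simp add: W_def weight_sum_def fun_eq_iff)

lemma good_cong:
  assumes "\<And>i. i \<in> {1..N} \<Longrightarrow> xs i = xs' i"
  shows "good N \<kappa> K1 x xs \<longleftrightarrow> good N \<kappa> K1 x xs'"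
proof -
  have g: "group_mean (\<nu> N) N xs j = group_mean (\<nu> N) N xs' j" if "j \<in> {1..N div \<nu> N}" for j
    by (rule group_mean_cong[OF assms that])
  have o: "order_stat N xs ((j - 1) * \<nu> N + i) = order_stat N xs' ((j - 1) * \<nu> N + i)"
    if "j \<in> {1..N div \<nu> N}" "i \<in> {1..\<nu> N}" for i j
    by (intro order_stat_cong assms group_index_in that)
  have Weq: "W N xs = W N xs'" by (rule W_cong) (rule assms)
  show ?thesis
    unfolding good_def by (simp only: Weq g o cong: sum.cong ball_cong)
qed

text \<open>The order of quantifiers matters: \<open>K1\<close> comes from (S4) and depends on the
  level \<eta> only, so \<kappa> can afterwards be chosen small in terms of
  \<open>K1\<close>.\<close>

lemma good_whp:
  assumes wc: "weight_conditions M X \<nu> h w b v T" and T: "T \<subseteq> I" and \<eta>: "0 < \<eta>"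
  shows "\<exists>K1\<ge>1. \<forall>\<kappa>>0. with_prob M \<eta> (\<lambda>N \<omega>. \<forall>x\<in>T. good N \<kappa> K1 x (obs N \<omega>))"
proof -
  \<comment> \<open>Seven events come from the weight conditions, the eighth is
    \<open>spread\<close>.\<close>
  define \<theta> where "\<theta> = \<eta> / 8"
  have \<theta>: "0 < \<theta>" using \<eta> by (simp add: \<theta>_def)
  let ?xs = "\<lambda>N \<omega> i. X N i \<omega>"
  have a0: "with_prob M \<theta> (\<lambda>N \<omega>. \<forall>x\<in>T. weight_sum w (\<nu> N) N (?xs N \<omega>) x \<noteq> 0)"
    and a1: "with_prob M \<theta> (\<lambda>N \<omega>. \<forall>x\<in>T. weighted_mean w (\<nu> N) N (?xs N \<omega>) x
         (\<lambda>j. group_mean (\<nu> N) N (?xs N \<omega>) j - x) = 0)"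
    using wc \<theta> unfolding weight_conditions_def whp_with_prob by auto
  have S4: "O_prob_on M (\<lambda>_. T)
       (\<lambda>N x \<omega>. (\<Sum>j=1..N div \<nu> N. \<bar>weight w N (?xs N \<omega>) j x\<bar> ^ k)
           / weight_sum w (\<nu> N) N (?xs N \<omega>) x ^ k)
       (\<lambda>N. (real (\<nu> N) / (real N * h N)) ^ (k - 1))" if "1 \<le> k" for k
    using wc that by (simp add: weight_conditions_def)
  obtain Ka where a4: "with_prob M \<theta> (\<lambda>N \<omega>. \<forall>x\<in>T. \<bar>(\<Sum>j=1..N div \<nu> N. \<bar>weight w N (?xs N \<omega>) j x\<bar> ^ 1)
           / weight_sum w (\<nu> N) N (?xs N \<omega>) x ^ 1\<bar> \<le> Ka * (real (\<nu> N) / (real N * h N)) ^ (1 - 1))"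
    by (rule with_prob_of_O[OF S4[OF order_refl] \<theta>])
  obtain Kb where a5: "with_prob M \<theta> (\<lambda>N \<omega>. \<forall>x\<in>T. \<bar>(\<Sum>j=1..N div \<nu> N. \<bar>weight w N (?xs N \<omega>) j x\<bar> ^ 3)
           / weight_sum w (\<nu> N) N (?xs N \<omega>) x ^ 3\<bar> \<le> Kb * (real (\<nu> N) / (real N * h N)) ^ (3 - 1))"
    by (rule with_prob_of_O[OF S4[OF one_le_numeral] \<theta>])
  obtain Kc where a6: "with_prob M \<theta> (\<lambda>N \<omega>. \<forall>x\<in>T. \<bar>(\<Sum>j=1..N div \<nu> N. \<bar>weight w N (?xs N \<omega>) j x\<bar> ^ 4)
           / weight_sum w (\<nu> N) N (?xs N \<omega>) x ^ 4\<bar> \<le> Kc * (real (\<nu> N) / (real N * h N)) ^ (4 - 1))"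
    by (rule with_prob_of_O[OF S4[OF one_le_numeral] \<theta>])
  define K1 where "K1 = max 1 (max Ka (max Kb Kc))"
  have K1: "1 \<le> K1" "Ka \<le> K1" "Kb \<le> K1" "Kc \<le> K1" by (auto simp: K1_def)
  have main: "with_prob M \<eta> (\<lambda>N \<omega>. \<forall>x\<in>T. good N \<kappa> K1 x (?xs N \<omega>))" if \<kappa>: "0 < \<kappa>" for \<kappa>
  proof -
    have a2: "with_prob M \<theta> (\<lambda>N \<omega>. \<forall>x\<in>T. \<bar>weighted_mean w (\<nu> N) N (?xs N \<omega>) x
             (\<lambda>j. (group_mean (\<nu> N) N (?xs N \<omega>) j - x)\<^sup>2) - (h N)\<^sup>2 * b x\<bar> \<le> \<kappa> * (h N)\<^sup>2)"
      by (rule with_prob_of_o[OF _ \<kappa> \<theta>]) (use wc in \<open>simp add: weight_conditions_def\<close>)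
    have a3: "with_prob M \<theta> (\<lambda>N \<omega>. \<forall>x\<in>T. \<bar>(\<Sum>j=1..N div \<nu> N. (weight w N (?xs N \<omega>) j x)\<^sup>2)
             / (weight_sum w (\<nu> N) N (?xs N \<omega>) x)\<^sup>2 - real (\<nu> N) * v x / (real N * h N)\<bar> \<le> \<kappa> * (real (\<nu> N) / (real N * h N)))"
      by (rule with_prob_of_o[OF _ \<kappa> \<theta>]) (use wc in \<open>simp add: weight_conditions_def\<close>)
    note all = with_prob_conj[OF a0 with_prob_conj[OF a1 with_prob_conj[OF a2 with_prob_conj[OF a3
        with_prob_conj[OF a4 with_prob_conj[OF a5 with_prob_conj[OF a6 spread_whp[OF \<kappa> \<theta>] prob] prob] prob] prob] prob] prob] prob]
    have r2K: "0 < r / (2 * K)" using r K by simp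
    show ?thesis
    proof (rule with_prob_mono[OF all])
      show "\<theta> + (\<theta> + (\<theta> + (\<theta> + (\<theta> + (\<theta> + (\<theta> + \<theta>)))))) \<le> \<eta>" by (simp add: \<theta>_def)
      show "\<forall>\<^sub>F N in sequentially. \<forall>\<omega>\<in>space (M N).
        (\<forall>x\<in>T. weight_sum w (\<nu> N) N (?xs N \<omega>) x \<noteq> 0) \<and>
        (\<forall>x\<in>T. weighted_mean w (\<nu> N) N (?xs N \<omega>) x (\<lambda>j. group_mean (\<nu> N) N (?xs N \<omega>) j - x) = 0) \<and>
        (\<forall>x\<in>T. \<bar>weighted_mean w (\<nu> N) N (?xs N \<omega>) x
             (\<lambda>j. (group_mean (\<nu> N) N (?xs N \<omega>) j - x)\<^sup>2) - (h N)\<^sup>2 * b x\<bar> \<le> \<kappa> * (h N)\<^sup>2) \<and>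
        (\<forall>x\<in>T. \<bar>(\<Sum>j=1..N div \<nu> N. (weight w N (?xs N \<omega>) j x)\<^sup>2)
             / (weight_sum w (\<nu> N) N (?xs N \<omega>) x)\<^sup>2 - real (\<nu> N) * v x / (real N * h N)\<bar> \<le> \<kappa> * (real (\<nu> N) / (real N * h N))) \<and>
        (\<forall>x\<in>T. \<bar>(\<Sum>j=1..N div \<nu> N. \<bar>weight w N (?xs N \<omega>) j x\<bar> ^ 1)
             / weight_sum w (\<nu> N) N (?xs N \<omega>) x ^ 1\<bar> \<le> Ka * (real (\<nu> N) / (real N * h N)) ^ (1 - 1)) \<and>
        (\<forall>x\<in>T. \<bar>(\<Sum>j=1..N div \<nu> N. \<bar>weight w N (?xs N \<omega>) j x\<bar> ^ 3)
             / weight_sum w (\<nu> N) N (?xs N \<omega>) x ^ 3\<bar> \<le> Kb * (real (\<nu> N) / (real N * h N)) ^ (3 - 1)) \<and>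
        (\<forall>x\<in>T. \<bar>(\<Sum>j=1..N div \<nu> N. \<bar>weight w N (?xs N \<omega>) j x\<bar> ^ 4)
             / weight_sum w (\<nu> N) N (?xs N \<omega>) x ^ 4\<bar> \<le> Kc * (real (\<nu> N) / (real N * h N)) ^ (4 - 1)) \<and>
        spread N \<kappa> (?xs N \<omega>) \<longrightarrow> (\<forall>x\<in>T. good N \<kappa> K1 x (?xs N \<omega>))"
        using h_small[OF r2K] ev_N0
      proof (eventually_elim, intro ballI impI, elim conjE)
        fix N \<omega> x
        assume hN: "h N \<le> r / (2 * K)" and NN: "N0 \<le> N" and \<omega>: "\<omega> \<in> space (M N)" and x: "x \<in> T"
        assume "\<forall>x\<in>T. weight_sum w (\<nu> N) N (?xs N \<omega>) x \<noteq> 0"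
        then have q0: "weight_sum w (\<nu> N) N (?xs N \<omega>) x \<noteq> 0" using x by blast
        assume "\<forall>x\<in>T. weighted_mean w (\<nu> N) N (?xs N \<omega>) x (\<lambda>j. group_mean (\<nu> N) N (?xs N \<omega>) j - x) = 0"
        then have q1: "weighted_mean w (\<nu> N) N (?xs N \<omega>) x (\<lambda>j. group_mean (\<nu> N) N (?xs N \<omega>) j - x) = 0" using x by blast
        assume "\<forall>x\<in>T. \<bar>weighted_mean w (\<nu> N) N (?xs N \<omega>) x
             (\<lambda>j. (group_mean (\<nu> N) N (?xs N \<omega>) j - x)\<^sup>2) - (h N)\<^sup>2 * b x\<bar> \<le> \<kappa> * (h N)\<^sup>2"
        then have q2: "\<bar>weighted_mean w (\<nu> N) N (?xs N \<omega>) x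
             (\<lambda>j. (group_mean (\<nu> N) N (?xs N \<omega>) j - x)\<^sup>2) - (h N)\<^sup>2 * b x\<bar> \<le> \<kappa> * (h N)\<^sup>2" using x by blast
        assume "\<forall>x\<in>T. \<bar>(\<Sum>j=1..N div \<nu> N. (weight w N (?xs N \<omega>) j x)\<^sup>2)
             / (weight_sum w (\<nu> N) N (?xs N \<omega>) x)\<^sup>2 - real (\<nu> N) * v x / (real N * h N)\<bar> \<le> \<kappa> * (real (\<nu> N) / (real N * h N))"
        then have q3: "\<bar>(\<Sum>j=1..N div \<nu> N. (weight w N (?xs N \<omega>) j x)\<^sup>2)
             / (weight_sum w (\<nu> N) N (?xs N \<omega>) x)\<^sup>2 - real (\<nu> N) * v x / (real N * h N)\<bar> \<le> \<kappa> * (real (\<nu> N) / (real N * h N))" using x by blast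
        assume "\<forall>x\<in>T. \<bar>(\<Sum>j=1..N div \<nu> N. \<bar>weight w N (?xs N \<omega>) j x\<bar> ^ 1)
             / weight_sum w (\<nu> N) N (?xs N \<omega>) x ^ 1\<bar> \<le> Ka * (real (\<nu> N) / (real N * h N)) ^ (1 - 1)"
        then have q4: "\<bar>(\<Sum>j=1..N div \<nu> N. \<bar>weight w N (?xs N \<omega>) j x\<bar> ^ 1)
             / weight_sum w (\<nu> N) N (?xs N \<omega>) x ^ 1\<bar> \<le> Ka * (real (\<nu> N) / (real N * h N)) ^ (1 - 1)" using x by blast
        assume "\<forall>x\<in>T. \<bar>(\<Sum>j=1..N div \<nu> N. \<bar>weight w N (?xs N \<omega>) j x\<bar> ^ 3)
             / weight_sum w (\<nu> N) N (?xs N \<omega>) x ^ 3\<bar> \<le> Kb * (real (\<nu> N) / (real N * h N)) ^ (3 - 1)"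
        then have q5: "\<bar>(\<Sum>j=1..N div \<nu> N. \<bar>weight w N (?xs N \<omega>) j x\<bar> ^ 3)
             / weight_sum w (\<nu> N) N (?xs N \<omega>) x ^ 3\<bar> \<le> Kb * (real (\<nu> N) / (real N * h N)) ^ (3 - 1)" using x by blast
        assume "\<forall>x\<in>T. \<bar>(\<Sum>j=1..N div \<nu> N. \<bar>weight w N (?xs N \<omega>) j x\<bar> ^ 4)
             / weight_sum w (\<nu> N) N (?xs N \<omega>) x ^ 4\<bar> \<le> Kc * (real (\<nu> N) / (real N * h N)) ^ (4 - 1)"
        then have q6: "\<bar>(\<Sum>j=1..N div \<nu> N. \<bar>weight w N (?xs N \<omega>) j x\<bar> ^ 4)
             / weight_sum w (\<nu> N) N (?xs N \<omega>) x ^ 4\<bar> \<le> Kc * (real (\<nu> N) / (real N * h N)) ^ (4 - 1)" using x by blast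
        assume sp: "spread N \<kappa> (?xs N \<omega>)"
        note B = basic[OF NN]
        have rho: "0 \<le> \<rho> N" using B(9) by simp
        have wm: "weighted_mean w (\<nu> N) N (?xs N \<omega>) x g = (\<Sum>j=1..N div \<nu> N. W N (?xs N \<omega>) x j * g j)" for g
          by (simp add: weighted_mean_def W_def sum_divide_distrib)
        have pw: "\<bar>(\<Sum>j=1..N div \<nu> N. \<bar>weight w N (?xs N \<omega>) j x\<bar> ^ k) / weight_sum w (\<nu> N) N (?xs N \<omega>) x ^ k\<bar>
            = (\<Sum>j=1..N div \<nu> N. \<bar>W N (?xs N \<omega>) x j\<bar> ^ k)" for k
          by (simp add: W_def sum_divide_distrib[symmetric] power_divide abs_divide power_abs sum_nonneg)
        show "good N \<kappa> K1 x (?xs N \<omega>)"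
          unfolding good_def
        proof (intro conjI ballI impI)
          show "(\<Sum>j=1..N div \<nu> N. W N (?xs N \<omega>) x j) = 1"
            using q0 by (simp add: W_def weight_sum_def sum_divide_distrib[symmetric])
          show "(\<Sum>j=1..N div \<nu> N. W N (?xs N \<omega>) x j * (group_mean (\<nu> N) N (?xs N \<omega>) j - x)) = 0"
            using q1 unfolding wm .
          show "\<bar>(\<Sum>j=1..N div \<nu> N. W N (?xs N \<omega>) x j * (group_mean (\<nu> N) N (?xs N \<omega>) j - x)\<^sup>2) - (h N)\<^sup>2 * b x\<bar> \<le> \<kappa> * (h N)\<^sup>2"
            using q2 unfolding wm .
          show "\<bar>(\<Sum>j=1..N div \<nu> N. (W N (?xs N \<omega>) x j)\<^sup>2) - \<rho> N * v x\<bar> \<le> \<kappa> * \<rho> N"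
            using q3 by (simp add: W_def power_divide sum_divide_distrib[symmetric])
          show "(\<Sum>j=1..N div \<nu> N. \<bar>W N (?xs N \<omega>) x j\<bar>) \<le> K1"
            using q4 K1(2) unfolding pw by simp
          show "(\<Sum>j=1..N div \<nu> N. \<bar>W N (?xs N \<omega>) x j\<bar> ^ 3) \<le> K1 * (\<rho> N)\<^sup>2"
            using q5 mult_right_mono[OF K1(3) zero_le_power[OF rho, of 2]] unfolding pw by simp
          show "(\<Sum>j=1..N div \<nu> N. \<bar>W N (?xs N \<omega>) x j\<bar> ^ 4) \<le> K1 * (\<rho> N) ^ 3"
            using q6 mult_right_mono[OF K1(4) zero_le_power[OF rho, of 3]] unfolding pw by simp
          have xI: "x \<in> I" using x T by blast
          show "W N (?xs N \<omega>) x j = 0" if "j \<in> {1..N div \<nu> N}" "K * h N < \<bar>group_mean (\<nu> N) N (?xs N \<omega>) j - x\<bar>" for j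
            using window[OF B(1) that(1) xI \<omega> that(2)] by (simp add: W_def)
          show "\<bar>order_stat N (?xs N \<omega>) ((j - 1) * \<nu> N + i) - group_mean (\<nu> N) N (?xs N \<omega>) j\<bar> \<le> \<kappa> * h N"
            if j: "j \<in> {1..N div \<nu> N}" "\<bar>group_mean (\<nu> N) N (?xs N \<omega>) j - x\<bar> \<le> K * h N" and i: "i \<in> {1..\<nu> N}" for j i
          proof -
            \<comment> \<open>Keeps the window of a point of \<open>I\<close> inside the range
              covered by \<open>spread\<close>.\<close>
            have "K * h N \<le> r / 2" using hN K by (simp add: field_simps)
            then have "group_mean (\<nu> N) N (?xs N \<omega>) j \<in> {l - r / 2..u + r / 2}"
              using j(2) xI I by auto
            then show ?thesis using sp j(1) i unfolding spread_def by blast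
          qed
        qed
      qed
    qed
  qed
  then show ?thesis using K1(1) by blast
qed

section \<open>Conditional bias and variance\<close>

abbreviation m :: "nat \<Rightarrow> (nat \<Rightarrow> real) \<Rightarrow> nat \<Rightarrow> real" where
  "m N xs j \<equiv> clear_prob (p N) (\<nu> N) N xs j"

abbreviation \<mu> :: "nat \<Rightarrow> real \<Rightarrow> real" where
  "\<mu> N x \<equiv> (1 - p N x) ^ \<nu> N"

abbreviation S :: "nat \<Rightarrow> real \<Rightarrow> (nat \<Rightarrow> real) \<Rightarrow> (nat \<Rightarrow> bool) \<Rightarrow> real" where
  "S N x xs y \<equiv> \<Sum>j=1..N div \<nu> N. W N xs x j * (group_clear (\<nu> N) N xs y j - m N xs j)"

text \<open>The form of the derivative uses that the root of \<mu> is \<open>1 - p\<close>.\<close>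

definition L :: "nat \<Rightarrow> real \<Rightarrow> real" where
  "L N x = - (1 - p N x) / (real (\<nu> N) * \<mu> N x)"

definition bias :: "nat \<Rightarrow> (nat \<Rightarrow> real) \<Rightarrow> real \<Rightarrow> real" where
  "bias N xs x = (\<Sum>j=1..N div \<nu> N. W N xs x j * m N xs j) - \<mu> N x"

definition cvar :: "nat \<Rightarrow> (nat \<Rightarrow> real) \<Rightarrow> real \<Rightarrow> real" where
  "cvar N xs x = (\<Sum>j=1..N div \<nu> N. (W N xs x j)\<^sup>2 * (m N xs j * (1 - m N xs j)))"

text \<open>The quantity under the square root in \<open>A_term\<close>, with the integer power
  written as a quotient by \<mu>. It equals the square of \<open>L\<close> times the Bernoulli
  variance \<open>\<mu> * (1 - \<mu>)\<close> times the limit \<open>\<rho> * v\<close> in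
  (S3).\<close>

definition A2 :: "nat \<Rightarrow> real \<Rightarrow> real" where
  "A2 N x = (1 - p N x)\<^sup>2 * (1 - \<mu> N x) * v x / (real (\<nu> N) * \<mu> N x * (real N * h N))"

definition Q0 :: real where "Q0 = K / c + 2 * K ^ 3 / c\<^sup>2"

text \<open>The conditions on N under which the deterministic expansions apply: the windows stay in
  the enlarged interval, \<open>prod_near_mean\<close> is applicable, and the last clause is the
  hypothesis \<open>osc\<close> of \<open>mu_taylor\<close>.\<close>

definition small :: "nat \<Rightarrow> real \<Rightarrow> bool" where
  "small N \<kappa> \<longleftrightarrow> N0 \<le> N \<and> h N \<le> 1 \<and> (K + 1) * h N \<le> r \<and> K * K * h N / c \<le> 1 / 2 \<and> K * (h N)\<^sup>2 * Q0 \<le> 1 \<and>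
     (\<forall>x\<in>I. \<forall>s. \<bar>s - x\<bar> \<le> K * h N \<longrightarrow> \<bar>\<pi>2 s - \<pi>2 x\<bar> + 4 * K ^ 5 * \<bar>s - x\<bar> \<le> \<kappa>)"

lemma Q0: "0 < Q0" using K c by (simp add: Q0_def add_pos_nonneg)

lemma I_sub: "x \<in> I \<Longrightarrow> x \<in> {l - r..u + r}" using I r by simp

lemma p_range:
  assumes "N0 \<le> N" "s \<in> {l - r..u + r}"
  shows "0 \<le> p N s" "p N s \<le> 1" "c \<le> 1 - p N s" "1 - p N s \<le> 1" "p N s \<le> \<delta> N * K"
proof -
  note B = basic[OF assms(1)]
  show 1: "0 \<le> p N s" using pi(2) B(2) by simp
  show 2: "c \<le> 1 - p N s" by (rule cp[OF assms])
  show "p N s \<le> 1" using 2 c by linarith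
  show "1 - p N s \<le> 1" using 1 by linarith
  have "\<pi> s \<le> K" using Kpi[OF assms(2)] by linarith
  then show "p N s \<le> \<delta> N * K" using B(2) by (intro mult_left_mono) auto
qed

lemma mu_range:
  assumes "N0 \<le> N" "x \<in> I"
  shows "c \<le> \<mu> N x" "\<mu> N x \<le> 1" "0 < \<mu> N x" "1 - \<mu> N x \<le> real (\<nu> N) * \<delta> N * K"
proof -
  note R = p_range[OF assms(1) I_sub[OF assms(2)]]
  show 1: "c \<le> \<mu> N x" by (rule cmu[OF assms])
  show "\<mu> N x \<le> 1" using R c by (intro power_le_one) auto
  show "0 < \<mu> N x" using 1 c by linarith
  have "1 + real (\<nu> N) * (- p N x) \<le> (1 + (- p N x)) ^ \<nu> N"
    using R by (intro Bernoulli_inequality) auto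
  then have "1 - \<mu> N x \<le> real (\<nu> N) * p N x" by simp
  also have "\<dots> \<le> real (\<nu> N) * (\<delta> N * K)" by (rule mult_left_mono[OF R(5)]) simp
  finally show "1 - \<mu> N x \<le> real (\<nu> N) * \<delta> N * K" by (simp add: mult.assoc)
qed

text \<open>\<open>L\<close> is exactly of order \<open>1 / \<nu>\<close>. The lower bound allows
  \<open>\<bar>S\<bar> / \<nu>\<close> to be measured by the linear term
  \<open>L * S\<close>.\<close>

lemma L_bounds:
  assumes "N0 \<le> N" "x \<in> I"
  shows "\<bar>L N x\<bar> \<le> 1 / (real (\<nu> N) * c)" "c / real (\<nu> N) \<le> \<bar>L N x\<bar>" "(L N x)\<^sup>2 \<le> 1 / ((real (\<nu> N))\<^sup>2 * c\<^sup>2)"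
proof -
  note R = p_range[OF assms(1) I_sub[OF assms(2)]]
  note MU = mu_range[OF assms]
  note B = basic[OF assms(1)]
  have q0: "0 < 1 - p N x" using R(3) c by linarith
  have abs: "\<bar>L N x\<bar> = (1 - p N x) / (real (\<nu> N) * \<mu> N x)"
    using q0 MU B by (simp add: L_def abs_mult abs_divide abs_of_pos)
  show 1: "\<bar>L N x\<bar> \<le> 1 / (real (\<nu> N) * c)"
    unfolding abs using R MU B c by (intro frac_le mult_left_mono) auto
  have "c / (real (\<nu> N) * 1) \<le> (1 - p N x) / (real (\<nu> N) * \<mu> N x)"
    using R MU B c by (intro frac_le mult_left_mono mult_pos_pos) auto
  then show "c / real (\<nu> N) \<le> \<bar>L N x\<bar>" unfolding abs by simp
  have "\<bar>L N x\<bar>\<^sup>2 \<le> (1 / (real (\<nu> N) * c))\<^sup>2" using 1 by (intro power_mono) auto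
  then show "(L N x)\<^sup>2 \<le> 1 / ((real (\<nu> N))\<^sup>2 * c\<^sup>2)" by (simp add: power_divide power_mult_distrib)
qed

lemma deriv_p:
  assumes "s \<in> J"
  shows "deriv (p N) s = \<delta> N * \<pi>1 s" "deriv (deriv (p N)) s = \<delta> N * \<pi>2 s"
proof -
  have d: "deriv (p N) s = \<delta> N * \<pi>1 s" if "s \<in> J" for s
    by (intro DERIV_imp_deriv DERIV_cmult pi_derivs that)
  show "deriv (p N) s = \<delta> N * \<pi>1 s" by (rule d[OF assms])
  have "((\<lambda>s. \<delta> N * \<pi>1 s) has_real_derivative \<delta> N * \<pi>2 s) (at s)"
    by (intro DERIV_cmult pi_derivs assms)
  then have "(deriv (p N) has_real_derivative \<delta> N * \<pi>2 s) (at s)"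
    by (rule has_field_derivative_transform_within_open[OF _ J(1) assms]) (simp add: d)
  then show "deriv (deriv (p N)) s = \<delta> N * \<pi>2 s" by (rule DERIV_imp_deriv)
qed

lemma B_term_eq:
  assumes "x \<in> I"
  shows "B_term \<nu> h p b N x = 1/2 * (h N)\<^sup>2 * (\<delta> N * \<pi>2 x
        - (real (\<nu> N) - 1) * inverse (1 - p N x) * (\<delta> N * \<pi>1 x)\<^sup>2) * b x"
proof -
  have "x \<in> J" using assms J by blast
  then show ?thesis by (simp add: B_term_def deriv_p)
qed

lemma A_term_sq:
  assumes "N0 \<le> N" "x \<in> I"
  shows "A_term \<nu> h p v N x = sqrt (A2 N x)"
proof -
  note R = p_range[OF assms(1) I_sub[OF assms(2)]]
  have "1 - p N x \<noteq> 0" using R c by linarith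
  then have "(1 - p N x) powi (2 - int (\<nu> N)) = (1 - p N x)\<^sup>2 / \<mu> N x"
    by (simp add: power_int_diff)
  then show ?thesis unfolding A_term_def A2_def by (simp add: mult_ac)
qed

text \<open>\<open>1 - \<mu>\<close> contributes at most \<open>\<nu> * \<delta> * K\<close>, which
  cancels \<nu> in the denominator and leaves the order \<open>\<delta> / (N * h)\<close>.\<close>

lemma A2_bound:
  assumes "N0 \<le> N" "x \<in> I"
  shows "\<bar>A2 N x\<bar> \<le> (K * K / c) * (\<delta> N / (real N * h N))"
proof -
  note R = p_range[OF assms(1) I_sub[OF assms(2)]]
  note MU = mu_range[OF assms]
  note B = basic[OF assms(1)]
  have "\<bar>A2 N x\<bar> = (1 - p N x)\<^sup>2 * (1 - \<mu> N x) * \<bar>v x\<bar> / (real (\<nu> N) * \<mu> N x * (real N * h N))"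
    using R MU B by (simp add: A2_def abs_mult abs_divide)
  also have "\<dots> \<le> 1 * (real (\<nu> N) * \<delta> N * K) * K / (real (\<nu> N) * c * (real N * h N))"
  proof (intro frac_le mult_mono)
    show "(1 - p N x)\<^sup>2 \<le> 1" using R c by (intro power_le_one) auto
  qed (use R MU B K Kbv[OF assms(2)] c in auto)
  also have "\<dots> = (K * K / c) * (\<delta> N / (real N * h N))" using B c by (simp add: field_simps)
  finally show ?thesis .
qed

lemma A_bound: "\<exists>K'. \<forall>\<^sub>F N in sequentially. \<forall>x\<in>I. \<bar>A_term \<nu> h p v N x\<bar> \<le> K' * sqrt (\<delta> N / (real N * h N))"
proof (intro exI)
  show "\<forall>\<^sub>F N in sequentially. \<forall>x\<in>I. \<bar>A_term \<nu> h p v N x\<bar> \<le> sqrt (K * K / c) * sqrt (\<delta> N / (real N * h N))"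
    using ev_N0
  proof eventually_elim
    case (elim N)
    show ?case
    proof
      fix x assume x: "x \<in> I"
      have "\<bar>A_term \<nu> h p v N x\<bar> = sqrt \<bar>A2 N x\<bar>" by (simp only: A_term_sq[OF elim x] sqrt_def real_root_abs[OF pos2])
      also have "\<dots> \<le> sqrt ((K * K / c) * (\<delta> N / (real N * h N)))" by (intro real_sqrt_le_mono A2_bound elim x)
      finally show "\<bar>A_term \<nu> h p v N x\<bar> \<le> sqrt (K * K / c) * sqrt (\<delta> N / (real N * h N))" by (simp only: real_sqrt_mult)
    qed
  qed
qed

text \<open>In the term with the squared derivative of p, one factor \<delta> is absorbed by
  \<open>(\<nu> - 1) * \<delta> \<le> K\<close>, so that both terms are of first order in
  \<delta>.\<close>

lemma B_bound':
  assumes "N0 \<le> N" "x \<in> I"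
  shows "\<bar>B_term \<nu> h p b N x\<bar> \<le> (K * (K + K ^ 3 / c)) * (\<delta> N * (h N)\<^sup>2)"
proof -
  note R = p_range[OF assms(1) I_sub[OF assms(2)]]
  note B = basic[OF assms(1)]
  note KP = Kpi[OF I_sub[OF assms(2)]]
  let ?i = "inverse (1 - p N x)"
  have i: "0 \<le> ?i" "?i \<le> 1 / c" using R(3) c by (auto simp: inverse_eq_divide intro!: frac_le)
  have "\<bar>(real (\<nu> N) - 1) * ?i * (\<delta> N * \<pi>1 x)\<^sup>2\<bar> = ((real (\<nu> N) - 1) * \<delta> N) * ?i * (\<delta> N * \<bar>\<pi>1 x\<bar>\<^sup>2)"
    using B i by (simp add: abs_mult power_mult_distrib power2_eq_square)
  also have "\<dots> \<le> K * (1 / c) * (\<delta> N * K\<^sup>2)"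
  proof (intro mult_mono power_mono)
    show "(real (\<nu> N) - 1) * \<delta> N \<le> K" using B by (simp add: left_diff_distrib)
  qed (use i B KP K c in auto)
  finally have 2: "\<bar>(real (\<nu> N) - 1) * ?i * (\<delta> N * \<pi>1 x)\<^sup>2\<bar> \<le> \<delta> N * (K ^ 3 / c)"
    by (simp add: power2_eq_square power3_eq_cube mult_ac)
  have 1: "\<bar>\<delta> N * \<pi>2 x\<bar> \<le> \<delta> N * K" using B KP by (simp add: abs_mult)
  have "\<bar>\<delta> N * \<pi>2 x - (real (\<nu> N) - 1) * ?i * (\<delta> N * \<pi>1 x)\<^sup>2\<bar> \<le> \<delta> N * K + \<delta> N * (K ^ 3 / c)"
    using abs_triangle_ineq4 1 2 by (meson add_mono order_trans)
  then have 3: "\<bar>\<delta> N * \<pi>2 x - (real (\<nu> N) - 1) * ?i * (\<delta> N * \<pi>1 x)\<^sup>2\<bar> \<le> \<delta> N * (K + K ^ 3 / c)"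
    by (simp only: distrib_left)
  have "\<bar>B_term \<nu> h p b N x\<bar> = 1 / 2 * (h N)\<^sup>2 * \<bar>\<delta> N * \<pi>2 x - (real (\<nu> N) - 1) * ?i * (\<delta> N * \<pi>1 x)\<^sup>2\<bar> * \<bar>b x\<bar>"
    unfolding B_term_eq[OF assms(2)] by (simp add: abs_mult)
  also have "\<dots> \<le> 1 * (h N)\<^sup>2 * (\<delta> N * (K + K ^ 3 / c)) * K"
    using 3 Kbv[OF assms(2)] K c B by (intro mult_mono) auto
  finally show ?thesis by (simp add: mult_ac)
qed

lemma B_bound: "\<exists>K'. \<forall>\<^sub>F N in sequentially. \<forall>x\<in>I. \<bar>B_term \<nu> h p b N x\<bar> \<le> K' * (\<delta> N * (h N)\<^sup>2)"
  using B_bound' by (intro exI[of _ "K * (K + K ^ 3 / c)"] eventually_mono[OF ev_N0]) blast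

lemma ev_small:
  assumes \<kappa>: "0 < \<kappa>"
  shows "\<forall>\<^sub>F N in sequentially. small N \<kappa>"
proof -
  have "uniformly_continuous_on {l - r..u + r} \<pi>2"
    by (intro compact_uniformly_continuous continuous_on_subset[OF T3(3) r(2)]) simp
  then obtain d where d: "0 < d" "\<And>s x. s \<in> {l - r..u + r} \<Longrightarrow> x \<in> {l - r..u + r} \<Longrightarrow> dist s x < d \<Longrightarrow> dist (\<pi>2 s) (\<pi>2 x) < \<kappa> / 2"
    unfolding uniformly_continuous_on_def using \<kappa> by (metis half_gt_zero)
  \<comment> \<open>One entry for each clause of \<open>small\<close>; the last two bound the two
    summands of the oscillation by \<open>\<kappa> / 2\<close> each.\<close>
  define z where "z = min (min 1 (r / (K + 1))) (min (c / (2 * K * K)) (min (1 / (K * Q0)) (min (d / (2 * K)) (\<kappa> / (8 * K ^ 6)))))"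
  have z: "0 < z" using r K c Q0 d \<kappa> by (simp add: z_def)
  show ?thesis
    using h_small[OF z] ev_N0
  proof eventually_elim
    case (elim N)
    note B = basic[OF elim(2)]
    have hz: "h N \<le> 1" "h N \<le> r / (K + 1)" "h N \<le> c / (2 * K * K)" "h N \<le> 1 / (K * Q0)" "h N \<le> d / (2 * K)" "h N \<le> \<kappa> / (8 * K ^ 6)"
      using elim(1) by (auto simp: z_def)
    have a1: "(K + 1) * h N \<le> r" using hz(2) K by (simp add: field_simps)
    have a2: "K * K * h N / c \<le> 1 / 2" using hz(3) K c by (simp add: field_simps)
    have "(h N)\<^sup>2 \<le> h N" using hz(1) B by (simp add: power2_eq_square mult_left_le)
    also have "\<dots> \<le> 1 / (K * Q0)" by (rule hz)
    finally have a3: "K * (h N)\<^sup>2 * Q0 \<le> 1" using K Q0 by (simp add: field_simps)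
    have a4: "K * h N < d" using hz(5) K d(1) by (simp add: field_simps)
    have "4 * K ^ 5 * (K * h N) = 4 * K ^ 6 * h N" by (simp add: eval_nat_numeral)
    also have "\<dots> \<le> \<kappa> / 2" using hz(6) K by (simp add: field_simps)
    finally have a5: "4 * K ^ 5 * (K * h N) \<le> \<kappa> / 2" .
    have Kr: "K * h N \<le> r" using a1 B by (simp add: distrib_right)
    show ?case
      unfolding small_def
    proof (intro conjI ballI allI impI elim hz a1 a2 a3)
      fix x s assume x: "x \<in> I" and s: "\<bar>s - x\<bar> \<le> K * h N"
      have "s \<in> {l - r..u + r}" using s Kr x I by auto
      then have "\<bar>\<pi>2 s - \<pi>2 x\<bar> < \<kappa> / 2" using d(2)[of s x] I_sub[OF x] s a4 by (simp add: dist_real_def)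
      moreover have "4 * K ^ 5 * \<bar>s - x\<bar> \<le> 4 * K ^ 5 * (K * h N)" using s K by (intro mult_left_mono) auto
      ultimately show "\<bar>\<pi>2 s - \<pi>2 x\<bar> + 4 * K ^ 5 * \<bar>s - x\<bar> \<le> \<kappa>" using a5 by linarith
    qed
  qed
qed

text \<open>A group with nonzero weight lies within \<open>(K + 1) * h\<close> of x. For the bias
  its clear probability is compared with the value at the group mean, where the diameter
  \<open>\<kappa> * h\<close> makes the error negligible against
  \<open>\<nu> * \<delta> * h\<^sup>2\<close>. For the variance the first-order comparison with x is
  enough.\<close>

lemma good_group:
  assumes s: "small N \<kappa>" and x: "x \<in> I" and g: "good N \<kappa> K1 x xs" and \<kappa>: "0 < \<kappa>" "\<kappa> \<le> 1"
    and j: "j \<in> {1..N div \<nu> N}" "W N xs x j \<noteq> 0"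
  defines "t \<equiv> group_mean (\<nu> N) N xs j"
  shows "\<bar>t - x\<bar> \<le> K * h N" "t \<in> {l - r..u + r}"
    and "\<bar>m N xs j - (1 - p N t) ^ \<nu> N\<bar> \<le> 2 * Q0 * \<kappa> * (real (\<nu> N) * \<delta> N * (h N)\<^sup>2)"
    and "\<bar>m N xs j - \<mu> N x\<bar> \<le> K * (K + 1) * (real (\<nu> N) * \<delta> N * h N)"
    and "1 - m N xs j \<le> K * (real (\<nu> N) * \<delta> N)"
proof -
  have N: "N0 \<le> N" using s by (simp add: small_def)
  note B = basic[OF N]
  have sm: "h N \<le> 1" "(K + 1) * h N \<le> r" "K * K * h N / c \<le> 1 / 2" "K * (h N)\<^sup>2 * Q0 \<le> 1"
    using s by (auto simp: small_def)
  show t: "\<bar>t - x\<bar> \<le> K * h N"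
    using g j unfolding good_def t_def by (meson not_le)
  have Kr: "K * h N + h N \<le> r" using sm(2) by (simp add: distrib_right)
  show t': "t \<in> {l - r..u + r}" using t Kr B x I by auto
  let ?o = "\<lambda>i. order_stat N xs ((j - 1) * \<nu> N + i)"
  have kh: "\<kappa> * h N \<le> h N" using \<kappa> B by simp
  have o: "\<bar>?o i - t\<bar> \<le> \<kappa> * h N" if "i \<in> {1..\<nu> N}" for i
    using g j(1) t that unfolding good_def t_def by blast
  have ox: "\<bar>?o i - x\<bar> \<le> (K + 1) * h N" if "i \<in> {1..\<nu> N}" for i
    using o[OF that] t kh unfolding distrib_right by linarith
  have oi: "?o i \<in> {l - r..u + r}" if "i \<in> {1..\<nu> N}" for i
    using ox[OF that] sm(2) x I by auto
  \<comment> \<open>All members are in the enlarged interval, where p lies in the unit interval and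
    the Bernoulli parameter is not truncated.\<close>
  have m: "m N xs j = (\<Prod>i=1..\<nu> N. 1 - p N (?o i))"
    unfolding clear_prob_def
    by (intro prod.cong refl pmf_bernoulli_False) (use p_range[OF N oi] in auto)
  have d1: "(\<pi> has_real_derivative \<pi>1 s) (at s)" "(\<pi>1 has_real_derivative \<pi>2 s) (at s)" if "s \<in> {l - r..u + r}" for s
    using pi_derivs r(2) that by blast+
  have Kp1: "\<bar>\<pi>1 s\<bar> \<le> K" and Kp2: "\<bar>\<pi>2 s\<bar> \<le> K" if "s \<in> {l - r..u + r}" for s
    using Kpi[OF that] by auto
  have q: "0 \<le> (h N)\<^sup>2" by simp
  have k2: "(\<kappa> * h N)\<^sup>2 \<le> \<kappa> * (h N)\<^sup>2"
  proof -
    have "\<kappa>\<^sup>2 \<le> \<kappa>" using \<kappa> by (simp add: power2_eq_square mult_left_le)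
    then show ?thesis unfolding power_mult_distrib by (intro mult_right_mono) auto
  qed
  have kh2: "(\<kappa> * h N)\<^sup>2 \<le> (h N)\<^sup>2" using kh \<kappa> B by (intro power_mono) auto
  have "\<bar>(\<Prod>i=1..\<nu> N. 1 - \<delta> N * \<pi> (?o i)) - (1 - \<delta> N * \<pi> t) ^ \<nu> N\<bar> \<le> 2 * (real (\<nu> N) * \<delta> N * (\<kappa> * h N)\<^sup>2 * (K / c + 2 * K ^ 3 / c\<^sup>2))"
  proof (rule prod_near_mean[OF d1 Kp1 Kp2 B(4) _ t' oi o])
    show "t = (\<Sum>i=1..\<nu> N. ?o i) / real (\<nu> N)" by (simp add: t_def group_mean_def)
    show "0 \<le> \<delta> N" "\<delta> N \<le> K" "0 < c" using B c by auto
    show "c \<le> 1 - \<delta> N * \<pi> t" "1 - \<delta> N * \<pi> t \<le> 1" using p_range[OF N t'] by auto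
    have "\<delta> N * K * (\<kappa> * h N) / c \<le> K * K * h N / c"
      using B K kh \<kappa> c by (intro divide_right_mono mult_mono) auto
    then show "\<delta> N * K * (\<kappa> * h N) / c \<le> 1 / 2" using sm(3) by linarith
    have "real (\<nu> N) * \<delta> N * (\<kappa> * h N)\<^sup>2 * Q0 \<le> K * (h N)\<^sup>2 * Q0"
      using B kh2 K Q0 by (intro mult_right_mono mult_mono) auto
    then show "real (\<nu> N) * \<delta> N * (\<kappa> * h N)\<^sup>2 * (K / c + 2 * K ^ 3 / c\<^sup>2) \<le> 1"
      using sm(4) unfolding Q0_def by linarith
  qed
  also have "\<dots> \<le> 2 * (real (\<nu> N) * \<delta> N * (\<kappa> * (h N)\<^sup>2) * Q0)"
    unfolding Q0_def[symmetric] using B k2 Q0 by (intro mult_left_mono mult_right_mono) auto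
  finally show "\<bar>m N xs j - (1 - p N t) ^ \<nu> N\<bar> \<le> 2 * Q0 * \<kappa> * (real (\<nu> N) * \<delta> N * (h N)\<^sup>2)"
    unfolding m by (simp add: mult_ac)
  have r01: "1 - p N (?o i) \<in> {0..1}" if "i \<in> {1..\<nu> N}" for i
    using p_range[OF N oi[OF that]] by auto
  have "\<bar>(\<Prod>i\<in>{1..\<nu> N}. 1 - p N (?o i)) - (1 - p N x) ^ card {1..\<nu> N}\<bar> \<le> real (card {1..\<nu> N}) * (\<delta> N * (K * ((K + 1) * h N)))"
  proof (rule prod_near_point)
    show "1 - p N x \<in> {0..1}" using p_range[OF N I_sub[OF x]] by auto
    fix i assume i: "i \<in> {1..\<nu> N}"
    show "1 - p N (?o i) \<in> {0..1}" by (rule r01[OF i])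
    have "\<bar>\<pi> (?o i) - \<pi> x\<bar> \<le> K * \<bar>?o i - x\<bar>"
      by (rule lipschitz_by_deriv[OF d1(1) Kp1 oi[OF i] I_sub[OF x]])
    also have "\<dots> \<le> K * ((K + 1) * h N)" using ox[OF i] K by (intro mult_left_mono) auto
    finally have "\<delta> N * \<bar>\<pi> (?o i) - \<pi> x\<bar> \<le> \<delta> N * (K * ((K + 1) * h N))" using B by (intro mult_left_mono) auto
    moreover have "\<bar>1 - p N (?o i) - (1 - p N x)\<bar> = \<delta> N * \<bar>\<pi> (?o i) - \<pi> x\<bar>"
    proof -
      have "1 - p N (?o i) - (1 - p N x) = - (\<delta> N * (\<pi> (?o i) - \<pi> x))" by (simp add: algebra_simps)
      then show ?thesis using B(2) by (simp add: abs_mult)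
    qed
    ultimately show "\<bar>1 - p N (?o i) - (1 - p N x)\<bar> \<le> \<delta> N * (K * ((K + 1) * h N))" by simp
  qed simp
  then show "\<bar>m N xs j - \<mu> N x\<bar> \<le> K * (K + 1) * (real (\<nu> N) * \<delta> N * h N)"
    unfolding m by (simp add: mult_ac)
  have "\<bar>(\<Prod>i\<in>{1..\<nu> N}. 1 - p N (?o i)) - 1 ^ card {1..\<nu> N}\<bar> \<le> real (card {1..\<nu> N}) * (\<delta> N * K)"
  proof (rule prod_near_point)
    fix i assume i: "i \<in> {1..\<nu> N}"
    show "1 - p N (?o i) \<in> {0..1}" by (rule r01[OF i])
    show "\<bar>1 - p N (?o i) - 1\<bar> \<le> \<delta> N * K" using p_range[OF N oi[OF i]] by auto
  qed auto
  then show "1 - m N xs j \<le> K * (real (\<nu> N) * \<delta> N)"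
    unfolding m by (simp add: mult_ac)
qed

text \<open>In the Taylor expansion at x of the values at the group means, the constant term is
  exact because the weights sum to 1, the linear term vanishes by (S1), and (S2) evaluates the
  quadratic one. \<open>L\<close> times that term is \<open>B_term\<close>.\<close>

lemma bias_expansion:
  assumes s: "small N \<kappa>" and x: "x \<in> I" and g: "good N \<kappa> K1 x xs" and \<kappa>: "0 < \<kappa>" "\<kappa> \<le> 1" and K1: "1 \<le> K1"
  shows "\<bar>L N x * bias N xs x - B_term \<nu> h p b N x\<bar> \<le> (K1 * (2 * Q0 + K\<^sup>2) + K ^ 3) / c * \<kappa> * (\<delta> N * (h N)\<^sup>2)"
    and "\<bar>bias N xs x\<bar> \<le> (K1 * (2 * Q0 + K\<^sup>2) + 2 * K ^ 4) * (real (\<nu> N) * \<delta> N * (h N)\<^sup>2)"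
proof -
  have N: "N0 \<le> N" using s by (simp add: small_def)
  note B = basic[OF N]
  note R = p_range[OF N I_sub[OF x]]
  note MU = mu_range[OF N x]
  let ?J = "{1..N div \<nu> N}"
  let ?n = "real (\<nu> N)" and ?d = "\<delta> N" and ?h2 = "(h N)\<^sup>2"
  define t where "t j = group_mean (\<nu> N) N xs j" for j
  define \<mu>1 where "\<mu>1 = - (?n * ?d * \<pi>1 x * (1 - p N x) ^ (\<nu> N - 1))"
  define \<mu>2 where "\<mu>2 = ?n * (?n - 1) * ?d\<^sup>2 * (\<pi>1 x)\<^sup>2 * (1 - p N x) ^ (\<nu> N - 2) - ?n * ?d * \<pi>2 x * (1 - p N x) ^ (\<nu> N - 1)"
  have d1: "(\<pi> has_real_derivative \<pi>1 s) (at s)" "(\<pi>1 has_real_derivative \<pi>2 s) (at s)" if "s \<in> {l - r..u + r}" for s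
    using pi_derivs r(2) that by blast+
  have Kp1: "\<bar>\<pi>1 s\<bar> \<le> K" and Kp2: "\<bar>\<pi>2 s\<bar> \<le> K" if "s \<in> {l - r..u + r}" for s
    using Kpi[OF that] by auto
  have range: "0 \<le> 1 - \<delta> N * \<pi> s \<and> 1 - \<delta> N * \<pi> s \<le> 1" if "s \<in> {l - r..u + r}" for s
    using p_range[OF N that] by auto
  have d0: "0 \<le> \<delta> N" using B by simp
  have osc: "\<bar>\<pi>2 s - \<pi>2 x\<bar> + 4 * K ^ 5 * \<bar>s - x\<bar> \<le> \<kappa>" if "\<bar>s - x\<bar> \<le> K * h N" for s
    using s x that unfolding small_def by blast
  have tay: "\<bar>(1 - p N (t j)) ^ \<nu> N - \<mu> N x - \<mu>1 * (t j - x) - \<mu>2 / 2 * (t j - x)\<^sup>2\<bar> \<le> ?n * ?d * \<kappa> * (t j - x)\<^sup>2"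
    if j: "j \<in> ?J" "W N xs x j \<noteq> 0" for j
  proof -
    note G = good_group[OF s x g \<kappa> j, folded t_def]
    have osc2: "\<bar>\<pi>2 s - \<pi>2 x\<bar> + 4 * K ^ 5 * \<bar>s - x\<bar> \<le> \<kappa>" if "s \<in> {l - r..u + r}" "\<bar>s - x\<bar> \<le> \<bar>t j - x\<bar>" for s
      by (rule osc[OF order_trans[OF that(2) G(1)]])
    show ?thesis
      unfolding \<mu>1_def \<mu>2_def
      by (rule mu_taylor(1)[OF d1 Kp1 Kp2 K(1) B(4) d0 B(10) range I_sub[OF x] G(2) osc2])
  qed
  have mu2_b: "\<bar>\<mu>2\<bar> \<le> ?n * ?d * (2 * K ^ 3)"
    unfolding \<mu>2_def
  proof (rule mu_taylor(2)[OF d1 Kp1 Kp2 K(1) B(4) d0 B(10) range I_sub[OF x] I_sub[OF x], where \<epsilon> = \<kappa>])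
    fix s assume "\<bar>s - x\<bar> \<le> \<bar>x - x\<bar>"
    also have "\<dots> \<le> K * h N" using B(6) K(1) by simp
    finally show "\<bar>\<pi>2 s - \<pi>2 x\<bar> + 4 * K ^ 5 * \<bar>s - x\<bar> \<le> \<kappa>" by (rule osc)
  qed
  have each: "\<bar>W N xs x j * (m N xs j - \<mu> N x - \<mu>1 * (t j - x) - \<mu>2 / 2 * (t j - x)\<^sup>2)\<bar>
      \<le> \<bar>W N xs x j\<bar> * ((2 * Q0 + K\<^sup>2) * \<kappa> * (?n * ?d * ?h2))" if j: "j \<in> ?J" for j
  proof (cases "W N xs x j = 0")
    case False
    note G = good_group[OF s x g \<kappa> j False, folded t_def]
    have "(t j - x)\<^sup>2 \<le> (K * h N)\<^sup>2" using G(1) by (metis abs_ge_zero power2_abs power_mono)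
    then have "?n * ?d * \<kappa> * (t j - x)\<^sup>2 \<le> ?n * ?d * \<kappa> * (K * h N)\<^sup>2"
      using B \<kappa> by (intro mult_left_mono) auto
    then have "\<bar>m N xs j - \<mu> N x - \<mu>1 * (t j - x) - \<mu>2 / 2 * (t j - x)\<^sup>2\<bar>
        \<le> 2 * Q0 * \<kappa> * (?n * ?d * ?h2) + ?n * ?d * \<kappa> * (K * h N)\<^sup>2"
      using tay[OF j False] G(3) by linarith
    also have "\<dots> = (2 * Q0 + K\<^sup>2) * \<kappa> * (?n * ?d * ?h2)" by (simp add: algebra_simps power_mult_distrib)
    finally show ?thesis unfolding abs_mult by (intro mult_left_mono) auto
  qed simp
  have W: "(\<Sum>j\<in>?J. W N xs x j) = 1" "(\<Sum>j\<in>?J. W N xs x j * (t j - x)) = 0"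
    "\<bar>(\<Sum>j\<in>?J. W N xs x j * (t j - x)\<^sup>2) - ?h2 * b x\<bar> \<le> \<kappa> * ?h2" "(\<Sum>j\<in>?J. \<bar>W N xs x j\<bar>) \<le> K1"
    using g unfolding good_def t_def by auto
  define T2 where "T2 = (\<Sum>j\<in>?J. W N xs x j * (t j - x)\<^sup>2)"
  have split: "(\<Sum>j\<in>?J. W N xs x j * (m N xs j - \<mu> N x - \<mu>1 * (t j - x) - \<mu>2 / 2 * (t j - x)\<^sup>2)) = bias N xs x - \<mu>2 / 2 * T2"
  proof -
    have "(\<Sum>j\<in>?J. W N xs x j * (m N xs j - \<mu> N x - \<mu>1 * (t j - x) - \<mu>2 / 2 * (t j - x)\<^sup>2))
        = (\<Sum>j\<in>?J. W N xs x j * m N xs j) - \<mu> N x * (\<Sum>j\<in>?J. W N xs x j)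
          - \<mu>1 * (\<Sum>j\<in>?J. W N xs x j * (t j - x)) - \<mu>2 / 2 * T2"
      unfolding T2_def sum_distrib_left sum_subtractf[symmetric] by (intro sum.cong refl) (simp add: algebra_simps)
    then show ?thesis using W by (simp add: bias_def)
  qed
  have "\<bar>bias N xs x - \<mu>2 / 2 * T2\<bar> \<le> (\<Sum>j\<in>?J. \<bar>W N xs x j\<bar> * ((2 * Q0 + K\<^sup>2) * \<kappa> * (?n * ?d * ?h2)))"
    unfolding split[symmetric] by (rule order_trans[OF sum_abs]) (intro sum_mono each)
  also have "\<dots> = (\<Sum>j\<in>?J. \<bar>W N xs x j\<bar>) * ((2 * Q0 + K\<^sup>2) * \<kappa> * (?n * ?d * ?h2))"
    by (rule sum_distrib_right[symmetric])
  also have "\<dots> \<le> K1 * ((2 * Q0 + K\<^sup>2) * \<kappa> * (?n * ?d * ?h2))"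
    using W(4) Q0 \<kappa> B by (intro mult_right_mono) auto
  finally have b1: "\<bar>bias N xs x - \<mu>2 / 2 * T2\<bar> \<le> K1 * ((2 * Q0 + K\<^sup>2) * \<kappa> * (?n * ?d * ?h2))" .
  have "\<bar>\<mu>2 / 2 * T2 - \<mu>2 / 2 * (?h2 * b x)\<bar> = \<bar>\<mu>2\<bar> / 2 * \<bar>T2 - ?h2 * b x\<bar>"
    unfolding right_diff_distrib[symmetric] abs_mult by simp
  also have "\<dots> \<le> (?n * ?d * (2 * K ^ 3)) / 2 * (\<kappa> * ?h2)"
    using mu2_b W(3) unfolding T2_def by (intro mult_mono divide_right_mono) (auto intro: order_trans)
  finally have b2: "\<bar>\<mu>2 / 2 * T2 - \<mu>2 / 2 * (?h2 * b x)\<bar> \<le> K ^ 3 * \<kappa> * (?n * ?d * ?h2)"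
    by (simp add: mult_ac)
  have b3: "\<bar>bias N xs x - \<mu>2 / 2 * (?h2 * b x)\<bar> \<le> (K1 * (2 * Q0 + K\<^sup>2) + K ^ 3) * \<kappa> * (?n * ?d * ?h2)"
  proof -
    have "(K1 * (2 * Q0 + K\<^sup>2) + K ^ 3) * \<kappa> * (?n * ?d * ?h2)
        = K1 * ((2 * Q0 + K\<^sup>2) * \<kappa> * (?n * ?d * ?h2)) + K ^ 3 * \<kappa> * (?n * ?d * ?h2)"
      by (simp add: algebra_simps)
    then show ?thesis using b1 b2 by linarith
  qed
  have q0: "1 - p N x \<noteq> 0" using R(3) c by linarith
  \<comment> \<open>\<open>B_term\<close> contains the second derivative of \<mu> pulled back
    through the root; the common power of \<open>1 - p\<close> cancels against \<mu> in
    \<open>L\<close>.\<close>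
  have LB: "L N x * (\<mu>2 / 2 * (?h2 * b x)) = B_term \<nu> h p b N x"
  proof -
    define a where "a = 1 - p N x"
    have a0: "a \<noteq> 0" using q0 by (simp add: a_def)
    have n0: "?n \<noteq> 0" using B by simp
    have pow1: "a ^ (\<nu> N - 1) = a ^ \<nu> N / a"
      using a0 B(4) by (simp add: power_diff)
    \<comment> \<open>The factor \<open>?n - 1\<close> is kept on both sides to cover
      \<open>\<nu> N = 1\<close>, where the exponent is truncated.\<close>
    have pow2: "(?n - 1) * a ^ (\<nu> N - 2) = (?n - 1) * (a ^ \<nu> N / a\<^sup>2)"
    proof (cases "\<nu> N = 1")
      case False
      then have "2 \<le> \<nu> N" using B(4) by linarith
      then show ?thesis using a0 by (simp add: power_diff)
    qed simp
    have "\<mu>2 = ?n * ?d\<^sup>2 * (\<pi>1 x)\<^sup>2 * ((?n - 1) * a ^ (\<nu> N - 2)) - ?n * ?d * \<pi>2 x * a ^ (\<nu> N - 1)"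
      by (simp add: \<mu>2_def a_def mult_ac)
    also have "\<dots> = ?n * a ^ \<nu> N * (?d\<^sup>2 * (\<pi>1 x)\<^sup>2 * (?n - 1) / a\<^sup>2 - ?d * \<pi>2 x / a)"
      unfolding pow1 pow2 using a0 by (simp add: field_simps)
    finally have m2: "\<mu>2 = ?n * a ^ \<nu> N * (?d\<^sup>2 * (\<pi>1 x)\<^sup>2 * (?n - 1) / a\<^sup>2 - ?d * \<pi>2 x / a)" .
    have "L N x * \<mu>2 = - a * (?d\<^sup>2 * (\<pi>1 x)\<^sup>2 * (?n - 1) / a\<^sup>2 - ?d * \<pi>2 x / a)"
      unfolding m2 L_def a_def[symmetric] using a0 n0 by simp
    also have "\<dots> = ?d * \<pi>2 x - (?n - 1) * inverse a * (?d * \<pi>1 x)\<^sup>2"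
      using a0 by (simp add: field_simps power2_eq_square)
    finally have Lm: "L N x * \<mu>2 = ?d * \<pi>2 x - (?n - 1) * inverse a * (?d * \<pi>1 x)\<^sup>2" .
    have "L N x * (\<mu>2 / 2 * (?h2 * b x)) = 1 / 2 * ?h2 * (L N x * \<mu>2) * b x" by simp
    then show ?thesis unfolding Lm B_term_eq[OF x] a_def .
  qed
  have "\<bar>L N x * bias N xs x - B_term \<nu> h p b N x\<bar> = \<bar>L N x\<bar> * \<bar>bias N xs x - \<mu>2 / 2 * (?h2 * b x)\<bar>"
    unfolding LB[symmetric] right_diff_distrib[symmetric] by (rule abs_mult)
  also have "\<dots> \<le> 1 / (?n * c) * ((K1 * (2 * Q0 + K\<^sup>2) + K ^ 3) * \<kappa> * (?n * ?d * ?h2))"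
    using L_bounds(1)[OF N x] b3 B c by (intro mult_mono) auto
  also have "\<dots> = (K1 * (2 * Q0 + K\<^sup>2) + K ^ 3) / c * \<kappa> * (?d * ?h2)"
    using B c by (simp add: field_simps)
  finally show "\<bar>L N x * bias N xs x - B_term \<nu> h p b N x\<bar> \<le> (K1 * (2 * Q0 + K\<^sup>2) + K ^ 3) / c * \<kappa> * (\<delta> N * (h N)\<^sup>2)" .
  have "\<bar>\<mu>2 / 2 * (?h2 * b x)\<bar> = \<bar>\<mu>2\<bar> / 2 * (?h2 * \<bar>b x\<bar>)" by (simp add: abs_mult)
  also have "\<dots> \<le> (?n * ?d * (2 * K ^ 3)) / 2 * (?h2 * K)"
    using mu2_b Kbv[OF x] by (intro mult_mono divide_right_mono mult_left_mono) (auto intro: order_trans)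
  finally have b4: "\<bar>\<mu>2 / 2 * (?h2 * b x)\<bar> \<le> K ^ 4 * (?n * ?d * ?h2)"
    by (simp add: eval_nat_numeral mult_ac)
  have x0: "0 \<le> ?n * ?d * ?h2" using B by simp
  have cc: "0 \<le> K1 * (2 * Q0 + K\<^sup>2) + K ^ 3" using K1 Q0 K by (simp add: add_nonneg_nonneg)
  have "(K1 * (2 * Q0 + K\<^sup>2) + K ^ 3) * \<kappa> * (?n * ?d * ?h2) \<le> (K1 * (2 * Q0 + K\<^sup>2) + K ^ 3) * 1 * (?n * ?d * ?h2)"
    using \<kappa> x0 cc by (intro mult_right_mono mult_left_mono) auto
  moreover have "K ^ 3 * (?n * ?d * ?h2) \<le> K ^ 4 * (?n * ?d * ?h2)"
    using x0 K power_increasing[of 3 4 K] by (intro mult_right_mono) auto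
  ultimately have "\<bar>bias N xs x\<bar> \<le> K1 * (2 * Q0 + K\<^sup>2) * (?n * ?d * ?h2) + 2 * (K ^ 4 * (?n * ?d * ?h2))"
    using b3 b4 unfolding distrib_right mult_1_right by linarith
  then show "\<bar>bias N xs x\<bar> \<le> (K1 * (2 * Q0 + K\<^sup>2) + 2 * K ^ 4) * (real (\<nu> N) * \<delta> N * (h N)\<^sup>2)"
    by (simp only: distrib_right mult.assoc)
qed

lemma good_sums:
  assumes s: "small N \<kappa>" and x: "x \<in> I" and g: "good N \<kappa> K1 x xs" and \<kappa>: "0 < \<kappa>" "\<kappa> \<le> 1"
  shows "(\<Sum>j=1..N div \<nu> N. (W N xs x j)\<^sup>2) \<le> (K + 1) * \<rho> N"
    and "cvar N xs x \<le> (K + 1) * K * (\<rho> N * (real (\<nu> N) * \<delta> N))"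
    and "(\<Sum>j=1..N div \<nu> N. \<bar>W N xs x j\<bar> ^ 3 * (m N xs j * (1 - m N xs j))) \<le> K1 * K * ((\<rho> N)\<^sup>2 * (real (\<nu> N) * \<delta> N))"
    and "(\<Sum>j=1..N div \<nu> N. (W N xs x j) ^ 4 * (m N xs j * (1 - m N xs j))) \<le> K1 * K * ((\<rho> N) ^ 3 * (real (\<nu> N) * \<delta> N))"
    and "(\<Sum>j=1..N div \<nu> N. (W N xs x j) ^ 4 * (m N xs j * (1 - m N xs j))\<^sup>2) \<le> K1 * K\<^sup>2 * ((\<rho> N) ^ 3 * (real (\<nu> N) * \<delta> N)\<^sup>2)"
proof -
  have N: "N0 \<le> N" using s by (simp add: small_def)
  note B = basic[OF N]
  let ?J = "{1..N div \<nu> N}" and ?nd = "real (\<nu> N) * \<delta> N"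
  let ?s = "\<lambda>j. m N xs j * (1 - m N xs j)"
  have m01: "0 \<le> m N xs j" "m N xs j \<le> 1" for j by (rule clear_prob_bounds)+
  have s0: "0 \<le> ?s j" for j using m01[of j] by simp
  have sK: "?s j \<le> K * ?nd" if "j \<in> ?J" "W N xs x j \<noteq> 0" for j
  proof -
    have "?s j \<le> 1 * (1 - m N xs j)" using m01[of j] by (intro mult_right_mono) auto
    then show ?thesis using good_group(5)[OF s x g \<kappa> that] by simp
  qed
  have nd0: "0 \<le> ?nd" using B by simp
  have v: "v x \<le> K" using Kbv[OF x] by auto
  have "\<bar>(\<Sum>j\<in>?J. (W N xs x j)\<^sup>2) - \<rho> N * v x\<bar> \<le> \<kappa> * \<rho> N"
    using g unfolding good_def by blast
  then have "(\<Sum>j\<in>?J. (W N xs x j)\<^sup>2) \<le> \<rho> N * v x + \<kappa> * \<rho> N" by linarith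
  also have "\<dots> \<le> \<rho> N * K + 1 * \<rho> N"
    using v B(9) \<kappa> by (intro add_mono mult_left_mono mult_right_mono) auto
  also have "\<dots> = (K + 1) * \<rho> N" by (simp only: distrib_right mult.commute)
  finally show 2: "(\<Sum>j\<in>?J. (W N xs x j)\<^sup>2) \<le> (K + 1) * \<rho> N" .
  \<comment> \<open>The variance bound is available only for groups carrying weight; for the others
    the power of the weight is zero since \<open>k \<ge> 1\<close>.\<close>
  have gen: "(\<Sum>j\<in>?J. \<bar>W N xs x j\<bar> ^ k * ?s j ^ i) \<le> C * (K * ?nd) ^ i" if "(\<Sum>j\<in>?J. \<bar>W N xs x j\<bar> ^ k) \<le> C" "k \<ge> 1" for k C i
  proof -
    have "(\<Sum>j\<in>?J. \<bar>W N xs x j\<bar> ^ k * ?s j ^ i) \<le> (\<Sum>j\<in>?J. \<bar>W N xs x j\<bar> ^ k * (K * ?nd) ^ i)"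
    proof (rule sum_mono)
      fix j assume j: "j \<in> ?J"
      show "\<bar>W N xs x j\<bar> ^ k * ?s j ^ i \<le> \<bar>W N xs x j\<bar> ^ k * (K * ?nd) ^ i"
      proof (cases "W N xs x j = 0")
        case False
        then show ?thesis using sK[OF j False] s0 by (intro mult_left_mono power_mono) auto
      qed (use that in \<open>simp add: power_0_left\<close>)
    qed
    also have "\<dots> = (\<Sum>j\<in>?J. \<bar>W N xs x j\<bar> ^ k) * (K * ?nd) ^ i" by (rule sum_distrib_right[symmetric])
    also have "\<dots> \<le> C * (K * ?nd) ^ i" using that K nd0 by (intro mult_right_mono) auto
    finally show ?thesis .
  qed
  show "cvar N xs x \<le> (K + 1) * K * (\<rho> N * ?nd)"
    using gen[of 2 "(K + 1) * \<rho> N" 1] 2 unfolding cvar_def by (simp add: mult_ac)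
  have 3: "(\<Sum>j\<in>?J. \<bar>W N xs x j\<bar> ^ 3) \<le> K1 * (\<rho> N)\<^sup>2" and 4: "(\<Sum>j\<in>?J. \<bar>W N xs x j\<bar> ^ 4) \<le> K1 * (\<rho> N) ^ 3"
    using g unfolding good_def by blast+
  show "(\<Sum>j=1..N div \<nu> N. \<bar>W N xs x j\<bar> ^ 3 * ?s j) \<le> K1 * K * ((\<rho> N)\<^sup>2 * ?nd)"
    using gen[OF 3, of 1] by (simp add: mult_ac)
  show "(\<Sum>j=1..N div \<nu> N. (W N xs x j) ^ 4 * ?s j) \<le> K1 * K * ((\<rho> N) ^ 3 * ?nd)"
    using gen[OF 4, of 1] by (simp add: mult_ac power_even_abs)
  show "(\<Sum>j=1..N div \<nu> N. (W N xs x j) ^ 4 * (?s j)\<^sup>2) \<le> K1 * K\<^sup>2 * ((\<rho> N) ^ 3 * ?nd\<^sup>2)"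
    using gen[OF 4, of 2] by (simp add: mult_ac power_even_abs power_mult_distrib)
qed

text \<open>On the window the clear probability differs from \<mu> by at most order
  \<open>\<nu> * \<delta> * h\<close>, so all Bernoulli variances may be replaced by
  \<open>\<mu> * (1 - \<mu>)\<close>; (S3) then evaluates the sum of squared weights.\<close>

lemma variance_expansion:
  assumes s: "small N \<kappa>" and x: "x \<in> I" and g: "good N \<kappa> K1 x xs" and \<kappa>: "0 < \<kappa>" "\<kappa> \<le> 1"
  shows "\<bar>(L N x)\<^sup>2 * cvar N xs x - A2 N x\<bar> \<le> K * (K + 1)\<^sup>2 / c\<^sup>2 * (\<kappa> + h N) * (\<delta> N / (real N * h N))"
proof -
  have N: "N0 \<le> N" using s by (simp add: small_def)
  note B = basic[OF N]
  note R = p_range[OF N I_sub[OF x]]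
  note MU = mu_range[OF N x]
  let ?J = "{1..N div \<nu> N}" and ?nd = "real (\<nu> N) * \<delta> N"
  let ?s = "\<lambda>j. m N xs j * (1 - m N xs j)"
  let ?v = "\<mu> N x * (1 - \<mu> N x)"
  have m01: "0 \<le> m N xs j" "m N xs j \<le> 1" for j by (rule clear_prob_bounds)+
  have each: "\<bar>(W N xs x j)\<^sup>2 * (?s j - ?v)\<bar> \<le> (W N xs x j)\<^sup>2 * (K * (K + 1) * (?nd * h N))" if j: "j \<in> ?J" for j
  proof (cases "W N xs x j = 0")
    case False
    \<comment> \<open>The second factor has modulus at most 1: \<open>y * (1 - y)\<close> is
      Lipschitz with constant 1 on the unit interval.\<close>
    have "?s j - ?v = (m N xs j - \<mu> N x) * (1 - m N xs j - \<mu> N x)" by (simp add: algebra_simps)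
    then have "\<bar>?s j - ?v\<bar> = \<bar>m N xs j - \<mu> N x\<bar> * \<bar>1 - m N xs j - \<mu> N x\<bar>" by (simp add: abs_mult)
    also have "\<dots> \<le> \<bar>m N xs j - \<mu> N x\<bar> * 1" using m01[of j] MU by (intro mult_left_mono) auto
    also have "\<dots> \<le> K * (K + 1) * (?nd * h N)" using good_group(4)[OF s x g \<kappa> j False] by simp
    finally show ?thesis unfolding abs_mult by (simp add: mult_left_mono)
  qed simp
  have "cvar N xs x - ?v * (\<Sum>j\<in>?J. (W N xs x j)\<^sup>2) = (\<Sum>j\<in>?J. (W N xs x j)\<^sup>2 * (?s j - ?v))"
    unfolding cvar_def sum_distrib_left sum_subtractf[symmetric] by (intro sum.cong refl) (simp add: algebra_simps)
  then have "\<bar>cvar N xs x - ?v * (\<Sum>j\<in>?J. (W N xs x j)\<^sup>2)\<bar> \<le> (\<Sum>j\<in>?J. (W N xs x j)\<^sup>2 * (K * (K + 1) * (?nd * h N)))"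
    by (simp only:) (rule order_trans[OF sum_abs], intro sum_mono each)
  also have "\<dots> = (\<Sum>j\<in>?J. (W N xs x j)\<^sup>2) * (K * (K + 1) * (?nd * h N))" by (rule sum_distrib_right[symmetric])
  also have "\<dots> \<le> ((K + 1) * \<rho> N) * (K * (K + 1) * (?nd * h N))"
    using good_sums(1)[OF s x g \<kappa>] K B by (intro mult_right_mono) auto
  also have "\<dots> = K * (K + 1)\<^sup>2 * h N * (\<rho> N * ?nd)"
    by (simp only: power2_eq_square mult_ac)
  finally have e1: "\<bar>cvar N xs x - ?v * (\<Sum>j\<in>?J. (W N xs x j)\<^sup>2)\<bar> \<le> K * (K + 1)\<^sup>2 * h N * (\<rho> N * ?nd)" .
  have "\<bar>(\<Sum>j\<in>?J. (W N xs x j)\<^sup>2) - \<rho> N * v x\<bar> \<le> \<kappa> * \<rho> N"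
    using g unfolding good_def by blast
  moreover have v: "0 \<le> ?v" "?v \<le> K * ?nd"
  proof -
    show "0 \<le> ?v" using MU by simp
    have "?v \<le> 1 * (1 - \<mu> N x)" using MU by (intro mult_right_mono) auto
    then show "?v \<le> K * ?nd" using MU(4) by (simp add: mult_ac)
  qed
  ultimately have "\<bar>?v\<bar> * \<bar>(\<Sum>j\<in>?J. (W N xs x j)\<^sup>2) - \<rho> N * v x\<bar> \<le> (K * ?nd) * (\<kappa> * \<rho> N)"
    using K B by (intro mult_mono) auto
  then have e2: "\<bar>?v * (\<Sum>j\<in>?J. (W N xs x j)\<^sup>2) - ?v * (\<rho> N * v x)\<bar> \<le> K * \<kappa> * (\<rho> N * ?nd)"
    unfolding right_diff_distrib[symmetric] abs_mult by (simp only: mult_ac)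
  have z0: "0 \<le> \<rho> N * ?nd" using B by simp
  have "K * 1 \<le> K * (K + 1)\<^sup>2" using K by (intro mult_left_mono one_le_power) auto
  then have "K * \<kappa> * (\<rho> N * ?nd) \<le> K * (K + 1)\<^sup>2 * \<kappa> * (\<rho> N * ?nd)"
    using \<kappa> z0 by (intro mult_right_mono) auto
  then have e3: "\<bar>cvar N xs x - ?v * (\<rho> N * v x)\<bar> \<le> K * (K + 1)\<^sup>2 * (\<kappa> + h N) * (\<rho> N * ?nd)"
    using e1 e2 unfolding distrib_left distrib_right by linarith
  have LA: "(L N x)\<^sup>2 * (?v * (\<rho> N * v x)) = A2 N x"
  proof -
    have alg: "(- a / (n * y))\<^sup>2 * (y * (1 - y) * (n / z * w)) = a\<^sup>2 * (1 - y) * w / (n * y * z)"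
      if "n \<noteq> 0" "y \<noteq> 0" "z \<noteq> 0" for a n y z w :: real
      using that by (simp add: power2_eq_square field_simps)
    show ?thesis unfolding L_def A2_def
    proof (rule alg)
      show "real (\<nu> N) \<noteq> 0" "real N * h N \<noteq> 0" using B by simp_all
      show "\<mu> N x \<noteq> 0" using MU(3) by (rule less_imp_neq[THEN not_sym])
    qed
  qed
  have "\<bar>(L N x)\<^sup>2 * cvar N xs x - A2 N x\<bar> = (L N x)\<^sup>2 * \<bar>cvar N xs x - ?v * (\<rho> N * v x)\<bar>"
    unfolding LA[symmetric] right_diff_distrib[symmetric] by (simp only: abs_mult abs_power2)
  also have "\<dots> \<le> 1 / ((real (\<nu> N))\<^sup>2 * c\<^sup>2) * (K * (K + 1)\<^sup>2 * (\<kappa> + h N) * (\<rho> N * ?nd))"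
    using L_bounds(3)[OF N x] e3 by (intro mult_mono) auto
  also have "\<dots> = K * (K + 1)\<^sup>2 / c\<^sup>2 * (\<kappa> + h N) * (\<delta> N / (real N * h N))"
    using B c by (simp add: field_simps power2_eq_square)
  finally show ?thesis .
qed

lemma root_expansion:
  assumes N: "N0 \<le> N" and x: "x \<in> I" and d: "\<bar>D\<bar> \<le> c / 2"
  shows "\<bar>(1 - root (\<nu> N) (\<mu> N x + D)) - p N x - L N x * D\<bar> \<le> 2 / c\<^sup>2 * (D\<^sup>2 / real (\<nu> N))"
proof -
  note B = basic[OF N]
  note R = p_range[OF N I_sub[OF x]]
  note MU = mu_range[OF N x]
  have q: "0 \<le> 1 - p N x" using R c by linarith
  have rt: "root (\<nu> N) (\<mu> N x) = 1 - p N x"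
    using q B(4) by (intro real_root_power_cancel) auto
  have "\<bar>D\<bar> \<le> \<mu> N x / 2" using d MU by linarith
  from root_taylor[OF B(4) MU(3) this]
  have "\<bar>root (\<nu> N) (\<mu> N x + D) - (1 - p N x) - (1 - p N x) / (real (\<nu> N) * \<mu> N x) * D\<bar>
      \<le> 2 * (1 - p N x) / (real (\<nu> N) * (\<mu> N x)\<^sup>2) * D\<^sup>2" unfolding rt .
  moreover have "(1 - root (\<nu> N) (\<mu> N x + D)) - p N x - L N x * D
      = - (root (\<nu> N) (\<mu> N x + D) - (1 - p N x) - (1 - p N x) / (real (\<nu> N) * \<mu> N x) * D)"
  proof -
    have L: "L N x = - ((1 - p N x) / (real (\<nu> N) * \<mu> N x))" by (simp only: L_def minus_divide_left)
    have "(1 - r) - s - (- q) * D = - (r - (1 - s) - q * D)" for r s q :: real by (simp add: algebra_simps)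
    then show ?thesis unfolding L .
  qed
  ultimately have "\<bar>(1 - root (\<nu> N) (\<mu> N x + D)) - p N x - L N x * D\<bar> \<le> 2 * (1 - p N x) / (real (\<nu> N) * (\<mu> N x)\<^sup>2) * D\<^sup>2"
    by (simp only: abs_minus_cancel)
  also have "\<dots> \<le> 2 * 1 / (real (\<nu> N) * c\<^sup>2) * D\<^sup>2"
    using R MU B c q by (intro mult_right_mono frac_le mult_left_mono power_mono) auto
  also have "\<dots> = 2 / c\<^sup>2 * (D\<^sup>2 / real (\<nu> N))" by simp
  finally show ?thesis .
qed

text \<open>The sign of v is forced by (S3), as a limit of sums of squares. For each \<kappa> one
  good sample is enough, and an event of probability at least 1/2 is not empty.\<close>

lemma v_nonneg:
  assumes wc: "weight_conditions M X \<nu> h w b v {x}" and x: "x \<in> I"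
  shows "0 \<le> v x"
proof (rule field_le_epsilon)
  fix \<kappa> :: real assume \<kappa>: "0 < \<kappa>"
  obtain K1 where "with_prob M (1 / 2) (\<lambda>N \<omega>. \<forall>x\<in>{x}. good N \<kappa> K1 x (obs N \<omega>))"
    using good_whp[OF wc, of "1 / 2"] x \<kappa> by auto
  then have "\<forall>\<^sub>F N in sequentially. N0 \<le> N \<and> (\<exists>xs. good N \<kappa> K1 x xs)"
    unfolding with_prob_def using ev_N0
  proof eventually_elim
    case (elim N)
    then obtain E where E: "E \<in> sets (M N)" "1 - 1 / 2 \<le> measure (M N) E" "\<forall>\<omega>\<in>E. good N \<kappa> K1 x (obs N \<omega>)" by auto
    then have "E \<noteq> {}" by auto
    then show ?case using E elim by blast
  qed
  then obtain N xs where N: "N0 \<le> N" and g: "good N \<kappa> K1 x xs"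
    by (auto dest: eventually_happens)
  note B = basic[OF N]
  have "0 \<le> (\<Sum>j=1..N div \<nu> N. (W N xs x j)\<^sup>2)" by (rule sum_nonneg) simp
  moreover have "\<bar>(\<Sum>j=1..N div \<nu> N. (W N xs x j)\<^sup>2) - \<rho> N * v x\<bar> \<le> \<kappa> * \<rho> N"
    using g unfolding good_def by blast
  ultimately have "0 \<le> \<rho> N * v x + \<kappa> * \<rho> N" by linarith
  then have "0 \<le> \<rho> N * (v x + \<kappa>)" by (simp only: distrib_left mult.commute[of \<kappa>])
  then show "0 \<le> v x + \<kappa>" using B(9) by (simp only: zero_le_mult_iff) linarith
qed

section \<open>The error at a point\<close>

abbreviation PX :: "nat \<Rightarrow> (nat \<Rightarrow> real) measure" where
  "PX N \<equiv> PiM {1..N} (\<lambda>_. borel)"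

text \<open>The observations cut off outside \<open>{1..N}\<close>, which makes them a point of
  \<open>PX N\<close>; \<open>obs\<close> agrees with it on these indices only.\<close>

abbreviation smp :: "nat \<Rightarrow> 'a \<Rightarrow> nat \<Rightarrow> real" where
  "smp N \<equiv> binary_sample.sample N (X N)"

abbreviation rsp :: "nat \<Rightarrow> 'a \<Rightarrow> nat \<Rightarrow> bool" where
  "rsp N \<equiv> binary_sample.resp N (Y N)"

lemma smp_eq: "1 \<le> N \<Longrightarrow> i \<in> {1..N} \<Longrightarrow> X N i \<omega> = smp N \<omega> i"
  by (simp add: binary_sample.sample_def[OF sample_interp])

lemma rsp_eq: "1 \<le> N \<Longrightarrow> rsp N \<omega> = (\<lambda>i. i \<in> {1..N} \<and> Y N i \<omega> = 1)"
  by (simp add: binary_sample.resp_def[OF sample_interp] fun_eq_iff)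

lemma good_smp: "1 \<le> N \<Longrightarrow> good N \<kappa> K1 x (obs N \<omega>) \<longleftrightarrow> good N \<kappa> K1 x (smp N \<omega>)"
  by (rule good_cong) (rule smp_eq)

lemma W_measurable:
  assumes "1 \<le> N" "j \<in> {1..N div \<nu> N}" "x \<in> I"
  shows "(\<lambda>xs. W N xs x j) \<in> borel_measurable (PX N)"
proof -
  have wm: "(\<lambda>xs. weight w N xs k x) \<in> borel_measurable (PX N)" if "k \<in> {1..N div \<nu> N}" for k
    unfolding weight_def
  proof (rule measurable_compose[where g = "w N k x" and N = "PX N"])
    show "(\<lambda>xs. \<lambda>i\<in>{1..N}. order_stat N xs i) \<in> measurable (PX N) (PX N)"
      by (rule measurable_restrict) measurable
    show "w N k x \<in> borel_measurable (PX N)" using w_measurable assms that by blast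
  qed
  then show ?thesis
    unfolding W_def weight_sum_def using assms(2)
    by (intro borel_measurable_divide borel_measurable_sum) auto
qed

lemma good_measurable:
  assumes N: "1 \<le> N" and x: "x \<in> I"
  shows "{xs\<in>space (PX N). good N \<kappa> K1 x xs} \<in> sets (PX N)"
proof -
  note Wm = W_measurable[OF N _ x]
  have gm [measurable]: "(\<lambda>xs. group_mean (\<nu> N) N xs j) \<in> borel_measurable (PX N)" for j
    by (rule measurable_group_mean)
  have s: "(\<lambda>xs. \<Sum>j=1..N div \<nu> N. G (W N xs x j) (group_mean (\<nu> N) N xs j)) \<in> borel_measurable (PX N)"
    if "(\<lambda>(a, t). G a t) \<in> borel_measurable (borel \<Otimes>\<^sub>M borel)" for G :: "real \<Rightarrow> real \<Rightarrow> real"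
  proof (rule borel_measurable_sum)
    fix j assume "j \<in> {1..N div \<nu> N}"
    note [measurable] = Wm[OF this] that
    have "(\<lambda>xs. (\<lambda>(a, t). G a t) (W N xs x j, group_mean (\<nu> N) N xs j)) \<in> borel_measurable (PX N)"
      by measurable
    then show "(\<lambda>xs. G (W N xs x j) (group_mean (\<nu> N) N xs j)) \<in> borel_measurable (PX N)" by simp
  qed
  have [measurable]: "(\<lambda>xs. \<Sum>j=1..N div \<nu> N. W N xs x j) \<in> borel_measurable (PX N)"
    by (rule s[of "\<lambda>a t. a"]) measurable
  have [measurable]: "(\<lambda>xs. \<Sum>j=1..N div \<nu> N. W N xs x j * (group_mean (\<nu> N) N xs j - x)) \<in> borel_measurable (PX N)"
    by (rule s[of "\<lambda>a t. a * (t - x)"]) measurable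
  have [measurable]: "(\<lambda>xs. \<Sum>j=1..N div \<nu> N. W N xs x j * (group_mean (\<nu> N) N xs j - x)\<^sup>2) \<in> borel_measurable (PX N)"
    by (rule s[of "\<lambda>a t. a * (t - x)\<^sup>2"]) measurable
  have [measurable]: "(\<lambda>xs. \<Sum>j=1..N div \<nu> N. (W N xs x j)\<^sup>2) \<in> borel_measurable (PX N)"
    by (rule s[of "\<lambda>a t. a\<^sup>2"]) measurable
  have [measurable]: "(\<lambda>xs. \<Sum>j=1..N div \<nu> N. \<bar>W N xs x j\<bar>) \<in> borel_measurable (PX N)"
    by (rule s[of "\<lambda>a t. \<bar>a\<bar>"]) measurable
  have [measurable]: "(\<lambda>xs. \<Sum>j=1..N div \<nu> N. \<bar>W N xs x j\<bar> ^ k) \<in> borel_measurable (PX N)" for k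
    by (rule s[of "\<lambda>a t. \<bar>a\<bar> ^ k"]) measurable
  have a: "Measurable.pred (PX N) (\<lambda>xs. \<forall>j\<in>{1..N div \<nu> N}. K * h N < \<bar>group_mean (\<nu> N) N xs j - x\<bar> \<longrightarrow> W N xs x j = 0)"
  proof (rule pred_intros_finite(3))
    fix j assume "j \<in> {1..N div \<nu> N}"
    note [measurable] = Wm[OF this]
    show "Measurable.pred (PX N) (\<lambda>xs. K * h N < \<bar>group_mean (\<nu> N) N xs j - x\<bar> \<longrightarrow> W N xs x j = 0)" by measurable
  qed simp
  have b: "Measurable.pred (PX N) (\<lambda>xs. \<forall>j\<in>{1..N div \<nu> N}. \<bar>group_mean (\<nu> N) N xs j - x\<bar> \<le> K * h N \<longrightarrow>
        (\<forall>i\<in>{1..\<nu> N}. \<bar>order_stat N xs ((j - 1) * \<nu> N + i) - group_mean (\<nu> N) N xs j\<bar> \<le> \<kappa> * h N))"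
    by (intro pred_intros_finite(3) pred_intros_logic(3)) simp_all
  note [measurable] = a b
  show ?thesis unfolding good_def by measurable
qed

lemma S_measurable:
  assumes N: "1 \<le> N" and x: "x \<in> I"
  shows "(\<lambda>xs. S N x xs y) \<in> borel_measurable (PX N)"
proof (rule borel_measurable_sum)
  fix j assume j: "j \<in> {1..N div \<nu> N}"
  note [measurable] = W_measurable[OF N j x]
  have [measurable]: "p N \<in> borel_measurable borel" using pi(1) by measurable
  have [measurable]: "(\<lambda>xs. group_clear (\<nu> N) N xs y j) \<in> borel_measurable (PX N)"
    unfolding group_clear_def by measurable
  show "(\<lambda>xs. W N xs x j * (group_clear (\<nu> N) N xs y j - m N xs j)) \<in> borel_measurable (PX N)"
    by measurable
qed

lemma conditional_model:
  assumes "1 \<le> N"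
  shows "indep_centred (measure_pmf (response_pmf (p N) N xs)) {1..N div \<nu> N}
    (\<lambda>j y. group_clear (\<nu> N) N xs y j - m N xs j)"
  by (rule response_indep_centred(1)) (use nu assms in blast)

lemma conditional_var:
  assumes "1 \<le> N" "j \<in> {1..N div \<nu> N}"
  shows "rexp N xs (\<lambda>y. (group_clear (\<nu> N) N xs y j - m N xs j)\<^sup>2)
     = m N xs j * (1 - m N xs j)"
  by (rule response_indep_centred(2)) (use nu assms in blast)+

lemma conditional_second_moment:
  assumes N: "1 \<le> N"
  shows "rexp N xs (\<lambda>y. (S N x xs y)\<^sup>2) = cvar N xs x"
  unfolding indep_centred.expectation_lin_square[OF conditional_model[OF N]] cvar_def
  by (intro sum.cong refl) (simp only: conditional_var[OF N])

lemma conditional_deviation: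
  assumes N: "1 \<le> N" and x: "x \<in> I" and G: "G \<in> sets (PX N)"
    and bound: "\<And>xs. xs \<in> G \<Longrightarrow> (L N x)\<^sup>2 * cvar N xs x \<le> C * t\<^sup>2" and t: "0 < t" and C: "0 \<le> C"
  shows "{\<omega>\<in>space (M N). smp N \<omega> \<in> G \<and> t \<le> \<bar>L N x * S N x (smp N \<omega>) (rsp N \<omega>)\<bar>} \<in> sets (M N)"
    and "measure (M N) {\<omega>\<in>space (M N). smp N \<omega> \<in> G \<and> t \<le> \<bar>L N x * S N x (smp N \<omega>) (rsp N \<omega>)\<bar>} \<le> C"
proof -
  interpret binary_sample "M N" N "X N" "Y N" "p N" by (rule sample_interp[OF N])
  note [measurable] = S_measurable[OF N x]
  have meas: "{xs\<in>space (PX N). t \<le> \<bar>L N x * S N x xs y\<bar>} \<in> sets (PX N)" for y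
    by measurable
  have le: "rprob N xs {y. t \<le> \<bar>L N x * S N x xs y\<bar>} \<le> C" if xs: "xs \<in> G" for xs
  proof -
    interpret c: indep_centred "measure_pmf (response_pmf (p N) N xs)" "{1..N div \<nu> N}"
      "\<lambda>j y. group_clear (\<nu> N) N xs y j - m N xs j" by (rule conditional_model[OF N])
    have "rprob N xs {y. t \<le> \<bar>L N x * S N x xs y\<bar>}
       \<le> rexp N xs (\<lambda>y. (L N x * S N x xs y)\<^sup>2) / t\<^sup>2"
      using prob_space.chebyshev_zero[OF measure_pmf.prob_space_axioms
          prob_space.bounded_rv_cmult[OF measure_pmf.prob_space_axioms c.brv_lin] t] by simp
    also have "rexp N xs (\<lambda>y. (L N x * S N x xs y)\<^sup>2) = (L N x)\<^sup>2 * cvar N xs x"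
      unfolding power_mult_distrib using conditional_second_moment[OF N, of xs x] by simp
    also have "(L N x)\<^sup>2 * cvar N xs x / t\<^sup>2 \<le> C"
      using bound[OF xs] t by (simp add: divide_le_eq)
    finally show ?thesis .
  qed
  show "{\<omega>\<in>space (M N). smp N \<omega> \<in> G \<and> t \<le> \<bar>L N x * S N x (smp N \<omega>) (rsp N \<omega>)\<bar>} \<in> sets (M N)"
    and "measure (M N) {\<omega>\<in>space (M N). smp N \<omega> \<in> G \<and> t \<le> \<bar>L N x * S N x (smp N \<omega>) (rsp N \<omega>)\<bar>} \<le> C"
    using conditional_prob_le[OF G meas le C] by blast+
qed

lemma p_hat_eq:
  assumes N: "N0 \<le> N" and \<omega>: "\<omega> \<in> space (M N)" and g: "(\<Sum>j=1..N div \<nu> N. W N (smp N \<omega>) x j) = 1"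
  shows "p_est N \<omega> x
    = 1 - root (\<nu> N) (\<mu> N x + (S N x (smp N \<omega>) (rsp N \<omega>) + bias N (smp N \<omega>) x))"
proof -
  note B = basic[OF N]
  have WW: "W N (obs N \<omega>) = W N (smp N \<omega>)" by (rule W_cong) (rule smp_eq[OF B(1)])
  have "mu_hat w (\<nu> N) N (obs N \<omega>) (\<lambda>i. Y N i \<omega>) x
      = (\<Sum>j=1..N div \<nu> N. W N (obs N \<omega>) x j * Z_star (\<nu> N) N (obs N \<omega>) (\<lambda>i. Y N i \<omega>) j)"
    by (simp add: mu_hat_def weighted_mean_def W_def sum_divide_distrib)
  also have "\<dots> = (\<Sum>j=1..N div \<nu> N. W N (smp N \<omega>) x j * group_clear (\<nu> N) N (smp N \<omega>) (rsp N \<omega>) j)"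
    unfolding WW
  proof (intro sum.cong refl arg_cong2[where f = "(*)"])
    fix j assume j: "j \<in> {1..N div \<nu> N}"
    show "Z_star (\<nu> N) N (obs N \<omega>) (\<lambda>i. Y N i \<omega>) j = group_clear (\<nu> N) N (smp N \<omega>) (rsp N \<omega>) j"
      unfolding rsp_eq[OF B(1)]
      by (rule Z_star_eq_group_clear[OF j B(4)]) (use Y01 B(1) \<omega> smp_eq[OF B(1)] in auto)
  qed
  also have "\<dots> = \<mu> N x + (S N x (smp N \<omega>) (rsp N \<omega>) + bias N (smp N \<omega>) x)"
    unfolding bias_def right_diff_distrib sum_subtractf by simp
  finally show ?thesis by (simp add: p_hat_def)
qed

text \<open>The root contributes an error of order \<open>D\<^sup>2 / \<nu>\<close> with
  \<open>D = T + bias\<close>. One factor is bounded by the small number \<tau>; the other, divided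
  by \<nu>, is of the order of \<open>L * T\<close> plus \<open>\<delta> * h\<^sup>2\<close>. Hence
  the error is negligible against the main terms.\<close>

lemma remainder:
  assumes s: "small N \<kappa>" and x: "x \<in> I" and g: "good N \<kappa> K1 x xs" and \<kappa>: "0 < \<kappa>" "\<kappa> \<le> 1" and K1: "1 \<le> K1"
    and \<tau>: "\<bar>T + bias N xs x\<bar> \<le> \<tau>" "\<tau> \<le> c / 2"
  shows "\<bar>(1 - root (\<nu> N) (\<mu> N x + (T + bias N xs x))) - p N x - (L N x * T + B_term \<nu> h p b N x)\<bar>
    \<le> (K1 * (2 * Q0 + K\<^sup>2) + K ^ 3) / c * \<kappa> * (\<delta> N * (h N)\<^sup>2)
      + 2 / c\<^sup>2 * \<tau> * (\<bar>L N x * T\<bar> / c + (K1 * (2 * Q0 + K\<^sup>2) + 2 * K ^ 4) * (\<delta> N * (h N)\<^sup>2))"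
proof -
  have N: "N0 \<le> N" using s by (simp add: small_def)
  note B = basic[OF N]
  let ?D = "T + bias N xs x" and ?Q2 = "K1 * (2 * Q0 + K\<^sup>2) + 2 * K ^ 4"
  have \<tau>0: "0 \<le> \<tau>" using \<tau>(1) by linarith
  have 1: "\<bar>(1 - root (\<nu> N) (\<mu> N x + ?D)) - p N x - L N x * ?D\<bar> \<le> 2 / c\<^sup>2 * (?D\<^sup>2 / real (\<nu> N))"
    by (rule root_expansion[OF N x]) (use \<tau> in linarith)
  have 2: "\<bar>L N x * bias N xs x - B_term \<nu> h p b N x\<bar> \<le> (K1 * (2 * Q0 + K\<^sup>2) + K ^ 3) / c * \<kappa> * (\<delta> N * (h N)\<^sup>2)"
    by (rule bias_expansion(1)[OF s x g \<kappa> K1])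
  have "c / real (\<nu> N) * \<bar>T\<bar> \<le> \<bar>L N x\<bar> * \<bar>T\<bar>" by (rule mult_right_mono[OF L_bounds(2)[OF N x]]) simp
  then have T: "\<bar>T\<bar> / real (\<nu> N) \<le> \<bar>L N x * T\<bar> / c" using c by (simp add: abs_mult field_simps)
  have bb: "\<bar>bias N xs x\<bar> / real (\<nu> N) \<le> ?Q2 * (\<delta> N * (h N)\<^sup>2)"
    using bias_expansion(2)[OF s x g \<kappa> K1] B by (simp add: divide_le_eq mult_ac)
  have "?D\<^sup>2 = \<bar>?D\<bar> * \<bar>?D\<bar>" by (simp add: power2_eq_square)
  also have "\<dots> \<le> \<tau> * (\<bar>T\<bar> + \<bar>bias N xs x\<bar>)"
    using \<tau>(1) \<tau>0 abs_triangle_ineq by (intro mult_mono) auto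
  finally have "?D\<^sup>2 / real (\<nu> N) \<le> \<tau> * (\<bar>T\<bar> + \<bar>bias N xs x\<bar>) / real (\<nu> N)" using B by (intro divide_right_mono) auto
  also have "\<dots> = \<tau> * (\<bar>T\<bar> / real (\<nu> N) + \<bar>bias N xs x\<bar> / real (\<nu> N))" by (simp only: add_divide_distrib[symmetric] times_divide_eq_right)
  also have "\<dots> \<le> \<tau> * (\<bar>L N x * T\<bar> / c + ?Q2 * (\<delta> N * (h N)\<^sup>2))"
    using T bb \<tau>0 by (intro mult_left_mono add_mono) auto
  finally have 3: "2 / c\<^sup>2 * (?D\<^sup>2 / real (\<nu> N)) \<le> 2 / c\<^sup>2 * (\<tau> * (\<bar>L N x * T\<bar> / c + ?Q2 * (\<delta> N * (h N)\<^sup>2)))"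
    by (intro mult_left_mono) auto
  have tri: "\<bar>a - q - (y + z)\<bar> \<le> e2 + e1" if "\<bar>a - q - (y + t)\<bar> \<le> e1" "\<bar>t - z\<bar> \<le> e2" for a q y z t e1 e2 :: real
    using that by linarith
  show ?thesis
    using tri[OF order_trans[OF 1[unfolded distrib_left] 3] 2] by (simp only: distrib_left mult.assoc)
qed

section \<open>Stochastic expansion at a point\<close>

abbreviation q :: "nat \<Rightarrow> real" where "q N \<equiv> \<delta> N / (real N * h N)"

lemma q_pos: "N0 \<le> N \<Longrightarrow> 0 < q N"
  using basic[of N] by simp

text \<open>This bounds the order of \<open>S\<close> itself, before multiplication by
  \<open>L\<close>. The square is the quantity controlled by (T4) times
  \<open>\<delta>\<^sup>2\<close>, and \<delta> is bounded.\<close>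

lemma nu_sqrt_q_small:
  assumes "0 < \<epsilon>"
  shows "\<forall>\<^sub>F N in sequentially. real (\<nu> N) * sqrt (q N) \<le> \<epsilon>"
proof -
  have "0 < (\<epsilon> / K)\<^sup>2" using assms K by simp
  from Nhd_large[OF this] ev_N0 show ?thesis
  proof eventually_elim
    case (elim N)
    note B = basic[OF elim(2)]
    have "(real (\<nu> N) * sqrt (q N))\<^sup>2 = (real (\<nu> N))\<^sup>2 / (real N * h N * \<delta> N) * (\<delta> N)\<^sup>2"
      unfolding power_mult_distrib real_sqrt_pow2[OF less_imp_le[OF q_pos[OF elim(2)]]]
      using B by (simp add: power2_eq_square)
    also have "\<dots> \<le> (\<epsilon> / K)\<^sup>2 * K\<^sup>2"
      using elim(1) B by (intro mult_mono power_mono) auto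
    also have "\<dots> = \<epsilon>\<^sup>2" using K by (simp add: power_divide)
    finally show ?case by (rule power2_le_imp_le) (use assms in simp)
  qed
qed

lemma nu_delta_h2_small:
  assumes "0 < \<epsilon>"
  shows "\<forall>\<^sub>F N in sequentially. real (\<nu> N) * \<delta> N * (h N)\<^sup>2 \<le> \<epsilon>"
proof -
  have "0 < min 1 (\<epsilon> / K)" using assms K by simp
  from h_small[OF this] ev_N0 show ?thesis
  proof eventually_elim
    case (elim N)
    note B = basic[OF elim(2)]
    have "(h N)\<^sup>2 \<le> h N" using elim(1) B by (simp add: power2_eq_square mult_left_le)
    then have "(h N)\<^sup>2 \<le> \<epsilon> / K" using elim(1) by simp
    then have "real (\<nu> N) * \<delta> N * (h N)\<^sup>2 \<le> K * (\<epsilon> / K)"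
      using B K by (intro mult_mono) auto
    then show ?case using K by simp
  qed
qed

lemma pointwise_remainder:
  assumes wc: "weight_conditions M X \<nu> h w b v {x}" and x: "x \<in> I"
  shows "o_prob M (\<lambda>N \<omega>. p_est N \<omega> x - p N x
      - (L N x * S N x (smp N \<omega>) (rsp N \<omega>) + B_term \<nu> h p b N x)) (\<lambda>N. \<delta> N * (h N)\<^sup>2 + sqrt (q N))"
  unfolding o_prob_def o_prob_on_def whp_with_prob
proof (intro allI impI)
  fix \<epsilon> \<eta> :: real assume \<epsilon>: "0 < \<epsilon>" and \<eta>: "0 < \<eta>"
  define \<theta> where "\<theta> = \<eta> / 2"
  have \<theta>: "0 < \<theta>" using \<eta> by (simp add: \<theta>_def)
  obtain K1 where K1: "1 \<le> K1" and gw: "\<And>\<kappa>. 0 < \<kappa> \<Longrightarrow> with_prob M \<theta> (\<lambda>N \<omega>. \<forall>x\<in>{x}. good N \<kappa> K1 x (obs N \<omega>))"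
    using good_whp[OF wc _ \<theta>] x by auto
  define Q1 Q2 where "Q1 = (K1 * (2 * Q0 + K\<^sup>2) + K ^ 3) / c" and "Q2 = K1 * (2 * Q0 + K\<^sup>2) + 2 * K ^ 4"
  have Q: "0 < Q1" "0 < Q2" using K1 Q0 K c by (auto simp: Q1_def Q2_def intro!: divide_pos_pos add_pos_nonneg mult_pos_pos)
  \<comment> \<open>Bounds the conditional variance of \<open>L * S\<close> in units of
    \<open>q\<close>: \<open>A2_bound\<close> plus the error of \<open>variance_expansion\<close>,
    in which \<open>\<kappa> + h \<le> 2\<close>.\<close>
  define C where "C = K * K / c + K * (K + 1)\<^sup>2 / c\<^sup>2 * 2"
  have C: "0 < C" using K c by (auto simp: C_def intro!: add_pos_nonneg)
  \<comment> \<open>The multiple of the standard deviation beyond which Chebyshev's inequality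
    leaves probability \<theta>.\<close>
  define T where "T = sqrt (C / \<theta>)"
  have T: "0 < T" "C / T\<^sup>2 = \<theta>" using C \<theta> by (auto simp: T_def)
  define \<kappa> where "\<kappa> = min 1 (\<epsilon> / (2 * Q1))"
  have \<kappa>: "0 < \<kappa>" "\<kappa> \<le> 1" "Q1 * \<kappa> \<le> \<epsilon> / 2"
    using \<epsilon> Q by (auto simp: \<kappa>_def min_def field_simps)
  define Z where "Z = 2 / c\<^sup>2 * (T / c + Q2)"
  have "0 < T / c + Q2" using c T Q by (intro add_pos_pos divide_pos_pos) auto
  moreover have "0 < 2 / c\<^sup>2" using c by simp
  ultimately have Z: "0 < Z" unfolding Z_def by (rule mult_pos_pos[rotated])
  \<comment> \<open>\<open>c / 2\<close> is the range of the expansion of the root; the other entry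
    gives the quadratic remainder half of \<epsilon>.\<close>
  define \<tau> where "\<tau> = min (c / 2) (\<epsilon> / (2 * Z))"
  have \<tau>: "0 < \<tau>" "\<tau> \<le> c / 2" "Z * \<tau> \<le> \<epsilon> / 2"
    using \<epsilon> Z c by (auto simp: \<tau>_def min_def field_simps)
  have dev: "with_prob M \<theta> (\<lambda>N \<omega>. good N \<kappa> K1 x (smp N \<omega>) \<longrightarrow> \<bar>L N x * S N x (smp N \<omega>) (rsp N \<omega>)\<bar> < T * sqrt (q N))"
  proof (rule with_prob_event)
    show "\<forall>\<^sub>F N in sequentially.
       {\<omega>\<in>space (M N). \<not> (good N \<kappa> K1 x (smp N \<omega>) \<longrightarrow> \<bar>L N x * S N x (smp N \<omega>) (rsp N \<omega>)\<bar> < T * sqrt (q N))} \<in> sets (M N)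
       \<and> measure (M N) {\<omega>\<in>space (M N). \<not> (good N \<kappa> K1 x (smp N \<omega>) \<longrightarrow> \<bar>L N x * S N x (smp N \<omega>) (rsp N \<omega>)\<bar> < T * sqrt (q N))} \<le> \<theta>"
      using ev_small[OF \<kappa>(1)]
    proof eventually_elim
      case (elim N)
      have N: "N0 \<le> N" and h1: "h N \<le> 1" using elim by (auto simp: small_def)
      note B = basic[OF N]
      interpret binary_sample "M N" N "X N" "Y N" "p N" by (rule sample_interp[OF B(1)])
      let ?G = "{xs\<in>space (PX N). good N \<kappa> K1 x xs}"
      have G: "?G \<in> sets (PX N)" by (rule good_measurable[OF B(1) x])
      have t: "0 < T * sqrt (q N)" using T q_pos[OF N] by simp
      have bound: "(L N x)\<^sup>2 * cvar N xs x \<le> \<theta> * (T * sqrt (q N))\<^sup>2" if "xs \<in> ?G" for xs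
      proof -
        have g: "good N \<kappa> K1 x xs" using that by simp
        have "(L N x)\<^sup>2 * cvar N xs x \<le> \<bar>A2 N x\<bar> + K * (K + 1)\<^sup>2 / c\<^sup>2 * (\<kappa> + h N) * q N"
          using variance_expansion[OF elim x g \<kappa>(1,2)] by linarith
        also have "\<dots> \<le> K * K / c * q N + K * (K + 1)\<^sup>2 / c\<^sup>2 * 2 * q N"
          using A2_bound[OF N x] q_pos[OF N] K c \<kappa> h1 by (intro add_mono mult_right_mono mult_left_mono) auto
        also have "\<dots> = C * q N" by (simp only: C_def distrib_right)
        also have "C = \<theta> * T\<^sup>2" using T by (simp add: divide_eq_eq)
        finally show ?thesis using q_pos[OF N] by (simp only: power_mult_distrib real_sqrt_pow2[OF less_imp_le] mult.assoc)
      qed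
      have eq: "{\<omega>\<in>space (M N). \<not> (good N \<kappa> K1 x (smp N \<omega>) \<longrightarrow> \<bar>L N x * S N x (smp N \<omega>) (rsp N \<omega>)\<bar> < T * sqrt (q N))}
         = {\<omega>\<in>space (M N). smp N \<omega> \<in> ?G \<and> T * sqrt (q N) \<le> \<bar>L N x * S N x (smp N \<omega>) (rsp N \<omega>)\<bar>}"
        using measurable_space[OF sample_measurable] by (auto simp: not_less)
      show ?case unfolding eq using conditional_deviation[OF B(1) x G bound t] \<theta> by simp
    qed
  qed (rule prob)
  show "with_prob M \<eta> (\<lambda>N \<omega>. \<forall>t\<in>{()}. \<bar>p_est N \<omega> x - p N x
      - (L N x * S N x (smp N \<omega>) (rsp N \<omega>) + B_term \<nu> h p b N x)\<bar> \<le> \<epsilon> * (\<delta> N * (h N)\<^sup>2 + sqrt (q N)))"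
  proof (rule with_prob_mono[OF with_prob_conj[OF gw[OF \<kappa>(1)] dev prob]])
    \<comment> \<open>Thresholds that keep \<open>S\<close> and the bias each below
      \<open>\<tau> / 2\<close>.\<close>
    have z1: "0 < \<tau> * c / (2 * T)" and z2: "0 < \<tau> / (2 * Q2)" using \<tau> c T Q by auto
    show "\<forall>\<^sub>F N in sequentially. \<forall>\<omega>\<in>space (M N). (\<forall>x\<in>{x}. good N \<kappa> K1 x (obs N \<omega>)) \<and>
        (good N \<kappa> K1 x (smp N \<omega>) \<longrightarrow> \<bar>L N x * S N x (smp N \<omega>) (rsp N \<omega>)\<bar> < T * sqrt (q N)) \<longrightarrow>
        (\<forall>t\<in>{()}. \<bar>p_est N \<omega> x - p N x
          - (L N x * S N x (smp N \<omega>) (rsp N \<omega>) + B_term \<nu> h p b N x)\<bar> \<le> \<epsilon> * (\<delta> N * (h N)\<^sup>2 + sqrt (q N)))"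
      using ev_small[OF \<kappa>(1)] nu_sqrt_q_small[OF z1] nu_delta_h2_small[OF z2]
    proof (eventually_elim, intro ballI impI)
      fix N \<omega> t
      assume s: "small N \<kappa>" and n1: "real (\<nu> N) * sqrt (q N) \<le> \<tau> * c / (2 * T)" and n2: "real (\<nu> N) * \<delta> N * (h N)\<^sup>2 \<le> \<tau> / (2 * Q2)"
        and \<omega>: "\<omega> \<in> space (M N)" and a: "(\<forall>x\<in>{x}. good N \<kappa> K1 x (obs N \<omega>)) \<and>
        (good N \<kappa> K1 x (smp N \<omega>) \<longrightarrow> \<bar>L N x * S N x (smp N \<omega>) (rsp N \<omega>)\<bar> < T * sqrt (q N))"
      have N: "N0 \<le> N" using s by (simp add: small_def)
      note B = basic[OF N]
      define xs where "xs = smp N \<omega>"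
      define R where "R = S N x xs (rsp N \<omega>)"
      have g: "good N \<kappa> K1 x xs" using a good_smp[OF B(1)] by (simp add: xs_def)
      have LS: "\<bar>L N x * R\<bar> \<le> T * sqrt (q N)" using a g by (simp add: xs_def R_def)
      have "c / real (\<nu> N) * \<bar>R\<bar> \<le> \<bar>L N x\<bar> * \<bar>R\<bar>" by (rule mult_right_mono[OF L_bounds(2)[OF N x]]) simp
      also have "\<dots> \<le> T * sqrt (q N)" using LS by (simp add: abs_mult)
      finally have "\<bar>R\<bar> \<le> T / c * (real (\<nu> N) * sqrt (q N))" using c B by (simp add: field_simps)
      also have "\<dots> \<le> T / c * (\<tau> * c / (2 * T))" using n1 T c by (intro mult_left_mono) auto
      finally have R: "\<bar>R\<bar> \<le> \<tau> / 2" using T c by simp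
      have "\<bar>bias N xs x\<bar> \<le> Q2 * (real (\<nu> N) * \<delta> N * (h N)\<^sup>2)"
        unfolding Q2_def by (rule bias_expansion(2)[OF s x g \<kappa>(1,2) K1])
      also have "\<dots> \<le> Q2 * (\<tau> / (2 * Q2))" using n2 Q by (intro mult_left_mono) auto
      finally have "\<bar>bias N xs x\<bar> \<le> \<tau> / 2" using Q by simp
      then have \<tau>': "\<bar>R + bias N xs x\<bar> \<le> \<tau>" using R by linarith
      have sum1: "(\<Sum>j=1..N div \<nu> N. W N (smp N \<omega>) x j) = 1" using g by (simp add: good_def xs_def)
      have "\<bar>p_est N \<omega> x - p N x - (L N x * R + B_term \<nu> h p b N x)\<bar>
         \<le> Q1 * \<kappa> * (\<delta> N * (h N)\<^sup>2) + 2 / c\<^sup>2 * \<tau> * (\<bar>L N x * R\<bar> / c + Q2 * (\<delta> N * (h N)\<^sup>2))"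
        unfolding p_hat_eq[OF N \<omega> sum1, folded xs_def, folded R_def] Q1_def Q2_def
        by (rule remainder[OF s x g \<kappa>(1,2) K1 \<tau>' \<tau>(2)])
      also have "\<dots> \<le> \<epsilon> / 2 * (\<delta> N * (h N)\<^sup>2) + \<epsilon> / 2 * (\<delta> N * (h N)\<^sup>2 + sqrt (q N))"
      proof (rule add_mono)
        have d0: "0 \<le> \<delta> N * (h N)\<^sup>2" and s0: "0 \<le> sqrt (q N)" using B by auto
        show "Q1 * \<kappa> * (\<delta> N * (h N)\<^sup>2) \<le> \<epsilon> / 2 * (\<delta> N * (h N)\<^sup>2)" by (rule mult_right_mono[OF \<kappa>(3) d0])
        have "\<bar>L N x * R\<bar> / c + Q2 * (\<delta> N * (h N)\<^sup>2) \<le> T * sqrt (q N) / c + Q2 * (\<delta> N * (h N)\<^sup>2)"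
          using LS c by (intro add_right_mono divide_right_mono) auto
        also have "\<dots> \<le> (T / c + Q2) * sqrt (q N) + (T / c + Q2) * (\<delta> N * (h N)\<^sup>2)"
          using T c Q d0 s0 by (intro add_mono mult_right_mono) (auto simp: distrib_right)
        also have "\<dots> = (T / c + Q2) * (\<delta> N * (h N)\<^sup>2 + sqrt (q N))" by (simp only: distrib_left add.commute)
        finally have "2 / c\<^sup>2 * \<tau> * (\<bar>L N x * R\<bar> / c + Q2 * (\<delta> N * (h N)\<^sup>2)) \<le> 2 / c\<^sup>2 * \<tau> * ((T / c + Q2) * (\<delta> N * (h N)\<^sup>2 + sqrt (q N)))"
          using \<tau> c by (intro mult_left_mono) auto
        also have "\<dots> = Z * \<tau> * (\<delta> N * (h N)\<^sup>2 + sqrt (q N))" by (simp only: Z_def mult_ac)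
        also have "\<dots> \<le> \<epsilon> / 2 * (\<delta> N * (h N)\<^sup>2 + sqrt (q N))" using \<tau>(3) d0 s0 by (intro mult_right_mono) auto
        finally show "2 / c\<^sup>2 * \<tau> * (\<bar>L N x * R\<bar> / c + Q2 * (\<delta> N * (h N)\<^sup>2)) \<le> \<epsilon> / 2 * (\<delta> N * (h N)\<^sup>2 + sqrt (q N))" .
      qed
      also have "\<dots> \<le> \<epsilon> * (\<delta> N * (h N)\<^sup>2 + sqrt (q N))"
      proof -
        have "0 \<le> \<epsilon> / 2 * sqrt (q N)" using \<epsilon> B by auto
        moreover have "\<epsilon> / 2 * a + \<epsilon> / 2 * (a + z) \<le> \<epsilon> * (a + z)" if "0 \<le> \<epsilon> / 2 * z" for a z :: real
        proof -
          have "\<epsilon> * (a + z) = \<epsilon> / 2 * a + \<epsilon> / 2 * (a + z) + \<epsilon> / 2 * z" by (simp add: field_simps)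
          then show ?thesis using that by linarith
        qed
        ultimately show ?thesis by blast
      qed
      finally show "\<bar>p_est N \<omega> x - p N x
          - (L N x * S N x (smp N \<omega>) (rsp N \<omega>) + B_term \<nu> h p b N x)\<bar> \<le> \<epsilon> * (\<delta> N * (h N)\<^sup>2 + sqrt (q N))"
        unfolding R_def xs_def .
    qed
    show "\<theta> + \<theta> \<le> \<eta>" by (simp add: \<theta>_def)
  qed
qed

section \<open>Asymptotic normality\<close>

lemma A2_lower:
  assumes N: "N0 \<le> N" and x: "x \<in> I" and v: "0 \<le> v x"
  shows "c ^ 3 * \<pi> x * v x * q N \<le> A2 N x"
proof -
  note R = p_range[OF N I_sub[OF x]]
  note MU = mu_range[OF N x]
  note B = basic[OF N]
  let ?a = "1 - p N x"
  \<comment> \<open>\<open>1 - \<mu>\<close> is p times a geometric sum of \<nu> terms, each at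
    least \<mu> and hence at least c. So \<open>1 - \<mu>\<close> is of order
    \<open>\<nu> * \<delta>\<close> also from below wherever \<pi> is positive.\<close>
  have "real (\<nu> N) * c \<le> (\<Sum>i<\<nu> N. ?a ^ i)"
  proof -
    have "(\<Sum>i<\<nu> N. c) \<le> (\<Sum>i<\<nu> N. ?a ^ i)"
    proof (rule sum_mono)
      fix i assume "i \<in> {..<\<nu> N}"
      then have "?a ^ \<nu> N \<le> ?a ^ i" using R c by (intro power_decreasing) auto
      then show "c \<le> ?a ^ i" using MU(1) by linarith
    qed
    then show ?thesis by simp
  qed
  then have "p N x * (real (\<nu> N) * c) \<le> p N x * (\<Sum>i<\<nu> N. ?a ^ i)" using R by (intro mult_left_mono) auto
  also have "\<dots> = 1 - \<mu> N x" using one_diff_power_eq[of ?a "\<nu> N"] by simp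
  finally have mu: "real (\<nu> N) * (\<delta> N * \<pi> x * c) \<le> 1 - \<mu> N x" by (simp add: mult_ac)
  have "c ^ 3 * \<pi> x * v x * q N = c\<^sup>2 * (real (\<nu> N) * (\<delta> N * \<pi> x * c)) * v x / (real (\<nu> N) * 1 * (real N * h N))"
    using B by (simp add: power2_eq_square power3_eq_cube)
  also have "\<dots> \<le> ?a\<^sup>2 * (1 - \<mu> N x) * v x / (real (\<nu> N) * \<mu> N x * (real N * h N))"
  proof (intro frac_le mult_mono)
    show "c\<^sup>2 \<le> ?a\<^sup>2" using R c by (intro power_mono) auto
    show "0 \<le> real (\<nu> N) * (\<delta> N * \<pi> x * c)" using B pi(2) c by simp
    show "0 < real (\<nu> N) * \<mu> N x * (real N * h N)" using B MU(3) by (intro mult_pos_pos) auto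
  qed (use mu v MU B in auto)
  finally show ?thesis by (simp add: A2_def)
qed

text \<open>Lyapunov's condition in explicit form. The squared scaling factor is at most
  \<open>T / (\<nu>\<^sup>2 * q)\<close>, so the powers of \<nu> cancel: the third-order error
  becomes of order \<open>1 / sqrt (N * h * \<delta>)\<close>, the fourth-order one of order \<rho>.
  The last term compares the actual variance with the nominal one.\<close>

lemma conditional_char:
  fixes t a0 :: real
  assumes s: "small N \<kappa>" and x: "x \<in> I" and g: "good N \<kappa> K1 x xs" and \<kappa>: "0 < \<kappa>" "\<kappa> \<le> 1" and K1: "1 \<le> K1"
    and a0: "0 < a0" "a0 * q N \<le> A2 N x"
  defines "T \<equiv> t\<^sup>2 / (c\<^sup>2 * a0)"
  shows "cmod (rexp N xs
        (\<lambda>y. iexp (t * (L N x * S N x xs y / sqrt (A2 N x)))) - of_real (exp (- t\<^sup>2 / 2)))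
    \<le> T * (K1 * K) * sqrt T * sqrt (1 / (real N * h N * \<delta> N)) + T\<^sup>2 * (K1 * K\<^sup>2) * \<rho> N
      + t\<^sup>2 * (K * (K + 1)\<^sup>2 / c\<^sup>2) / a0 * (\<kappa> + h N)"
proof -
  have N: "N0 \<le> N" using s by (simp add: small_def)
  note B = basic[OF N]
  have q: "0 < q N" by (rule q_pos[OF N])
  have A2: "0 < A2 N x" using a0 q by (meson less_le_trans mult_pos_pos)
  interpret C: indep_centred "measure_pmf (response_pmf (p N) N xs)" "{1..N div \<nu> N}"
      "\<lambda>j y. group_clear (\<nu> N) N xs y j - m N xs j" by (rule conditional_model[OF B(1)])
  define \<theta> where "\<theta> = t * L N x / sqrt (A2 N x)"
  let ?J = "{1..N div \<nu> N}" and ?n = "real (\<nu> N)"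
  let ?s = "\<lambda>j. m N xs j * (1 - m N xs j)"
  have th2: "\<theta>\<^sup>2 = t\<^sup>2 * (L N x)\<^sup>2 / A2 N x"
    unfolding \<theta>_def power_divide power_mult_distrib real_sqrt_pow2[OF less_imp_le[OF A2]] ..
  have th2_le: "\<theta>\<^sup>2 \<le> T / (?n\<^sup>2 * q N)"
  proof -
    have "\<theta>\<^sup>2 \<le> t\<^sup>2 * (1 / (?n\<^sup>2 * c\<^sup>2)) / (a0 * q N)"
      unfolding th2 using L_bounds(3)[OF N x] a0 q by (intro frac_le mult_left_mono mult_pos_pos) auto
    also have "\<dots> = T / (?n\<^sup>2 * q N)" by (simp add: T_def)
    finally show ?thesis .
  qed
  have T0: "0 \<le> T" using a0 by (simp add: T_def)
  have nq: "0 < ?n\<^sup>2 * q N" using B q by (intro mult_pos_pos) auto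
  have lin: "t * (L N x * S N x xs y / sqrt (A2 N x)) = C.lin (\<lambda>j. \<theta> * W N xs x j) y" for y
    by (simp add: \<theta>_def sum_distrib_left sum_divide_distrib mult_ac)
  have var: "C.var j = ?s j" if "j \<in> ?J" for j by (rule conditional_var[OF B(1) that])
  have sum2: "(\<Sum>j\<in>?J. (\<theta> * W N xs x j)\<^sup>2 * C.var j) = \<theta>\<^sup>2 * cvar N xs x"
    unfolding cvar_def sum_distrib_left by (intro sum.cong refl) (simp add: var power_mult_distrib)
  have sum3: "(\<Sum>j\<in>?J. \<bar>\<theta> * W N xs x j\<bar> ^ 3 * C.var j) = \<bar>\<theta>\<bar> ^ 3 * (\<Sum>j\<in>?J. \<bar>W N xs x j\<bar> ^ 3 * ?s j)"
    unfolding sum_distrib_left by (intro sum.cong refl) (simp add: var power_mult_distrib abs_mult)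
  have sum4: "(\<Sum>j\<in>?J. (\<theta> * W N xs x j) ^ 4 * (C.var j)\<^sup>2) = \<theta> ^ 4 * (\<Sum>j\<in>?J. (W N xs x j) ^ 4 * (?s j)\<^sup>2)"
    unfolding sum_distrib_left by (intro sum.cong refl) (simp add: var power_mult_distrib)
  have t3: "\<bar>\<theta>\<bar> ^ 3 * (\<Sum>j\<in>?J. \<bar>W N xs x j\<bar> ^ 3 * ?s j) \<le> T * (K1 * K) * sqrt T * sqrt (1 / (real N * h N * \<delta> N))"
  proof -
    have TT: "0 \<le> T / (?n\<^sup>2 * q N)" by (rule divide_nonneg_pos[OF T0 nq])
    have "\<bar>\<theta>\<bar> = sqrt (\<theta>\<^sup>2)" by simp
    also have "\<dots> \<le> sqrt (T / (?n\<^sup>2 * q N))" by (rule real_sqrt_le_mono[OF th2_le])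
    finally have ab: "\<bar>\<theta>\<bar> \<le> sqrt (T / (?n\<^sup>2 * q N))" .
    have "\<bar>\<theta>\<bar> ^ 3 = \<bar>\<theta>\<bar> * \<theta>\<^sup>2" by (simp add: power3_eq_cube power2_eq_square abs_mult[symmetric])
    also have "\<dots> \<le> sqrt (T / (?n\<^sup>2 * q N)) * (T / (?n\<^sup>2 * q N))"
      by (rule mult_mono[OF ab th2_le real_sqrt_ge_zero[OF TT]]) simp
    finally have "\<bar>\<theta>\<bar> ^ 3 * (\<Sum>j\<in>?J. \<bar>W N xs x j\<bar> ^ 3 * ?s j)
       \<le> (sqrt (T / (?n\<^sup>2 * q N)) * (T / (?n\<^sup>2 * q N))) * (K1 * K * ((\<rho> N)\<^sup>2 * (?n * \<delta> N)))"
    proof (rule mult_mono[OF _ good_sums(3)[OF s x g \<kappa>] mult_nonneg_nonneg[OF real_sqrt_ge_zero[OF TT] TT]])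
      show "0 \<le> (\<Sum>j\<in>?J. \<bar>W N xs x j\<bar> ^ 3 * ?s j)"
        by (intro sum_nonneg mult_nonneg_nonneg) (auto simp: clear_prob_bounds)
    qed
    also have "\<dots> = T * (K1 * K) * (sqrt (T / (?n\<^sup>2 * q N)) * (((\<rho> N)\<^sup>2 * (?n * \<delta> N)) / (?n\<^sup>2 * q N)))"
      by simp
    also have "((\<rho> N)\<^sup>2 * (?n * \<delta> N)) / (?n\<^sup>2 * q N) = \<rho> N"
      using B by (simp add: field_simps power2_eq_square)
    also have "sqrt (T / (?n\<^sup>2 * q N)) * \<rho> N = sqrt T * sqrt (1 / (real N * h N * \<delta> N))"
    proof -
      have "\<rho> N = sqrt ((\<rho> N)\<^sup>2)" using B(9) by (simp only: real_sqrt_abs abs_of_pos)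
      then have "sqrt (T / (?n\<^sup>2 * q N)) * \<rho> N = sqrt (T / (?n\<^sup>2 * q N) * (\<rho> N)\<^sup>2)" by (metis real_sqrt_mult)
      also have "T / (?n\<^sup>2 * q N) * (\<rho> N)\<^sup>2 = T * (1 / (real N * h N * \<delta> N))"
        using B by (simp add: field_simps power2_eq_square)
      finally show ?thesis by (simp only: real_sqrt_mult)
    qed
    finally show ?thesis by (simp only: mult.assoc)
  qed
  have t4: "\<theta> ^ 4 * (\<Sum>j\<in>?J. (W N xs x j) ^ 4 * (?s j)\<^sup>2) \<le> T\<^sup>2 * (K1 * K\<^sup>2) * \<rho> N"
  proof -
    have "\<theta> ^ 4 = (\<theta>\<^sup>2)\<^sup>2" by simp
    also have "\<dots> \<le> (T / (?n\<^sup>2 * q N))\<^sup>2" by (rule power_mono[OF th2_le]) simp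
    finally have "\<theta> ^ 4 * (\<Sum>j\<in>?J. (W N xs x j) ^ 4 * (?s j)\<^sup>2)
       \<le> (T / (?n\<^sup>2 * q N))\<^sup>2 * (K1 * K\<^sup>2 * ((\<rho> N) ^ 3 * (?n * \<delta> N)\<^sup>2))"
      using good_sums(5)[OF s x g \<kappa>] by (intro mult_mono) (auto intro!: sum_nonneg)
    also have "\<dots> = T\<^sup>2 * (K1 * K\<^sup>2) * (((\<rho> N) ^ 3 * (?n * \<delta> N)\<^sup>2) / (?n\<^sup>2 * q N)\<^sup>2)"
    proof -
      have "(T / z)\<^sup>2 * (y * d) = T\<^sup>2 * y * (d / z\<^sup>2)" for z y d :: real by (simp add: power_divide)
      then show ?thesis .
    qed
    also have "((\<rho> N) ^ 3 * (?n * \<delta> N)\<^sup>2) / (?n\<^sup>2 * q N)\<^sup>2 = \<rho> N"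
      using B by (simp add: field_simps power2_eq_square power3_eq_cube)
    finally show ?thesis .
  qed
  have cv0: "0 \<le> cvar N xs x"
    unfolding cvar_def using clear_prob_bounds by (auto intro!: sum_nonneg mult_nonneg_nonneg)
  have t5: "\<bar>exp (- (\<theta>\<^sup>2 * cvar N xs x) / 2) - exp (- t\<^sup>2 / 2)\<bar> \<le> t\<^sup>2 * (K * (K + 1)\<^sup>2 / c\<^sup>2) / a0 * (\<kappa> + h N)"
  proof -
    have "\<bar>exp (- (\<theta>\<^sup>2 * cvar N xs x / 2)) - exp (- (t\<^sup>2 / 2))\<bar> \<le> \<bar>\<theta>\<^sup>2 * cvar N xs x / 2 - t\<^sup>2 / 2\<bar>"
      using cv0 by (intro exp_minus_lipschitz) auto
    also have "\<dots> \<le> \<bar>\<theta>\<^sup>2 * cvar N xs x - t\<^sup>2\<bar>" by linarith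
    also have "\<theta>\<^sup>2 * cvar N xs x - t\<^sup>2 = t\<^sup>2 * ((L N x)\<^sup>2 * cvar N xs x - A2 N x) / A2 N x"
      unfolding th2 using A2 by (simp add: field_simps)
    also have "\<bar>\<dots>\<bar> = t\<^sup>2 * \<bar>(L N x)\<^sup>2 * cvar N xs x - A2 N x\<bar> / A2 N x"
      using A2 by (simp add: abs_mult abs_divide)
    also have "\<dots> \<le> t\<^sup>2 * (K * (K + 1)\<^sup>2 / c\<^sup>2 * (\<kappa> + h N) * q N) / (a0 * q N)"
      using variance_expansion[OF s x g \<kappa>] a0 q K \<kappa> B by (intro frac_le mult_left_mono) auto
    also have "\<dots> = t\<^sup>2 * (K * (K + 1)\<^sup>2 / c\<^sup>2) / a0 * (\<kappa> + h N)"
    proof -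
      have "y * (k * z * u) / (a0 * u) = y * k / a0 * z" if "0 < u" for y k z u :: real
        using that a0(1) by simp
      from this[OF q] show ?thesis .
    qed
    finally show ?thesis by simp
  qed
  have "cmod (rexp N xs (\<lambda>y. iexp (t * (L N x * S N x xs y / sqrt (A2 N x))))
      - of_real (exp (- (\<theta>\<^sup>2 * cvar N xs x) / 2)))
    \<le> \<bar>\<theta>\<bar> ^ 3 * (\<Sum>j\<in>?J. \<bar>W N xs x j\<bar> ^ 3 * ?s j) + \<theta> ^ 4 * (\<Sum>j\<in>?J. (W N xs x j) ^ 4 * (?s j)\<^sup>2)"
    using C.char_lin[of "\<lambda>j. \<theta> * W N xs x j"] unfolding lin sum2 sum3 sum4 .
  moreover have "cmod (of_real (exp (- (\<theta>\<^sup>2 * cvar N xs x) / 2)) - of_real (exp (- t\<^sup>2 / 2)))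
      = \<bar>exp (- (\<theta>\<^sup>2 * cvar N xs x) / 2) - exp (- t\<^sup>2 / 2)\<bar>"
    by (simp only: of_real_diff[symmetric] norm_of_real)
  ultimately show ?thesis
    using t3 t4 t5 norm_triangle_via[of "rexp N xs (\<lambda>y. iexp (t * (L N x * S N x xs y / sqrt (A2 N x))))"
        "of_real (exp (- t\<^sup>2 / 2))" "of_real (exp (- (\<theta>\<^sup>2 * cvar N xs x) / 2))"]
    by linarith
qed

definition V :: "real \<Rightarrow> nat \<Rightarrow> 'a \<Rightarrow> real" where
  "V x N \<omega> = L N x * S N x (smp N \<omega>) (rsp N \<omega>) / sqrt (A2 N x)"

lemma V_measurable:
  assumes N: "1 \<le> N" and x: "x \<in> I"
  shows "V x N \<in> borel_measurable (M N)"
proof -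
  interpret binary_sample "M N" N "X N" "Y N" "p N" by (rule sample_interp[OF N])
  note [measurable] = S_measurable[OF N x]
  show ?thesis unfolding V_def
    by (rule sample_resp_measurable[where F = "\<lambda>xs y. L N x * S N x xs y / sqrt (A2 N x)"]) measurable
qed

text \<open>The characteristic function is the mean of the conditional ones. These are within
  \<open>4 * z\<close> of the limit on good samples and within 2 elsewhere; with z and \<eta> both
  \<open>\<epsilon> / 8\<close> the total is below \<epsilon>.\<close>

lemma char_V:
  assumes wc: "weight_conditions M X \<nu> h w b v {x}" and x: "x \<in> I" and pv: "0 < \<pi> x" "0 < v x"
  shows "(\<lambda>N. char (distr (M N) borel (V x N)) t) \<longlonglongrightarrow> of_real (exp (- t\<^sup>2 / 2))"
proof (rule tendstoI)
  fix \<epsilon> :: real assume \<epsilon>: "0 < \<epsilon>"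
  define \<eta> where "\<eta> = \<epsilon> / 8"
  have \<eta>: "0 < \<eta>" using \<epsilon> by (simp add: \<eta>_def)
  obtain K1 where K1: "1 \<le> K1" and gw: "\<And>\<kappa>. 0 < \<kappa> \<Longrightarrow> with_prob M \<eta> (\<lambda>N \<omega>. \<forall>x\<in>{x}. good N \<kappa> K1 x (obs N \<omega>))"
    using good_whp[OF wc _ \<eta>] x by auto
  define a0 where "a0 = c ^ 3 * \<pi> x * v x"
  have a0: "0 < a0" using c pv by (simp add: a0_def)
  define T where "T = t\<^sup>2 / (c\<^sup>2 * a0)"
  define D1 D2 D3 where "D1 = T * (K1 * K) * sqrt T" and "D2 = T\<^sup>2 * (K1 * K\<^sup>2)" and "D3 = t\<^sup>2 * (K * (K + 1)\<^sup>2 / c\<^sup>2) / a0"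
  have T0: "0 \<le> T" using a0 by (simp add: T_def)
  have D: "0 \<le> D1" "0 \<le> D2" "0 \<le> D3" using T0 K K1 a0 by (auto simp: D1_def D2_def D3_def)
  define z where "z = \<epsilon> / 8"
  have z: "0 < z" using \<epsilon> by (simp add: z_def)
  define \<kappa> where "\<kappa> = min 1 (z / (D3 + 1))"
  have \<kappa>: "0 < \<kappa>" "\<kappa> \<le> 1" "D3 * \<kappa> \<le> z"
  proof -
    show "0 < \<kappa>" "\<kappa> \<le> 1" using z D by (auto simp: \<kappa>_def add_nonneg_pos)
    have "D3 * \<kappa> \<le> D3 * (z / (D3 + 1))" using D by (intro mult_left_mono) (auto simp: \<kappa>_def)
    also have "\<dots> \<le> z" using D z by (simp add: field_simps)
    finally show "D3 * \<kappa> \<le> z" .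
  qed
  have p1: "0 < (z / (D1 + 1))\<^sup>2" and p2: "0 < z / (D2 + 1)" and p3: "0 < z / (D3 + 1)"
    using z D by (auto simp: add_nonneg_pos)
  show "\<forall>\<^sub>F N in sequentially. dist (char (distr (M N) borel (V x N)) t) (of_real (exp (- t\<^sup>2 / 2))) < \<epsilon>"
    using gw[OF \<kappa>(1), unfolded with_prob_def] ev_small[OF \<kappa>(1)] Nhd_large[OF p1] rho_small[OF p2] h_small[OF p3]
  proof eventually_elim
    case (elim N)
    have N: "N0 \<le> N" using elim(2) by (simp add: small_def)
    note B = basic[OF N]
    interpret binary_sample "M N" N "X N" "Y N" "p N" by (rule sample_interp[OF B(1)])
    note [measurable] = S_measurable[OF B(1) x] V_measurable[OF B(1) x]
    let ?z = "of_real (exp (- t\<^sup>2 / 2)) :: complex"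
    define F where "F xs y = iexp (t * (L N x * S N x xs y / sqrt (A2 N x)))" for xs y
    define g where "g \<omega> = (\<integral>y. F (smp N \<omega>) y \<partial>measure_pmf (response_pmf (p N) N (smp N \<omega>)))" for \<omega>
    have Fm: "(\<lambda>xs. F xs y) \<in> borel_measurable (PX N)" for y
      unfolding F_def by measurable
    have Fb: "cmod (F xs y) \<le> 1" for xs y unfolding F_def by simp
    have char: "char (distr (M N) borel (V x N)) t = (\<integral>\<omega>. g \<omega> \<partial>M N)"
    proof -
      have "char (distr (M N) borel (V x N)) t = (\<integral>\<omega>. F (smp N \<omega>) (rsp N \<omega>) \<partial>M N)"
        unfolding char_def F_def V_def[symmetric] by (subst integral_distr) auto
      also have "\<dots> = (\<integral>\<omega>. g \<omega> \<partial>M N)"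
        unfolding g_def by (rule disintegration(1)[OF Fm Fb])
      finally show ?thesis .
    qed
    have gm [measurable]: "g \<in> borel_measurable (M N)"
      unfolding g_def by (rule disintegration(2)[OF Fm Fb])
    have g1: "cmod (g \<omega>) \<le> 1" for \<omega>
    proof -
      have "cmod (g \<omega>) \<le> (\<integral>y. cmod (F (smp N \<omega>) y) \<partial>measure_pmf (response_pmf (p N) N (smp N \<omega>)))"
        unfolding g_def by (rule integral_norm_bound)
      also have "\<dots> \<le> (\<integral>y. 1 \<partial>measure_pmf (response_pmf (p N) N (smp N \<omega>)))"
        by (intro integral_mono integrable_measure_pmf_finite finite_set_response_pmf Fb)
      finally show ?thesis by simp
    qed
    have small1: "cmod (g \<omega> - ?z) \<le> 4 * z" if gd: "good N \<kappa> K1 x (smp N \<omega>)" for \<omega>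
    proof -
      have "a0 * q N \<le> A2 N x" unfolding a0_def by (rule A2_lower[OF N x]) (use pv in simp)
      from conditional_char[OF elim(2) x gd \<kappa>(1,2) K1 a0 this, of t]
      have "cmod (g \<omega> - ?z) \<le> D1 * sqrt (1 / (real N * h N * \<delta> N)) + D2 * \<rho> N + D3 * (\<kappa> + h N)"
        unfolding g_def F_def T_def[symmetric] D1_def[symmetric] D2_def[symmetric] D3_def[symmetric] .
      moreover have "D1 * sqrt (1 / (real N * h N * \<delta> N)) \<le> z"
      proof -
        have "sqrt (1 / (real N * h N * \<delta> N)) \<le> sqrt ((z / (D1 + 1))\<^sup>2)" using elim(3) by (intro real_sqrt_le_mono) simp
        also have "\<dots> = z / (D1 + 1)" using z D by simp
        finally have "D1 * sqrt (1 / (real N * h N * \<delta> N)) \<le> D1 * (z / (D1 + 1))" using D by (intro mult_left_mono) auto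
        also have "\<dots> \<le> z" using D z by (simp add: field_simps)
        finally show ?thesis .
      qed
      moreover have "D2 * \<rho> N \<le> z"
      proof -
        have "D2 * \<rho> N \<le> D2 * (z / (D2 + 1))" using D elim(4) by (intro mult_left_mono) auto
        also have "\<dots> \<le> z" using D z by (simp add: field_simps)
        finally show ?thesis .
      qed
      moreover have "D3 * h N \<le> z"
      proof -
        have "D3 * h N \<le> D3 * (z / (D3 + 1))" using D elim(5) by (intro mult_left_mono) auto
        also have "\<dots> \<le> z" using D z by (simp add: field_simps)
        finally show ?thesis .
      qed
      ultimately show ?thesis using \<kappa>(3) unfolding distrib_left by linarith
    qed
    have zn: "cmod ?z \<le> 1" by (simp only: norm_of_real) simp
    define Bd where "Bd = {\<omega>\<in>space (M N). \<not> good N \<kappa> K1 x (smp N \<omega>)}"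
    have "smp N -` {xs\<in>space (PX N). good N \<kappa> K1 x xs} \<inter> space (M N) \<in> sets (M N)"
      by (rule measurable_sets[OF sample_measurable good_measurable[OF B(1) x]])
    then have Gs: "{\<omega>\<in>space (M N). good N \<kappa> K1 x (smp N \<omega>)} \<in> sets (M N)"
    proof (rule back_subst[of "\<lambda>A. A \<in> sets (M N)"])
      show "smp N -` {xs\<in>space (PX N). good N \<kappa> K1 x xs} \<inter> space (M N) = {\<omega>\<in>space (M N). good N \<kappa> K1 x (smp N \<omega>)}"
        using measurable_space[OF sample_measurable] by blast
    qed
    have Bd_eq: "Bd = space (M N) - {\<omega>\<in>space (M N). good N \<kappa> K1 x (smp N \<omega>)}" by (auto simp: Bd_def)
    have Bds [measurable]: "Bd \<in> sets (M N)" unfolding Bd_eq using Gs by blast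
    have PBd: "measure (M N) Bd \<le> \<eta>"
    proof -
      obtain E where E: "E \<in> sets (M N)" "1 - \<eta> \<le> measure (M N) E" "\<forall>\<omega>\<in>E. \<forall>x\<in>{x}. good N \<kappa> K1 x (obs N \<omega>)"
        using elim(1) by blast
      have "E \<subseteq> {\<omega>\<in>space (M N). good N \<kappa> K1 x (smp N \<omega>)}"
        using E good_smp[OF B(1)] sets.sets_into_space by blast
      then have "measure (M N) E \<le> measure (M N) {\<omega>\<in>space (M N). good N \<kappa> K1 x (smp N \<omega>)}"
        using Gs by (intro finite_measure_mono)
      then show ?thesis using E(2) prob_compl[OF Gs] unfolding Bd_eq by linarith
    qed
    have ig: "integrable (M N) g" by (rule integrable_const_bound[where B = 1]) (use g1 in auto)
    then have int: "integrable (M N) (\<lambda>\<omega>. g \<omega> - ?z)" by simp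
    have "(\<integral>\<omega>. g \<omega> \<partial>M N) - ?z = (\<integral>\<omega>. g \<omega> - ?z \<partial>M N)"
      using ig by (subst Bochner_Integration.integral_diff) (auto simp: prob_space)
    then have "cmod ((\<integral>\<omega>. g \<omega> \<partial>M N) - ?z) \<le> (\<integral>\<omega>. cmod (g \<omega> - ?z) \<partial>M N)"
      by (simp only: integral_norm_bound)
    also have "\<dots> \<le> (\<integral>\<omega>. 4 * z + 2 * indicat_real Bd \<omega> \<partial>M N)"
    proof (rule integral_mono)
      show "integrable (M N) (\<lambda>\<omega>. cmod (g \<omega> - ?z))" by (rule integrable_norm[OF int])
      show "integrable (M N) (\<lambda>\<omega>. 4 * z + 2 * indicat_real Bd \<omega>)"
        by (intro Bochner_Integration.integrable_add integrable_mult_right) (auto simp: less_top[symmetric])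
      show "cmod (g \<omega> - ?z) \<le> 4 * z + 2 * indicat_real Bd \<omega>" if "\<omega> \<in> space (M N)" for \<omega>
      proof (cases "\<omega> \<in> Bd")
        case True
        have "cmod (g \<omega> - ?z) \<le> cmod (g \<omega>) + cmod ?z" by (rule norm_triangle_ineq4)
        also have "\<dots> \<le> 1 + 1" by (rule add_mono[OF g1 zn])
        finally show ?thesis using True z by simp
      next
        case False
        then show ?thesis using small1 that by (simp add: Bd_def)
      qed
    qed
    also have "\<dots> = 4 * z + 2 * measure (M N) Bd"
      by (subst Bochner_Integration.integral_add) (auto simp: prob_space less_top[symmetric])
    also have "\<dots> < \<epsilon>" using PBd \<epsilon> unfolding z_def \<eta>_def by linarith
    finally show ?case unfolding char dist_norm .
  qed
qed

text \<open>The model is a probability space only from \<open>N = 1\<close> on, so the continuity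
  theorem is applied to the shifted sequence.\<close>

lemma weak_conv_V:
  assumes wc: "weight_conditions M X \<nu> h w b v {x}" and x: "x \<in> I" and pv: "0 < \<pi> x" "0 < v x"
  shows "weak_conv_m (\<lambda>N. distr (M N) borel (V x N)) std_normal_distribution"
proof -
  have "weak_conv_m (\<lambda>N. distr (M (Suc N)) borel (V x (Suc N))) std_normal_distribution"
  proof (rule levy_continuity)
    show "real_distribution (distr (M (Suc N)) borel (V x (Suc N)))" for N
    proof -
      interpret prob_space "M (Suc N)" using prob by simp
      show ?thesis by (rule real_distribution_distr) (rule V_measurable[OF _ x], simp)
    qed
    show "real_distribution std_normal_distribution" by (rule real_dist_normal_dist)
    show "(\<lambda>N. char (distr (M (Suc N)) borel (V x (Suc N))) t) \<longlonglongrightarrow> char std_normal_distribution t" for t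
      unfolding char_std_normal_distribution by (rule LIMSEQ_Suc[OF char_V[OF assms]])
  qed
  then show ?thesis
    unfolding weak_conv_m_def weak_conv_def by (blast intro: LIMSEQ_imp_Suc)
qed

text \<open>If the nominal variance vanishes, \<open>variance_expansion\<close> shows that the true
  one is negligible against \<open>q\<close>, and Chebyshev's inequality puts the whole fluctuation
  into the remainder.\<close>

lemma degenerate_deviation:
  assumes wc: "weight_conditions M X \<nu> h w b v {x}" and x: "x \<in> I" and A0: "\<And>N. N0 \<le> N \<Longrightarrow> A2 N x = 0"
  shows "o_prob M (\<lambda>N \<omega>. L N x * S N x (smp N \<omega>) (rsp N \<omega>)) (\<lambda>N. \<delta> N * (h N)\<^sup>2 + sqrt (q N))"
  unfolding o_prob_def o_prob_on_def whp_with_prob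
proof (intro allI impI)
  fix \<epsilon> \<eta> :: real assume \<epsilon>: "0 < \<epsilon>" and \<eta>: "0 < \<eta>"
  define \<theta> where "\<theta> = \<eta> / 2"
  have \<theta>: "0 < \<theta>" using \<eta> by (simp add: \<theta>_def)
  obtain K1 where K1: "1 \<le> K1" and gw: "\<And>\<kappa>. 0 < \<kappa> \<Longrightarrow> with_prob M \<theta> (\<lambda>N \<omega>. \<forall>x\<in>{x}. good N \<kappa> K1 x (obs N \<omega>))"
    using good_whp[OF wc _ \<theta>] x by auto
  define C where "C = K * (K + 1)\<^sup>2 / c\<^sup>2"
  have C: "0 < C" using K c by (simp add: C_def)
  define z where "z = \<theta> * \<epsilon>\<^sup>2 / (2 * C)"
  have z: "0 < z" using \<theta> \<epsilon> C by (simp add: z_def)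
  define \<kappa> where "\<kappa> = min 1 z"
  have \<kappa>: "0 < \<kappa>" "\<kappa> \<le> 1" "\<kappa> \<le> z" using z by (auto simp: \<kappa>_def)
  have dev: "with_prob M \<theta> (\<lambda>N \<omega>. good N \<kappa> K1 x (smp N \<omega>) \<longrightarrow> \<bar>L N x * S N x (smp N \<omega>) (rsp N \<omega>)\<bar> < \<epsilon> * sqrt (q N))"
  proof (rule with_prob_event)
    show "\<forall>\<^sub>F N in sequentially.
       {\<omega>\<in>space (M N). \<not> (good N \<kappa> K1 x (smp N \<omega>) \<longrightarrow> \<bar>L N x * S N x (smp N \<omega>) (rsp N \<omega>)\<bar> < \<epsilon> * sqrt (q N))} \<in> sets (M N)
       \<and> measure (M N) {\<omega>\<in>space (M N). \<not> (good N \<kappa> K1 x (smp N \<omega>) \<longrightarrow> \<bar>L N x * S N x (smp N \<omega>) (rsp N \<omega>)\<bar> < \<epsilon> * sqrt (q N))} \<le> \<theta>"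
      using ev_small[OF \<kappa>(1)] h_small[OF z]
    proof eventually_elim
      case (elim N)
      have N: "N0 \<le> N" using elim by (auto simp: small_def)
      note B = basic[OF N]
      interpret binary_sample "M N" N "X N" "Y N" "p N" by (rule sample_interp[OF B(1)])
      let ?G = "{xs\<in>space (PX N). good N \<kappa> K1 x xs}"
      have G: "?G \<in> sets (PX N)" by (rule good_measurable[OF B(1) x])
      have t: "0 < \<epsilon> * sqrt (q N)" using \<epsilon> q_pos[OF N] by simp
      have bound: "(L N x)\<^sup>2 * cvar N xs x \<le> \<theta> * (\<epsilon> * sqrt (q N))\<^sup>2" if "xs \<in> ?G" for xs
      proof -
        have g: "good N \<kappa> K1 x xs" using that by simp
        have "(L N x)\<^sup>2 * cvar N xs x \<le> C * (\<kappa> + h N) * q N"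
          using variance_expansion[OF elim(1) x g \<kappa>(1,2)] unfolding A0[OF N] C_def by linarith
        also have "\<dots> \<le> C * (z + z) * q N"
          using C \<kappa> elim(2) q_pos[OF N] by (intro mult_right_mono mult_left_mono add_mono) auto
        also have "C * (z + z) = \<theta> * \<epsilon>\<^sup>2" using C by (simp add: z_def)
        finally show ?thesis using q_pos[OF N] by (simp only: power_mult_distrib real_sqrt_pow2[OF less_imp_le] mult.assoc)
      qed
      have eq: "{\<omega>\<in>space (M N). \<not> (good N \<kappa> K1 x (smp N \<omega>) \<longrightarrow> \<bar>L N x * S N x (smp N \<omega>) (rsp N \<omega>)\<bar> < \<epsilon> * sqrt (q N))}
         = {\<omega>\<in>space (M N). smp N \<omega> \<in> ?G \<and> \<epsilon> * sqrt (q N) \<le> \<bar>L N x * S N x (smp N \<omega>) (rsp N \<omega>)\<bar>}"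
        using measurable_space[OF sample_measurable] by (auto simp: not_less)
      show ?case unfolding eq using conditional_deviation[OF B(1) x G bound t] \<theta> by simp
    qed
  qed (rule prob)
  show "with_prob M \<eta> (\<lambda>N \<omega>. \<forall>t\<in>{()}. \<bar>L N x * S N x (smp N \<omega>) (rsp N \<omega>)\<bar> \<le> \<epsilon> * (\<delta> N * (h N)\<^sup>2 + sqrt (q N)))"
  proof (rule with_prob_mono[OF with_prob_conj[OF gw[OF \<kappa>(1)] dev prob]])
    show "\<forall>\<^sub>F N in sequentially. \<forall>\<omega>\<in>space (M N). (\<forall>x\<in>{x}. good N \<kappa> K1 x (obs N \<omega>)) \<and>
        (good N \<kappa> K1 x (smp N \<omega>) \<longrightarrow> \<bar>L N x * S N x (smp N \<omega>) (rsp N \<omega>)\<bar> < \<epsilon> * sqrt (q N)) \<longrightarrow>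
        (\<forall>t\<in>{()}. \<bar>L N x * S N x (smp N \<omega>) (rsp N \<omega>)\<bar> \<le> \<epsilon> * (\<delta> N * (h N)\<^sup>2 + sqrt (q N)))"
      using ev_N0
    proof (eventually_elim, intro ballI impI)
      fix N \<omega> t
      assume N: "N0 \<le> N" and a: "(\<forall>x\<in>{x}. good N \<kappa> K1 x (obs N \<omega>)) \<and>
        (good N \<kappa> K1 x (smp N \<omega>) \<longrightarrow> \<bar>L N x * S N x (smp N \<omega>) (rsp N \<omega>)\<bar> < \<epsilon> * sqrt (q N))"
      note B = basic[OF N]
      have "\<bar>L N x * S N x (smp N \<omega>) (rsp N \<omega>)\<bar> < \<epsilon> * sqrt (q N)" using a good_smp[OF B(1)] by blast
      moreover have "\<epsilon> * sqrt (q N) \<le> \<epsilon> * (\<delta> N * (h N)\<^sup>2 + sqrt (q N))" using \<epsilon> B by (intro mult_left_mono) auto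
      ultimately show "\<bar>L N x * S N x (smp N \<omega>) (rsp N \<omega>)\<bar> \<le> \<epsilon> * (\<delta> N * (h N)\<^sup>2 + sqrt (q N))" by linarith
    qed
    show "\<theta> + \<theta> \<le> \<eta>" by (simp add: \<theta>_def)
  qed
qed

lemma X_atomless:
  assumes N: "1 \<le> N"
  shows "measure (M N) {\<omega>\<in>space (M N). X N 1 \<omega> = t} = 0"
proof -
  interpret binary_sample "M N" N "X N" "Y N" "p N" by (rule sample_interp[OF N])
  have "emeasure (M N) (X N 1 -` {t} \<inter> space (M N)) = (\<integral>\<^sup>+s. ennreal (f s) * indicator {t} s \<partial>lborel)"
    by (rule distributed_emeasure) (use density N in auto)
  also have "\<dots> = 0"
    by (subst nn_integral_indicator_singleton) auto
  finally have "emeasure (M N) (X N 1 -` {t} \<inter> space (M N)) = 0" .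
  moreover have "X N 1 -` {t} \<inter> space (M N) = {\<omega>\<in>space (M N). X N 1 \<omega> = t}" by auto
  ultimately show ?thesis by (simp add: measure_def)
qed

theorem pointwise:
  assumes wc: "weight_conditions M X \<nu> h w b v {x}" and x: "x \<in> I"
  shows "\<exists>V. (\<forall>N\<ge>1. V N \<in> borel_measurable (M N))
       \<and> weak_conv_m (\<lambda>N. distr (M N) borel (V N)) std_normal_distribution
       \<and> o_prob M
           (\<lambda>N \<omega>. p_est N \<omega> x - p N x
                   - (A_term \<nu> h p v N x * V N \<omega> + B_term \<nu> h p b N x))
           (\<lambda>N. \<delta> N * (h N)\<^sup>2 + sqrt (\<delta> N / (real N * h N)))"
proof -
  have v0: "0 \<le> v x" by (rule v_nonneg[OF wc x])
  let ?Rem = "\<lambda>N \<omega>. p_est N \<omega> x - p N x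
      - (L N x * S N x (smp N \<omega>) (rsp N \<omega>) + B_term \<nu> h p b N x)"
  let ?r = "\<lambda>N. \<delta> N * (h N)\<^sup>2 + sqrt (q N)"
  have rem: "o_prob M ?Rem ?r" by (rule pointwise_remainder[OF wc x])
  show ?thesis
  proof (cases "0 < \<pi> x \<and> 0 < v x")
    case True
    then have pv: "0 < \<pi> x" "0 < v x" by auto
    show ?thesis
    proof (intro exI[of _ "V x"] conjI allI impI)
      show "V x N \<in> borel_measurable (M N)" if "1 \<le> N" for N by (rule V_measurable[OF that x])
      show "weak_conv_m (\<lambda>N. distr (M N) borel (V x N)) std_normal_distribution"
        by (rule weak_conv_V[OF wc x pv])
      have z: "o_prob M (\<lambda>N \<omega>. 0) ?r"
        unfolding o_prob_def o_prob_on_def whp_with_prob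
      proof (intro allI impI)
        fix \<epsilon> \<eta> :: real assume e: "0 < \<epsilon>" "0 < \<eta>"
        show "with_prob M \<eta> (\<lambda>N \<omega>. \<forall>t\<in>{()}. \<bar>0\<bar> \<le> \<epsilon> * ?r N)"
        proof (rule with_prob_event)
          show "\<forall>\<^sub>F N in sequentially. {\<omega>\<in>space (M N). \<not> (\<forall>t\<in>{()}. \<bar>0\<bar> \<le> \<epsilon> * ?r N)} \<in> sets (M N)
             \<and> measure (M N) {\<omega>\<in>space (M N). \<not> (\<forall>t\<in>{()}. \<bar>0\<bar> \<le> \<epsilon> * ?r N)} \<le> \<eta>"
            using ev_N0
          proof eventually_elim
            case (elim N)
            have "0 \<le> ?r N" using basic[OF elim] by (intro add_nonneg_nonneg mult_nonneg_nonneg) auto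
            then have "0 \<le> \<epsilon> * ?r N" using e(1) by (intro mult_nonneg_nonneg) auto
            then show ?case using e(2) by simp
          qed
        qed (rule prob)
      qed
      show "o_prob M (\<lambda>N \<omega>. p_est N \<omega> x - p N x
            - (A_term \<nu> h p v N x * V x N \<omega> + B_term \<nu> h p b N x)) ?r"
      proof (rule o_prob_add[OF rem z prob])
        show "\<forall>\<^sub>F N in sequentially. \<forall>\<omega>\<in>space (M N). p_est N \<omega> x - p N x
            - (A_term \<nu> h p v N x * V x N \<omega> + B_term \<nu> h p b N x) = ?Rem N \<omega> + 0"
          using ev_N0
        proof eventually_elim
          case (elim N)
          have "0 < c ^ 3 * \<pi> x * v x * q N" using c pv q_pos[OF elim] by (intro mult_pos_pos) auto
          then have "0 < A2 N x" using A2_lower[OF elim x v0] by linarith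
          then have "A_term \<nu> h p v N x * V x N \<omega> = L N x * S N x (smp N \<omega>) (rsp N \<omega>)" for \<omega>
            unfolding A_term_sq[OF elim x] V_def by simp
          then show ?case by simp
        qed
      qed
    qed
  next
    \<comment> \<open>Either v vanishes at x, or \<pi> does and then \<open>\<mu> = 1\<close>; in
      both cases the coefficient of \<open>V\<close> is zero. An exactly normal variable is then
      used for \<open>V\<close>.\<close>
    case False
    have p0: "0 \<le> \<pi> x" using pi(2) by blast
    have A0: "A2 N x = 0" if "N0 \<le> N" for N
      using False p0 v0 unfolding A2_def by (cases "\<pi> x = 0") auto
    have "\<exists>V. \<forall>N\<ge>1. V N \<in> borel_measurable (M N) \<and> distr (M N) borel (V N) = std_normal_distribution"
    proof -
      have "\<forall>N. \<exists>V. 1 \<le> N \<longrightarrow> V \<in> borel_measurable (M N) \<and> distr (M N) borel V = std_normal_distribution"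
      proof (intro allI)
        fix N
        show "\<exists>V. 1 \<le> N \<longrightarrow> V \<in> borel_measurable (M N) \<and> distr (M N) borel V = std_normal_distribution"
        proof (cases "1 \<le> N")
          case True
          interpret binary_sample "M N" N "X N" "Y N" "p N" by (rule sample_interp[OF True])
          show ?thesis using exists_std_normal[OF X_measurable X_atomless[OF True]] True by auto
        qed simp
      qed
      then show ?thesis by metis
    qed
    then obtain V where V: "\<And>N. 1 \<le> N \<Longrightarrow> V N \<in> borel_measurable (M N)"
      "\<And>N. 1 \<le> N \<Longrightarrow> distr (M N) borel (V N) = std_normal_distribution" by blast
    show ?thesis
    proof (intro exI[of _ V] conjI allI impI)
      show "V N \<in> borel_measurable (M N)" if "1 \<le> N" for N by (rule V(1)[OF that])
      show "weak_conv_m (\<lambda>N. distr (M N) borel (V N)) std_normal_distribution"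
        unfolding weak_conv_m_def weak_conv_def
      proof (intro allI impI)
        fix y
        have "(\<lambda>N. cdf (distr (M (Suc N)) borel (V (Suc N))) y) \<longlonglongrightarrow> cdf std_normal_distribution y"
          by (simp add: V(2))
        then show "(\<lambda>N. cdf (distr (M N) borel (V N)) y) \<longlonglongrightarrow> cdf std_normal_distribution y"
          by (rule LIMSEQ_imp_Suc)
      qed
      show "o_prob M (\<lambda>N \<omega>. p_est N \<omega> x - p N x
            - (A_term \<nu> h p v N x * V N \<omega> + B_term \<nu> h p b N x)) ?r"
      proof (rule o_prob_add[OF rem degenerate_deviation[OF wc x A0] prob])
        show "\<forall>\<^sub>F N in sequentially. \<forall>\<omega>\<in>space (M N). p_est N \<omega> x - p N x
            - (A_term \<nu> h p v N x * V N \<omega> + B_term \<nu> h p b N x) = ?Rem N \<omega> + L N x * S N x (smp N \<omega>) (rsp N \<omega>)"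
          using ev_N0 by eventually_elim (simp add: A_term_sq[OF _ x] A0)
      qed
    qed
  qed
qed

section \<open>The integrated error\<close>

definition Gn :: "real \<Rightarrow> nat \<Rightarrow> nat" where "Gn a N = nat \<lceil>K * real N powr a\<rceil>"
definition step :: "real \<Rightarrow> nat \<Rightarrow> real" where "step a N = (u - l) / real (Gn a N)"
definition pt :: "real \<Rightarrow> nat \<Rightarrow> nat \<Rightarrow> real" where "pt a N k = l + real k * step a N"
text \<open>The value \<open>Gn a N\<close> occurs at the right end point \<open>u\<close>, so sums
  over the grid run up to and including it.\<close>

definition idx :: "real \<Rightarrow> nat \<Rightarrow> real \<Rightarrow> nat" where "idx a N x = nat \<lfloor>(x - l) / step a N\<rfloor>"

lemma u_l: "0 < u - l" "u - l \<le> K"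
  using I r K by auto

lemma grid:
  assumes N: "N0 \<le> N" and a: "0 < a"
  shows "1 \<le> Gn a N" "0 < step a N" "step a N \<le> real N powr (- a)" "real (Gn a N) \<le> K * real N powr a + 1"
    "real (Gn a N) * step a N = u - l"
proof -
  note B = basic[OF N]
  have "1 \<le> real N powr a" using B a by (simp add: ge_one_powr_ge_zero)
  then have KN: "1 \<le> K * real N powr a" using K mult_mono[of 1 K 1 "real N powr a"] by simp
  have ge: "K * real N powr a \<le> real (Gn a N)" unfolding Gn_def by (rule real_nat_ceiling_ge)
  show G1: "1 \<le> Gn a N" using ge KN by linarith
  show st: "0 < step a N" using G1 u_l by (simp add: step_def)
  show "real (Gn a N) \<le> K * real N powr a + 1" using KN unfolding Gn_def by linarith
  show "real (Gn a N) * step a N = u - l" using G1 by (simp add: step_def)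
  have pos: "0 < real N powr a" using B by simp
  have "step a N \<le> K / (K * real N powr a)"
    unfolding step_def using u_l ge K pos by (intro frac_le) auto
  also have "\<dots> = real N powr (- a)" using K by (simp add: powr_minus_divide)
  finally show "step a N \<le> real N powr (- a)" .
qed

lemma pt_in:
  assumes N: "N0 \<le> N" and a: "0 < a" and k: "k \<le> Gn a N"
  shows "pt a N k \<in> I"
proof -
  note G = grid[OF N a]
  have "real k * step a N \<le> real (Gn a N) * step a N" using k G(2) by (intro mult_right_mono) auto
  moreover have "0 \<le> real k * step a N" using G(2) by simp
  ultimately show ?thesis using G(5) I by (auto simp: pt_def)
qed

lemma idx_props:
  assumes N: "N0 \<le> N" and a: "0 < a" and x: "x \<in> I"
  shows "idx a N x \<le> Gn a N" "pt a N (idx a N x) \<le> x" "x \<le> pt a N (idx a N x) + step a N" "pt a N (idx a N x) \<in> I"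
proof -
  note G = grid[OF N a]
  have q0: "0 \<le> (x - l) / step a N" using x I G(2) by simp
  have r: "real (idx a N x) \<le> (x - l) / step a N" "(x - l) / step a N < real (idx a N x) + 1"
    unfolding idx_def using q0 by linarith+
  have "(x - l) / step a N \<le> (u - l) / step a N" using x I G(2) by (intro divide_right_mono) auto
  also have "\<dots> = real (Gn a N)" using G(2,5) by (simp add: divide_eq_eq)
  finally show i: "idx a N x \<le> Gn a N" using r(1) by linarith
  show "pt a N (idx a N x) \<le> x" using r(1) G(2) by (simp add: pt_def field_simps)
  show "x \<le> pt a N (idx a N x) + step a N" using r(2) G(2) by (simp add: pt_def field_simps)
  show "pt a N (idx a N x) \<in> I" by (rule pt_in[OF N a i])
qed

lemma idx_measurable [measurable]: "idx a N \<in> measurable borel (count_space UNIV)"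
  unfolding idx_def by measurable

abbreviation near :: "real \<Rightarrow> nat \<Rightarrow> nat \<Rightarrow> nat \<Rightarrow> bool" where
  "near a N k k' \<equiv> \<bar>pt a N k - pt a N k'\<bar> \<le> 2 * K * h N"

text \<open>A grid point has of the order of \<open>h / step\<close> neighbours within
  \<open>2 * K * h\<close>, so near pairs are a fraction of order h of all pairs. This is the source
  of the factor h in the variances. The constant is \<open>2 * K\<close>, bounding the total length,
  times \<open>5 * K\<close> from the neighbour count.\<close>

lemma near_sum:
  assumes N: "N0 \<le> N" and a: "0 < a" and st: "step a N \<le> h N"
    and phi: "\<And>k. k \<le> Gn a N \<Longrightarrow> 0 \<le> \<phi> k \<and> \<phi> k \<le> B * step a N" and B: "0 \<le> B"
  shows "(\<Sum>k\<le>Gn a N. \<Sum>k'\<le>Gn a N. if near a N k k' then \<phi> k * \<phi> k' else 0) \<le> 10 * K\<^sup>2 * h N * B\<^sup>2"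
proof -
  note G = grid[OF N a]
  note Bs = basic[OF N]
  have inner: "(\<Sum>k'\<le>Gn a N. if near a N k k' then \<phi> k * \<phi> k' else 0) \<le> (B * step a N)\<^sup>2 * (5 * K * h N / step a N)"
    if k: "k \<le> Gn a N" for k
  proof -
    define m where "m = nat \<lfloor>2 * K * h N / step a N\<rfloor>"
    have q0: "0 \<le> 2 * K * h N / step a N" using K Bs G by simp
    have mr: "real m \<le> 2 * K * h N / step a N" unfolding m_def using q0 by linarith
    have sub: "{k'. k' \<le> Gn a N \<and> near a N k k'} \<subseteq> {k - m..k + m}"
    proof
      fix k' assume "k' \<in> {k'. k' \<le> Gn a N \<and> near a N k k'}"
      then have "\<bar>real k - real k'\<bar> * step a N \<le> 2 * K * h N"
        using G(2) by (simp add: pt_def abs_mult left_diff_distrib[symmetric])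
      then have "\<bar>real k - real k'\<bar> \<le> 2 * K * h N / step a N" using G(2) by (simp add: field_simps)
      then have "\<bar>int k - int k'\<bar> \<le> int m" unfolding m_def using q0 by linarith
      then show "k' \<in> {k - m..k + m}" by auto
    qed
    have "(\<Sum>k'\<le>Gn a N. if near a N k k' then \<phi> k * \<phi> k' else 0) = (\<Sum>k'\<in>{k'. k' \<le> Gn a N \<and> near a N k k'}. \<phi> k * \<phi> k')"
      by (subst sum.inter_filter[symmetric]) (auto intro!: sum.cong)
    also have "\<dots> \<le> (\<Sum>k'\<in>{k'. k' \<le> Gn a N \<and> near a N k k'}. (B * step a N)\<^sup>2)"
      using phi k B G(2) unfolding power2_eq_square by (intro sum_mono mult_mono) auto
    also have "\<dots> = real (card {k'. k' \<le> Gn a N \<and> near a N k k'}) * (B * step a N)\<^sup>2" by simp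
    also have "\<dots> \<le> (5 * K * h N / step a N) * (B * step a N)\<^sup>2"
    proof (rule mult_right_mono)
      have "card {k'. k' \<le> Gn a N \<and> near a N k k'} \<le> card {k - m..k + m}" by (rule card_mono[OF _ sub]) simp
      also have "\<dots> \<le> 2 * m + 1" by auto
      finally have "real (card {k'. k' \<le> Gn a N \<and> near a N k k'}) \<le> 2 * real m + 1" by linarith
      also have "\<dots> \<le> 4 * K * h N / step a N + h N / step a N"
      proof -
        have "1 \<le> h N / step a N" using st G(2) by simp
        then show ?thesis using mr by simp
      qed
      also have "\<dots> \<le> 4 * K * h N / step a N + K * h N / step a N"
        using K Bs G by (intro add_left_mono divide_right_mono) auto
      also have "\<dots> = 5 * K * h N / step a N" by (simp add: add_divide_distrib[symmetric])
      finally show "real (card {k'. k' \<le> Gn a N \<and> near a N k k'}) \<le> 5 * K * h N / step a N" .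
    qed simp
    finally show ?thesis by (simp only: mult.commute)
  qed
  have "(\<Sum>k\<le>Gn a N. \<Sum>k'\<le>Gn a N. if near a N k k' then \<phi> k * \<phi> k' else 0)
      \<le> (\<Sum>k\<le>Gn a N. (B * step a N)\<^sup>2 * (5 * K * h N / step a N))"
    by (intro sum_mono inner) simp
  also have "\<dots> = (real (Gn a N) * step a N + step a N) * (5 * K * h N * B\<^sup>2)"
    using G(2) by (simp add: power2_eq_square field_simps)
  also have "\<dots> \<le> (2 * K) * (5 * K * h N * B\<^sup>2)"
  proof (rule mult_right_mono)
    have "1 * step a N \<le> real (Gn a N) * step a N" using G(1,2) by (intro mult_right_mono) auto
    then show "real (Gn a N) * step a N + step a N \<le> 2 * K" using G(5) u_l by linarith
  qed (use K Bs in simp)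
  also have "\<dots> = 10 * K\<^sup>2 * h N * B\<^sup>2" by (simp add: power2_eq_square)
  finally show ?thesis .
qed

text \<open>Integrating against a function of \<open>idx\<close> gives a finite combination of its
  values at the grid points. Applied to random values, this makes the integrals finite sums of
  random variables with deterministic coefficients.\<close>

lemma step_integral:
  assumes N: "N0 \<le> N" and a: "0 < a" and g: "set_integrable lborel I g"
  defines "ck \<equiv> \<lambda>k. LINT x:I|lborel. g x * of_bool (idx a N x = k)"
  shows "set_integrable lborel I (\<lambda>x. g x * F (idx a N x))"
    and "(LINT x:I|lborel. g x * F (idx a N x)) = (\<Sum>k\<le>Gn a N. ck k * F k)"
    and "(\<And>x. x \<in> I \<Longrightarrow> \<bar>g x\<bar> \<le> B) \<Longrightarrow> \<bar>ck k\<bar> \<le> B * step a N"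
    and "(\<And>x. x \<in> I \<Longrightarrow> 0 \<le> g x) \<Longrightarrow> 0 \<le> ck k"
proof -
  have Fm: "(\<lambda>x. F (idx a N x)) \<in> borel_measurable borel" for F :: "nat \<Rightarrow> real"
    by (rule measurable_compose[OF idx_measurable]) simp
  have gi: "set_integrable lborel I (\<lambda>x. g x * F (idx a N x))" for F :: "nat \<Rightarrow> real"
  proof (rule set_integrable_bounded_mult[OF g Fm])
    fix x assume "x \<in> I"
    then have "idx a N x \<in> {..Gn a N}" using idx_props[OF N a] by simp
    then show "\<bar>F (idx a N x)\<bar> \<le> (\<Sum>k\<le>Gn a N. \<bar>F k\<bar>)" by (intro member_le_sum) auto
  qed
  show "set_integrable lborel I (\<lambda>x. g x * F (idx a N x))" by (rule gi)
  have gk: "set_integrable lborel I (\<lambda>x. g x * of_bool (idx a N x = k))" for k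
    using gi[of "\<lambda>i. of_bool (i = k)"] .
  have Im: "I \<in> sets lborel" using I by simp
  have "(LINT x:I|lborel. g x * F (idx a N x)) = (LINT x:I|lborel. (\<Sum>k\<le>Gn a N. (g x * of_bool (idx a N x = k)) * F k))"
  proof (rule set_lebesgue_integral_cong[OF Im], intro allI impI)
    fix x assume "x \<in> I"
    then have i: "idx a N x \<le> Gn a N" using idx_props[OF N a] by simp
    have "(\<Sum>k\<le>Gn a N. (g x * of_bool (idx a N x = k)) * F k) = (\<Sum>k\<le>Gn a N. if k = idx a N x then g x * F k else 0)"
      by (intro sum.cong) auto
    then show "g x * F (idx a N x) = (\<Sum>k\<le>Gn a N. (g x * of_bool (idx a N x = k)) * F k)"
      using i by simp
  qed
  also have "\<dots> = (\<Sum>k\<le>Gn a N. LINT x:I|lborel. (g x * of_bool (idx a N x = k)) * F k)"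
    by (rule set_lint_sum) (auto intro: set_integrable_mult_left gk)
  also have "\<dots> = (\<Sum>k\<le>Gn a N. ck k * F k)"
    unfolding ck_def by (intro sum.cong refl set_integral_mult_left)
  finally show "(LINT x:I|lborel. g x * F (idx a N x)) = (\<Sum>k\<le>Gn a N. ck k * F k)" .
  show "0 \<le> ck k" if "\<And>x. x \<in> I \<Longrightarrow> 0 \<le> g x"
    unfolding ck_def set_lebesgue_integral_def by (rule Bochner_Integration.integral_nonneg) (simp add: that indicator_def)
  show "\<bar>ck k\<bar> \<le> B * step a N" if B: "\<And>x. x \<in> I \<Longrightarrow> \<bar>g x\<bar> \<le> B"
  proof -
    have "l \<in> I" using I by simp
    then have B0: "0 \<le> B" using B[of l] by linarith
    have st: "0 \<le> step a N" using grid(2)[OF N a] by simp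
    \<comment> \<open>The set where \<open>idx\<close> equals \<open>k\<close> lies in this
      interval, whose length is one step.\<close>
    let ?C = "{pt a N k..pt a N k + step a N}"
    have Ci: "set_integrable lborel I (indicat_real ?C)"
      unfolding set_integrable_def real_scaleR_def
      by (rule integrable_real_mult_indicator) (use I in \<open>auto simp: emeasure_lborel_Icc_eq\<close>)
    have "\<bar>ck k\<bar> \<le> (LINT x:I|lborel. B * indicat_real ?C x)"
      unfolding ck_def
    proof (rule set_integral_abs_le[OF gk])
      show "set_integrable lborel I (\<lambda>x. B * indicat_real ?C x)" by (rule set_integrable_mult_right) (rule Ci)
      fix x assume x: "x \<in> I"
      show "\<bar>g x * of_bool (idx a N x = k)\<bar> \<le> B * indicat_real ?C x"
        using B[OF x] B0 idx_props[OF N a x] by (auto simp: indicator_def)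
    qed
    also have "\<dots> = B * (LINT x:I|lborel. indicat_real ?C x)" by simp
    also have "\<dots> \<le> B * step a N"
    proof (rule mult_left_mono[OF _ B0])
      have "(LINT x:I|lborel. indicat_real ?C x) = (LINT x|lborel. indicat_real (I \<inter> ?C) x)"
        unfolding set_lebesgue_integral_def by (intro Bochner_Integration.integral_cong refl) (auto simp: indicator_def)
      also have "\<dots> = measure lborel (I \<inter> ?C)" by simp
      also have "\<dots> \<le> measure lborel ?C"
        by (rule measure_mono_fmeasurable) (use I in \<open>auto simp: fmeasurable_def emeasure_lborel_Icc_eq\<close>)
      also have "\<dots> = step a N" using st by simp
      finally show "(LINT x:I|lborel. indicat_real ?C x) \<le> step a N" .
    qed
    finally show ?thesis .
  qed
qed

text \<open>The fourth moment has the order of the squared second moment: the sum of fourth powers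
  of the weights is smaller by a factor \<open>1 / (N * h * \<delta>)\<close>.\<close>

lemma fourth_moment:
  assumes s: "small N \<kappa>" and x: "x \<in> I" and g: "good N \<kappa> K1 x xs" and \<kappa>: "0 < \<kappa>" "\<kappa> \<le> 1" and K1: "1 \<le> K1"
    and z: "1 / (real N * h N * \<delta> N) \<le> 1"
  shows "rexp N xs (\<lambda>y. (S N x xs y) ^ 4)
     \<le> (3 * ((K + 1) * K)\<^sup>2 + K1 * K) * ((real (\<nu> N))\<^sup>2 * q N)\<^sup>2"
proof -
  have N: "N0 \<le> N" using s by (simp add: small_def)
  note B = basic[OF N]
  interpret C: indep_centred "measure_pmf (response_pmf (p N) N xs)" "{1..N div \<nu> N}"
      "\<lambda>j y. group_clear (\<nu> N) N xs y j - m N xs j" by (rule conditional_model[OF B(1)])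
  let ?J = "{1..N div \<nu> N}" and ?n = "real (\<nu> N)"
  let ?s = "\<lambda>j. m N xs j * (1 - m N xs j)"
  have var: "C.var j = ?s j" if "j \<in> ?J" for j by (rule conditional_var[OF B(1) that])
  have v2: "(\<Sum>j\<in>?J. (W N xs x j)\<^sup>2 * C.var j) = cvar N xs x"
    unfolding cvar_def by (intro sum.cong refl) (simp add: var)
  have v4: "(\<Sum>j\<in>?J. (W N xs x j) ^ 4 * C.var j) = (\<Sum>j\<in>?J. (W N xs x j) ^ 4 * ?s j)"
    by (intro sum.cong refl) (simp add: var)
  have cv0: "0 \<le> cvar N xs x"
    unfolding cvar_def using clear_prob_bounds by (auto intro!: sum_nonneg mult_nonneg_nonneg)
  have nq: "\<rho> N * (?n * \<delta> N) = ?n\<^sup>2 * q N" by (simp add: power2_eq_square)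
  have "rexp N xs (\<lambda>y. (S N x xs y) ^ 4)
     \<le> 3 * (cvar N xs x)\<^sup>2 + (\<Sum>j\<in>?J. (W N xs x j) ^ 4 * ?s j)"
    using C.expectation_lin_4[of "W N xs x"] unfolding v2 v4 .
  also have "\<dots> \<le> 3 * ((K + 1) * K * (?n\<^sup>2 * q N))\<^sup>2 + K1 * K * ((\<rho> N) ^ 3 * (?n * \<delta> N))"
    using good_sums(2)[OF s x g \<kappa>, unfolded nq] good_sums(4)[OF s x g \<kappa>] cv0
    by (intro add_mono mult_left_mono power_mono) auto
  also have "(\<rho> N) ^ 3 * (?n * \<delta> N) = (?n\<^sup>2 * q N)\<^sup>2 * (1 / (real N * h N * \<delta> N))"
    using B by (simp add: field_simps power2_eq_square power3_eq_cube)
  also have "K1 * K * ((?n\<^sup>2 * q N)\<^sup>2 * (1 / (real N * h N * \<delta> N))) \<le> K1 * K * ((?n\<^sup>2 * q N)\<^sup>2 * 1)"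
    using z K1 K by (intro mult_left_mono) auto
  also have "3 * ((K + 1) * K * (?n\<^sup>2 * q N))\<^sup>2 + K1 * K * ((?n\<^sup>2 * q N)\<^sup>2 * 1)
      = (3 * ((K + 1) * K)\<^sup>2 + K1 * K) * (?n\<^sup>2 * q N)\<^sup>2"
  proof -
    have "3 * (y * z)\<^sup>2 + k * (z\<^sup>2 * 1) = (3 * y\<^sup>2 + k) * z\<^sup>2" for y z k :: real by (simp add: power_mult_distrib distrib_right)
    then show ?thesis .
  qed
  finally show ?thesis by simp
qed

lemma disjoint_support:
  assumes "good N \<kappa> K1 x xs" "good N \<kappa> K1 x' xs" "\<not> \<bar>x - x'\<bar> \<le> 2 * K * h N" "j \<in> {1..N div \<nu> N}"
  shows "W N xs x j = 0 \<or> W N xs x' j = 0"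
proof (rule ccontr)
  assume n: "\<not> ?thesis"
  then have "\<bar>group_mean (\<nu> N) N xs j - x\<bar> \<le> K * h N" "\<bar>group_mean (\<nu> N) N xs j - x'\<bar> \<le> K * h N"
    using assms unfolding good_def by (meson not_le)+
  then show False using assms(3) by linarith
qed

text \<open>Far grid points have disjoint windows, so squares of \<open>S\<close> there are
  independent and products centred. In the bounds the powers of \<nu> from the moments of
  \<open>S\<close> cancel against those from \<open>L\<close>, and \<open>near_sum\<close>
  contributes the factor h.\<close>

lemma grid_moments:
  assumes s: "small N \<kappa>" and \<kappa>: "0 < \<kappa>" "\<kappa> \<le> 1" and K1: "1 \<le> K1" and a: "0 < a"
    and st: "step a N \<le> h N" and z: "1 / (real N * h N * \<delta> N) \<le> 1"
    and g: "\<And>k. k \<le> Gn a N \<Longrightarrow> good N \<kappa> K1 (pt a N k) xs"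
    and lam: "\<And>k. k \<le> Gn a N \<Longrightarrow> 0 \<le> lam k \<and> lam k \<le> 1 / ((real (\<nu> N))\<^sup>2 * c\<^sup>2) * step a N"
    and ck: "\<And>k. k \<le> Gn a N \<Longrightarrow> \<bar>ck k\<bar> \<le> B / (real (\<nu> N) * c) * step a N" and B: "0 \<le> B"
  shows "rexp N xs
      (\<lambda>y. (\<Sum>k\<le>Gn a N. lam k * ((S N (pt a N k) xs y)\<^sup>2 - cvar N xs (pt a N k)))\<^sup>2)
      \<le> (10 * (3 * ((K + 1) * K)\<^sup>2 + K1 * K) * K\<^sup>2 / c ^ 4) * h N * (q N)\<^sup>2"
    and "rexp N xs (\<lambda>y. (\<Sum>k\<le>Gn a N. ck k * S N (pt a N k) xs y)\<^sup>2)
      \<le> (10 * (K + 1) * K ^ 3 / c\<^sup>2) * h N * (q N * B\<^sup>2)"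
proof -
  have N: "N0 \<le> N" using s by (simp add: small_def)
  note Bs = basic[OF N]
  let ?P = "measure_pmf (response_pmf (p N) N xs)"
  let ?n = "real (\<nu> N)"
  interpret C: indep_centred ?P "{1..N div \<nu> N}"
      "\<lambda>j y. group_clear (\<nu> N) N xs y j - m N xs j" by (rule conditional_model[OF Bs(1)])
  note ps = measure_pmf.prob_space_axioms[of "response_pmf (p N) N xs"]
  have pI: "pt a N k \<in> I" if "k \<le> Gn a N" for k by (rule pt_in[OF N a that])
  have bS: "prob_space.bounded_rv ?P (S N x xs)" for x by (rule C.brv_lin)
  have bS2: "prob_space.bounded_rv ?P (\<lambda>y. (S N x xs y)\<^sup>2)" for x by (rule prob_space.bounded_rv_power[OF ps bS])
  have ES: "rexp N xs (\<lambda>y. (S N x xs y)\<^sup>2) = cvar N xs x" for x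
    by (rule conditional_second_moment[OF Bs(1)])
  have dis: "W N xs (pt a N k) j = 0 \<or> W N xs (pt a N k') j = 0"
    if "k \<in> {..Gn a N}" "k' \<in> {..Gn a N}" "\<not> near a N k k'" "j \<in> {1..N div \<nu> N}" for k k' j
    by (rule disjoint_support[OF g g that(3,4)]) (use that in auto)
  have "rexp N xs
      (\<lambda>y. (\<Sum>k\<le>Gn a N. lam k * ((S N (pt a N k) xs y)\<^sup>2 - rexp N xs (\<lambda>y. (S N (pt a N k) xs y)\<^sup>2)))\<^sup>2)
      \<le> ((3 * ((K + 1) * K)\<^sup>2 + K1 * K) * (?n\<^sup>2 * q N)\<^sup>2) * (\<Sum>k\<le>Gn a N. \<Sum>k'\<le>Gn a N. if near a N k k' then lam k * lam k' else 0)"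
  proof (rule prob_space.expectation_square_centred_sum[OF ps])
    show "rexp N xs (\<lambda>y. (S N (pt a N k) xs y)\<^sup>2 * (S N (pt a N k') xs y)\<^sup>2)
       = rexp N xs (\<lambda>y. (S N (pt a N k) xs y)\<^sup>2) * rexp N xs (\<lambda>y. (S N (pt a N k') xs y)\<^sup>2)"
      if "k \<in> {..Gn a N}" "k' \<in> {..Gn a N}" "\<not> near a N k k'" for k k'
      by (rule C.expectation_lin_squares_disjoint) (rule dis[OF that])
    show "rexp N xs (\<lambda>y. ((S N (pt a N k) xs y)\<^sup>2)\<^sup>2) \<le> (3 * ((K + 1) * K)\<^sup>2 + K1 * K) * (?n\<^sup>2 * q N)\<^sup>2"
      if "k \<in> {..Gn a N}" for k
      using fourth_moment[OF s pI g \<kappa> K1 z, of k] that by (simp flip: power_mult)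
  qed (use lam bS2 in auto)
  also have "\<dots> \<le> ((3 * ((K + 1) * K)\<^sup>2 + K1 * K) * (?n\<^sup>2 * q N)\<^sup>2) * (10 * K\<^sup>2 * h N * (1 / (?n\<^sup>2 * c\<^sup>2))\<^sup>2)"
    by (rule mult_left_mono[OF near_sum[OF N a st lam]]) (use K K1 in auto)
  also have "\<dots> = (10 * (3 * ((K + 1) * K)\<^sup>2 + K1 * K) * K\<^sup>2 / c ^ 4) * h N * (q N)\<^sup>2"
  proof -
    have alg: "(y * (n * z)\<^sup>2) * (10 * k * t * (1 / (n * c\<^sup>2))\<^sup>2) = (10 * y * k / c ^ 4) * t * z\<^sup>2" if "0 < n" for y n z k t :: real
      using that c by (simp add: field_simps power2_eq_square eval_nat_numeral)
    show ?thesis by (rule alg) (use Bs in simp)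
  qed
  finally show "rexp N xs
      (\<lambda>y. (\<Sum>k\<le>Gn a N. lam k * ((S N (pt a N k) xs y)\<^sup>2 - cvar N xs (pt a N k)))\<^sup>2)
      \<le> (10 * (3 * ((K + 1) * K)\<^sup>2 + K1 * K) * K\<^sup>2 / c ^ 4) * h N * (q N)\<^sup>2"
    unfolding ES .
  have nq: "\<rho> N * (?n * \<delta> N) = ?n\<^sup>2 * q N" by (simp add: power2_eq_square)
  have "rexp N xs (\<lambda>y. (\<Sum>k\<le>Gn a N. ck k * S N (pt a N k) xs y)\<^sup>2)
     \<le> ((K + 1) * K * (?n\<^sup>2 * q N)) * (\<Sum>k\<le>Gn a N. \<Sum>k'\<le>Gn a N. if near a N k k' then \<bar>ck k\<bar> * \<bar>ck k'\<bar> else 0)"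
  proof (rule prob_space.expectation_square_sum_le[OF ps])
    show "rexp N xs (\<lambda>y. S N (pt a N k) xs y * S N (pt a N k') xs y) = 0"
      if "k \<in> {..Gn a N}" "k' \<in> {..Gn a N}" "\<not> near a N k k'" for k k'
      unfolding C.expectation_lin_mult using dis[OF that] by (intro sum.neutral) auto
    show "rexp N xs (\<lambda>y. (S N (pt a N k) xs y)\<^sup>2) \<le> (K + 1) * K * (?n\<^sup>2 * q N)"
      if "k \<in> {..Gn a N}" for k
      unfolding ES using good_sums(2)[OF s pI g \<kappa>, of k, unfolded nq] that by simp
  qed (use bS in auto)
  also have "\<dots> \<le> ((K + 1) * K * (?n\<^sup>2 * q N)) * (10 * K\<^sup>2 * h N * (B / (?n * c))\<^sup>2)"
    by (rule mult_left_mono[OF near_sum[OF N a st]]) (use K Bs B c ck in auto)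
  also have "\<dots> = (10 * (K + 1) * K ^ 3 / c\<^sup>2) * h N * (q N * B\<^sup>2)"
  proof -
    have alg: "(y * K * (n\<^sup>2 * z)) * (10 * K\<^sup>2 * t * (B / (n * c))\<^sup>2) = (10 * y * K ^ 3 / c\<^sup>2) * t * (z * B\<^sup>2)" if "0 < n" for y n z t :: real
      using that c by (simp add: field_simps power2_eq_square eval_nat_numeral)
    show ?thesis by (rule alg) (use Bs in simp)
  qed
  finally show "rexp N xs (\<lambda>y. (\<Sum>k\<le>Gn a N. ck k * S N (pt a N k) xs y)\<^sup>2)
      \<le> (10 * (K + 1) * K ^ 3 / c\<^sup>2) * h N * (q N * B\<^sup>2)" .
qed

section \<open>Regularity in x\<close>

lemma L_continuous: "N0 \<le> N \<Longrightarrow> continuous_on I (L N)"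
proof -
  assume N: "N0 \<le> N"
  have pc: "continuous_on I \<pi>" by (rule continuous_on_subset[OF pi_cont(1) J(3)])
  have ne: "real (\<nu> N) * \<mu> N x \<noteq> 0" if "x \<in> I" for x
    using mu_range(3)[OF N that] basic[OF N] by (metis less_irrefl mult_pos_pos of_nat_0_less_iff zero_less_one order_less_le_trans)
  show ?thesis unfolding L_def[abs_def]
    by (intro continuous_intros pc ballI ne)
qed

lemma B_continuous: "N0 \<le> N \<Longrightarrow> continuous_on I (B_term \<nu> h p b N)"
proof -
  assume N: "N0 \<le> N"
  have pc: "continuous_on I \<pi>" "continuous_on I \<pi>1" "continuous_on I \<pi>2" "continuous_on I b"
    using continuous_on_subset[OF _ J(3)] pi_cont T3(3) b_v_cont by blast+
  have ne: "1 - p N x \<noteq> 0" if "x \<in> I" for x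
    using p_range(3)[OF N I_sub[OF that]] c by linarith
  have "continuous_on I (\<lambda>x. 1/2 * (h N)\<^sup>2 * (\<delta> N * \<pi>2 x
        - (real (\<nu> N) - 1) * inverse (1 - p N x) * (\<delta> N * \<pi>1 x)\<^sup>2) * b x)"
    by (intro continuous_intros pc ballI ne)
  then show ?thesis by (subst continuous_on_cong[OF refl B_term_eq])
qed

lemma A2_continuous: "N0 \<le> N \<Longrightarrow> continuous_on I (A2 N)"
proof -
  assume N: "N0 \<le> N"
  have pc: "continuous_on I \<pi>" "continuous_on I v"
    using continuous_on_subset[OF _ J(3)] pi_cont b_v_cont by blast+
  have ne: "real (\<nu> N) * \<mu> N x * (real N * h N) \<noteq> 0" if "x \<in> I" for x
  proof -
    have "0 < real (\<nu> N)" using basic(5)[OF N] by linarith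
    then have "0 < real (\<nu> N) * \<mu> N x * (real N * h N)"
      by (rule mult_pos_pos[OF mult_pos_pos[OF _ mu_range(3)[OF N that]] basic(8)[OF N]])
    then show ?thesis by (rule less_imp_neq[symmetric])
  qed
  show ?thesis unfolding A2_def[abs_def]
    by (intro continuous_intros pc ballI ne)
qed

lemma cont_set_integrable: "continuous_on I g \<Longrightarrow> set_integrable lborel I (g :: real \<Rightarrow> real)"
  using borel_integrable_atLeastAtMost'[of l u g] I by simp

text \<open>The Hoelder condition multiplied out, so that it also makes sense for coinciding
  points.\<close>

definition modulus :: "nat \<Rightarrow> real \<Rightarrow> real \<Rightarrow> real \<Rightarrow> (nat \<Rightarrow> real) \<Rightarrow> bool" where
  "modulus N Cc \<zeta> Kh xs \<longleftrightarrow> (\<forall>x\<in>I. \<forall>x'\<in>I. \<bar>x - x'\<bar> \<le> real N powr (- Cc) \<longrightarrow>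
     (\<Sum>j=1..N div \<nu> N. \<bar>W N xs x j - W N xs x' j\<bar>) \<le> Kh * \<bar>x - x'\<bar> powr \<zeta>)"

lemma weighted_sum_diff:
  assumes "\<And>j. \<bar>g j\<bar> \<le> (1::real)"
  shows "\<bar>(\<Sum>j=1..N div \<nu> N. W N xs x j * g j) - (\<Sum>j=1..N div \<nu> N. W N xs x' j * g j)\<bar>
    \<le> (\<Sum>j=1..N div \<nu> N. \<bar>W N xs x j - W N xs x' j\<bar>)"
proof -
  have "\<bar>(W N xs x j - W N xs x' j) * g j\<bar> \<le> \<bar>W N xs x j - W N xs x' j\<bar>" for j
    unfolding abs_mult using assms[of j] by (rule mult_left_le) simp
  then show ?thesis
    unfolding sum_subtractf[symmetric] left_diff_distrib[symmetric]
    by (intro order_trans[OF sum_abs] sum_mono)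
qed

lemma S_diff:
  "\<bar>S N x xs y - S N x' xs y\<bar> \<le> (\<Sum>j=1..N div \<nu> N. \<bar>W N xs x j - W N xs x' j\<bar>)"
proof (rule weighted_sum_diff)
  show "\<bar>group_clear (\<nu> N) N xs y j - m N xs j\<bar> \<le> 1" for j
    using clear_prob_bounds[of "p N" "\<nu> N" N xs j] by (auto simp: group_clear_def)
qed

lemma cvar_diff:
  assumes g: "good N \<kappa> K1 x xs" "good N \<kappa> K1 x' xs"
  shows "\<bar>cvar N xs x - cvar N xs x'\<bar> \<le> 2 * K1 * (\<Sum>j=1..N div \<nu> N. \<bar>W N xs x j - W N xs x' j\<bar>)"
proof -
  have W1: "\<bar>W N xs z j\<bar> \<le> K1" if "good N \<kappa> K1 z xs" "j \<in> {1..N div \<nu> N}" for z j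
  proof -
    have "\<bar>W N xs z j\<bar> \<le> (\<Sum>j=1..N div \<nu> N. \<bar>W N xs z j\<bar>)" by (rule member_le_sum[OF that(2)]) auto
    also have "\<dots> \<le> K1" using that(1) unfolding good_def by blast
    finally show ?thesis .
  qed
  have each: "\<bar>(W N xs x j)\<^sup>2 * (m N xs j * (1 - m N xs j)) - (W N xs x' j)\<^sup>2 * (m N xs j * (1 - m N xs j))\<bar>
      \<le> 2 * K1 * \<bar>W N xs x j - W N xs x' j\<bar>" if j: "j \<in> {1..N div \<nu> N}" for j
  proof -
    have m01: "0 \<le> m N xs j" "m N xs j \<le> 1" by (rule clear_prob_bounds)+
    have "m N xs j * (1 - m N xs j) \<le> 1 * 1" using m01 by (intro mult_mono) auto
    then have s1: "\<bar>m N xs j * (1 - m N xs j)\<bar> \<le> 1" using m01 by simp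
    have "\<bar>W N xs x j + W N xs x' j\<bar> \<le> \<bar>W N xs x j\<bar> + \<bar>W N xs x' j\<bar>" by (rule abs_triangle_ineq)
    also have "\<dots> \<le> 2 * K1" using add_mono[OF W1[OF g(1) j] W1[OF g(2) j]] by simp
    finally have "\<bar>W N xs x j + W N xs x' j\<bar> * \<bar>m N xs j * (1 - m N xs j)\<bar> \<le> 2 * K1 * 1"
      using s1 by (intro mult_mono) auto
    then have "\<bar>W N xs x j - W N xs x' j\<bar> * (\<bar>W N xs x j + W N xs x' j\<bar> * \<bar>m N xs j * (1 - m N xs j)\<bar>)
        \<le> \<bar>W N xs x j - W N xs x' j\<bar> * (2 * K1)" by (intro mult_left_mono) auto
    moreover have "z\<^sup>2 * s - z'\<^sup>2 * s = (z - z') * ((z + z') * s)" for z z' s :: real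
      by (simp add: algebra_simps power2_eq_square)
    ultimately show ?thesis by (simp only: abs_mult mult.commute[of _ "2 * K1"])
  qed
  show ?thesis
    unfolding cvar_def sum_subtractf[symmetric] sum_distrib_left
    by (intro order_trans[OF sum_abs] sum_mono each)
qed

text \<open>Group indicators are bounded by 1, so increments of the weighted mean are bounded by
  those of the normalised weights. The odd extension of the root is continuous on the whole line, so
  the sign of the weighted mean does not matter.\<close>

lemma p_hat_continuous:
  assumes N: "N0 \<le> N" and \<omega>: "\<omega> \<in> space (M N)" and \<zeta>: "0 < \<zeta>"
    and g: "\<And>x. x \<in> I \<Longrightarrow> (\<Sum>j=1..N div \<nu> N. W N (smp N \<omega>) x j) = 1" and md: "modulus N Cc \<zeta> Kh (smp N \<omega>)"
  shows "continuous_on I (p_est N \<omega>)"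
proof -
  note B = basic[OF N]
  define F where "F x = (\<Sum>j=1..N div \<nu> N. W N (smp N \<omega>) x j * group_clear (\<nu> N) N (smp N \<omega>) (rsp N \<omega>) j)" for x
  have F: "\<mu> N x + (S N x (smp N \<omega>) (rsp N \<omega>) + bias N (smp N \<omega>) x) = F x" for x
    unfolding bias_def right_diff_distrib sum_subtractf F_def by simp
  have Fd: "\<bar>F x' - F x\<bar> \<le> Kh * \<bar>x' - x\<bar> powr \<zeta>" if "x \<in> I" "x' \<in> I" "\<bar>x' - x\<bar> \<le> real N powr (- Cc)" for x x'
    unfolding F_def
    by (rule order_trans[OF weighted_sum_diff]) (use md that in \<open>auto simp: modulus_def group_clear_def\<close>)
  have "continuous_on I F"
    unfolding continuous_on_def
  proof
    fix x assume x: "x \<in> I"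
    have ev: "\<forall>\<^sub>F x' in at x within I. norm (F x' - F x) \<le> Kh * \<bar>x' - x\<bar> powr \<zeta>"
      unfolding eventually_at
    proof (intro exI[of _ "real N powr (- Cc)"] conjI ballI impI)
      show "0 < real N powr (- Cc)" using B by simp
      fix x' assume "x' \<in> I" "x' \<noteq> x \<and> dist x' x < real N powr (- Cc)"
      then show "norm (F x' - F x) \<le> Kh * \<bar>x' - x\<bar> powr \<zeta>" using Fd[OF x] by (simp add: dist_real_def)
    qed
    have "((\<lambda>x'. \<bar>x' - x\<bar>) \<longlongrightarrow> \<bar>x - x\<bar>) (at x within I)" by (intro tendsto_intros)
    then have "((\<lambda>x'. Kh * \<bar>x' - x\<bar> powr \<zeta>) \<longlongrightarrow> Kh * \<bar>x - x\<bar> powr \<zeta>) (at x within I)"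
      using \<zeta> by (intro tendsto_mult tendsto_const tendsto_powr') auto
    then have "((\<lambda>x'. Kh * \<bar>x' - x\<bar> powr \<zeta>) \<longlongrightarrow> 0) (at x within I)" by simp
    from Lim_null_comparison[OF ev this] show "(F \<longlongrightarrow> F x) (at x within I)" by (rule LIM_zero_cancel)
  qed
  then have "continuous_on I (\<lambda>x. 1 - root (\<nu> N) (F x))" by (intro continuous_intros)
  then show ?thesis
    by (rule continuous_on_cong[THEN iffD1, OF refl, rotated]) (unfold p_hat_eq[OF N \<omega> g] F, rule refl)
qed

text \<open>
  The exponent \<open>4 / \<zeta>\<close> makes the Hoelder increments over one step at most of order \<open>N powr (- 4)\<close>,
  while \<open>q N\<close> is at least \<open>N powr (- 2)\<close>.
\<close>

lemma grid_fine:
  assumes Cc: "0 < Cc" and \<zeta>: "0 < \<zeta>" and Kh: "0 \<le> Kh" and z: "0 < z"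
  defines "a \<equiv> Cc + 4 / \<zeta> + 2"
  shows "\<forall>\<^sub>F N in sequentially. step a N \<le> real N powr (- Cc) \<and> step a N \<le> h N \<and> Kh * step a N powr \<zeta> \<le> z * q N"
proof -
  have \<zeta>4: "0 < 4 / \<zeta>" using \<zeta> by simp
  then have a: "0 < a" using Cc by (simp add: a_def add_pos_pos)
  have "\<forall>\<^sub>F N in sequentially. max K (Kh / z + 1) \<le> real N" by (rule eventually_at_top_linorder[THEN iffD2]) (meson order_trans real_arch_simple of_nat_mono)
  from this Nhd_large[of 1, OF zero_less_one] h_small[OF zero_less_one] ev_N0 show ?thesis
  proof eventually_elim
    case (elim N)
    note B = basic[OF elim(4)]
    note G = grid[OF elim(4) a]
    have N1: "1 \<le> real N" using B by simp
    have "step a N \<le> real N powr (- a)" by (rule G(3))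
    also have "\<dots> \<le> real N powr (- Cc)" using N1 \<zeta>4 unfolding a_def by (intro powr_mono) linarith+
    finally have s1: "step a N \<le> real N powr (- Cc)" .
    have Nhd: "1 \<le> real N * h N * \<delta> N" using elim(2) B by (simp add: divide_le_eq)
    have "step a N \<le> real N powr (- a)" by (rule G(3))
    also have "\<dots> \<le> real N powr (- 2)" using N1 \<zeta>4 Cc unfolding a_def by (intro powr_mono) linarith+
    also have "\<dots> = 1 / (real N * real N)" using B by (simp add: powr_minus_divide power2_eq_square)
    also have "\<dots> \<le> h N"
    proof -
      have "1 \<le> real N * h N * K" by (rule order_trans[OF Nhd mult_left_mono[OF B(3) less_imp_le[OF B(8)]]])
      also have "\<dots> \<le> real N * h N * real N" using elim(1) B by (intro mult_left_mono) auto
      finally show ?thesis using B by (simp add: divide_le_eq mult_ac)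
    qed
    finally have s2: "step a N \<le> h N" .
    have "step a N powr \<zeta> \<le> (real N powr (- a)) powr \<zeta>" using G \<zeta> by (intro powr_mono2) auto
    also have "\<dots> = real N powr (- (a * \<zeta>))" by (simp add: powr_powr)
    also have "\<dots> \<le> real N powr (- 4)"
    proof (rule powr_mono[OF _ N1])
      have "a * \<zeta> = Cc * \<zeta> + 4 + 2 * \<zeta>" using \<zeta> by (simp add: a_def field_simps)
      moreover have "0 \<le> Cc * \<zeta>" using Cc \<zeta> by simp
      ultimately show "- (a * \<zeta>) \<le> - 4" using \<zeta> by linarith
    qed
    also have "\<dots> = 1 / real N ^ 4" using B by (simp add: powr_minus_divide)
    finally have "Kh * step a N powr \<zeta> \<le> Kh * (1 / real N ^ 4)" using Kh by (rule mult_left_mono)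
    also have "\<dots> \<le> z * (1 / (real N)\<^sup>2)"
    proof -
      have "real N * 1 \<le> real N * real N" using N1 by (intro mult_left_mono) auto
      then have "Kh / z \<le> real N * real N" using elim(1) by linarith
      then have "Kh \<le> z * (real N)\<^sup>2" using z by (simp add: divide_le_eq power2_eq_square mult_ac)
      then have "Kh * (1 / real N ^ 4) \<le> z * (real N)\<^sup>2 * (1 / real N ^ 4)" by (rule mult_right_mono) simp
      also have "\<dots> = z * (1 / (real N)\<^sup>2)" using B by (simp add: field_simps eval_nat_numeral)
      finally show ?thesis .
    qed
    also have "\<dots> \<le> z * q N"
    proof (rule mult_left_mono)
      have "real N * h N \<le> real N * 1" using elim(3) B by (intro mult_left_mono) auto
      then have "real N * h N * (real N * h N) \<le> real N * real N" using B by (intro mult_mono) auto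
      then have "1 / (real N)\<^sup>2 \<le> 1 / (real N * h N * (real N * h N))"
        unfolding power2_eq_square using B by (intro divide_left_mono mult_pos_pos) auto
      also have "\<dots> \<le> (real N * h N * \<delta> N) / (real N * h N * (real N * h N))"
        using Nhd B by (intro divide_right_mono) auto
      also have "\<dots> = q N" using B by simp
      finally show "1 / (real N)\<^sup>2 \<le> q N" .
    qed (use z in simp)
    finally show ?case using s1 s2 by blast
  qed
qed

section \<open>Events of high probability on the grid\<close>

lemma grid_event:
  assumes a: "0 < a" and \<theta>: "0 \<le> \<theta>"
    and ev: "\<forall>\<^sub>F N in sequentially. N0 \<le> N \<and> (\<forall>y. {xs\<in>space (PX N). Q N xs y} \<in> sets (PX N)) \<and>
      (\<forall>xs. (\<forall>k\<le>Gn a N. good N \<kappa> K1 (pt a N k) xs) \<longrightarrow> rprob N xs {y. Q N xs y} \<le> \<theta>)"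
  shows "with_prob M \<theta> (\<lambda>N \<omega>. (\<forall>k\<le>Gn a N. good N \<kappa> K1 (pt a N k) (smp N \<omega>)) \<longrightarrow> \<not> Q N (smp N \<omega>) (rsp N \<omega>))"
proof (rule with_prob_event)
  show "\<forall>\<^sub>F N in sequentially.
      {\<omega>\<in>space (M N). \<not> ((\<forall>k\<le>Gn a N. good N \<kappa> K1 (pt a N k) (smp N \<omega>)) \<longrightarrow> \<not> Q N (smp N \<omega>) (rsp N \<omega>))} \<in> sets (M N) \<and>
      measure (M N) {\<omega>\<in>space (M N). \<not> ((\<forall>k\<le>Gn a N. good N \<kappa> K1 (pt a N k) (smp N \<omega>)) \<longrightarrow> \<not> Q N (smp N \<omega>) (rsp N \<omega>))} \<le> \<theta>"
    using ev
  proof eventually_elim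
    case (elim N)
    then have N: "N0 \<le> N" by blast
    note B = basic[OF N]
    interpret binary_sample "M N" N "X N" "Y N" "p N" by (rule sample_interp[OF B(1)])
    \<comment> \<open>Goodness is required only at the finitely many grid points, which keeps this
      set of samples measurable.\<close>
    let ?G = "{xs\<in>space (PX N). \<forall>k\<in>{..Gn a N}. good N \<kappa> K1 (pt a N k) xs}"
    have G: "?G \<in> sets (PX N)"
    proof (rule sets.sets_Collect_finite_All)
      show "{xs\<in>space (PX N). good N \<kappa> K1 (pt a N k) xs} \<in> sets (PX N)" if "k \<in> {..Gn a N}" for k
        using that by (intro good_measurable[OF B(1)] pt_in[OF N a]) simp
    qed simp
    have meas: "{xs\<in>space (PX N). Q N xs y} \<in> sets (PX N)" for y using elim by blast
    have le: "rprob N xs {y. Q N xs y} \<le> \<theta>" if "xs \<in> ?G" for xs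
      using elim that by auto
    have eq: "{\<omega>\<in>space (M N). \<not> ((\<forall>k\<le>Gn a N. good N \<kappa> K1 (pt a N k) (smp N \<omega>)) \<longrightarrow> \<not> Q N (smp N \<omega>) (rsp N \<omega>))}
       = {\<omega>\<in>space (M N). smp N \<omega> \<in> ?G \<and> Q N (smp N \<omega>) (rsp N \<omega>)}"
      using measurable_space[OF sample_measurable] by auto
    show ?case unfolding eq using conditional_prob_le[OF G meas le \<theta>] by blast
  qed
qed (rule prob)

text \<open>Hoeffding's exponent is of order \<open>1 / \<rho>\<close>, which by (T4) is at least
  \<open>N powr e\<close>; this outweighs the number of grid points in the union bound.\<close>

lemma grid_sup_event:
  assumes \<kappa>: "0 < \<kappa>" "\<kappa> \<le> 1" and a: "0 < a" and z: "0 < z" and \<theta>: "0 < \<theta>"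
  shows "with_prob M \<theta> (\<lambda>N \<omega>. (\<forall>k\<le>Gn a N. good N \<kappa> K1 (pt a N k) (smp N \<omega>)) \<longrightarrow>
    \<not> (\<exists>k\<in>{..Gn a N}. z \<le> \<bar>S N (pt a N k) (smp N \<omega>) (rsp N \<omega>)\<bar>))"
proof (rule grid_event[OF a less_imp_le[OF \<theta>]])
  \<comment> \<open>Hoeffding's exponent with \<open>(K + 1) * \<rho>\<close> for the sum of squared
    weights, after replacing \<open>1 / \<rho>\<close> by its lower bound
    \<open>N powr e\<close>.\<close>
  define C where "C = z\<^sup>2 / (2 * (K + 1))"
  have C: "0 < C" using z K by (simp add: C_def)
  have "((\<lambda>x::real. (K * x powr a + 2) * (2 * exp (- C * x powr e))) \<longlongrightarrow> 0) at_top"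
    using C a e(1) K by real_asymp
  then have "(\<lambda>N. (K * real N powr a + 2) * (2 * exp (- C * real N powr e))) \<longlonglongrightarrow> 0"
    by (rule filterlim_compose[OF _ filterlim_real_sequentially])
  from order_tendstoD(2)[OF this \<theta>] ev_small[OF \<kappa>(1)] rho_small[of 1, OF zero_less_one]
  show "\<forall>\<^sub>F N in sequentially. N0 \<le> N \<and>
      (\<forall>y. {xs\<in>space (PX N). \<exists>k\<in>{..Gn a N}. z \<le> \<bar>S N (pt a N k) xs y\<bar>} \<in> sets (PX N)) \<and>
      (\<forall>xs. (\<forall>k\<le>Gn a N. good N \<kappa> K1 (pt a N k) xs) \<longrightarrow>
        rprob N xs {y. \<exists>k\<in>{..Gn a N}. z \<le> \<bar>S N (pt a N k) xs y\<bar>} \<le> \<theta>)"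
  proof eventually_elim
    case (elim N)
    have N: "N0 \<le> N" using elim(2) by (simp add: small_def)
    note B = basic[OF N]
    have pI: "pt a N k \<in> I" if "k \<in> {..Gn a N}" for k using that by (intro pt_in[OF N a]) simp
    have meas: "{xs\<in>space (PX N). \<exists>k\<in>{..Gn a N}. z \<le> \<bar>S N (pt a N k) xs y\<bar>} \<in> sets (PX N)" for y
    proof (rule sets.sets_Collect_finite_Ex)
      fix k assume "k \<in> {..Gn a N}"
      note [measurable] = S_measurable[OF B(1) pI[OF this]]
      show "{xs\<in>space (PX N). z \<le> \<bar>S N (pt a N k) xs y\<bar>} \<in> sets (PX N)" by measurable
    qed simp
    have le: "rprob N xs {y. \<exists>k\<in>{..Gn a N}. z \<le> \<bar>S N (pt a N k) xs y\<bar>} \<le> \<theta>"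
      if g: "\<forall>k\<le>Gn a N. good N \<kappa> K1 (pt a N k) xs" for xs
    proof -
      interpret C: indep_centred "measure_pmf (response_pmf (p N) N xs)" "{1..N div \<nu> N}"
        "\<lambda>j y. group_clear (\<nu> N) N xs y j - m N xs j" by (rule conditional_model[OF B(1)])
      have "1 / \<rho> N \<ge> real N powr e" using elim(3) B by (simp add: field_simps)
      then have "C * real N powr e \<le> C * (1 / \<rho> N)" using C by (intro mult_left_mono) auto
      also have "\<dots> = z\<^sup>2 / (2 * ((K + 1) * \<rho> N))" by (simp add: C_def)
      finally have ex: "exp (- z\<^sup>2 / (2 * ((K + 1) * \<rho> N))) \<le> exp (- C * real N powr e)" by simp
      have each: "rprob N xs {y. z \<le> \<bar>S N (pt a N k) xs y\<bar>} \<le> 2 * exp (- C * real N powr e)"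
        if k: "k \<in> {..Gn a N}" for k
      proof -
        have gk: "good N \<kappa> K1 (pt a N k) xs" using g k by simp
        have "0 < (K + 1) * \<rho> N" using K B by simp
        from C.hoeffding_lin[OF good_sums(1)[OF elim(2) pI[OF k] gk \<kappa>] this z]
        have "rprob N xs {y. z \<le> \<bar>S N (pt a N k) xs y\<bar>}
            \<le> 2 * exp (- z\<^sup>2 / (2 * ((K + 1) * \<rho> N)))"
          by (simp only: space_measure_pmf UNIV_I simp_thms)
        also have "\<dots> \<le> 2 * exp (- C * real N powr e)" by (rule mult_left_mono[OF ex]) simp
        finally show ?thesis .
      qed
      have "{y. \<exists>k\<in>{..Gn a N}. z \<le> \<bar>S N (pt a N k) xs y\<bar>} = (\<Union>k\<in>{..Gn a N}. {y. z \<le> \<bar>S N (pt a N k) xs y\<bar>})" by auto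
      then have "rprob N xs {y. \<exists>k\<in>{..Gn a N}. z \<le> \<bar>S N (pt a N k) xs y\<bar>}
          \<le> (\<Sum>k\<in>{..Gn a N}. rprob N xs {y. z \<le> \<bar>S N (pt a N k) xs y\<bar>})"
        by (simp only:) (rule measure_pmf.finite_measure_subadditive_finite, auto)
      also have "\<dots> \<le> (\<Sum>k\<in>{..Gn a N}. 2 * exp (- C * real N powr e))" by (intro sum_mono each)
      also have "\<dots> = (real (Gn a N) + 1) * (2 * exp (- C * real N powr e))" by (simp add: algebra_simps)
      also have "\<dots> \<le> (K * real N powr a + 2) * (2 * exp (- C * real N powr e))"
        using grid(4)[OF N a] by (intro mult_right_mono) auto
      finally show ?thesis using elim(1) by linarith
    qed
    show ?case using N meas le by blast
  qed
qed

text \<open>The form of \<open>grid_event\<close> for quantities controlled by a conditional second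
  moment, through Chebyshev's inequality.\<close>

lemma grid_linear_event:
  assumes a: "0 < a" and \<theta>: "0 < \<theta>"
    and ev: "\<forall>\<^sub>F N in sequentially. N0 \<le> N \<and> 0 < t N \<and>
      (\<forall>y. (\<lambda>xs. F N xs y) \<in> borel_measurable (PX N)) \<and>
      (\<forall>xs. (\<forall>k\<le>Gn a N. good N \<kappa> K1 (pt a N k) xs) \<longrightarrow>
        prob_space.bounded_rv (measure_pmf (response_pmf (p N) N xs)) (F N xs) \<and>
        rexp N xs (\<lambda>y. (F N xs y)\<^sup>2) \<le> \<theta> * (t N)\<^sup>2)"
  shows "with_prob M \<theta> (\<lambda>N \<omega>. (\<forall>k\<le>Gn a N. good N \<kappa> K1 (pt a N k) (smp N \<omega>)) \<longrightarrow> \<not> t N \<le> \<bar>F N (smp N \<omega>) (rsp N \<omega>)\<bar>)"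
proof (rule grid_event[OF a less_imp_le[OF \<theta>]])
  show "\<forall>\<^sub>F N in sequentially. N0 \<le> N \<and> (\<forall>y. {xs\<in>space (PX N). t N \<le> \<bar>F N xs y\<bar>} \<in> sets (PX N)) \<and>
      (\<forall>xs. (\<forall>k\<le>Gn a N. good N \<kappa> K1 (pt a N k) xs) \<longrightarrow>
        rprob N xs {y. t N \<le> \<bar>F N xs y\<bar>} \<le> \<theta>)"
    using ev
  proof eventually_elim
    case (elim N)
    have t: "0 < t N" using elim by blast
    have meas: "{xs\<in>space (PX N). t N \<le> \<bar>F N xs y\<bar>} \<in> sets (PX N)" for y
    proof -
      have [measurable]: "(\<lambda>xs. F N xs y) \<in> borel_measurable (PX N)" using elim by blast
      show ?thesis by measurable
    qed
    have le: "rprob N xs {y. t N \<le> \<bar>F N xs y\<bar>} \<le> \<theta>"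
      if g: "\<forall>k\<le>Gn a N. good N \<kappa> K1 (pt a N k) xs" for xs
    proof -
      have b: "prob_space.bounded_rv (measure_pmf (response_pmf (p N) N xs)) (F N xs)"
        and E: "rexp N xs (\<lambda>y. (F N xs y)\<^sup>2) \<le> \<theta> * (t N)\<^sup>2"
        using elim g by blast+
      have "rprob N xs {y. t N \<le> \<bar>F N xs y\<bar>}
          \<le> rexp N xs (\<lambda>y. (F N xs y)\<^sup>2) / (t N)\<^sup>2"
        using prob_space.chebyshev_zero[OF measure_pmf.prob_space_axioms b t] by simp
      also have "\<dots> \<le> \<theta>" using E t by (simp add: divide_le_eq)
      finally show ?thesis .
    qed
    show ?case using elim meas le by blast
  qed
qed

definition lam :: "real \<Rightarrow> nat \<Rightarrow> nat \<Rightarrow> real" where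
  "lam a N k = (LINT x:I|lborel. (L N x)\<^sup>2 * of_bool (idx a N x = k))"

text \<open>The coefficient of \<open>S\<close> at the k-th grid point in the integrated cross term,
  as \<open>lam\<close> is that of the square of \<open>S\<close> in the integrated
  variance.\<close>

definition lin_coeff :: "real \<Rightarrow> nat \<Rightarrow> nat \<Rightarrow> real" where
  "lin_coeff a N k = (LINT x:I|lborel. (L N x * B_term \<nu> h p b N x) * of_bool (idx a N x = k))"

definition Bc :: real where "Bc = K * (K + K ^ 3 / c)"

lemma Bc: "1 \<le> Bc"
proof -
  have "0 \<le> K ^ 3 / c" using K c by simp
  then have "1 * 1 \<le> K * (K + K ^ 3 / c)" using K by (intro mult_mono) auto
  then show ?thesis by (simp add: Bc_def)
qed

lemma L2_integrable: "N0 \<le> N \<Longrightarrow> set_integrable lborel I (\<lambda>x. (L N x)\<^sup>2)"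
  by (intro cont_set_integrable continuous_intros L_continuous)

lemma LB_integrable: "N0 \<le> N \<Longrightarrow> set_integrable lborel I (\<lambda>x. L N x * B_term \<nu> h p b N x)"
  by (intro cont_set_integrable continuous_intros L_continuous B_continuous)

lemma lam_bounds:
  assumes N: "N0 \<le> N" and a: "0 < a"
  shows "0 \<le> lam a N k \<and> lam a N k \<le> 1 / ((real (\<nu> N))\<^sup>2 * c\<^sup>2) * step a N"
proof -
  have "0 \<le> lam a N k" unfolding lam_def by (rule step_integral(4)[OF N a L2_integrable[OF N]]) simp
  moreover have "\<bar>lam a N k\<bar> \<le> 1 / ((real (\<nu> N))\<^sup>2 * c\<^sup>2) * step a N"
    unfolding lam_def by (rule step_integral(3)[OF N a L2_integrable[OF N]]) (use L_bounds(3)[OF N] in simp)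
  ultimately show ?thesis by linarith
qed

lemma lin_coeff_bound:
  assumes N: "N0 \<le> N" and a: "0 < a"
  shows "\<bar>lin_coeff a N k\<bar> \<le> (Bc * (\<delta> N * (h N)\<^sup>2)) / (real (\<nu> N) * c) * step a N"
  unfolding lin_coeff_def
proof (rule step_integral(3)[OF N a LB_integrable[OF N]])
  fix x assume x: "x \<in> I"
  have "\<bar>L N x * B_term \<nu> h p b N x\<bar> \<le> 1 / (real (\<nu> N) * c) * (Bc * (\<delta> N * (h N)\<^sup>2))"
    unfolding abs_mult Bc_def using c by (intro mult_mono L_bounds(1)[OF N x] B_bound'[OF N x]) auto
  then show "\<bar>L N x * B_term \<nu> h p b N x\<bar> \<le> (Bc * (\<delta> N * (h N)\<^sup>2)) / (real (\<nu> N) * c)" by simp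
qed

text \<open>The second moment is at most a constant times \<open>h * q\<^sup>2\<close>, while the
  squared threshold is a constant times \<open>q\<^sup>2\<close>; h tending to 0 decides.\<close>

lemma square_sum_event:
  assumes \<kappa>: "0 < \<kappa>" "\<kappa> \<le> 1" and K1: "1 \<le> K1" and a: "0 < a" and z: "0 < z" and \<theta>: "0 < \<theta>"
    and st: "\<forall>\<^sub>F N in sequentially. step a N \<le> h N"
  shows "with_prob M \<theta> (\<lambda>N \<omega>. (\<forall>k\<le>Gn a N. good N \<kappa> K1 (pt a N k) (smp N \<omega>)) \<longrightarrow>
    \<not> z * q N \<le> \<bar>\<Sum>k\<le>Gn a N. lam a N k * ((S N (pt a N k) (smp N \<omega>) (rsp N \<omega>))\<^sup>2 - cvar N (smp N \<omega>) (pt a N k))\<bar>)"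
proof (rule grid_linear_event[OF a \<theta>])
  define C where "C = 10 * (3 * ((K + 1) * K)\<^sup>2 + K1 * K) * K\<^sup>2 / c ^ 4"
  have C: "0 < C" using K K1 c by (auto simp: C_def intro!: divide_pos_pos mult_pos_pos add_pos_pos)
  have "0 < \<theta> * z\<^sup>2 / C" using \<theta> z C by simp
  from h_small[OF this] ev_small[OF \<kappa>(1)] st Nhd_large[of 1, OF zero_less_one]
  show "\<forall>\<^sub>F N in sequentially. N0 \<le> N \<and> 0 < z * q N \<and>
      (\<forall>y. (\<lambda>xs. \<Sum>k\<le>Gn a N. lam a N k * ((S N (pt a N k) xs y)\<^sup>2 - cvar N xs (pt a N k))) \<in> borel_measurable (PX N)) \<and>
      (\<forall>xs. (\<forall>k\<le>Gn a N. good N \<kappa> K1 (pt a N k) xs) \<longrightarrow>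
        prob_space.bounded_rv (measure_pmf (response_pmf (p N) N xs))
          (\<lambda>y. \<Sum>k\<le>Gn a N. lam a N k * ((S N (pt a N k) xs y)\<^sup>2 - cvar N xs (pt a N k))) \<and>
        rexp N xs
          (\<lambda>y. (\<Sum>k\<le>Gn a N. lam a N k * ((S N (pt a N k) xs y)\<^sup>2 - cvar N xs (pt a N k)))\<^sup>2) \<le> \<theta> * (z * q N)\<^sup>2)"
  proof eventually_elim
    case (elim N)
    have N: "N0 \<le> N" using elim(2) by (simp add: small_def)
    note B = basic[OF N]
    have zq: "0 < z * q N" by (rule mult_pos_pos[OF z q_pos[OF N]])
    have pI: "pt a N k \<in> I" if "k \<in> {..Gn a N}" for k using that by (intro pt_in[OF N a]) simp
    have cm: "(\<lambda>xs. cvar N xs x) \<in> borel_measurable (PX N)" if x: "x \<in> I" for x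
      unfolding cvar_def
    proof (rule borel_measurable_sum)
      fix j assume "j \<in> {1..N div \<nu> N}"
      note [measurable] = W_measurable[OF B(1) this x]
      have [measurable]: "p N \<in> borel_measurable borel" using pi(1) by measurable
      show "(\<lambda>xs. (W N xs x j)\<^sup>2 * (m N xs j * (1 - m N xs j))) \<in> borel_measurable (PX N)" by measurable
    qed
    have meas: "(\<lambda>xs. \<Sum>k\<le>Gn a N. lam a N k * ((S N (pt a N k) xs y)\<^sup>2 - cvar N xs (pt a N k))) \<in> borel_measurable (PX N)" for y
    proof (rule borel_measurable_sum)
      fix k assume k: "k \<in> {..Gn a N}"
      show "(\<lambda>xs. lam a N k * ((S N (pt a N k) xs y)\<^sup>2 - cvar N xs (pt a N k))) \<in> borel_measurable (PX N)"
        by (rule borel_measurable_times[OF borel_measurable_const borel_measurable_diff[OF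
              borel_measurable_power[OF S_measurable[OF B(1) pI[OF k]]] cm[OF pI[OF k]]]])
    qed
    have E: "prob_space.bounded_rv (measure_pmf (response_pmf (p N) N xs))
          (\<lambda>y. \<Sum>k\<le>Gn a N. lam a N k * ((S N (pt a N k) xs y)\<^sup>2 - cvar N xs (pt a N k)))" (is "prob_space.bounded_rv ?P _")
      "rexp N xs
          (\<lambda>y. (\<Sum>k\<le>Gn a N. lam a N k * ((S N (pt a N k) xs y)\<^sup>2 - cvar N xs (pt a N k)))\<^sup>2) \<le> \<theta> * (z * q N)\<^sup>2"
      if g: "\<forall>k\<le>Gn a N. good N \<kappa> K1 (pt a N k) xs" for xs
    proof -
      let ?P = "measure_pmf (response_pmf (p N) N xs)"
      interpret C: indep_centred ?P "{1..N div \<nu> N}"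
        "\<lambda>j y. group_clear (\<nu> N) N xs y j - m N xs j" by (rule conditional_model[OF B(1)])
      note ps = measure_pmf.prob_space_axioms[of "response_pmf (p N) N xs"]
      show "prob_space.bounded_rv ?P (\<lambda>y. \<Sum>k\<le>Gn a N. lam a N k * ((S N (pt a N k) xs y)\<^sup>2 - cvar N xs (pt a N k)))"
        by (rule prob_space.bounded_rv_sum[OF ps], rule prob_space.bounded_rv_cmult[OF ps],
            rule prob_space.bounded_rv_diff[OF ps prob_space.bounded_rv_power[OF ps C.brv_lin] prob_space.bounded_rv_const[OF ps]])
      have "rexp N xs
          (\<lambda>y. (\<Sum>k\<le>Gn a N. lam a N k * ((S N (pt a N k) xs y)\<^sup>2 - cvar N xs (pt a N k)))\<^sup>2) \<le> C * h N * (q N)\<^sup>2"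
        unfolding C_def
      proof (rule grid_moments(1)[OF elim(2) \<kappa> K1 a elim(3)])
        show "1 / (real N * h N * \<delta> N) \<le> 1" using elim(4) by blast
        show "0 \<le> lam a N k \<and> lam a N k \<le> 1 / ((real (\<nu> N))\<^sup>2 * c\<^sup>2) * step a N" for k by (rule lam_bounds[OF N a])
        show "\<bar>lin_coeff a N k\<bar> \<le> (Bc * (\<delta> N * (h N)\<^sup>2)) / (real (\<nu> N) * c) * step a N" for k by (rule lin_coeff_bound[OF N a])
        show "0 \<le> Bc * (\<delta> N * (h N)\<^sup>2)" using Bc B by simp
        show "good N \<kappa> K1 (pt a N k) xs" if "k \<le> Gn a N" for k using g that by blast
      qed
      also have "\<dots> \<le> C * (\<theta> * z\<^sup>2 / C) * (q N)\<^sup>2"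
        using elim(1) C by (intro mult_right_mono mult_left_mono) auto
      also have "\<dots> = \<theta> * (z * q N)\<^sup>2" unfolding power_mult_distrib using C by simp
      finally show "rexp N xs
          (\<lambda>y. (\<Sum>k\<le>Gn a N. lam a N k * ((S N (pt a N k) xs y)\<^sup>2 - cvar N xs (pt a N k)))\<^sup>2) \<le> \<theta> * (z * q N)\<^sup>2" .
    qed
    show ?case using N zq meas E by blast
  qed
qed

text \<open>The second moment is of order \<open>h * q\<close> times the squared order of the bias.
  It is compared with the square of the sum of both natural orders, and again h tending to 0
  decides.\<close>

lemma linear_sum_event:
  assumes \<kappa>: "0 < \<kappa>" "\<kappa> \<le> 1" and K1: "1 \<le> K1" and a: "0 < a" and z: "0 < z" and \<theta>: "0 < \<theta>"
    and st: "\<forall>\<^sub>F N in sequentially. step a N \<le> h N"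
  shows "with_prob M \<theta> (\<lambda>N \<omega>. (\<forall>k\<le>Gn a N. good N \<kappa> K1 (pt a N k) (smp N \<omega>)) \<longrightarrow>
    \<not> z * ((\<delta> N * (h N)\<^sup>2)\<^sup>2 + q N) \<le> \<bar>\<Sum>k\<le>Gn a N. lin_coeff a N k * S N (pt a N k) (smp N \<omega>) (rsp N \<omega>)\<bar>)"
proof (rule grid_linear_event[OF a \<theta>])
  define C where "C = 10 * (K + 1) * K ^ 3 / c\<^sup>2 * Bc\<^sup>2"
  have C: "0 < C" using K c Bc by (auto simp: C_def intro!: divide_pos_pos mult_pos_pos add_pos_pos)
  have "0 < \<theta> * z\<^sup>2 / C" using \<theta> z C by simp
  from h_small[OF this] ev_small[OF \<kappa>(1)] st Nhd_large[of 1, OF zero_less_one]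
  show "\<forall>\<^sub>F N in sequentially. N0 \<le> N \<and> 0 < z * ((\<delta> N * (h N)\<^sup>2)\<^sup>2 + q N) \<and>
      (\<forall>y. (\<lambda>xs. \<Sum>k\<le>Gn a N. lin_coeff a N k * S N (pt a N k) xs y) \<in> borel_measurable (PX N)) \<and>
      (\<forall>xs. (\<forall>k\<le>Gn a N. good N \<kappa> K1 (pt a N k) xs) \<longrightarrow>
        prob_space.bounded_rv (measure_pmf (response_pmf (p N) N xs))
          (\<lambda>y. \<Sum>k\<le>Gn a N. lin_coeff a N k * S N (pt a N k) xs y) \<and>
        rexp N xs
          (\<lambda>y. (\<Sum>k\<le>Gn a N. lin_coeff a N k * S N (pt a N k) xs y)\<^sup>2) \<le> \<theta> * (z * ((\<delta> N * (h N)\<^sup>2)\<^sup>2 + q N))\<^sup>2)"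
  proof eventually_elim
    case (elim N)
    have N: "N0 \<le> N" using elim(2) by (simp add: small_def)
    note B = basic[OF N]
    let ?e = "\<delta> N * (h N)\<^sup>2"
    have q0: "0 < q N" by (rule q_pos[OF N])
    have zq: "0 < z * (?e\<^sup>2 + q N)" using z q0 by (intro mult_pos_pos add_nonneg_pos) auto
    have pI: "pt a N k \<in> I" if "k \<in> {..Gn a N}" for k using that by (intro pt_in[OF N a]) simp
    have meas: "(\<lambda>xs. \<Sum>k\<le>Gn a N. lin_coeff a N k * S N (pt a N k) xs y) \<in> borel_measurable (PX N)" for y
    proof (rule borel_measurable_sum)
      fix k assume k: "k \<in> {..Gn a N}"
      show "(\<lambda>xs. lin_coeff a N k * S N (pt a N k) xs y) \<in> borel_measurable (PX N)"
        by (rule borel_measurable_times[OF borel_measurable_const S_measurable[OF B(1) pI[OF k]]])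
    qed
    have E: "prob_space.bounded_rv (measure_pmf (response_pmf (p N) N xs))
          (\<lambda>y. \<Sum>k\<le>Gn a N. lin_coeff a N k * S N (pt a N k) xs y)"
      "rexp N xs
          (\<lambda>y. (\<Sum>k\<le>Gn a N. lin_coeff a N k * S N (pt a N k) xs y)\<^sup>2) \<le> \<theta> * (z * (?e\<^sup>2 + q N))\<^sup>2"
      if g: "\<forall>k\<le>Gn a N. good N \<kappa> K1 (pt a N k) xs" for xs
    proof -
      let ?P = "measure_pmf (response_pmf (p N) N xs)"
      interpret C: indep_centred ?P "{1..N div \<nu> N}"
        "\<lambda>j y. group_clear (\<nu> N) N xs y j - m N xs j" by (rule conditional_model[OF B(1)])
      note ps = measure_pmf.prob_space_axioms[of "response_pmf (p N) N xs"]
      show "prob_space.bounded_rv ?P (\<lambda>y. \<Sum>k\<le>Gn a N. lin_coeff a N k * S N (pt a N k) xs y)"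
        by (rule prob_space.bounded_rv_sum[OF ps], rule prob_space.bounded_rv_cmult[OF ps C.brv_lin])
      have "rexp N xs
          (\<lambda>y. (\<Sum>k\<le>Gn a N. lin_coeff a N k * S N (pt a N k) xs y)\<^sup>2)
          \<le> (10 * (K + 1) * K ^ 3 / c\<^sup>2) * h N * (q N * (Bc * ?e)\<^sup>2)"
      proof (rule grid_moments(2)[OF elim(2) \<kappa> K1 a elim(3)])
        show "1 / (real N * h N * \<delta> N) \<le> 1" using elim(4) by blast
        show "0 \<le> lam a N k \<and> lam a N k \<le> 1 / ((real (\<nu> N))\<^sup>2 * c\<^sup>2) * step a N" for k by (rule lam_bounds[OF N a])
        show "\<bar>lin_coeff a N k\<bar> \<le> (Bc * ?e) / (real (\<nu> N) * c) * step a N" for k by (rule lin_coeff_bound[OF N a])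
        show "0 \<le> Bc * (\<delta> N * (h N)\<^sup>2)" using Bc B by simp
        show "good N \<kappa> K1 (pt a N k) xs" if "k \<le> Gn a N" for k using g that by blast
      qed
      also have "\<dots> = C * h N * (q N * ?e\<^sup>2)" by (simp only: C_def power_mult_distrib mult_ac)
      also have "\<dots> \<le> C * (\<theta> * z\<^sup>2 / C) * (?e\<^sup>2 + q N)\<^sup>2"
      proof (intro mult_mono mult_left_mono elim(1))
        \<comment> \<open>The mixed product of variance and squared bias is at most the square of
          their sum.\<close>
        have "y * x \<le> (x + y)\<^sup>2" if "0 \<le> x" "0 \<le> y" for x y :: real
          using that mult_mono[of y "x + y" x "x + y"] by (simp add: power2_eq_square)
        from this[of "?e\<^sup>2" "q N"] show "q N * ?e\<^sup>2 \<le> (?e\<^sup>2 + q N)\<^sup>2" using q0 by simp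
      qed (use C B \<theta> in simp_all)
      also have "\<dots> = \<theta> * (z * (?e\<^sup>2 + q N))\<^sup>2" unfolding power_mult_distrib using C by simp
      finally show "rexp N xs
          (\<lambda>y. (\<Sum>k\<le>Gn a N. lin_coeff a N k * S N (pt a N k) xs y)\<^sup>2) \<le> \<theta> * (z * (?e\<^sup>2 + q N))\<^sup>2" .
    qed
    show ?case using N zq meas E by blast
  qed
qed

section \<open>The integrated square for a fixed sample and response vector\<close>

definition Q1 :: "real \<Rightarrow> real" where "Q1 K1 = (K1 * (2 * Q0 + K\<^sup>2) + K ^ 3) / c"
definition Q2 :: "real \<Rightarrow> real" where "Q2 K1 = K1 * (2 * Q0 + K\<^sup>2) + 2 * K ^ 4"
definition E1 :: "real \<Rightarrow> real" where "E1 K1 = Q1 K1 + 2 / c\<^sup>2 * (1 / c + Q2 K1)"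

lemma Q12: "1 \<le> K1 \<Longrightarrow> 0 < Q1 K1" "1 \<le> K1 \<Longrightarrow> 0 < Q2 K1" "1 \<le> K1 \<Longrightarrow> 0 < E1 K1"
proof -
  assume K1: "1 \<le> K1"
  show Q: "0 < Q1 K1" "0 < Q2 K1"
    using K1 Q0 K c by (auto simp: Q1_def Q2_def intro!: divide_pos_pos add_pos_nonneg mult_pos_pos)
  have "0 < 1 / c + Q2 K1" using c Q by (intro add_pos_pos) auto
  then have "0 < 2 / c\<^sup>2 * (1 / c + Q2 K1)" using c by (intro mult_pos_pos) auto
  then show "0 < E1 K1" using Q unfolding E1_def by linarith
qed

abbreviation err :: "nat \<Rightarrow> (nat \<Rightarrow> real) \<Rightarrow> (nat \<Rightarrow> bool) \<Rightarrow> real \<Rightarrow> real" where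
  "err N xs y x \<equiv> (1 - root (\<nu> N) (\<mu> N x + (S N x xs y + bias N xs x))) - p N x"

text \<open>\<open>T\<close> stands for the value of \<open>S\<close> at the nearest lower grid
  point and \<omega> for the weight increment over one step. The expansion from
  \<open>remainder\<close> is transferred from \<open>S\<close> to \<open>T\<close> and then squared
  by \<open>square_expand\<close>.\<close>

lemma square_approx:
  assumes s: "small N \<kappa>" and \<kappa>: "0 < \<kappa>" "\<kappa> \<le> z" and K1: "1 \<le> K1"
    and z: "0 < z" "z \<le> 1" "z \<le> c / 2" "z * E1 K1 \<le> 1"
    and x: "x \<in> I" and g: "good N \<kappa> K1 x xs"
    and T: "\<bar>S N x xs y - T\<bar> \<le> \<omega>" "\<bar>T\<bar> \<le> z / 4" and \<omega>: "\<omega> \<le> z / 4"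
    and bz: "Q2 K1 * (real (\<nu> N) * \<delta> N * (h N)\<^sup>2) \<le> z / 2" and e1: "\<delta> N * (h N)\<^sup>2 \<le> 1"
  shows "\<bar>(err N xs y x)\<^sup>2 - ((L N x * T)\<^sup>2 + 2 * (L N x * T * B_term \<nu> h p b N x) + (B_term \<nu> h p b N x)\<^sup>2)\<bar>
    \<le> 2 * (z * E1 K1) * (2 * Bc + 1) * ((\<delta> N * (h N)\<^sup>2)\<^sup>2 + (L N x * T)\<^sup>2) + (12 + 8 * Bc) * (\<omega> / c)"
proof -
  have N: "N0 \<le> N" using s by (simp add: small_def)
  note B = basic[OF N]
  let ?e = "\<delta> N * (h N)\<^sup>2" and ?S = "S N x xs y" and ?B = "B_term \<nu> h p b N x"
  have e0: "0 \<le> ?e" using B by simp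
  have \<omega>0: "0 \<le> \<omega>" using T(1) by linarith
  have \<kappa>1: "\<kappa> \<le> 1" using \<kappa> z by linarith
  note Q = Q12[OF K1]
  have "\<bar>?S\<bar> \<le> \<bar>?S - T\<bar> + \<bar>T\<bar>" by linarith
  then have S2: "\<bar>?S\<bar> \<le> z / 2" using T \<omega> by linarith
  have "\<bar>bias N xs x\<bar> \<le> Q2 K1 * (real (\<nu> N) * \<delta> N * (h N)\<^sup>2)"
    unfolding Q2_def by (rule bias_expansion(2)[OF s x g \<kappa>(1) \<kappa>1 K1])
  then have "\<bar>bias N xs x\<bar> \<le> z / 2" using bz by linarith
  then have \<tau>: "\<bar>?S + bias N xs x\<bar> \<le> z" using S2 abs_triangle_ineq[of ?S "bias N xs x"] by linarith
  have Lc: "\<bar>L N x\<bar> \<le> 1 / c"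
  proof -
    have "1 * c \<le> real (\<nu> N) * c" using B c by (intro mult_right_mono) auto
    then have "1 / (real (\<nu> N) * c) \<le> 1 / c" using c by (simp add: frac_le)
    then show ?thesis using L_bounds(1)[OF N x] by linarith
  qed
  have "\<bar>err N xs y x - (L N x * ?S + ?B)\<bar> \<le> Q1 K1 * \<kappa> * ?e + 2 / c\<^sup>2 * z * (\<bar>L N x * ?S\<bar> / c + Q2 K1 * ?e)"
    unfolding Q1_def Q2_def by (rule remainder[OF s x g \<kappa>(1) \<kappa>1 K1 \<tau> z(3)])
  also have "\<dots> \<le> z * E1 K1 * (?e + \<bar>L N x * ?S\<bar>)"
  proof -
    have i1: "Q1 K1 * \<kappa> * ?e \<le> Q1 K1 * z * (?e + \<bar>L N x * ?S\<bar>)"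
      using Q \<kappa> e0 z by (intro mult_mono mult_left_mono) auto
    have i2: "2 / c\<^sup>2 * z * (\<bar>L N x * ?S\<bar> / c + Q2 K1 * ?e) \<le> 2 / c\<^sup>2 * z * ((1 / c + Q2 K1) * (?e + \<bar>L N x * ?S\<bar>))"
    proof (rule mult_left_mono)
      have "y / c + k * e \<le> (1 / c + k) * (e + y)" if "0 \<le> y" "0 \<le> k" "0 \<le> e" for y k e :: real
      proof -
        have "(1 / c + k) * (e + y) = y / c + k * e + (k * y + e / c)" by (simp add: algebra_simps add_divide_distrib)
        moreover have "0 \<le> k * y + e / c" using that c by (intro add_nonneg_nonneg) auto
        ultimately show ?thesis by linarith
      qed
      from this[of "\<bar>L N x * ?S\<bar>" "Q2 K1" ?e] show "\<bar>L N x * ?S\<bar> / c + Q2 K1 * ?e \<le> (1 / c + Q2 K1) * (?e + \<bar>L N x * ?S\<bar>)"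
        using Q e0 by simp
    qed (use z c in simp)
    have eq: "Q1 K1 * z * w + 2 / c\<^sup>2 * z * ((1 / c + Q2 K1) * w) = z * E1 K1 * w" for w
      by (simp only: E1_def distrib_left distrib_right mult_ac)
    show ?thesis by (rule order_trans[OF add_mono[OF i1 i2]]) (simp only: eq order_refl)
  qed
  finally have d1: "\<bar>err N xs y x - (L N x * ?S + ?B)\<bar> \<le> z * E1 K1 * (?e + \<bar>L N x * ?S\<bar>)" .
  have "\<bar>L N x * ?S - L N x * T\<bar> = \<bar>L N x\<bar> * \<bar>?S - T\<bar>" by (simp only: right_diff_distrib[symmetric] abs_mult)
  also have "\<dots> \<le> 1 / c * \<omega>" using Lc T c by (intro mult_mono) auto
  finally have d2: "\<bar>L N x * ?S - L N x * T\<bar> \<le> \<omega> / c" by simp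
  have t0: "0 \<le> \<omega> / c" using \<omega>0 c by simp
  have ze: "0 \<le> z * E1 K1" using z Q by simp
  have d3: "\<bar>err N xs y x - (L N x * T + ?B)\<bar> \<le> z * E1 K1 * (?e + \<bar>L N x * T\<bar>) + 2 * (\<omega> / c)"
  proof -
    have "\<bar>L N x * ?S\<bar> \<le> \<bar>L N x * T\<bar> + \<omega> / c" using d2 by linarith
    then have "z * E1 K1 * (?e + \<bar>L N x * ?S\<bar>) \<le> z * E1 K1 * (?e + \<bar>L N x * T\<bar> + \<omega> / c)"
      using ze by (intro mult_left_mono) auto
    also have "\<dots> = z * E1 K1 * (?e + \<bar>L N x * T\<bar>) + z * E1 K1 * (\<omega> / c)" by (simp only: distrib_left)
    also have "\<dots> \<le> z * E1 K1 * (?e + \<bar>L N x * T\<bar>) + 1 * (\<omega> / c)"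
      using z(4) t0 by (intro add_left_mono mult_right_mono) auto
    finally have d3: "\<bar>err N xs y x - (L N x * ?S + ?B)\<bar> \<le> z * E1 K1 * (?e + \<bar>L N x * T\<bar>) + \<omega> / c" using d1 by linarith
    have "\<bar>E - (P + b')\<bar> \<le> k + 2 * t" if "\<bar>E - (R + b')\<bar> \<le> k + t" "\<bar>R - P\<bar> \<le> t" for E P R b' k t :: real
      using that by linarith
    from this[OF d3 d2] show ?thesis .
  qed
  show ?thesis
  proof (rule square_expand[OF e0 e1 ze z(4) Bc t0 _ _ _ d3])
    have "\<omega> \<le> c" using \<omega> z c by linarith
    then show "\<omega> / c \<le> 1" using c by simp
    show "\<bar>?B\<bar> \<le> Bc * ?e" unfolding Bc_def by (rule B_bound'[OF N x])
    have "\<bar>L N x * T\<bar> \<le> 1 / c * c" unfolding abs_mult using Lc T z c by (intro mult_mono) auto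
    then show "\<bar>L N x * T\<bar> \<le> 1" using c by simp
  qed
qed

definition CV :: real where "CV = K * (K + 1)\<^sup>2 / c\<^sup>2"
text \<open>The constant of \<open>variance_approx\<close> times a bound for the length of
  \<open>I\<close>, plus 1 for the fluctuation allowed by \<open>square_sum_event\<close>.\<close>

definition H1 :: "real \<Rightarrow> real" where "H1 K1 = K * (2 * K1 / c\<^sup>2 + 2 * CV) + 1"
definition G1 :: "real \<Rightarrow> real" where "G1 K1 = K * (K * K / c) + H1 K1"
text \<open>The factor produced by \<open>integral_combine\<close> with these constants
  inserted.\<close>

definition Big :: "real \<Rightarrow> real" where
  "Big K1 = 2 * E1 K1 * (2 * Bc + 1) * (K + G1 K1) + (12 + 8 * Bc) * (K / c) + H1 K1 + 2"

lemma consts_pos: "1 \<le> K1 \<Longrightarrow> 0 < CV" "1 \<le> K1 \<Longrightarrow> 1 \<le> H1 K1" "1 \<le> K1 \<Longrightarrow> 0 < G1 K1" "1 \<le> K1 \<Longrightarrow> 0 < Big K1"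
proof -
  assume K1: "1 \<le> K1"
  show CV: "0 < CV" using K c by (simp add: CV_def)
  have "0 \<le> K * (2 * K1 / c\<^sup>2 + 2 * CV)" using K K1 c CV by (intro mult_nonneg_nonneg add_nonneg_nonneg) auto
  then show H: "1 \<le> H1 K1" by (simp add: H1_def)
  have "0 < K * (K * K / c)" using K c by simp
  then show G: "0 < G1 K1" using H unfolding G1_def by linarith
  have "0 \<le> 2 * E1 K1 * (2 * Bc + 1) * (K + G1 K1)" using Q12[OF K1] Bc K G by (intro mult_nonneg_nonneg) auto
  moreover have "0 \<le> (12 + 8 * Bc) * (K / c)" using Bc K c by (intro mult_nonneg_nonneg) auto
  ultimately show "0 < Big K1" using H unfolding Big_def by linarith
qed

lemma lint_const: "(LINT x:I|lborel. (k::real)) = k * (u - l)"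
  using I by (simp add: set_lebesgue_integral_def)

lemma variance_approx:
  assumes s: "small N \<kappa>" and \<kappa>: "0 < \<kappa>" "\<kappa> \<le> z" "h N \<le> z" "z \<le> 1" and K1: "1 \<le> K1"
    and x: "x \<in> I" "x' \<in> I" and g: "good N \<kappa> K1 x xs" "good N \<kappa> K1 x' xs"
    and \<omega>: "(\<Sum>j=1..N div \<nu> N. \<bar>W N xs x' j - W N xs x j\<bar>) \<le> z * q N"
  shows "\<bar>(L N x)\<^sup>2 * cvar N xs x' - A2 N x\<bar> \<le> (2 * K1 / c\<^sup>2 + 2 * CV) * (z * q N)"
proof -
  have N: "N0 \<le> N" using s by (simp add: small_def)
  note B = basic[OF N]
  note q0 = q_pos[OF N]
  have L2: "(L N x)\<^sup>2 \<le> 1 / c\<^sup>2"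
  proof -
    have "1 * c\<^sup>2 \<le> (real (\<nu> N))\<^sup>2 * c\<^sup>2" using B by (intro mult_right_mono one_le_power) auto
    then have "1 / ((real (\<nu> N))\<^sup>2 * c\<^sup>2) \<le> 1 / c\<^sup>2" using c by (simp add: frac_le)
    then show ?thesis using L_bounds(3)[OF N x(1)] by linarith
  qed
  have "\<bar>cvar N xs x' - cvar N xs x\<bar> \<le> 2 * K1 * (\<Sum>j=1..N div \<nu> N. \<bar>W N xs x' j - W N xs x j\<bar>)"
    by (rule cvar_diff[OF g(2,1)])
  also have "\<dots> \<le> 2 * K1 * (z * q N)" using \<omega> K1 by (intro mult_left_mono) auto
  finally have cd: "\<bar>cvar N xs x' - cvar N xs x\<bar> \<le> 2 * K1 * (z * q N)" .
  have "\<bar>(L N x)\<^sup>2 * cvar N xs x' - (L N x)\<^sup>2 * cvar N xs x\<bar> = (L N x)\<^sup>2 * \<bar>cvar N xs x' - cvar N xs x\<bar>"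
    by (simp add: right_diff_distrib[symmetric] abs_mult)
  also have "\<dots> \<le> 1 / c\<^sup>2 * (2 * K1 * (z * q N))" using L2 cd by (intro mult_mono) auto
  also have "\<dots> = 2 * K1 / c\<^sup>2 * (z * q N)" by (simp only: times_divide_eq_left times_divide_eq_right mult_1_left mult.assoc)
  finally have p1: "\<bar>(L N x)\<^sup>2 * cvar N xs x' - (L N x)\<^sup>2 * cvar N xs x\<bar> \<le> 2 * K1 / c\<^sup>2 * (z * q N)" .
  have \<kappa>1: "\<kappa> \<le> 1" using \<kappa> by linarith
  have "\<bar>(L N x)\<^sup>2 * cvar N xs x - A2 N x\<bar> \<le> CV * (\<kappa> + h N) * q N"
    unfolding CV_def by (rule variance_expansion[OF s x(1) g(1) \<kappa>(1) \<kappa>1])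
  also have "\<dots> \<le> CV * (z + z) * q N"
    using consts_pos(1)[OF K1] \<kappa> q0 by (intro mult_right_mono mult_left_mono add_mono) auto
  also have "\<dots> = 2 * CV * (z * q N)" by (simp only: mult_2[symmetric] mult_ac)
  finally show ?thesis using p1 unfolding distrib_right by linarith
qed

text \<open>A deterministic statement: its hypotheses are the outcomes of the random events. The
  square is expanded around the step function \<open>T\<close>; the integral of its stochastic part
  is moved to the conditional variance by \<open>U\<close> and from there to \<open>A2\<close>, and
  the cross term is removed by \<open>C\<close>.\<close>

lemma integral_pathwise:
  assumes s: "small N \<kappa>" and \<kappa>: "0 < \<kappa>" "\<kappa> \<le> z" "h N \<le> z" and K1: "1 \<le> K1" and a: "0 < a"
    and z: "0 < z" "z \<le> 1" "z \<le> c / 2" "z * E1 K1 \<le> 1"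
    and g: "\<And>x. x \<in> I \<Longrightarrow> good N \<kappa> K1 x xs"
    and md: "\<And>x x'. x \<in> I \<Longrightarrow> x' \<in> I \<Longrightarrow> \<bar>x - x'\<bar> \<le> step a N \<Longrightarrow> (\<Sum>j=1..N div \<nu> N. \<bar>W N xs x j - W N xs x' j\<bar>) \<le> \<omega>"
    and \<omega>: "\<omega> \<le> z * q N" "q N \<le> 1 / 4"
    and Sg: "\<And>k. k \<le> Gn a N \<Longrightarrow> \<bar>S N (pt a N k) xs y\<bar> \<le> z / 4"
    and bz: "Q2 K1 * (real (\<nu> N) * \<delta> N * (h N)\<^sup>2) \<le> z / 2" and e1: "\<delta> N * (h N)\<^sup>2 \<le> 1"
    and U: "\<bar>\<Sum>k\<le>Gn a N. lam a N k * ((S N (pt a N k) xs y)\<^sup>2 - cvar N xs (pt a N k))\<bar> \<le> z * q N"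
    and C: "\<bar>\<Sum>k\<le>Gn a N. lin_coeff a N k * S N (pt a N k) xs y\<bar> \<le> z * ((\<delta> N * (h N)\<^sup>2)\<^sup>2 + q N)"
    and Di: "set_integrable lborel I (\<lambda>x. (err N xs y x)\<^sup>2)" and v0: "\<And>x. x \<in> I \<Longrightarrow> 0 \<le> v x"
  shows "\<bar>(LINT x:I|lborel. (err N xs y x)\<^sup>2) - (LINT x:I|lborel. (A_term \<nu> h p v N x)\<^sup>2 + (B_term \<nu> h p b N x)\<^sup>2)\<bar>
    \<le> z * Big K1 * ((\<delta> N * (h N)\<^sup>2)\<^sup>2 + q N)"
proof -
  have N: "N0 \<le> N" using s by (simp add: small_def)
  note B = basic[OF N]
  note q0 = q_pos[OF N]
  let ?e = "\<delta> N * (h N)\<^sup>2" and ?B = "B_term \<nu> h p b N"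
  define T where "T x = S N (pt a N (idx a N x)) xs y" for x
  define cv where "cv x = cvar N xs (pt a N (idx a N x))" for x
  have near: "\<bar>pt a N (idx a N x) - x\<bar> \<le> step a N" if "x \<in> I" for x
    using idx_props(2,3)[OF N a that] by linarith
  have B2i: "set_integrable lborel I (\<lambda>x. (?B x)\<^sup>2)" by (intro cont_set_integrable continuous_intros B_continuous[OF N])
  have A2i: "set_integrable lborel I (A2 N)" by (intro cont_set_integrable A2_continuous[OF N])
  have ci: "set_integrable lborel I (\<lambda>_. k)" for k :: real by (intro cont_set_integrable continuous_intros)
  note st2 = step_integral[OF N a L2_integrable[OF N], folded lam_def]
  note st1 = step_integral[OF N a LB_integrable[OF N], folded lin_coeff_def]
  have LTi: "set_integrable lborel I (\<lambda>x. (L N x * T x)\<^sup>2)"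
    unfolding power_mult_distrib T_def by (rule st2(1))
  have LT: "(LINT x:I|lborel. (L N x * T x)\<^sup>2) = (\<Sum>k\<le>Gn a N. lam a N k * (S N (pt a N k) xs y)\<^sup>2)"
    unfolding power_mult_distrib T_def by (rule st2(2))
  have Lcvi: "set_integrable lborel I (\<lambda>x. (L N x)\<^sup>2 * cv x)" unfolding cv_def by (rule st2(1))
  have Lcv: "(LINT x:I|lborel. (L N x)\<^sup>2 * cv x) = (\<Sum>k\<le>Gn a N. lam a N k * cvar N xs (pt a N k))"
    unfolding cv_def by (rule st2(2))
  have LTB: "L N x * T x * ?B x = L N x * ?B x * T x" for x by simp
  have LTBi: "set_integrable lborel I (\<lambda>x. L N x * T x * ?B x)"
    unfolding LTB unfolding T_def by (rule st1(1))
  have LTBv: "(LINT x:I|lborel. L N x * T x * ?B x) = (\<Sum>k\<le>Gn a N. lin_coeff a N k * S N (pt a N k) xs y)"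
    unfolding LTB unfolding T_def by (rule st1(2))
  have \<omega>4: "\<omega> \<le> z / 4"
  proof -
    have "z * q N \<le> z * (1 / 4)" by (rule mult_left_mono[OF \<omega>(2) less_imp_le[OF z(1)]])
    then show ?thesis using \<omega>(1) by linarith
  qed
  define F where "F x = 2 * (z * E1 K1) * (2 * Bc + 1) * (?e\<^sup>2 + (L N x * T x)\<^sup>2) + (12 + 8 * Bc) * (\<omega> / c)" for x
  have Fi: "set_integrable lborel I F"
    unfolding F_def[abs_def] by (intro set_integral_add set_integrable_mult_right ci LTi)
  have Fv: "(LINT x:I|lborel. F x) = 2 * (z * E1 K1) * (2 * Bc + 1) * (?e\<^sup>2 * (u - l) + (LINT x:I|lborel. (L N x * T x)\<^sup>2))
      + (12 + 8 * Bc) * (\<omega> / c * (u - l))"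
    unfolding F_def[abs_def]
    by (subst set_integral_add(2)[OF set_integrable_mult_right[OF set_integral_add(1)[OF ci LTi]] ci])
       (simp only: set_integral_mult_right set_integral_add(2)[OF ci LTi] lint_const mult.assoc)
  define P where "P x = (L N x * T x)\<^sup>2 + 2 * (L N x * T x * ?B x) + (?B x)\<^sup>2" for x
  have Pi1: "set_integrable lborel I (\<lambda>x. (L N x * T x)\<^sup>2 + 2 * (L N x * T x * ?B x))"
    by (intro set_integral_add set_integrable_mult_right LTi LTBi)
  have Pi: "set_integrable lborel I P" unfolding P_def[abs_def] by (rule set_integral_add(1)[OF Pi1 B2i])
  have Pv: "(LINT x:I|lborel. P x) = (LINT x:I|lborel. (L N x * T x)\<^sup>2)
      + 2 * (LINT x:I|lborel. L N x * T x * ?B x) + (LINT x:I|lborel. (?B x)\<^sup>2)"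
    unfolding P_def[abs_def] set_integral_add(2)[OF Pi1 B2i]
      set_integral_add(2)[OF LTi set_integrable_mult_right[OF LTBi]] set_integral_mult_right ..
  have "\<bar>LINT x:I|lborel. (err N xs y x)\<^sup>2 - P x\<bar> \<le> (LINT x:I|lborel. F x)"
  proof (rule set_integral_abs_le[OF set_integral_diff(1)[OF Di Pi] Fi])
    fix x assume x: "x \<in> I"
    note ip = idx_props[OF N a x]
    have T1: "\<bar>S N x xs y - T x\<bar> \<le> \<omega>"
      unfolding T_def by (rule order_trans[OF S_diff md[OF x ip(4)]]) (use near[OF x] in \<open>simp add: abs_minus_commute\<close>)
    have T2: "\<bar>T x\<bar> \<le> z / 4" unfolding T_def by (rule Sg[OF ip(1)])
    show "\<bar>(err N xs y x)\<^sup>2 - P x\<bar> \<le> F x"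
      unfolding P_def F_def by (rule square_approx[OF s \<kappa>(1,2) K1 z x g[OF x] T1 T2 \<omega>4 bz e1])
  qed
  then have d: "\<bar>(LINT x:I|lborel. (err N xs y x)\<^sup>2) - ((LINT x:I|lborel. (L N x * T x)\<^sup>2)
      + 2 * (LINT x:I|lborel. L N x * T x * ?B x) + (LINT x:I|lborel. (?B x)\<^sup>2))\<bar>
    \<le> 2 * (z * E1 K1) * (2 * Bc + 1) * (?e\<^sup>2 * (u - l) + (LINT x:I|lborel. (L N x * T x)\<^sup>2)) + (12 + 8 * Bc) * (\<omega> / c * (u - l))"
    unfolding set_integral_diff(2)[OF Di Pi] Pv Fv .
  have "\<bar>LINT x:I|lborel. (L N x)\<^sup>2 * cv x - A2 N x\<bar> \<le> (LINT x:I|lborel. (2 * K1 / c\<^sup>2 + 2 * CV) * (z * q N))"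
  proof (rule set_integral_abs_le[OF set_integral_diff(1)[OF Lcvi A2i] ci])
    fix x assume x: "x \<in> I"
    note ip = idx_props[OF N a x]
    show "\<bar>(L N x)\<^sup>2 * cv x - A2 N x\<bar> \<le> (2 * K1 / c\<^sup>2 + 2 * CV) * (z * q N)"
      unfolding cv_def
      by (rule variance_approx[OF s \<kappa> z(2) K1 x ip(4) g[OF x] g[OF ip(4)] order_trans[OF md[OF ip(4) x near[OF x]] \<omega>(1)]])
  qed
  also have "\<dots> = (2 * K1 / c\<^sup>2 + 2 * CV) * (z * q N) * (u - l)" by (rule lint_const)
  also have "\<dots> \<le> (2 * K1 / c\<^sup>2 + 2 * CV) * (z * q N) * K"
  proof (rule mult_left_mono[OF u_l(2)])
    show "0 \<le> (2 * K1 / c\<^sup>2 + 2 * CV) * (z * q N)"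
      by (intro mult_nonneg_nonneg add_nonneg_nonneg) (use K1 c consts_pos(1)[OF K1] z q0 in simp_all)
  qed
  also have "\<dots> = (H1 K1 - 1) * (z * q N)" by (simp only: H1_def add_diff_cancel_right' mult_ac)
  finally have c1: "\<bar>(LINT x:I|lborel. (L N x)\<^sup>2 * cv x) - (LINT x:I|lborel. A2 N x)\<bar> \<le> (H1 K1 - 1) * (z * q N)"
    unfolding set_integral_diff(2)[OF Lcvi A2i] .
  have c2: "\<bar>(LINT x:I|lborel. (L N x * T x)\<^sup>2) - (LINT x:I|lborel. (L N x)\<^sup>2 * cv x)\<bar> \<le> z * q N"
    using U unfolding LT Lcv right_diff_distrib sum_subtractf .
  have a0: "\<bar>(LINT x:I|lborel. (L N x * T x)\<^sup>2) - (LINT x:I|lborel. A2 N x)\<bar> \<le> z * H1 K1 * q N"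
  proof -
    have "\<bar>P - R\<bar> \<le> z * k * w" if "\<bar>Q - R\<bar> \<le> (k - 1) * (z * w)" "\<bar>P - Q\<bar> \<le> z * w" for P Q R k w :: real
    proof -
      have "(k - 1) * (z * w) + z * w = z * k * w" by (simp add: algebra_simps)
      then show ?thesis using that by linarith
    qed
    from this[OF c1 c2] show ?thesis .
  qed
  have A0: "(LINT x:I|lborel. A2 N x) \<le> K * (K * K / c) * q N"
  proof -
    have "\<bar>LINT x:I|lborel. A2 N x\<bar> \<le> (LINT x:I|lborel. K * K / c * q N)"
      by (rule set_integral_abs_le[OF A2i ci A2_bound[OF N]])
    also have "\<dots> = K * K / c * q N * (u - l)" by (rule lint_const)
    also have "\<dots> \<le> K * K / c * q N * K" by (rule mult_left_mono[OF u_l(2) mult_nonneg_nonneg[OF _ less_imp_le[OF q0]]]) (use K c in simp)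
    also have "\<dots> = K * (K * K / c) * q N" by (simp only: mult_ac)
    finally show ?thesis by linarith
  qed
  have Av: "(LINT x:I|lborel. (A_term \<nu> h p v N x)\<^sup>2 + (?B x)\<^sup>2) = (LINT x:I|lborel. A2 N x) + (LINT x:I|lborel. (?B x)\<^sup>2)"
  proof -
    have "(LINT x:I|lborel. (A_term \<nu> h p v N x)\<^sup>2 + (?B x)\<^sup>2) = (LINT x:I|lborel. A2 N x + (?B x)\<^sup>2)"
    proof (rule set_lebesgue_integral_cong, goal_cases)
      case 1 then show ?case using I by simp
    next
      case 2
      show ?case
      proof (intro allI impI)
        fix x assume x: "x \<in> I"
        \<comment> \<open>Nonnegativity of \<open>A2\<close> is what makes the square of
          \<open>A_term\<close> equal to it.\<close>
        have "0 \<le> c ^ 3 * \<pi> x * v x * q N" using c pi(2) v0[OF x] q0 by (intro mult_nonneg_nonneg) auto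
        also have "\<dots> \<le> A2 N x" by (rule A2_lower[OF N x v0[OF x]])
        finally show "(A_term \<nu> h p v N x)\<^sup>2 + (?B x)\<^sup>2 = A2 N x + (?B x)\<^sup>2"
          unfolding A_term_sq[OF N x] by simp
      qed
    qed
    then show ?thesis unfolding set_integral_add(2)[OF A2i B2i] .
  qed
  show ?thesis
    unfolding Av Big_def G1_def
  proof (rule integral_combine[OF _ z(2) _ Bc _ u_l(2) _ less_imp_le[OF q0] c(1) _ _ d a0 _ A0])
    show "\<bar>LINT x:I|lborel. L N x * T x * ?B x\<bar> \<le> z * (?e\<^sup>2 + q N)" unfolding LTBv by (rule C)
    show "\<omega> / c \<le> z * q N / c" using \<omega>(1) c by (intro divide_right_mono) auto
  qed (use z Q12[OF K1] u_l K c consts_pos(2)[OF K1] in auto)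
qed

section \<open>Conclusion for the integrated error\<close>

lemma modulus_of_quotient:
  assumes "\<forall>t\<in>{(x, x'). x \<in> I \<and> x' \<in> I \<and> x \<noteq> x' \<and> \<bar>x - x'\<bar> \<le> real N powr (- Cc)}.
     \<bar>case t of (x, x') \<Rightarrow> 1 / \<bar>x - x'\<bar> powr \<zeta> * (\<Sum>k=1..N div \<nu> N. \<bar>W N xs x k - W N xs x' k\<bar>)\<bar> \<le> Kh"
    and Kh: "0 \<le> Kh"
  shows "modulus N Cc \<zeta> Kh xs"
  unfolding modulus_def
proof (intro ballI impI)
  fix x x' assume x: "x \<in> I" "x' \<in> I" "\<bar>x - x'\<bar> \<le> real N powr (- Cc)"
  show "(\<Sum>j=1..N div \<nu> N. \<bar>W N xs x j - W N xs x' j\<bar>) \<le> Kh * \<bar>x - x'\<bar> powr \<zeta>"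
  proof (cases "x = x'")
    case False
    then have pos: "0 < \<bar>x - x'\<bar> powr \<zeta>" by simp
    have "(x, x') \<in> {(x, x'). x \<in> I \<and> x' \<in> I \<and> x \<noteq> x' \<and> \<bar>x - x'\<bar> \<le> real N powr (- Cc)}" using x False by simp
    from bspec[OF assms(1) this]
    have "1 / \<bar>x - x'\<bar> powr \<zeta> * (\<Sum>k=1..N div \<nu> N. \<bar>W N xs x k - W N xs x' k\<bar>) \<le> Kh" by simp
    moreover have "s \<le> k * t" if "1 / t * s \<le> k" "0 < t" for s k t :: real
      using that by (simp add: divide_le_eq)
    ultimately show ?thesis using pos by blast
  qed simp
qed

lemma integral_whp:
  assumes wc: "weight_conditions M X \<nu> h w b v I"
    and Cc: "0 < Cc" and \<zeta>: "0 < \<zeta>"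
    and ho: "O_prob_on M
            (\<lambda>N. {(x, x'). x \<in> I \<and> x' \<in> I \<and> x \<noteq> x' \<and> \<bar>x - x'\<bar> \<le> real N powr (- Cc)})
            (\<lambda>N (x, x') \<omega>. 1 / \<bar>x - x'\<bar> powr \<zeta> * (\<Sum>k=1..N div \<nu> N.
               \<bar>weight w N (obs N \<omega>) k x / weight_sum w (\<nu> N) N (obs N \<omega>) x
                - weight w N (obs N \<omega>) k x' / weight_sum w (\<nu> N) N (obs N \<omega>) x'\<bar>))
            (\<lambda>_. 1)"
    and \<epsilon>: "0 < \<epsilon>" and \<eta>: "0 < \<eta>"
  shows "with_prob M \<eta> (\<lambda>N \<omega>. set_integrable lborel I
              (\<lambda>x. (p_est N \<omega> x - p N x)\<^sup>2)
         \<and> \<bar>(LINT x:I|lborel. (p_est N \<omega> x - p N x)\<^sup>2)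
                 - (LINT x:I|lborel. (A_term \<nu> h p v N x)\<^sup>2 + (B_term \<nu> h p b N x)\<^sup>2)\<bar>
             \<le> \<epsilon> * ((\<delta> N)\<^sup>2 * (h N) ^ 4 + \<delta> N / (real N * h N)))"
proof -
  \<comment> \<open>Shared among goodness on \<open>I\<close>, the weight increments and the three
    grid events.\<close>
  define \<theta> where "\<theta> = \<eta> / 5"
  have \<theta>: "0 < \<theta>" using \<eta> by (simp add: \<theta>_def)
  obtain K1 where K1: "1 \<le> K1" and gw: "\<And>\<kappa>. 0 < \<kappa> \<Longrightarrow> with_prob M \<theta> (\<lambda>N \<omega>. \<forall>x\<in>I. good N \<kappa> K1 x (obs N \<omega>))"
    using good_whp[OF wc order_refl \<theta>] by blast
  obtain Kh0 where hw: "with_prob M \<theta> (\<lambda>N \<omega>. \<forall>t\<in>{(x, x'). x \<in> I \<and> x' \<in> I \<and> x \<noteq> x' \<and> \<bar>x - x'\<bar> \<le> real N powr (- Cc)}.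
      \<bar>(case t of (x, x') \<Rightarrow> \<lambda>\<omega>. 1 / \<bar>x - x'\<bar> powr \<zeta> * (\<Sum>k=1..N div \<nu> N.
               \<bar>weight w N (obs N \<omega>) k x / weight_sum w (\<nu> N) N (obs N \<omega>) x
                - weight w N (obs N \<omega>) k x' / weight_sum w (\<nu> N) N (obs N \<omega>) x'\<bar>)) \<omega>\<bar> \<le> Kh0 * 1)"
    by (rule with_prob_of_O[OF ho \<theta>])
  define Kh where "Kh = max Kh0 0"
  have Kh: "0 \<le> Kh" "Kh0 \<le> Kh" by (simp_all add: Kh_def)
  have hm: "with_prob M \<theta> (\<lambda>N \<omega>. modulus N Cc \<zeta> Kh (smp N \<omega>))"
  proof (rule with_prob_mono[OF hw _ order_refl])
    show "\<forall>\<^sub>F N in sequentially. \<forall>\<omega>\<in>space (M N). (\<forall>t\<in>{(x, x'). x \<in> I \<and> x' \<in> I \<and> x \<noteq> x' \<and> \<bar>x - x'\<bar> \<le> real N powr (- Cc)}.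
      \<bar>(case t of (x, x') \<Rightarrow> \<lambda>\<omega>. 1 / \<bar>x - x'\<bar> powr \<zeta> * (\<Sum>k=1..N div \<nu> N.
               \<bar>weight w N (obs N \<omega>) k x / weight_sum w (\<nu> N) N (obs N \<omega>) x
                - weight w N (obs N \<omega>) k x' / weight_sum w (\<nu> N) N (obs N \<omega>) x'\<bar>)) \<omega>\<bar> \<le> Kh0 * 1)
        \<longrightarrow> modulus N Cc \<zeta> Kh (smp N \<omega>)"
      using ev_N0
    proof (eventually_elim, intro ballI impI)
      fix N \<omega>
      assume N: "N0 \<le> N"
      assume A: "\<forall>t\<in>{(x, x'). x \<in> I \<and> x' \<in> I \<and> x \<noteq> x' \<and> \<bar>x - x'\<bar> \<le> real N powr (- Cc)}.
        \<bar>(case t of (x, x') \<Rightarrow> \<lambda>\<omega>. 1 / \<bar>x - x'\<bar> powr \<zeta> * (\<Sum>k=1..N div \<nu> N.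
               \<bar>weight w N (obs N \<omega>) k x / weight_sum w (\<nu> N) N (obs N \<omega>) x
                - weight w N (obs N \<omega>) k x' / weight_sum w (\<nu> N) N (obs N \<omega>) x'\<bar>)) \<omega>\<bar> \<le> Kh0 * 1"
      have WW: "W N (obs N \<omega>) = W N (smp N \<omega>)" by (rule W_cong) (rule smp_eq[OF basic(1)[OF N]])
      show "modulus N Cc \<zeta> Kh (smp N \<omega>)"
      proof (rule modulus_of_quotient[OF ballI Kh(1)])
        fix t assume t: "t \<in> {(x, x'). x \<in> I \<and> x' \<in> I \<and> x \<noteq> x' \<and> \<bar>x - x'\<bar> \<le> real N powr (- Cc)}"
        from bspec[OF A this] Kh(2)
        show "\<bar>case t of (x, x') \<Rightarrow> 1 / \<bar>x - x'\<bar> powr \<zeta> * (\<Sum>k=1..N div \<nu> N. \<bar>W N (smp N \<omega>) x k - W N (smp N \<omega>) x' k\<bar>)\<bar> \<le> Kh"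
          unfolding WW[symmetric] by (simp add: W_def split: prod.splits)
      qed
    qed
  qed
  \<comment> \<open>A single tolerance serves as \<kappa>, as bound for h and in all grid events. It
    respects the range of the root expansion and makes \<open>z * E1 K1 \<le> 1\<close> and
    \<open>z * Big K1 \<le> \<epsilon>\<close>.\<close>
  define z where "z = min (min 1 (c / 2)) (min (1 / E1 K1) (\<epsilon> / Big K1))"
  note E1 = Q12(3)[OF K1] and Big = consts_pos(4)[OF K1]
  have z: "0 < z" using E1 Big c \<epsilon> by (simp add: z_def)
  have z1: "z \<le> 1" "z \<le> c / 2" and "z \<le> 1 / E1 K1" "z \<le> \<epsilon> / Big K1" unfolding z_def by linarith+
  from this(3,4) have z2: "z * E1 K1 \<le> 1" "z * Big K1 \<le> \<epsilon>" using E1 Big by (simp_all add: pos_le_divide_eq)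
  define a where "a = Cc + 4 / \<zeta> + 2"
  have "0 < 4 / \<zeta>" using \<zeta> by simp
  then have a: "0 < a" using Cc unfolding a_def by linarith
  have fine: "\<forall>\<^sub>F N in sequentially. step a N \<le> real N powr (- Cc) \<and> step a N \<le> h N \<and> Kh * step a N powr \<zeta> \<le> z * q N"
    unfolding a_def by (rule grid_fine[OF Cc \<zeta> Kh(1) z])
  then have st: "\<forall>\<^sub>F N in sequentially. step a N \<le> h N" by (rule eventually_mono) blast
  have z4: "0 < z / 4" using z by simp
  have ev: "with_prob M (\<theta> + (\<theta> + (\<theta> + (\<theta> + \<theta>)))) (\<lambda>N \<omega>. (\<forall>x\<in>I. good N z K1 x (obs N \<omega>)) \<and> modulus N Cc \<zeta> Kh (smp N \<omega>) \<and>
     ((\<forall>k\<le>Gn a N. good N z K1 (pt a N k) (smp N \<omega>)) \<longrightarrow> \<not> (\<exists>k\<in>{..Gn a N}. z / 4 \<le> \<bar>S N (pt a N k) (smp N \<omega>) (rsp N \<omega>)\<bar>)) \<and>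
     ((\<forall>k\<le>Gn a N. good N z K1 (pt a N k) (smp N \<omega>)) \<longrightarrow>
        \<not> z * q N \<le> \<bar>\<Sum>k\<le>Gn a N. lam a N k * ((S N (pt a N k) (smp N \<omega>) (rsp N \<omega>))\<^sup>2 - cvar N (smp N \<omega>) (pt a N k))\<bar>) \<and>
     ((\<forall>k\<le>Gn a N. good N z K1 (pt a N k) (smp N \<omega>)) \<longrightarrow>
        \<not> z * ((\<delta> N * (h N)\<^sup>2)\<^sup>2 + q N) \<le> \<bar>\<Sum>k\<le>Gn a N. lin_coeff a N k * S N (pt a N k) (smp N \<omega>) (rsp N \<omega>)\<bar>))"
    by (intro with_prob_conj[OF gw[OF z]] with_prob_conj[OF hm] with_prob_conj[OF grid_sup_event[OF z z1(1) a z4 \<theta>]]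
        with_prob_conj[OF square_sum_event[OF z z1(1) K1 a z \<theta> st]] linear_sum_event[OF z z1(1) K1 a z \<theta> st] prob)
  have n2: "0 < z / (2 * Q2 K1)" using z Q12(2)[OF K1] by simp
  have half: "0 < 1 / (2::real)" by simp
  show ?thesis
  proof (rule with_prob_mono[OF ev])
    show "\<theta> + (\<theta> + (\<theta> + (\<theta> + \<theta>))) \<le> \<eta>" by (simp add: \<theta>_def)
    show "\<forall>\<^sub>F N in sequentially. \<forall>\<omega>\<in>space (M N). (\<forall>x\<in>I. good N z K1 x (obs N \<omega>)) \<and> modulus N Cc \<zeta> Kh (smp N \<omega>) \<and>
     ((\<forall>k\<le>Gn a N. good N z K1 (pt a N k) (smp N \<omega>)) \<longrightarrow> \<not> (\<exists>k\<in>{..Gn a N}. z / 4 \<le> \<bar>S N (pt a N k) (smp N \<omega>) (rsp N \<omega>)\<bar>)) \<and>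
     ((\<forall>k\<le>Gn a N. good N z K1 (pt a N k) (smp N \<omega>)) \<longrightarrow>
        \<not> z * q N \<le> \<bar>\<Sum>k\<le>Gn a N. lam a N k * ((S N (pt a N k) (smp N \<omega>) (rsp N \<omega>))\<^sup>2 - cvar N (smp N \<omega>) (pt a N k))\<bar>) \<and>
     ((\<forall>k\<le>Gn a N. good N z K1 (pt a N k) (smp N \<omega>)) \<longrightarrow>
        \<not> z * ((\<delta> N * (h N)\<^sup>2)\<^sup>2 + q N) \<le> \<bar>\<Sum>k\<le>Gn a N. lin_coeff a N k * S N (pt a N k) (smp N \<omega>) (rsp N \<omega>)\<bar>) \<longrightarrow>
      set_integrable lborel I (\<lambda>x. (p_est N \<omega> x - p N x)\<^sup>2)
         \<and> \<bar>(LINT x:I|lborel. (p_est N \<omega> x - p N x)\<^sup>2)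
                 - (LINT x:I|lborel. (A_term \<nu> h p v N x)\<^sup>2 + (B_term \<nu> h p b N x)\<^sup>2)\<bar>
             \<le> \<epsilon> * ((\<delta> N)\<^sup>2 * (h N) ^ 4 + \<delta> N / (real N * h N))"
      using ev_small[OF z] h_small[OF z] fine nu_delta_h2_small[OF n2] nu_delta_h2_small[OF zero_less_one] nu_sqrt_q_small[OF half]
    proof (eventually_elim, intro ballI impI, elim conjE)
      fix N \<omega>
      assume s: "small N z" and hz: "h N \<le> z" and f1: "step a N \<le> real N powr (- Cc)" and f3: "Kh * step a N powr \<zeta> \<le> z * q N"
        and b1: "real (\<nu> N) * \<delta> N * (h N)\<^sup>2 \<le> z / (2 * Q2 K1)" and b2: "real (\<nu> N) * \<delta> N * (h N)\<^sup>2 \<le> 1"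
        and b3: "real (\<nu> N) * sqrt (q N) \<le> 1 / 2"
        and \<omega>: "\<omega> \<in> space (M N)"
        and g0: "\<forall>x\<in>I. good N z K1 x (obs N \<omega>)" and md: "modulus N Cc \<zeta> Kh (smp N \<omega>)"
        and e1: "(\<forall>k\<le>Gn a N. good N z K1 (pt a N k) (smp N \<omega>)) \<longrightarrow> \<not> (\<exists>k\<in>{..Gn a N}. z / 4 \<le> \<bar>S N (pt a N k) (smp N \<omega>) (rsp N \<omega>)\<bar>)"
        and e2: "(\<forall>k\<le>Gn a N. good N z K1 (pt a N k) (smp N \<omega>)) \<longrightarrow>
          \<not> z * q N \<le> \<bar>\<Sum>k\<le>Gn a N. lam a N k * ((S N (pt a N k) (smp N \<omega>) (rsp N \<omega>))\<^sup>2 - cvar N (smp N \<omega>) (pt a N k))\<bar>"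
        and e3: "(\<forall>k\<le>Gn a N. good N z K1 (pt a N k) (smp N \<omega>)) \<longrightarrow>
          \<not> z * ((\<delta> N * (h N)\<^sup>2)\<^sup>2 + q N) \<le> \<bar>\<Sum>k\<le>Gn a N. lin_coeff a N k * S N (pt a N k) (smp N \<omega>) (rsp N \<omega>)\<bar>"
      have N: "N0 \<le> N" using s by (simp add: small_def)
      note B = basic[OF N]
      note q0 = q_pos[OF N]
      have g: "good N z K1 x (smp N \<omega>)" if "x \<in> I" for x using g0 that good_smp[OF B(1)] by blast
      have gk: "\<forall>k\<le>Gn a N. good N z K1 (pt a N k) (smp N \<omega>)" using g pt_in[OF N a] by blast
      have sum1: "(\<Sum>j=1..N div \<nu> N. W N (smp N \<omega>) x j) = 1" if "x \<in> I" for x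
        using g[OF that] unfolding good_def by blast
      have err: "p_est N \<omega> x - p N x = err N (smp N \<omega>) (rsp N \<omega>) x" if "x \<in> I" for x
        by (rule arg_cong[OF p_hat_eq[OF N \<omega> sum1[OF that]]])
      have pc: "continuous_on I \<pi>" by (rule continuous_on_subset[OF pi_cont(1) J(3)])
      have Pi: "set_integrable lborel I (\<lambda>x. (p_est N \<omega> x - p N x)\<^sup>2)"
        by (intro cont_set_integrable continuous_intros p_hat_continuous[OF N \<omega> \<zeta> sum1 md] pc)
      have Di: "set_integrable lborel I (\<lambda>x. (err N (smp N \<omega>) (rsp N \<omega>) x)\<^sup>2)"
        by (rule set_integrable_cong[THEN iffD1, OF refl refl _ Pi]) (simp only: err)
      have PD: "(LINT x:I|lborel. (p_est N \<omega> x - p N x)\<^sup>2)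
          = (LINT x:I|lborel. (err N (smp N \<omega>) (rsp N \<omega>) x)\<^sup>2)"
        by (rule set_lebesgue_integral_cong) (use I err in auto)
      have q4: "q N \<le> 1 / 4"
      proof -
        have "1 * sqrt (q N) \<le> real (\<nu> N) * sqrt (q N)" using B q0 by (intro mult_right_mono) auto
        then have "sqrt (q N) \<le> 1 / 2" using b3 by linarith
        then have "(sqrt (q N))\<^sup>2 \<le> (1 / 2)\<^sup>2" using q0 by (intro power_mono) auto
        then show ?thesis using real_sqrt_pow2[OF less_imp_le[OF q0]] by (simp only: power_one_over) (simp add: power2_eq_square)
      qed
      have e1': "\<delta> N * (h N)\<^sup>2 \<le> 1"
      proof -
        have "1 * (\<delta> N * (h N)\<^sup>2) \<le> real (\<nu> N) * (\<delta> N * (h N)\<^sup>2)" using B by (intro mult_right_mono) auto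
        then show ?thesis using b2 by (simp only: mult.assoc mult_1_left)
      qed
      have "\<bar>(LINT x:I|lborel. (err N (smp N \<omega>) (rsp N \<omega>) x)\<^sup>2) - (LINT x:I|lborel. (A_term \<nu> h p v N x)\<^sup>2 + (B_term \<nu> h p b N x)\<^sup>2)\<bar>
         \<le> z * Big K1 * ((\<delta> N * (h N)\<^sup>2)\<^sup>2 + q N)"
      proof (rule integral_pathwise[OF s z order_refl hz K1 a z z1 z2(1) g _ f3 q4 _ _ e1' _ _ Di])
        fix x x' assume x: "x \<in> I" "x' \<in> I" "\<bar>x - x'\<bar> \<le> step a N"
        have "(\<Sum>j=1..N div \<nu> N. \<bar>W N (smp N \<omega>) x j - W N (smp N \<omega>) x' j\<bar>) \<le> Kh * \<bar>x - x'\<bar> powr \<zeta>"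
          using md x order_trans[OF x(3) f1] unfolding modulus_def by blast
        also have "\<dots> \<le> Kh * step a N powr \<zeta>"
          using Kh(1) x(3) \<zeta> by (intro mult_left_mono powr_mono2) auto
        finally show "(\<Sum>j=1..N div \<nu> N. \<bar>W N (smp N \<omega>) x j - W N (smp N \<omega>) x' j\<bar>) \<le> Kh * step a N powr \<zeta>" .
      next
        fix k assume "k \<le> Gn a N"
        then have "\<not> z / 4 \<le> \<bar>S N (pt a N k) (smp N \<omega>) (rsp N \<omega>)\<bar>" using e1 gk by blast
        then show "\<bar>S N (pt a N k) (smp N \<omega>) (rsp N \<omega>)\<bar> \<le> z / 4" by (rule less_imp_le[OF not_le_imp_less])
      next
        have "Q2 K1 * (real (\<nu> N) * \<delta> N * (h N)\<^sup>2) \<le> Q2 K1 * (z / (2 * Q2 K1))"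
          using b1 Q12(2)[OF K1] by (intro mult_left_mono) auto
        also have "\<dots> = z / 2" using Q12(2)[OF K1] by simp
        finally show "Q2 K1 * (real (\<nu> N) * \<delta> N * (h N)\<^sup>2) \<le> z / 2" .
      next
        show "\<bar>\<Sum>k\<le>Gn a N. lam a N k * ((S N (pt a N k) (smp N \<omega>) (rsp N \<omega>))\<^sup>2 - cvar N (smp N \<omega>) (pt a N k))\<bar> \<le> z * q N"
          by (rule less_imp_le[OF not_le_imp_less[OF mp[OF e2 gk]]])
        show "\<bar>\<Sum>k\<le>Gn a N. lin_coeff a N k * S N (pt a N k) (smp N \<omega>) (rsp N \<omega>)\<bar> \<le> z * ((\<delta> N * (h N)\<^sup>2)\<^sup>2 + q N)"
          by (rule less_imp_le[OF not_le_imp_less[OF mp[OF e3 gk]]])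
      next
        fix x assume x: "x \<in> I"
        show "0 \<le> v x" by (rule v_nonneg[OF weight_conditions_subset[OF wc] x]) (use x in simp)
      qed
      also have "\<dots> \<le> \<epsilon> * ((\<delta> N * (h N)\<^sup>2)\<^sup>2 + q N)"
        using z2(2) q0 by (intro mult_right_mono add_nonneg_nonneg) auto
      also have "(\<delta> N * (h N)\<^sup>2)\<^sup>2 = (\<delta> N)\<^sup>2 * (h N) ^ 4" by (simp add: power_mult_distrib flip: power_mult)
      finally show "set_integrable lborel I (\<lambda>x. (p_est N \<omega> x - p N x)\<^sup>2)
         \<and> \<bar>(LINT x:I|lborel. (p_est N \<omega> x - p N x)\<^sup>2)
                 - (LINT x:I|lborel. (A_term \<nu> h p v N x)\<^sup>2 + (B_term \<nu> h p b N x)\<^sup>2)\<bar>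
             \<le> \<epsilon> * ((\<delta> N)\<^sup>2 * (h N) ^ 4 + \<delta> N / (real N * h N))"
        using Pi unfolding PD by blast
    qed
  qed
qed

theorem integrated_error:
  assumes wc: "weight_conditions M X \<nu> h w b v I"
    and ho: "\<exists>C>0. \<exists>\<epsilon>>0. O_prob_on M
            (\<lambda>N. {(x, x'). x \<in> I \<and> x' \<in> I \<and> x \<noteq> x' \<and> \<bar>x - x'\<bar> \<le> real N powr (- C)})
            (\<lambda>N (x, x') \<omega>. 1 / \<bar>x - x'\<bar> powr \<epsilon> * (\<Sum>k=1..N div \<nu> N.
               \<bar>weight w N (obs N \<omega>) k x / weight_sum w (\<nu> N) N (obs N \<omega>) x
                - weight w N (obs N \<omega>) k x' / weight_sum w (\<nu> N) N (obs N \<omega>) x'\<bar>))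
            (\<lambda>_. 1)"
  shows "whp M (\<lambda>N \<omega>. set_integrable lborel I
              (\<lambda>x. (p_est N \<omega> x - p N x)\<^sup>2))
         \<and> o_prob M
             (\<lambda>N \<omega>. (LINT x:I|lborel. (p_est N \<omega> x - p N x)\<^sup>2)
                 - (LINT x:I|lborel. (A_term \<nu> h p v N x)\<^sup>2 + (B_term \<nu> h p b N x)\<^sup>2))
             (\<lambda>N. (\<delta> N)\<^sup>2 * (h N) ^ 4 + \<delta> N / (real N * h N))"
proof -
  obtain Cc \<zeta> where C: "0 < Cc" "0 < \<zeta>" and ho': "O_prob_on M
            (\<lambda>N. {(x, x'). x \<in> I \<and> x' \<in> I \<and> x \<noteq> x' \<and> \<bar>x - x'\<bar> \<le> real N powr (- Cc)})
            (\<lambda>N (x, x') \<omega>. 1 / \<bar>x - x'\<bar> powr \<zeta> * (\<Sum>k=1..N div \<nu> N.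
               \<bar>weight w N (obs N \<omega>) k x / weight_sum w (\<nu> N) N (obs N \<omega>) x
                - weight w N (obs N \<omega>) k x' / weight_sum w (\<nu> N) N (obs N \<omega>) x'\<bar>))
            (\<lambda>_. 1)"
    using ho by (elim exE conjE) (rule that)
  note main = integral_whp[OF wc C ho']
  show ?thesis
    unfolding o_prob_def o_prob_on_def whp_with_prob
  proof (intro conjI allI impI)
    fix \<eta> :: real assume \<eta>: "0 < \<eta>"
    show "with_prob M \<eta> (\<lambda>N \<omega>. set_integrable lborel I
              (\<lambda>x. (p_est N \<omega> x - p N x)\<^sup>2))"
      by (rule with_prob_mono[OF main[OF zero_less_one \<eta>] always_eventually order_refl]) blast
  next
    fix \<epsilon> \<eta> :: real assume \<epsilon>: "0 < \<epsilon>" and \<eta>: "0 < \<eta>"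
    show "with_prob M \<eta> (\<lambda>N \<omega>. \<forall>t\<in>{()}. \<bar>(LINT x:I|lborel. (p_est N \<omega> x - p N x)\<^sup>2)
                 - (LINT x:I|lborel. (A_term \<nu> h p v N x)\<^sup>2 + (B_term \<nu> h p b N x)\<^sup>2)\<bar>
             \<le> \<epsilon> * ((\<delta> N)\<^sup>2 * (h N) ^ 4 + \<delta> N / (real N * h N)))"
      by (rule with_prob_mono[OF main[OF \<epsilon> \<eta>] always_eventually order_refl]) blast
  qed
qed

end

theorem theorem3p1:
  fixes M :: "nat \<Rightarrow> 'a measure"
    and X Y :: "nat \<Rightarrow> nat \<Rightarrow> 'a \<Rightarrow> real"
    and f \<pi> b v :: "real \<Rightarrow> real"
    and p :: "nat \<Rightarrow> real \<Rightarrow> real"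
    and \<delta> h :: "nat \<Rightarrow> real"
    and \<nu> :: "nat \<Rightarrow> nat"
    and w :: weights
    and I J :: "real set"
    and l u :: real
  assumes I: "I = {l..u}" "l < u"
    and J: "open J" "is_interval J" "I \<subseteq> J"
    and delta: "\<forall>N\<ge>1. 0 < \<delta> N"
    and pi: "\<pi> \<in> borel_measurable borel" "\<forall>x. 0 \<le> \<pi> x"
    and p: "p = (\<lambda>N x. \<delta> N * \<pi> x)"
    and nu: "\<forall>N\<ge>1. 1 \<le> \<nu> N \<and> \<nu> N dvd N"
    and h: "\<forall>N\<ge>1. 0 < h N" "\<forall>m n. 1 \<le> m \<longrightarrow> m \<le> n \<longrightarrow> h n \<le> h m" "h \<longlonglongrightarrow> 0"
    and prob: "\<forall>N\<ge>1. prob_space (M N)"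
    and iid: "\<forall>N\<ge>1. prob_space.indep_vars (M N) (\<lambda>_. borel) (\<lambda>i \<omega>. (X N i \<omega>, Y N i \<omega>)) {1..N}"
    and density: "\<forall>N\<ge>1. \<forall>i\<in>{1..N}. distributed (M N) lborel (X N i) (\<lambda>x. ennreal (f x))"
    and Y01: "\<forall>N\<ge>1. \<forall>i\<in>{1..N}. \<forall>\<omega>\<in>space (M N). Y N i \<omega> \<in> {0, 1}"
    and cond_prob: "\<forall>N\<ge>1. \<forall>i\<in>{1..N}. AE \<omega> in M N.
        real_cond_exp (M N) (vimage_algebra (space (M N)) (X N i) borel)
          (indicat_real {\<omega>\<in>space (M N). Y N i \<omega> = 1}) \<omega> = p N (X N i \<omega>)"
    and w_measurable: "\<forall>N\<ge>1. \<forall>j\<in>{1..N div \<nu> N}. \<forall>x\<in>I.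
        w N j x \<in> borel_measurable (Pi\<^sub>M {1..N} (\<lambda>_. borel))"
    and b_v_cont: "continuous_on J b" "continuous_on J v"
    and S1_S4: "\<forall>x\<in>I. weight_conditions M X \<nu> h w b v {x}"
    and T1: "\<forall>x. 0 \<le> f x" "continuous_on J f" "\<exists>c>0. \<forall>x\<in>J. c \<le> f x"
    and T2: "\<exists>c>0. \<forall>N\<ge>1. \<forall>x\<in>I. p N x \<le> 1 - c"
    and T3: "\<forall>x\<in>J. \<pi> field_differentiable at x" "\<forall>x\<in>J. deriv \<pi> field_differentiable at x"
        "hoelder_on J (deriv \<pi>)" "hoelder_on J (deriv (deriv \<pi>))"
    and T4: "\<exists>\<epsilon>>0. (\<lambda>N. h N + real (\<nu> N) * \<delta> N * h N
        + (real (\<nu> N))\<^sup>2 / (real N powr (1 - \<epsilon>) * h N * \<delta> N)) \<longlonglongrightarrow> 0"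
    and T5: "\<exists>C>0. \<forall>N\<ge>1. \<forall>j\<in>{1..N div \<nu> N}. \<forall>x\<in>I. \<forall>\<omega>\<in>space (M N).
        \<bar>group_mean (\<nu> N) N (\<lambda>i. X N i \<omega>) j - x\<bar> > C * h N
        \<longrightarrow> weight w N (\<lambda>i. X N i \<omega>) j x = 0"
    and nu_delta: "(\<lambda>N. real (\<nu> N) * \<delta> N) \<in> O(\<lambda>_. 1)"
  shows "(\<exists>K. \<forall>\<^sub>F N in sequentially. \<forall>x\<in>I. \<bar>A_term \<nu> h p v N x\<bar> \<le> K * sqrt (\<delta> N / (real N * h N)))
    \<and> (\<exists>K. \<forall>\<^sub>F N in sequentially. \<forall>x\<in>I. \<bar>B_term \<nu> h p b N x\<bar> \<le> K * (\<delta> N * (h N)\<^sup>2))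
    \<and> (\<forall>x\<in>I. \<exists>V :: nat \<Rightarrow> 'a \<Rightarrow> real.
         (\<forall>N\<ge>1. V N \<in> borel_measurable (M N))
       \<and> weak_conv_m (\<lambda>N. distr (M N) borel (V N)) std_normal_distribution
       \<and> o_prob M
           (\<lambda>N \<omega>. p_hat w (\<nu> N) N (\<lambda>i. X N i \<omega>) (\<lambda>i. Y N i \<omega>) x - p N x
                   - (A_term \<nu> h p v N x * V N \<omega> + B_term \<nu> h p b N x))
           (\<lambda>N. \<delta> N * (h N)\<^sup>2 + sqrt (\<delta> N / (real N * h N))))
    \<and> (weight_conditions M X \<nu> h w b v I
       \<and> (\<exists>C>0. \<exists>\<epsilon>>0. O_prob_on M
            (\<lambda>N. {(x, x'). x \<in> I \<and> x' \<in> I \<and> x \<noteq> x' \<and> \<bar>x - x'\<bar> \<le> real N powr (- C)})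
            (\<lambda>N (x, x') \<omega>. 1 / \<bar>x - x'\<bar> powr \<epsilon> * (\<Sum>k=1..N div \<nu> N.
               \<bar>weight w N (\<lambda>i. X N i \<omega>) k x / weight_sum w (\<nu> N) N (\<lambda>i. X N i \<omega>) x
                - weight w N (\<lambda>i. X N i \<omega>) k x' / weight_sum w (\<nu> N) N (\<lambda>i. X N i \<omega>) x'\<bar>))
            (\<lambda>_. 1))
       \<and> bounded (b ` J) \<and> bounded (v ` J)
       \<longrightarrow> whp M (\<lambda>N \<omega>. set_integrable lborel I
              (\<lambda>x. (p_hat w (\<nu> N) N (\<lambda>i. X N i \<omega>) (\<lambda>i. Y N i \<omega>) x - p N x)\<^sup>2))
         \<and> o_prob M
             (\<lambda>N \<omega>. (LINT x:I|lborel. (p_hat w (\<nu> N) N (\<lambda>i. X N i \<omega>) (\<lambda>i. Y N i \<omega>) x - p N x)\<^sup>2)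
                 - (LINT x:I|lborel. (A_term \<nu> h p v N x)\<^sup>2 + (B_term \<nu> h p b N x)\<^sup>2))
             (\<lambda>N. (\<delta> N)\<^sup>2 * (h N) ^ 4 + \<delta> N / (real N * h N)))"
proof -
  \<comment> \<open>Continuity of the second derivative is the form in which its Hoelder condition
    enters the locale.\<close>
  have pi2: "continuous_on J (deriv (deriv \<pi>))"
  proof -
    obtain \<alpha> K where \<alpha>: "0 < \<alpha>" and K: "\<And>x y. x \<in> J \<Longrightarrow> y \<in> J \<Longrightarrow> \<bar>deriv (deriv \<pi>) x - deriv (deriv \<pi>) y\<bar> \<le> K * \<bar>x - y\<bar> powr \<alpha>"
      using T3(4) unfolding hoelder_on_def by blast
    show ?thesis
      unfolding continuous_on_def
    proof
      fix x assume x: "x \<in> J"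
      have ev: "\<forall>\<^sub>F y in at x within J. norm (deriv (deriv \<pi>) y - deriv (deriv \<pi>) x) \<le> K * \<bar>y - x\<bar> powr \<alpha>"
        unfolding eventually_at_filter using K[OF _ x] by (simp add: always_eventually)
      have "((\<lambda>y. \<bar>y - x\<bar>) \<longlongrightarrow> \<bar>x - x\<bar>) (at x within J)" by (intro tendsto_intros)
      then have "((\<lambda>y. K * \<bar>y - x\<bar> powr \<alpha>) \<longlongrightarrow> K * \<bar>x - x\<bar> powr \<alpha>) (at x within J)"
        using \<alpha> by (intro tendsto_mult tendsto_const tendsto_powr') auto
      then have "((\<lambda>y. K * \<bar>y - x\<bar> powr \<alpha>) \<longlongrightarrow> 0) (at x within J)" by simp
      from Lim_null_comparison[OF ev this]
      show "(deriv (deriv \<pi>) \<longlongrightarrow> deriv (deriv \<pi>) x) (at x within J)" by (rule LIM_zero_cancel)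
    qed
  qed
  have gt: "group_testing M X Y f \<pi> b v \<delta> h \<nu> w I J l u"
    by (rule group_testing.intro)
       (fact I J delta pi nu h(1) h(3) prob iid density Y01 cond_prob[unfolded p] w_measurable b_v_cont
          T1(3) T2[unfolded p] T3(1) T3(2) pi2 T4 T5 nu_delta)+
  obtain r K c e N0 where "group_testing_consts M X Y f \<pi> b v \<delta> h \<nu> w I J l u r K c e N0"
    using group_testing.consts_exist[OF gt] by blast
  then interpret group_testing_consts M X Y f \<pi> b v \<delta> h \<nu> w I J l u r K c e N0 .
  show ?thesis
    unfolding p
  proof (intro conjI impI A_bound B_bound ballI)
    fix x assume "x \<in> I"
    then show "\<exists>V. (\<forall>N\<ge>1. V N \<in> borel_measurable (M N))
       \<and> weak_conv_m (\<lambda>N. distr (M N) borel (V N)) std_normal_distribution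
       \<and> o_prob M
           (\<lambda>N \<omega>. p_hat w (\<nu> N) N (\<lambda>i. X N i \<omega>) (\<lambda>i. Y N i \<omega>) x - \<delta> N * \<pi> x
                   - (A_term \<nu> h (\<lambda>N x. \<delta> N * \<pi> x) v N x * V N \<omega> + B_term \<nu> h (\<lambda>N x. \<delta> N * \<pi> x) b N x))
           (\<lambda>N. \<delta> N * (h N)\<^sup>2 + sqrt (\<delta> N / (real N * h N)))"
      using S1_S4 by (intro pointwise) auto
  qed (elim conjE, rule integrated_error[THEN conjunct1] integrated_error[THEN conjunct2], assumption+)+
qed

end
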